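(* Let $E$ be an elliptic curve defined over $\mathbb{Q}$, let $p$ be a prime, and let $n\geq 1$ be an integer. (1) Suppose that $\mathbb{Q}(E[p^{n+1}]) = \mathbb{Q}(E[p^n])$. Then $p=2$, $n=1$, and there is a rational number $t\in\mathbb{Q}$ such that $E$ is isomorphic over $\mathbb{Q}$ to the elliptic curve $$E_t\colon y^2 = x^3 + A(t)x + B(t),$$ where $A(t) = -27t^8+648t^7-4212t^6-2376t^5+60102t^4+79704t^3-105732t^2-235224t-107811$ and $B(t) = 54t^{12}-1944t^{11}+24300t^{10}-97848t^9-251262t^8+1722384t^7+4821768t^6-8697456t^5-64323558t^4-140447736t^3-157012020t^2-90561240t-21346578.$ (2) If $\mathbb{Q}(E[p^n])\cap \mathbb{Q}(\zeta_{p^{n+1}}) = \mathbb{Q}(\zeta_{p^{n+1}})$, then $p=2$.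
   Context: For an integer $N\geq 1$, $\mathbb{Q}(E[N])$ denotes the $N$-th division field of $E$, i.e. the subfield of a fixed algebraic closure $\overline{\mathbb{Q}}$ generated by the coordinates of all points of $E(\overline{\mathbb{Q}})$ of order dividing $N$. $\zeta_N$ denotes a primitive $N$-th root of unity in $\overline{\mathbb{Q}}$. *)

theory Defs
  imports "HOL-Algebra.Algebraic_Closure_Type" "HOL-Algebra.Generated_Fields"
begin

section \<open>Weierstrass curves\<close>

text \<open>The curve \<open>y\<^sup>2 + a\<^sub>1 x y + a\<^sub>3 y = x\<^sup>3 + a\<^sub>2 x\<^sup>2 + a\<^sub>4 x + a\<^sub>6\<close>, arguments in the order
  \<open>a\<^sub>1, a\<^sub>2, a\<^sub>3, a\<^sub>4, a\<^sub>6\<close>.\<close>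

datatype 'a weierstrass =
  Weierstrass (wc_a1: 'a) (wc_a2: 'a) (wc_a3: 'a) (wc_a4: 'a) (wc_a6: 'a)

definition wc_discriminant :: "'a::field weierstrass \<Rightarrow> 'a" where
  "wc_discriminant E =
    (let b2 = wc_a1 E ^ 2 + 4 * wc_a2 E;
         b4 = 2 * wc_a4 E + wc_a1 E * wc_a3 E;
         b6 = wc_a3 E ^ 2 + 4 * wc_a6 E;
         b8 = wc_a1 E ^ 2 * wc_a6 E + 4 * wc_a2 E * wc_a6 E - wc_a1 E * wc_a3 E * wc_a4 E
              + wc_a2 E * wc_a3 E ^ 2 - wc_a4 E ^ 2
     in - (b2 ^ 2) * b8 - 8 * b4 ^ 3 - 27 * b6 ^ 2 + 9 * b2 * b4 * b6)"

definition elliptic_curve :: "'a::field weierstrass \<Rightarrow> bool" where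
  "elliptic_curve E \<longleftrightarrow> wc_discriminant E \<noteq> 0"

definition wc_poly :: "'a::field weierstrass \<Rightarrow> 'a \<Rightarrow> 'a \<Rightarrow> 'a" where
  "wc_poly E x y = y ^ 2 + wc_a1 E * x * y + wc_a3 E * y
     - (x ^ 3 + wc_a2 E * x ^ 2 + wc_a4 E * x + wc_a6 E)"

text \<open>Isomorphism over the base field \<open>'a\<close>: \<open>E'\<close> arises from \<open>E\<close> by an admissible change of
  variables \<open>x = u\<^sup>2 x' + r\<close>, \<open>y = u\<^sup>3 y' + s u\<^sup>2 x' + t\<close> with \<open>u, r, s, t\<close> in \<open>'a\<close>.\<close>

definition wc_isomorphic :: "'a::field weierstrass \<Rightarrow> 'a weierstrass \<Rightarrow> bool" where
  "wc_isomorphic E E' \<longleftrightarrow> (\<exists>u r s t. u \<noteq> 0 \<and>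
     u * wc_a1 E' = wc_a1 E + 2 * s \<and>
     u ^ 2 * wc_a2 E' = wc_a2 E - s * wc_a1 E + 3 * r - s ^ 2 \<and>
     u ^ 3 * wc_a3 E' = wc_a3 E + r * wc_a1 E + 2 * t \<and>
     u ^ 4 * wc_a4 E' = wc_a4 E - s * wc_a3 E + 2 * r * wc_a2 E - (t + r * s) * wc_a1 E
                          + 3 * r ^ 2 - 2 * s * t \<and>
     u ^ 6 * wc_a6 E' = wc_a6 E + r * wc_a4 E + r ^ 2 * wc_a2 E + r ^ 3 - t * wc_a3 E
                          - t ^ 2 - r * t * wc_a1 E)"

lemma wc_isomorphic_imp_substitution:
  assumes "wc_isomorphic E E'"
  shows "\<exists>u r s t. u \<noteq> 0 \<and>
    (\<forall>x y. wc_poly E (u ^ 2 * x + r) (u ^ 3 * y + s * u ^ 2 * x + t) = u ^ 6 * wc_poly E' x y)"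
proof -
  from assms obtain u r s t where u: "u \<noteq> 0"
    and a1: "u * wc_a1 E' = wc_a1 E + 2 * s"
    and a2: "u ^ 2 * wc_a2 E' = wc_a2 E - s * wc_a1 E + 3 * r - s ^ 2"
    and a3: "u ^ 3 * wc_a3 E' = wc_a3 E + r * wc_a1 E + 2 * t"
    and a4: "u ^ 4 * wc_a4 E' = wc_a4 E - s * wc_a3 E + 2 * r * wc_a2 E
               - (t + r * s) * wc_a1 E + 3 * r ^ 2 - 2 * s * t"
    and a6: "u ^ 6 * wc_a6 E' = wc_a6 E + r * wc_a4 E + r ^ 2 * wc_a2 E + r ^ 3
               - t * wc_a3 E - t ^ 2 - r * t * wc_a1 E"
    unfolding wc_isomorphic_def by blast
  have "wc_poly E (u ^ 2 * x + r) (u ^ 3 * y + s * u ^ 2 * x + t) = u ^ 6 * wc_poly E' x y"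
    for x y
  proof -
    have "u ^ 6 * wc_poly E' x y =
        u ^ 6 * y ^ 2 + u ^ 5 * (u * wc_a1 E') * x * y + u ^ 3 * (u ^ 3 * wc_a3 E') * y
        - u ^ 6 * x ^ 3 - u ^ 4 * (u ^ 2 * wc_a2 E') * x ^ 2 - u ^ 2 * (u ^ 4 * wc_a4 E') * x
        - u ^ 6 * wc_a6 E'"
      by (simp add: wc_poly_def algebra_simps eval_nat_numeral)
    also have "\<dots> = wc_poly E (u ^ 2 * x + r) (u ^ 3 * y + s * u ^ 2 * x + t)"
      unfolding a1 a2 a3 a4 a6 by (simp add: wc_poly_def algebra_simps eval_nat_numeral)
    finally show ?thesis by simp
  qed
  with u show ?thesis by blast
qed


section \<open>Points and the group law\<close>

datatype 'a point = Infinity | Affine 'a 'a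

fun on_curve :: "'a::field weierstrass \<Rightarrow> 'a point \<Rightarrow> bool" where
  "on_curve E Infinity \<longleftrightarrow> True"
| "on_curve E (Affine x y) \<longleftrightarrow> wc_poly E x y = 0"

text \<open>Chord and tangent addition. The negative of \<open>(x, y)\<close> is \<open>(x, - y - a\<^sub>1 x - a\<^sub>3)\<close>;
  \<open>l\<close> is the slope of the line through the two points.\<close>

fun point_add :: "'a::field weierstrass \<Rightarrow> 'a point \<Rightarrow> 'a point \<Rightarrow> 'a point" where
  "point_add E Infinity Q = Q"
| "point_add E P Infinity = P"
| "point_add E (Affine x1 y1) (Affine x2 y2) =
     (if x1 = x2 \<and> y1 + y2 + wc_a1 E * x2 + wc_a3 E = 0 then Infinity
      else let l = (if x1 = x2
                    then (3 * x1 ^ 2 + 2 * wc_a2 E * x1 + wc_a4 E - wc_a1 E * y1)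
                           / (2 * y1 + wc_a1 E * x1 + wc_a3 E)
                    else (y2 - y1) / (x2 - x1));
               x3 = l ^ 2 + wc_a1 E * l - wc_a2 E - x1 - x2
           in Affine x3 (- (l + wc_a1 E) * x3 - (y1 - l * x1) - wc_a3 E))"

primrec point_mult :: "'a::field weierstrass \<Rightarrow> nat \<Rightarrow> 'a point \<Rightarrow> 'a point" where
  "point_mult E 0 P = Infinity"
| "point_mult E (Suc n) P = point_add E P (point_mult E n P)"

fun point_coords :: "'a point \<Rightarrow> 'a set" where
  "point_coords Infinity = {}"
| "point_coords (Affine x y) = {x, y}"


section \<open>Division fields and cyclotomic fields\<close>

type_synonym qbar = "rat alg_closure"

text \<open>The subfield \<open>\<rat>(S)\<close>; the rationals are contained in every subfield of \<open>qbar\<close>.\<close>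

definition rat_adjoin :: "qbar set \<Rightarrow> qbar set" where
  "rat_adjoin S = generate_field ring_of_type_algebra S"

definition torsion_points :: "rat weierstrass \<Rightarrow> nat \<Rightarrow> qbar point set" where
  "torsion_points E N =
    (let Eb = map_weierstrass to_ac E in {P. on_curve Eb P \<and> point_mult Eb N P = Infinity})"

definition division_field :: "rat weierstrass \<Rightarrow> nat \<Rightarrow> qbar set" where
  "division_field E N = rat_adjoin (\<Union>P \<in> torsion_points E N. point_coords P)"

definition primitive_root_of_unity :: "nat \<Rightarrow> 'a::field \<Rightarrow> bool" where
  "primitive_root_of_unity N z \<longleftrightarrow> N > 0 \<and> z ^ N = 1 \<and> (\<forall>k. 0 < k \<and> k < N \<longrightarrow> z ^ k \<noteq> 1)"


section \<open>The one-parameter family\<close>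

definition family_A :: "rat \<Rightarrow> rat" where
  "family_A t = - 27 * t ^ 8 + 648 * t ^ 7 - 4212 * t ^ 6 - 2376 * t ^ 5 + 60102 * t ^ 4
     + 79704 * t ^ 3 - 105732 * t ^ 2 - 235224 * t - 107811"

definition family_B :: "rat \<Rightarrow> rat" where
  "family_B t = 54 * t ^ 12 - 1944 * t ^ 11 + 24300 * t ^ 10 - 97848 * t ^ 9 - 251262 * t ^ 8
     + 1722384 * t ^ 7 + 4821768 * t ^ 6 - 8697456 * t ^ 5 - 64323558 * t ^ 4
     - 140447736 * t ^ 3 - 157012020 * t ^ 2 - 90561240 * t - 21346578"

definition family_curve :: "rat \<Rightarrow> rat weierstrass" where
  "family_curve t = Weierstrass 0 0 0 (family_A t) (family_B t)"

end

theory Submission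
  imports Defs "HOL-Library.Infinite_Set" "HOL-Number_Theory.Number_Theory"
    "HOL-Computational_Algebra.Nth_Powers"
begin

text \<open>
  All statements about division fields are read off from the automorphisms of \<open>qbar\<close> fixing the
  torsion points.

  For odd \<open>p\<close> take \<open>\<sigma>\<close> acting on a primitive \<open>p ^ (n + 1)\<close>-th root of unity as raising to the power
  \<open>\<gamma>\<close>, a primitive root modulo all powers of \<open>p\<close>. If the order \<open>k\<close> of \<open>\<sigma>\<close> on \<open>E[p]\<close> is prime to \<open>p\<close>,
  then \<open>\<sigma> ^ (k p ^ (n - 1))\<close> fixes \<open>E[p ^ n]\<close>, but not the root of unity. Otherwise \<open>\<sigma>\<close> is
  triangular on \<open>E[p]\<close> with equal diagonal entries \<open>a\<close>, and the Weil pairing gives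
  \<open>\<gamma> \<equiv> a\<^sup>2\<close> modulo \<open>p\<close>, which is absurd for a primitive root. The Weil pairing of odd order is built
  from explicit chord functions.

  For \<open>p = 2\<close> halving points expresses \<open>E[4]\<close> and \<open>E[8]\<close> by iterated square roots of differences of
  the abscissas of the \<open>2\<close>-torsion points. A coincidence at level \<open>2 ^ n\<close> with \<open>n \<ge> 3\<close> descends to
  level \<open>2 ^ (n - 1)\<close>. At level \<open>2\<close> the three roots \<open>r\<^sub>k\<close> of the differences are permuted by the
  Galois group up to a common factor \<open>\<i>\<close>, and the invariants of this action parametrise the family.
  At level \<open>4\<close> the actions on the roots and on \<open>\<zeta>\<^sub>8\<close> are so restricted that one obtains a
  nontrivial rational point on a quartic excluded by Fermat's descent.
\<close>

section \<open>The group law\<close>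

text \<open>The reciprocity laws for chord functions hold only up to signs, because these functions
  share a pole at O; odd exponents absorb the signs. This ties the pairing to odd order, while p = 2
  is treated by square roots alone. A primitive root modulo an odd prime is never a square, whence
  the absurdity of \<gamma> \<equiv> a^2. The descent from level 2^n needs E[4] to be fixed already,
  so it ends at level 4, and the two lowest levels are studied separately. At level 2 an
  automorphism fixing the 2-torsion also fixes \<open>ii\<close> and the r_k, so the Galois group
  acts through permutations of three roots. Transpositions twist by j =
  \<plusminus>\<open>ii\<close>; the factors 1 \<plusminus> j undo the twist and give rational q, W,
  D. Their relation 16 D^2 = 432 W^2 + 40 q^3 W + q^6 is a conic in (D : W : q^3) with the rational
  point W = 0, 4 D = q^3. Lines of slope m through it parametrise the conic, and t = 4 - m is the
  parameter of the family.\<close>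

fun pneg :: "'a::field point => 'a point" where
 "pneg Infinity = Infinity"
| "pneg (Affine x y) = Affine x (- y)"

fun xc :: "'a::field point => 'a" where
 "xc Infinity = 0"
| "xc (Affine x y) = x"

fun yc :: "'a::field point => 'a" where
 "yc Infinity = 0"
| "yc (Affine x y) = y"

lemma pneg_pneg [simp]: "pneg (pneg P) = P"
 by (cases P) auto

lemma pneg_eq_Infinity [simp]: "pneg P = Infinity \<longleftrightarrow> P = Infinity"
 by (cases P) auto

lemma xc_pneg [simp]: "xc (pneg P) = xc P"
 by (cases P) auto

lemma yc_pneg [simp]: "yc (pneg P) = - yc P"
 by (cases P) auto

lemma poly_neq_0_if_coeff: "Polynomial.coeff p n ~= 0 ==> p ~= 0"
 by auto

lemma alg_closed_sqrt: "\<exists>y. y ^ 2 = (c :: 'a :: alg_closed_field)"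
 using nth_root_exists[of 2 c] by auto

section \<open>Chord and tangent addition on a short Weierstrass curve\<close>

locale short_weierstrass =
 fixes a b :: "'k :: {alg_closed_field, field_char_0}"
 assumes disc_nz: "4 * a ^ 3 + 27 * b ^ 2 ~= 0"
begin

definition W :: "'k weierstrass" where "W = Weierstrass 0 0 0 a b"
definition C :: "'k point set" where "C = {P. on_curve W P}"
definition padd :: "'k point => 'k point => 'k point" (infixl \<open>\<uplus>\<close> 65)
 where "P \<uplus> Q = point_add W P Q"
definition rhs :: "'k => 'k" where "rhs x = x ^ 3 + a * x + b"

lemma W_simps [simp]: "wc_a1 W = 0" "wc_a2 W = 0" "wc_a3 W = 0" "wc_a4 W = a" "wc_a6 W = b"
 by (simp_all add: W_def)

lemma Infinity_in_C [simp]: "Infinity \<in> C"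
 by (simp add: C_def)

lemma Affine_in_C: "Affine x y \<in> C \<longleftrightarrow> y ^ 2 = rhs x"
 by (simp add: C_def wc_poly_def rhs_def)

lemma in_C_eq: "P \<in> C ==> P ~= Infinity ==> yc P ^ 2 = rhs (xc P)"
 by (cases P) (auto simp: Affine_in_C)

lemma pneg_in_C [simp]: "pneg P \<in> C \<longleftrightarrow> P \<in> C"
 by (cases P) (auto simp: Affine_in_C)

definition slope :: "'k point => 'k point => 'k" where
 "slope P Q = (if xc P = xc Q then (3 * xc P ^ 2 + a) / (2 * yc P)
        else (yc Q - yc P) / (xc Q - xc P))"

lemma padd_Infinity [simp]: "Infinity \<uplus> P = P" "P \<uplus> Infinity = P"
 by (cases P; simp add: padd_def)+

lemma padd_pneg [simp]: "P \<uplus> pneg P = Infinity" "pneg P \<uplus> P = Infinity"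
 by (cases P; simp add: padd_def)+

lemma same_x: "P \<in> C ==> Q \<in> C ==> P ~= Infinity ==> Q ~= Infinity ==> xc P = xc Q ==> P = Q \<or> P = pneg Q"
 by (cases P; cases Q) (auto simp: Affine_in_C power2_eq_iff dest!: sym[of _ "rhs _"])

lemma padd_affine:
 assumes "P \<in> C" "Q \<in> C" "P ~= Infinity" "Q ~= Infinity" "P ~= pneg Q"
 defines "l \<equiv> slope P Q"
 defines "x3 \<equiv> l ^ 2 - xc P - xc Q"
 shows "P \<uplus> Q = Affine x3 (- (yc P + l * (x3 - xc P)))"
proof -
 obtain x1 y1 x2 y2 where PQ: "P = Affine x1 y1" "Q = Affine x2 y2"
  using assms by (cases P; cases Q) auto
 have ne: "\<not> (x1 = x2 \<and> y1 + y2 = 0)"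
  using assms(5) by (auto simp: PQ add_eq_0_iff)
 have l: "l = (if x1 = x2 then (3 * x1 ^ 2 + a) / (2 * y1) else (y2 - y1) / (x2 - x1))"
  by (simp add: l_def slope_def PQ)
 have x3: "x3 = l ^ 2 - x1 - x2" by (simp add: x3_def PQ)
 have "P \<uplus> Q = Affine (l ^ 2 - x1 - x2) (- l * (l ^ 2 - x1 - x2) - (y1 - l * x1))"
  using ne unfolding padd_def PQ by (auto simp: l Let_def)
 thus ?thesis by (simp add: x3 PQ algebra_simps)
qed

lemma sum_affine:
 assumes "P \<in> C" "Q \<in> C" "P ~= Infinity" "Q ~= Infinity" "P ~= pneg Q"
 shows "P \<uplus> Q ~= Infinity"
  and "xc (P \<uplus> Q) = slope P Q ^ 2 - xc P - xc Q"
  and "yc (P \<uplus> Q) = - (yc P + slope P Q * (xc (P \<uplus> Q) - xc P))"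
 using padd_affine[OF assms] by simp_all

lemma slope_eq:
 assumes "P \<in> C" "Q \<in> C" "P ~= Infinity" "Q ~= Infinity" "P ~= pneg Q"
 shows "yc Q = yc P + slope P Q * (xc Q - xc P)"
proof (cases "xc P = xc Q")
 case True
 with same_x[OF assms(1-4)] assms(5) show ?thesis by auto
qed (simp add: slope_def)

text \<open>Dividing y2^2 - y1^2 by x2 - x1 gives an expression for the slope that is also right for
  the tangent. Later identities rest on it and treat chord and tangent at once.\<close>

lemma slope_mult:
 assumes "P \<in> C" "Q \<in> C" "P ~= Infinity" "Q ~= Infinity" "P ~= pneg Q"
 shows "slope P Q * (yc P + yc Q) = xc P ^ 2 + xc P * xc Q + xc Q ^ 2 + a"
proof (cases "xc P = xc Q")
 case True
 with same_x[OF assms(1-4)] assms(5) have "P = Q" by auto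
 moreover have "yc P ~= 0"
  using assms \<open>P = Q\<close> by (cases P) auto
 ultimately show ?thesis by (simp add: slope_def power2_eq_square)
next
 case False
 have *: "yc P ^ 2 = rhs (xc P)" "yc Q ^ 2 = rhs (xc Q)"
  using assms in_C_eq by auto
 have "(yc Q - yc P) * (yc P + yc Q) = (xc Q - xc P) * (xc P ^ 2 + xc P * xc Q + xc Q ^ 2 + a)"
  using * by (simp add: algebra_simps rhs_def power2_eq_square power3_eq_cube)
 thus ?thesis using False by (simp add: slope_def field_simps)
qed

text \<open>The line meets the cubic in P, Q and -(P + Q), multiplicities included; since
  \<open>slope_mult\<close> covers tangents, this is one polynomial identity in z.\<close>

lemma line_cubic:
 assumes "P \<in> C" "Q \<in> C" "P ~= Infinity" "Q ~= Infinity" "P ~= pneg Q"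
 shows "rhs z - (yc P + slope P Q * (z - xc P)) ^ 2
     = (z - xc P) * (z - xc Q) * (z - xc (P \<uplus> Q))"
proof -
 have "yc P ^ 2 = rhs (xc P)" using assms in_C_eq by auto
 thus ?thesis
  using slope_mult[OF assms] slope_eq[OF assms] sum_affine(2)[OF assms]
  unfolding rhs_def by Groebner_Basis.algebra
qed

lemma padd_in_C [intro, simp]:
 assumes "P \<in> C" "Q \<in> C" shows "P \<uplus> Q \<in> C"
proof (cases "P = Infinity \<or> Q = Infinity \<or> P = pneg Q")
 case True thus ?thesis using assms by auto
next
 case False
 hence *: "P ~= Infinity" "Q ~= Infinity" "P ~= pneg Q" by auto
 have "yc (P \<uplus> Q) ^ 2 = rhs (xc (P \<uplus> Q))"
  using line_cubic[OF assms *, of "xc (P \<uplus> Q)"] unfolding sum_affine(3)[OF assms *] power2_minus by simp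
 with sum_affine(1)[OF assms *] show ?thesis
  by (cases "P \<uplus> Q") (auto simp: Affine_in_C)
qed

lemma slope_commute:
 assumes "P \<in> C" "Q \<in> C" "P ~= Infinity" "Q ~= Infinity" "P ~= pneg Q"
 shows "slope Q P = slope P Q"
proof (cases "xc P = xc Q")
 case True
 with same_x[OF assms(1-4)] assms(5) show ?thesis by auto
next
 case False
 thus ?thesis by (simp add: slope_def field_simps)
qed

lemma padd_commute:
 assumes "P \<in> C" "Q \<in> C" shows "P \<uplus> Q = Q \<uplus> P"
proof (cases "P = Infinity \<or> Q = Infinity \<or> P = pneg Q")
 case True thus ?thesis by auto
next
 case False
 hence *: "P ~= Infinity" "Q ~= Infinity" "P ~= pneg Q" "Q ~= pneg P" by auto
 show ?thesis
  using padd_affine[OF assms *(1-3)] padd_affine[OF assms(2,1) *(2,1,4)]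
   slope_commute[OF assms *(1-3)] slope_eq[OF assms *(1-3)]
  by (simp add: algebra_simps)
qed

lemma pneg_padd:
 assumes "P \<in> C" "Q \<in> C" shows "pneg (P \<uplus> Q) = pneg P \<uplus> pneg Q"
proof (cases "P = Infinity \<or> Q = Infinity \<or> P = pneg Q")
 case True thus ?thesis by auto
next
 case False
 hence *: "P ~= Infinity" "Q ~= Infinity" "P ~= pneg Q" "pneg P ~= pneg (pneg Q)"
  using pneg_pneg by metis+
 have "slope (pneg P) (pneg Q) = - slope P Q"
  by (auto simp: slope_def field_simps)
 thus ?thesis
  using padd_affine[OF assms *(1-3)] padd_affine[of "pneg P" "pneg Q"] * assms
  by (simp add: algebra_simps)
qed

section \<open>Functions u(x) + v(x) y and properties of general points\<close>

lemma rhs_poly: "rhs x = poly [:b, a, 0, 1:] x"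
 by (simp add: rhs_def algebra_simps power3_eq_cube)

definition fP :: "'k poly" where "fP = [:b, a, 0, 1:]"

lemma poly_fP [simp]: "poly fP x = rhs x"
 by (simp add: rhs_poly fP_def)

lemma degree_fP [simp]: "degree fP = 3" and lead_fP [simp]: "lead_coeff fP = 1"
 and fP_nz [simp]: "fP ~= 0"
 by (simp_all add: fP_def)

lemma nonsingular: "rhs x = 0 ==> 3 * x ^ 2 + a ~= 0"
proof
 assume "rhs x = 0" "3 * x ^ 2 + a = 0"
 hence "4 * a ^ 3 + 27 * b ^ 2 = 0" unfolding rhs_def by Groebner_Basis.algebra
 thus False using disc_nz by simp
qed

text \<open>By parity of degrees, norms of nonzero functions \<open>u(x) + v(x) y\<close> do not vanish.\<close>

lemma degree_norm:
 fixes u v :: "'k poly"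
 assumes "u ~= 0 \<or> v ~= 0"
 shows "u ^ 2 - fP * v ^ 2 ~= 0"
  and "v ~= 0 ==> degree (u ^ 2 - fP * v ^ 2) \<ge> 2 * degree v + 3"
  and "degree (u ^ 2 - fP * v ^ 2) \<ge> 2 * degree u"
proof -
 have dv: "degree (fP * v ^ 2) = 3 + 2 * degree v" if "v ~= 0"
  using that by (simp add: degree_mult_eq degree_power_eq)
 have du: "degree (u ^ 2) = 2 * degree u"
  by (cases "u = 0") (simp_all add: degree_power_eq)
 have main: "u ^ 2 - fP * v ^ 2 ~= 0 \<and> (v ~= 0 \<longrightarrow> degree (u ^ 2 - fP * v ^ 2) \<ge> 2 * degree v + 3) \<and>
   degree (u ^ 2 - fP * v ^ 2) \<ge> 2 * degree u"
 proof (cases "v = 0")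
  case True thus ?thesis using assms du by simp
 next
  case v: False
  have "2 * degree u ~= 3 + 2 * degree v" by presburger
  then consider "degree (u ^ 2) < degree (fP * v ^ 2)" | "degree (fP * v ^ 2) < degree (u ^ 2)"
   using du dv v by linarith
  thus ?thesis
  proof cases
   case 1
   hence "degree (u ^ 2 + - (fP * v ^ 2)) = degree (fP * v ^ 2)"
    using degree_add_eq_right[of "u ^ 2" "- (fP * v ^ 2)"] by simp
   thus ?thesis using du dv v 1 by (auto simp del: add_uminus_conv_diff simp add: diff_conv_add_uminus)
  next
   case 2
   hence "degree (u ^ 2 + - (fP * v ^ 2)) = degree (u ^ 2)"
    using degree_add_eq_left[of "- (fP * v ^ 2)" "u ^ 2"] by simp
   thus ?thesis using du dv v 2 by (auto simp del: add_uminus_conv_diff simp add: diff_conv_add_uminus)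
  qed
 qed
 thus "u ^ 2 - fP * v ^ 2 ~= 0"
  and "v ~= 0 ==> degree (u ^ 2 - fP * v ^ 2) \<ge> 2 * degree v + 3"
  and "degree (u ^ 2 - fP * v ^ 2) \<ge> 2 * degree u"
  by auto
qed

lemma finite_xc_C: "finite A ==> finite {P \<in> C. xc P \<in> A}"
proof -
 assume A: "finite A"
 have fin: "finite {y. y ^ 2 = rhs x}" for x
 proof -
  have "{y. y ^ 2 = rhs x} = {y. poly [:- rhs x, 0, 1:] y = 0}"
   by (auto simp: power2_eq_square)
  thus ?thesis using poly_roots_finite[of "[:- rhs x, 0, 1:]"] by simp
 qed
 have "{P \<in> C. xc P \<in> A} \<subseteq> insert Infinity (\<Union>x\<in>A. Affine x ` {y. y ^ 2 = rhs x})"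
 proof
  fix P assume "P \<in> {P \<in> C. xc P \<in> A}"
  thus "P \<in> insert Infinity (\<Union>x\<in>A. Affine x ` {y. y ^ 2 = rhs x})"
   by (cases P) (auto simp: Affine_in_C)
 qed
 thus ?thesis by (rule finite_subset) (use A fin in auto)
qed

lemma infinite_C: "infinite C"
proof
 assume "finite C"
 have "\<exists>P\<in>C. xc P = x" for x
 proof -
  obtain y where "y ^ 2 = rhs x" using alg_closed_sqrt[of "rhs x"] by (elim exE)
  hence "Affine x y \<in> C" by (simp add: Affine_in_C)
  thus ?thesis by force
 qed
 hence "xc ` C = UNIV" by (auto simp: image_iff) metis
 moreover have "infinite (UNIV :: 'k set)" by (rule infinite_UNIV_char_0)
 ultimately show False using \<open>finite C\<close> finite_imageI[of C xc] by simp
qed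

lemma finite_zeros:
 fixes u v :: "'k poly"
 assumes "u ~= 0 \<or> v ~= 0"
 shows "finite {P \<in> C. poly u (xc P) + poly v (xc P) * yc P = 0}"
proof -
 let ?n = "u ^ 2 - fP * v ^ 2"
 have "finite {x. poly ?n x = 0}" using degree_norm(1)[OF assms] poly_roots_finite by blast
 \<comment> \<open>0 is added because \<open>xc Infinity\<close> is 0 by convention, so that O is
   covered as well.\<close>
 hence "finite (insert 0 {x. poly ?n x = 0})" by simp
 note fin = finite_xc_C[OF this]
 have "xc P \<in> insert 0 {x. poly ?n x = 0}" if "P \<in> C" "poly u (xc P) + poly v (xc P) * yc P = 0" for P
 proof (cases "P = Infinity")
  case False
  hence "yc P ^ 2 = rhs (xc P)" using that in_C_eq by auto
  moreover have "poly u (xc P) ^ 2 = poly v (xc P) ^ 2 * yc P ^ 2"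
   using that(2) by (metis add_eq_0_iff power2_minus power_mult_distrib)
  ultimately show ?thesis by (simp add: algebra_simps)
 qed auto
 hence "{P \<in> C. poly u (xc P) + poly v (xc P) * yc P = 0} \<subseteq> {P \<in> C. xc P \<in> insert 0 {x. poly ?n x = 0}}"
  by blast
 thus ?thesis using fin finite_subset by blast
qed

text \<open>A property of the general point. C is infinite, so finitely many such properties have a
  common point; identities checked only in general position can then be transported to special
  positions.\<close>

definition most :: "('k point => bool) => bool" where
 "most p \<longleftrightarrow> finite {Z \<in> C. \<not> p Z}"

lemma most_conj: "most p ==> most q ==> most (\<lambda>Z. p Z \<and> q Z)"
proof -
 assume "most p" "most q"
 moreover have "{Z \<in> C. \<not> (p Z \<and> q Z)} = {Z \<in> C. \<not> p Z} \<union> {Z \<in> C. \<not> q Z}" by blast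
 ultimately show ?thesis by (simp add: most_def)
qed

lemma most_mono: "most p ==> (\<And>Z. Z \<in> C ==> p Z ==> q Z) ==> most q"
 unfolding most_def by (erule rev_finite_subset) blast

lemma most_ex: "most p ==> \<exists>Z\<in>C. p Z"
 unfolding most_def using infinite_C by (metis (mono_tags, lifting) Collect_cong Collect_mem_eq)

lemma most_ball: "finite A ==> (\<And>i. i \<in> A ==> most (p i)) ==> most (\<lambda>Z. \<forall>i\<in>A. p i Z)"
 by (induction A rule: finite_induct) (auto simp: most_def[of "\<lambda>_. True"] intro: most_conj)

lemma most_neq: "most (\<lambda>Z. Z ~= P)"
 unfolding most_def by (rule finite_subset[of _ "{P}"]) auto

lemma most_xc_neq: "most (\<lambda>Z. xc Z ~= c)"
 unfolding most_def using finite_xc_C[of "{c}"] by simp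

lemma most_nonzero:
 assumes "u ~= 0 \<or> v ~= (0 :: 'k poly)"
 shows "most (\<lambda>Z. poly u (xc Z) + poly v (xc Z) * yc Z ~= 0)"
 unfolding most_def using finite_zeros[OF assms] by simp

text \<open>The equation x(U + Z) = x(Z) with cleared denominators is a nonzero function of Z,
  because its x^3 coefficient is 1 - 2.\<close>

lemma sum_neq_same_x:
 assumes "U \<in> C" "U ~= Infinity"
 shows "most (\<lambda>Z. xc (U \<uplus> Z) ~= xc Z)"
proof -
 let ?u = "fP + [:yc U ^ 2:] - [:xc U, 2:] * [:- xc U, 1:] ^ 2" and ?v = "[:-2 * yc U:]"
 have "Polynomial.coeff ?u 3 ~= 0" by (simp add: fP_def numeral_eq_Suc)
 hence "?u ~= 0" by (rule poly_neq_0_if_coeff)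
 hence "most (\<lambda>Z. poly ?u (xc Z) + poly ?v (xc Z) * yc Z ~= 0)"
  by (intro most_nonzero) auto
 with most_conj[OF most_neq[of Infinity] most_xc_neq[of "xc U"]]
 have "most (\<lambda>Z. (Z ~= Infinity \<and> xc Z ~= xc U) \<and> poly ?u (xc Z) + poly ?v (xc Z) * yc Z ~= 0)"
  by (rule most_conj)
 thus ?thesis
 proof (rule most_mono)
  fix Z assume Z: "Z \<in> C" "(Z ~= Infinity \<and> xc Z ~= xc U) \<and> poly ?u (xc Z) + poly ?v (xc Z) * yc Z ~= 0"
  hence ne: "U ~= pneg Z" "Z ~= Infinity" by auto
  note s = sum_affine(2)[OF assms(1) Z(1) assms(2) ne(2,1)] slope_eq[OF assms(1) Z(1) assms(2) ne(2,1)]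
  show "xc (U \<uplus> Z) ~= xc Z"
  proof
   assume *: "xc (U \<uplus> Z) = xc Z"
   have l2: "slope U Z ^ 2 = xc U + 2 * xc Z"
    using s(1) unfolding * by (simp add: eq_diff_eq algebra_simps)
   have "poly ?u (xc Z) + poly ?v (xc Z) * yc Z
     = rhs (xc Z) + yc U ^ 2 - (xc U + 2 * xc Z) * (xc Z - xc U) ^ 2 - 2 * yc U * yc Z"
    by (simp add: algebra_simps power2_eq_square)
   also have "rhs (xc Z) = yc Z ^ 2" using Z in_C_eq by auto
   also have "yc Z ^ 2 + yc U ^ 2 - (xc U + 2 * xc Z) * (xc Z - xc U) ^ 2 - 2 * yc U * yc Z = 0"
    using s(2) l2 by Groebner_Basis.algebra
   finally show False using Z by simp
  qed
 qed
qed

text \<open>The chord through U + Z and - Z is the mirror image of the chord through U and Z, so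
  adding - Z leads back to U. The excluded Z are those for which one of the two chords could be
  tangent or vertical.\<close>

lemma padd_cancel_generic:
 assumes "U \<in> C"
 shows "most (\<lambda>Z. (U \<uplus> Z) \<uplus> pneg Z = U)"
proof (cases "U = Infinity")
 case True thus ?thesis by (simp add: most_def)
next
 case False
 from most_conj[OF most_conj[OF most_neq[of Infinity] most_xc_neq[of "xc U"]] sum_neq_same_x[OF assms False]]
 show ?thesis
 proof (rule most_mono)
  fix Z assume Z: "Z \<in> C" "(Z ~= Infinity \<and> xc Z ~= xc U) \<and> xc (U \<uplus> Z) ~= xc Z"
  hence ne: "U ~= pneg Z" "Z ~= Infinity" by auto
  let ?R = "U \<uplus> Z"
  have R: "?R \<in> C" "?R ~= Infinity" "?R ~= pneg (pneg Z)"
   using Z assms sum_affine(1)[OF assms Z(1) False ne(2,1)] by auto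
  note s = sum_affine[OF assms Z(1) False ne(2,1)] slope_eq[OF assms Z(1) False ne(2,1)]
  have yR: "yc ?R = - (yc Z + slope U Z * (xc ?R - xc Z))"
   using s(3) s(4) by Groebner_Basis.algebra
  have sl: "slope ?R (pneg Z) = - slope U Z"
  proof -
   have "slope ?R (pneg Z) = (- yc Z - yc ?R) / (xc Z - xc ?R)"
    using Z by (simp add: slope_def)
   also have "\<dots> = - slope U Z"
   proof -
    have "- yc Z - yc ?R = - slope U Z * (xc Z - xc ?R)" using yR by (simp add: algebra_simps)
    moreover have "xc Z - xc ?R ~= 0" using Z by auto
    ultimately show ?thesis by simp
   qed
   finally show ?thesis .
  qed
  have "?R \<uplus> pneg Z = Affine (xc U) (yc U)"
   using padd_affine[OF R(1) _ R(2) _ R(3)] Z sl s yR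
   by (simp add: algebra_simps)
  thus "?R \<uplus> pneg Z = U" using False by (cases U) auto
 qed
qed

text \<open>Associativity as a pure identity: C = A + B, D = B + Z, and l, m, n, r are the slopes
  for AB, BZ, CZ, AD. The hypothesis \<open>rel\<close> results from two instances of
  \<open>slope_mult\<close> by eliminating the coefficient a. It forces r = l + n - m, and then both
  coordinates differ by multiples of a single expression that vanishes.\<close>

lemma assoc_identity:
 fixes xA xB xZ yB l m n r :: 'k
 assumes yA: "yA = yB + l * (xA - xB)" and yZ: "yZ = yB + m * (xZ - xB)"
  and rel: "2 * yB * (l - m) + l ^ 2 * (xA - xB) - m ^ 2 * (xZ - xB) - (xA - xZ) * (xA + xB + xZ) = 0"
  and C: "xC = l ^ 2 - xA - xB" "yC = - (yA + l * (xC - xA))"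
  and D: "xD = m ^ 2 - xB - xZ" "yD = - (yB + m * (xD - xB))"
  and ne: "xZ ~= xC" "xD ~= xA"
  and n: "n * (xZ - xC) = yZ - yC" and r: "r * (xD - xA) = yD - yA"
 shows "n ^ 2 - xC - xZ = r ^ 2 - xA - xD"
  and "yZ + n * (n ^ 2 - xC - xZ - xZ) = yA + r * (r ^ 2 - xA - xD - xA)"
proof -
 define R where "R = 2 * yB * (l - m) + l ^ 2 * (xA - xB) - m ^ 2 * (xZ - xB) - (xA - xZ) * (xA + xB + xZ)"
 have R: "R = 0" using rel by (simp add: R_def)
 have "(xZ - xC) * (xD - xA) * (l + n - m - r) = - (l + m) * R"
  using n r C D yA yZ R_def by Groebner_Basis.algebra
 hence 1: "r = l + n - m" using ne R by simp
 have "(xZ - xC) * ((m - l) * (l + n) - (xZ - xA)) = - R"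
  using n C yA yZ R_def by Groebner_Basis.algebra
 hence 2: "(m - l) * (l + n) - (xZ - xA) = 0" using ne R by simp
 have "n ^ 2 - xC - xZ - (r ^ 2 - xA - xD) = 2 * ((m - l) * (l + n) - (xZ - xA))"
  unfolding 1 C D by (simp add: algebra_simps power2_eq_square)
 thus 3: "n ^ 2 - xC - xZ = r ^ 2 - xA - xD" using 2 by simp
 have "yZ + n * (n ^ 2 - xC - xZ - xZ) - (yA + r * (n ^ 2 - xC - xZ - xA))
  = (n - l) * ((m - l) * (l + n) - (xZ - xA))"
  unfolding 1 C yA yZ by (simp add: algebra_simps power2_eq_square)
 thus "yZ + n * (n ^ 2 - xC - xZ - xZ) = yA + r * (r ^ 2 - xA - xD - xA)"
  using 2 unfolding 3 by simp
qed

lemma sum_x_neq_generic: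
 assumes "A \<in> C" "B \<in> C" "A ~= Infinity" "B ~= Infinity" "A ~= pneg B"
 shows "most (\<lambda>Z. xc (B \<uplus> Z) ~= xc A)"
proof -
 \<comment> \<open>\<open>?u\<close> + \<open>?v\<close> y vanishes at Z if x(B + Z) = x(A). Its x^2
   coefficient is x(A) - x(B); if that is zero, then A = B and \<open>?v\<close> is nonzero because
   2 B \<noteq> O.\<close>
 let ?u = "fP + [:yc B ^ 2:] - [:xc A + xc B, 1:] * [:- xc B, 1:] ^ 2" and ?v = "[:-2 * yc B:]"
 have "?u ~= 0 \<or> ?v ~= 0"
 proof (cases "xc A = xc B")
  case False
  hence "Polynomial.coeff ?u 2 ~= 0" by (simp add: fP_def numeral_eq_Suc)
  hence "?u ~= 0" by (rule poly_neq_0_if_coeff)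
  thus ?thesis by simp
 next
  case True
  hence "A = B" using same_x assms by blast
  hence "yc B ~= 0" using assms by (cases B) auto
  thus ?thesis by simp
 qed
 hence "most (\<lambda>Z. poly ?u (xc Z) + poly ?v (xc Z) * yc Z ~= 0)"
  by (rule most_nonzero)
 from most_conj[OF most_conj[OF most_neq[of Infinity] most_xc_neq[of "xc B"]] this]
 show ?thesis
 proof (rule most_mono)
  fix Z assume Z: "Z \<in> C" "(Z ~= Infinity \<and> xc Z ~= xc B) \<and> poly ?u (xc Z) + poly ?v (xc Z) * yc Z ~= 0"
  hence ne: "B ~= pneg Z" "Z ~= Infinity" by auto
  note s = sum_affine(2)[OF assms(2) Z(1) assms(4) ne(2,1)] slope_eq[OF assms(2) Z(1) assms(4) ne(2,1)]
  show "xc (B \<uplus> Z) ~= xc A"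
  proof
   assume "xc (B \<uplus> Z) = xc A"
   hence l2: "slope B Z ^ 2 = xc A + xc B + xc Z" using s Z by (simp add: algebra_simps)
   have "poly ?u (xc Z) + poly ?v (xc Z) * yc Z
     = rhs (xc Z) + yc B ^ 2 - (xc A + xc B + xc Z) * (xc Z - xc B) ^ 2 - 2 * yc B * yc Z"
    by (simp add: algebra_simps power2_eq_square)
   also have "rhs (xc Z) = yc Z ^ 2" using Z in_C_eq by auto
   also have "yc Z ^ 2 + yc B ^ 2 - (xc A + xc B + xc Z) * (xc Z - xc B) ^ 2 - 2 * yc B * yc Z = 0"
    using s(2) l2 by Groebner_Basis.algebra
   finally show False using Z by simp
  qed
 qed
qed

text \<open>Only Z is general: A and B may coincide or be opposite. The opposite case asks for - B +
  (B + Z) = Z and is treated by itself, with another split for B of order 2.\<close>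

lemma padd_assoc_generic:
 assumes "A \<in> C" "B \<in> C"
 shows "most (\<lambda>Z. (A \<uplus> B) \<uplus> Z = A \<uplus> (B \<uplus> Z))"
proof -
 consider "A = Infinity \<or> B = Infinity" | "A = pneg B" | "A ~= Infinity" "B ~= Infinity" "A ~= pneg B" by blast
 thus ?thesis
 proof cases
  case 1 thus ?thesis by (auto simp: most_def)
 next
  case 2
  have "most (\<lambda>Z. pneg B \<uplus> (B \<uplus> Z) = Z)"
  proof (cases "B = Infinity")
   case True thus ?thesis by (simp add: most_def)
  next
   case False
   have "most (\<lambda>Z. (Z ~= Infinity \<and> xc Z ~= xc B) \<and> xc (B \<uplus> Z) ~= xc B)"
   proof (cases "yc B = 0")
    case y0: False
    hence "B ~= pneg B" using False by (cases B) (auto simp: eq_neg_iff_add_eq_0)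
    from sum_x_neq_generic[OF assms(2) assms(2) False False this]
    show ?thesis by (intro most_conj most_neq most_xc_neq)
   next
    case y0: True
    \<comment> \<open>For B of order 2 the condition x(B + Z) = x(B) involves only x(Z); the linear
      coefficient is the derivative of the cubic at x(B), nonzero by nonsingularity.\<close>
    let ?u = "fP - [:2 * xc B, 1:] * [:- xc B, 1:] ^ 2"
    have "rhs (xc B) = 0" using assms(2) False y0 in_C_eq[of B] by simp
    hence "Polynomial.coeff ?u 1 ~= 0" using nonsingular[of "xc B"]
     by (simp add: fP_def numeral_eq_Suc algebra_simps)
    hence "?u ~= 0" by (rule poly_neq_0_if_coeff)
    hence "most (\<lambda>Z. poly ?u (xc Z) + poly 0 (xc Z) * yc Z ~= 0)"
     by (intro most_nonzero) auto
    from most_conj[OF most_conj[OF most_neq[of Infinity] most_xc_neq[of "xc B"]] this]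
    show ?thesis
    proof (rule most_mono)
     fix Z assume Z: "Z \<in> C" "(Z ~= Infinity \<and> xc Z ~= xc B) \<and> poly ?u (xc Z) + poly 0 (xc Z) * yc Z ~= 0"
     hence ne: "B ~= pneg Z" "Z ~= Infinity" by auto
     note s = sum_affine(2)[OF assms(2) Z(1) False ne(2,1)] slope_eq[OF assms(2) Z(1) False ne(2,1)]
     have "xc (B \<uplus> Z) ~= xc B"
     proof
      assume "xc (B \<uplus> Z) = xc B"
      hence l2: "slope B Z ^ 2 = 2 * xc B + xc Z" using s Z by (simp add: algebra_simps)
      have "poly ?u (xc Z) = rhs (xc Z) - (2 * xc B + xc Z) * (xc Z - xc B) ^ 2"
       by (simp add: algebra_simps power2_eq_square)
      also have "rhs (xc Z) = yc Z ^ 2" using Z in_C_eq by auto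
      also have "yc Z ^ 2 - (2 * xc B + xc Z) * (xc Z - xc B) ^ 2 = 0"
       using s(2) l2 y0 by Groebner_Basis.algebra
      finally show False using Z by simp
     qed
     thus "(Z ~= Infinity \<and> xc Z ~= xc B) \<and> xc (B \<uplus> Z) ~= xc B" using Z by simp
    qed
   qed
   thus ?thesis
   proof (rule most_mono)
    fix Z assume Z: "Z \<in> C" "(Z ~= Infinity \<and> xc Z ~= xc B) \<and> xc (B \<uplus> Z) ~= xc B"
    hence ne: "B ~= pneg Z" "Z ~= Infinity" by auto
    let ?R = "B \<uplus> Z"
    have R: "?R \<in> C" "?R ~= Infinity" "pneg B ~= pneg ?R"
     using Z assms sum_affine(1)[OF assms(2) Z(1) False ne(2,1)] by (auto, metis pneg_pneg)
    note s = sum_affine[OF assms(2) Z(1) False ne(2,1)] slope_eq[OF assms(2) Z(1) False ne(2,1)]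
    have sl: "slope (pneg B) ?R = - slope B Z"
    proof -
     have "slope (pneg B) ?R = (yc ?R + yc B) / (xc ?R - xc B)"
      using Z by (auto simp: slope_def)
     also have "\<dots> = - slope B Z"
     proof -
      have "yc ?R + yc B = - slope B Z * (xc ?R - xc B)" using s(3) by (simp add: algebra_simps)
      thus ?thesis using Z by (simp add: nonzero_divide_eq_eq)
     qed
     finally show ?thesis .
    qed
    have "pneg B \<uplus> ?R = Affine (xc Z) (yc Z)"
     using padd_affine[of "pneg B" ?R] R False assms Z sl s
     by (simp add: algebra_simps)
    thus "pneg B \<uplus> ?R = Z" using Z by (cases Z) auto
   qed
  qed
  thus ?thesis using 2 by (simp add: eq_commute)
 next
  case 3
  let ?S = "A \<uplus> B"
  have S: "?S \<in> C" "?S ~= Infinity" using sum_affine(1)[OF assms 3] assms by auto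
  from most_conj[OF most_conj[OF most_conj[OF most_neq[of Infinity] most_xc_neq[of "xc B"]]
   most_xc_neq[of "xc ?S"]] sum_x_neq_generic[OF assms 3]]
  show ?thesis
  proof (rule most_mono)
   fix Z assume Z: "Z \<in> C" "((Z ~= Infinity \<and> xc Z ~= xc B) \<and> xc Z ~= xc ?S) \<and> xc (B \<uplus> Z) ~= xc A"
   hence ne: "B ~= pneg Z" "Z ~= Infinity" by auto
   let ?D = "B \<uplus> Z"
   have D: "?D \<in> C" "?D ~= Infinity" using sum_affine(1)[OF assms(2) Z(1) 3(2) ne(2,1)] assms Z by auto
   have ne2: "?S ~= pneg Z" "A ~= pneg ?D" using Z by auto
   note sS = sum_affine[OF assms 3] slope_eq[OF assms 3] slope_mult[OF assms 3]
   note sD = sum_affine[OF assms(2) Z(1) 3(2) ne(2,1)] slope_eq[OF assms(2) Z(1) 3(2) ne(2,1)]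
    slope_mult[OF assms(2) Z(1) 3(2) ne(2,1)]
   have rel: "2 * yc B * (slope A B - slope B Z) + (slope A B)\<^sup>2 * (xc A - xc B) - (slope B Z)\<^sup>2 * (xc Z - xc B) -
     (xc A - xc Z) * (xc A + xc B + xc Z) = 0"
   proof -
    have 1: "slope A B * (2 * yc B + slope A B * (xc A - xc B)) = xc A ^ 2 + xc A * xc B + xc B ^ 2 + a"
     using sS(4,5) by Groebner_Basis.algebra
    have 2: "slope B Z * (2 * yc B + slope B Z * (xc Z - xc B)) = xc B ^ 2 + xc B * xc Z + xc Z ^ 2 + a"
     using sD(4,5) by Groebner_Basis.algebra
    have "2 * yc B * (slope A B - slope B Z) + (slope A B)\<^sup>2 * (xc A - xc B) - (slope B Z)\<^sup>2 * (xc Z - xc B) -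
     (xc A - xc Z) * (xc A + xc B + xc Z) = slope A B * (2 * yc B + slope A B * (xc A - xc B))
     - slope B Z * (2 * yc B + slope B Z * (xc Z - xc B)) - (xc A - xc Z) * (xc A + xc B + xc Z)"
     by (simp add: algebra_simps power2_eq_square)
    also have "\<dots> = 0" unfolding 1 2 by (simp add: algebra_simps power2_eq_square)
    finally show ?thesis .
   qed
   have n: "slope ?S Z * (xc Z - xc ?S) = yc Z - yc ?S"
    using Z by (auto simp: slope_def)
   have r: "slope A ?D * (xc ?D - xc A) = yc ?D - yc A"
    using Z by (auto simp: slope_def)
   have yA: "yc A = yc B + slope A B * (xc A - xc B)" using sS(4) by (simp add: algebra_simps)
   note id = assoc_identity[OF yA sD(4) rel sS(2,3) sD(2,3) _ _ n r]
   have id1: "slope ?S Z ^ 2 - xc ?S - xc Z = slope A ?D ^ 2 - xc A - xc ?D"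
    using id(1) Z by auto
   have id2: "yc Z + slope ?S Z * (slope ?S Z ^ 2 - xc ?S - xc Z - xc Z)
    = yc A + slope A ?D * (slope A ?D ^ 2 - xc A - xc ?D - xc A)"
    using id(2) Z by auto
   have yS: "yc ?S = yc Z + slope ?S Z * (xc ?S - xc Z)" using n by (simp add: algebra_simps)
   have "?S \<uplus> Z = Affine (slope ?S Z ^ 2 - xc ?S - xc Z)
     (- (yc ?S + slope ?S Z * (slope ?S Z ^ 2 - xc ?S - xc Z - xc ?S)))"
    by (rule padd_affine[OF S(1) Z(1) S(2) ne(2) ne2(1)])
   also have "yc ?S + slope ?S Z * (slope ?S Z ^ 2 - xc ?S - xc Z - xc ?S)
    = yc Z + slope ?S Z * (slope ?S Z ^ 2 - xc ?S - xc Z - xc Z)"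
    by (subst yS) (simp add: algebra_simps)
   finally have eq1: "?S \<uplus> Z = Affine (slope ?S Z ^ 2 - xc ?S - xc Z)
     (- (yc Z + slope ?S Z * (slope ?S Z ^ 2 - xc ?S - xc Z - xc Z)))" .
   have eq2: "A \<uplus> ?D = Affine (slope A ?D ^ 2 - xc A - xc ?D)
     (- (yc A + slope A ?D * (slope A ?D ^ 2 - xc A - xc ?D - xc A)))"
    by (rule padd_affine[OF assms(1) D(1) 3(1) D(2) ne2(2)])
   show "?S \<uplus> Z = A \<uplus> ?D" unfolding eq1 eq2 using id1 id2 by simp
  qed
 qed
qed

text \<open>Generically, translation by - D undoes translation by D, so a finite exceptional set
  pulls back to a finite set.\<close>

lemma most_translate:
 assumes "D \<in> C" "most p"
 shows "most (\<lambda>Z. p (D \<uplus> Z))"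
proof -
 have "most (\<lambda>Z. pneg D \<uplus> (D \<uplus> Z) = Z)"
  by (rule most_mono[OF padd_assoc_generic[of "pneg D" D]]) (use assms in auto)
 hence "finite ({Z \<in> C. pneg D \<uplus> (D \<uplus> Z) ~= Z} \<union> (\<lambda>V. pneg D \<uplus> V) ` {V \<in> C. \<not> p V})"
  using assms(2) by (simp add: most_def)
 moreover have "{Z \<in> C. \<not> p (D \<uplus> Z)} \<subseteq>
   {Z \<in> C. pneg D \<uplus> (D \<uplus> Z) ~= Z} \<union> (\<lambda>V. pneg D \<uplus> V) ` {V \<in> C. \<not> p V}"
 proof
  fix Z assume "Z \<in> {Z \<in> C. \<not> p (D \<uplus> Z)}"
  hence "Z \<in> C" "D \<uplus> Z \<in> {V \<in> C. \<not> p V}" using assms by auto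
  thus "Z \<in> {Z \<in> C. pneg D \<uplus> (D \<uplus> Z) ~= Z} \<union> (\<lambda>V. pneg D \<uplus> V) ` {V \<in> C. \<not> p V}"
  proof (cases "pneg D \<uplus> (D \<uplus> Z) = Z")
   case True
   hence "Z \<in> (\<lambda>V. pneg D \<uplus> V) ` {V \<in> C. \<not> p V}"
    by (intro image_eqI[OF _ \<open>D \<uplus> Z \<in> {V \<in> C. \<not> p V}\<close>]) (rule sym)
   thus ?thesis by (rule UnI2)
  qed (use \<open>Z \<in> C\<close> in blast)
 qed
 ultimately show ?thesis unfolding most_def by (rule finite_subset[rotated])
qed

text \<open>An arbitrary triple is moved into general position by adding a general Z: both sides
  plus Z agree by the generic statements, and Z is then cancelled by
  \<open>padd_cancel_generic\<close>.\<close>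

lemma padd_assoc:
 assumes "A \<in> C" "B \<in> C" "D \<in> C"
 shows "(A \<uplus> B) \<uplus> D = A \<uplus> (B \<uplus> D)"
proof -
 let ?U = "(A \<uplus> B) \<uplus> D" and ?V = "A \<uplus> (B \<uplus> D)"
 note 1 = padd_assoc_generic[of "A \<uplus> B" D]
 note 2 = most_translate[OF assms(3) padd_assoc_generic[OF assms(1,2)]]
 note 3 = padd_assoc_generic[OF assms(2,3)]
 note 4 = padd_assoc_generic[of A "B \<uplus> D"]
 note 5 = padd_cancel_generic[of ?U]
 note 6 = padd_cancel_generic[of ?V]
 have "most (\<lambda>Z. (?U \<uplus> Z = (A \<uplus> B) \<uplus> (D \<uplus> Z) \<and>
   (A \<uplus> B) \<uplus> (D \<uplus> Z) = A \<uplus> (B \<uplus> (D \<uplus> Z))) \<and>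
   ((B \<uplus> D) \<uplus> Z = B \<uplus> (D \<uplus> Z) \<and> ?V \<uplus> Z = A \<uplus> ((B \<uplus> D) \<uplus> Z)) \<and>
   ((?U \<uplus> Z) \<uplus> pneg Z = ?U \<and> (?V \<uplus> Z) \<uplus> pneg Z = ?V))"
  by (rule most_conj[OF most_conj[OF 1 2] most_conj[OF most_conj[OF 3 4] most_conj[OF 5 6]]])
   (use assms in simp_all)
 from most_ex[OF this] obtain Z where Z: "?U \<uplus> Z = (A \<uplus> B) \<uplus> (D \<uplus> Z)"
   "(A \<uplus> B) \<uplus> (D \<uplus> Z) = A \<uplus> (B \<uplus> (D \<uplus> Z))"
   "(B \<uplus> D) \<uplus> Z = B \<uplus> (D \<uplus> Z)" "?V \<uplus> Z = A \<uplus> ((B \<uplus> D) \<uplus> Z)"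
   "(?U \<uplus> Z) \<uplus> pneg Z = ?U" "(?V \<uplus> Z) \<uplus> pneg Z = ?V"
  by (elim bexE conjE) (rule that)
 have "?U \<uplus> Z = ?V \<uplus> Z" unfolding Z(4,3,1,2) ..
 hence "(?U \<uplus> Z) \<uplus> pneg Z = (?V \<uplus> Z) \<uplus> pneg Z" by (rule arg_cong)
 thus ?thesis unfolding Z(5,6) .
qed

lemma padd_left_commute:
 "A \<in> C ==> B \<in> C ==> D \<in> C ==> A \<uplus> (B \<uplus> D) = B \<uplus> (A \<uplus> D)"
 by (metis padd_assoc padd_commute)

lemmas padd_ac = padd_assoc padd_commute padd_left_commute

lemma padd_cancel_left [simp]: "A \<in> C ==> B \<in> C ==> pneg A \<uplus> (A \<uplus> B) = B"
 and padd_cancel_left' [simp]: "A \<in> C ==> B \<in> C ==> A \<uplus> (pneg A \<uplus> B) = B"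
 by (simp_all flip: padd_assoc)

lemma padd_left_inject [simp]:
 "A \<in> C ==> B \<in> C ==> D \<in> C ==> A \<uplus> B = A \<uplus> D \<longleftrightarrow> B = D"
proof
 assume *: "A \<in> C" "B \<in> C" "D \<in> C" "A \<uplus> B = A \<uplus> D"
 have "B = pneg A \<uplus> (A \<uplus> B)" using *(1,2) by simp
 also have "\<dots> = pneg A \<uplus> (A \<uplus> D)" by (simp only: *(4))
 also have "\<dots> = D" using *(1,3) by simp
 finally show "B = D" .
qed simp

lemma padd_right_inject [simp]:
 "A \<in> C ==> B \<in> C ==> D \<in> C ==> B \<uplus> A = D \<uplus> A \<longleftrightarrow> B = D"
 using padd_left_inject[of A B D] padd_commute[of A B] padd_commute[of A D] by simp

lemma padd_eq_Infinity: "A \<in> C ==> B \<in> C ==> A \<uplus> B = Infinity \<longleftrightarrow> B = pneg A"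
 using padd_left_inject[of A B "pneg A"] by simp

section \<open>Multiples of points and torsion subgroups\<close>

primrec pmul :: "nat => 'k point => 'k point" (infixr \<open>\<odot>\<close> 70) where
 "0 \<odot> P = Infinity"
| "Suc n \<odot> P = P \<uplus> n \<odot> P"

lemma pmul_eq_point_mult: "n \<odot> P = point_mult W n P"
 by (induction n) (simp_all add: padd_def)

lemma pmul_in_C [simp, intro]: "P \<in> C ==> n \<odot> P \<in> C"
 by (induction n) auto

lemma pmul_Infinity [simp]: "n \<odot> Infinity = Infinity"
 by (induction n) auto

lemma pmul_1 [simp]: "Suc 0 \<odot> P = P" by simp

lemma pmul_add: "P \<in> C ==> (m + n) \<odot> P = m \<odot> P \<uplus> n \<odot> P"
 by (induction m) (simp_all add: padd_assoc)

lemma pmul_mult: "P \<in> C ==> (m * n) \<odot> P = m \<odot> n \<odot> P"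
 by (induction m) (simp_all add: pmul_add)

lemma pmul_padd: "P \<in> C ==> Q \<in> C ==> n \<odot> (P \<uplus> Q) = n \<odot> P \<uplus> n \<odot> Q"
 by (induction n) (simp_all add: padd_ac)

lemma pmul_pneg: "P \<in> C ==> n \<odot> pneg P = pneg (n \<odot> P)"
 by (induction n) (simp_all add: pneg_padd)

lemma pmul_left_commute: "P \<in> C ==> m \<odot> n \<odot> P = n \<odot> m \<odot> P"
 by (metis pmul_mult mult.commute)

definition tors :: "nat => 'k point set" where
 "tors n = {P \<in> C. n \<odot> P = Infinity}"

lemma tors_padd: "P \<in> tors n ==> Q \<in> tors n ==> P \<uplus> Q \<in> tors n"
 by (simp add: tors_def pmul_padd)

lemma tors_pneg: "P \<in> tors n ==> pneg P \<in> tors n"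
 by (simp add: tors_def pmul_pneg)

lemma tors_Infinity [simp]: "Infinity \<in> tors n"
 by (simp add: tors_def)

lemma tors_in_C: "P \<in> tors n ==> P \<in> C"
 by (simp add: tors_def)

lemma tors_pmul: "P \<in> tors n ==> m \<odot> P \<in> tors n"
 by (simp add: tors_def pmul_left_commute[of _ n])

lemma tors_mono: "P \<in> tors n ==> n dvd m ==> P \<in> tors m"
 by (auto simp: tors_def pmul_mult mult.commute[of n] elim!: dvdE)

end

section \<open>Multiplication by integers\<close>

text \<open>Linear factors of p are split off one at a time; each must divide q because r does not
  vanish at its root.\<close>

lemma dvd_if_no_common_root:
 fixes p q r :: "'a :: alg_closed_field poly"
 assumes "p ~= 0" "p dvd q * r" "\<And>x. poly p x = 0 ==> poly r x ~= 0"
 shows "p dvd q"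
 using assms
proof (induction "degree p" arbitrary: p q)
 case 0
 then obtain c where "p = [:c:]" "c ~= 0" using degree_eq_zeroE by (metis pCons_eq_0_iff)
 hence "q = p * smult (1 / c) q" by simp
 thus ?case by (rule dvdI)
next
 case (Suc n)
 obtain c where c: "poly p c = 0" using alg_closed_imp_poly_has_root[of p] Suc by auto
 then obtain p1 where p1: "p = [:-c, 1:] * p1" by (auto simp: poly_eq_0_iff_dvd)
 have [simp]: "p1 ~= 0" using p1 Suc by auto
 have "[:-c, 1:] dvd q * r" using p1 Suc by (metis dvd_mult_left)
 hence "poly q c * poly r c = 0" by (simp flip: poly_eq_0_iff_dvd)
 hence "poly q c = 0" using Suc c by auto
 then obtain q1 where q1: "q = [:-c, 1:] * q1" by (auto simp: poly_eq_0_iff_dvd)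
 have "degree p = Suc (degree p1)" unfolding p1 by (subst degree_mult_eq) auto
 moreover have "[:-c, 1:] * p1 dvd [:-c, 1:] * (q1 * r)" using Suc.prems(2) unfolding p1 q1 by (simp only: mult.assoc)
 hence "p1 dvd q1 * r" by (subst (asm) dvd_mult_cancel_left) auto
 ultimately have "p1 dvd q1"
  using Suc.hyps(1)[of p1 q1] Suc.hyps(2) Suc.prems(3) by (simp add: p1)
 thus ?case unfolding p1 q1 by (rule mult_dvd_mono[OF dvd_refl])
qed

lemma card_roots_eq_degree:
 fixes p :: "'a :: {alg_closed_field, field_char_0} poly"
 assumes "p ~= 0" "\<And>x. poly p x = 0 ==> poly (pderiv p) x ~= 0"
 shows "card {x. poly p x = 0} = degree p"
 using assms
proof (induction "degree p" arbitrary: p)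
 case 0
 then obtain c where "p = [:c:]" "c ~= 0" using degree_eq_zeroE by (metis pCons_eq_0_iff)
 thus ?case by simp
next
 case (Suc n)
 obtain c where c: "poly p c = 0" using alg_closed_imp_poly_has_root[of p] Suc by auto
 then obtain q where q: "p = [:-c, 1:] * q" by (auto simp: poly_eq_0_iff_dvd)
 have [simp]: "q ~= 0" using q Suc by auto
 have deg: "degree p = Suc (degree q)" unfolding q by (subst degree_mult_eq) auto
 have pd: "poly (pderiv p) x = (x - c) * poly (pderiv q) x + poly q x" for x
  unfolding q pderiv_mult by (simp add: algebra_simps pderiv_pCons)
 have qc: "poly q c ~= 0" using Suc.prems(2)[OF c] pd[of c] by simp
 have "card {x. poly q x = 0} = degree q"
 proof (rule Suc.hyps(1))
  show "n = degree q" using Suc deg by simp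
  fix x assume "poly q x = 0"
  thus "poly (pderiv q) x ~= 0" using Suc.prems(2)[of x] pd[of x] by (auto simp: q)
 qed auto
 moreover have "{x. poly p x = 0} = insert c {x. poly q x = 0}" by (auto simp: q)
 moreover have "c \<notin> {x. poly q x = 0}" using qc by simp
 moreover have "finite {x. poly q x = 0}" by (rule poly_roots_finite) simp
 ultimately show ?case using deg by simp
qed

context short_weierstrass
begin

text \<open>\<open>(p : q)\<close> are homogeneous coordinates of the \<open>x\<close>-coordinate of \<open>R\<close>.\<close>

definition xrep :: "'k point => 'k => 'k => bool" where
 "xrep R p q \<longleftrightarrow> (q = 0 \<longleftrightarrow> R = Infinity) \<and> (R ~= Infinity \<longrightarrow> p = xc R * q) \<and> (p ~= 0 \<or> q ~= 0)"

text \<open>The quadratic form \<open>fD T\<^sup>2 - fS T U + fM U\<^sup>2\<close> has the roots \<open>x(A + B)\<close> and \<open>x(A - B)\<close>,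
 where \<open>x(A) = (p : q)\<close> and \<open>x(B) = (x : 1)\<close>.\<close>

definition fD where "fD p q x = (p - x * q) ^ 2" for p q x :: "'a :: comm_ring_1"
definition fS where "fS \<alpha> \<beta> p q x = 2 * ((p * x + \<alpha> * q) * (p + x * q) + 2 * \<beta> * q ^ 2)" for p q x \<alpha> \<beta> :: "'a :: comm_ring_1"
definition fM where "fM \<alpha> \<beta> p q x = (p * x - \<alpha> * q) ^ 2 - 4 * \<beta> * (p + x * q) * q" for p q x \<alpha> \<beta> :: "'a :: comm_ring_1"

lemma xc_double:
 assumes "B \<in> C" "B ~= Infinity" "B ~= pneg B"
 shows "xc (B \<uplus> B) * (4 * rhs (xc B)) = (xc B ^ 2 - a) ^ 2 - 8 * b * xc B" "rhs (xc B) ~= 0"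
proof -
 have y: "yc B ~= 0" using assms by (cases B) auto
 have y2: "yc B ^ 2 = rhs (xc B)" using assms in_C_eq by auto
 show "rhs (xc B) ~= 0" using y y2 by auto
 have "slope B B * (2 * yc B) = 3 * xc B ^ 2 + a" using y by (simp add: slope_def)
 thus "xc (B \<uplus> B) * (4 * rhs (xc B)) = (xc B ^ 2 - a) ^ 2 - 8 * b * xc B"
  using sum_affine(2)[OF assms(1,1) assms(2,2,3)] y2 unfolding rhs_def by Groebner_Basis.algebra
qed

lemma xc_sum_diff:
 assumes "A \<in> C" "B \<in> C" "A ~= Infinity" "B ~= Infinity" "xc A ~= xc B"
 shows "(xc (A \<uplus> B) + xc (A \<uplus> pneg B)) * fD (xc A) 1 (xc B) = fS a b (xc A) 1 (xc B)"
  and "xc (A \<uplus> B) * xc (A \<uplus> pneg B) * fD (xc A) 1 (xc B) = fM a b (xc A) 1 (xc B)"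
proof -
 have ne: "A ~= pneg B" "A ~= pneg (pneg B)" using assms by auto
 have l: "slope A B * (xc B - xc A) = yc B - yc A"
  "slope A (pneg B) * (xc B - xc A) = - yc B - yc A"
  using assms by (auto simp: slope_def)
 have y: "yc A ^ 2 = rhs (xc A)" "yc B ^ 2 = rhs (xc B)" using assms in_C_eq by auto
 have x1: "xc (A \<uplus> B) = slope A B ^ 2 - xc A - xc B"
  using sum_affine(2)[OF assms(1-4) ne(1)] .
 have x2: "xc (A \<uplus> pneg B) = slope A (pneg B) ^ 2 - xc A - xc B"
  using sum_affine(2)[OF assms(1) _ assms(3) _ ne(2)] assms by simp
 have d: "(xc B - xc A) ^ 2 ~= 0" using assms by simp
 define u where "u = xc (A \<uplus> B) * (xc B - xc A) ^ 2"
 define v where "v = xc (A \<uplus> pneg B) * (xc B - xc A) ^ 2"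
 have u: "u = (yc B - yc A) ^ 2 - (xc A + xc B) * (xc B - xc A) ^ 2"
  using l(1) x1 u_def by Groebner_Basis.algebra
 have v: "v = (yc B + yc A) ^ 2 - (xc A + xc B) * (xc B - xc A) ^ 2"
  using l(2) x2 v_def by Groebner_Basis.algebra
 have "u + v = fS a b (xc A) 1 (xc B)"
 proof -
  have "fS a b (xc A) 1 (xc B) = 2 * ((xc A * xc B + a) * (xc A + xc B) + 2 * b)" by (simp add: fS_def)
  thus ?thesis using y unfolding u v rhs_def by Groebner_Basis.algebra
 qed
 thus "(xc (A \<uplus> B) + xc (A \<uplus> pneg B)) * fD (xc A) 1 (xc B) = fS a b (xc A) 1 (xc B)"
  by (simp add: u_def v_def fD_def algebra_simps power2_eq_square)
 have "u * v = (xc B - xc A) ^ 2 * fM a b (xc A) 1 (xc B)"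
 proof -
  have "fM a b (xc A) 1 (xc B) = (xc A * xc B - a) ^ 2 - 4 * b * (xc A + xc B)" by (simp add: fM_def)
  thus ?thesis using y unfolding u v rhs_def by Groebner_Basis.algebra
 qed
 hence "(xc B - xc A) ^ 2 * (xc (A \<uplus> B) * xc (A \<uplus> pneg B) * (xc B - xc A) ^ 2)
  = (xc B - xc A) ^ 2 * fM a b (xc A) 1 (xc B)"
  by (simp add: u_def v_def mult_ac)
 hence "xc (A \<uplus> B) * xc (A \<uplus> pneg B) * (xc B - xc A) ^ 2 = fM a b (xc A) 1 (xc B)"
  using d by (subst (asm) mult_left_cancel) auto
 thus "xc (A \<uplus> B) * xc (A \<uplus> pneg B) * fD (xc A) 1 (xc B) = fM a b (xc A) 1 (xc B)"
  by (simp add: fD_def power2_commute)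
qed

lemma form_scale:
 "fD (p * c) (q * c) x = c ^ 2 * fD p q x" "fS \<alpha> \<beta> (p * c) (q * c) x = c ^ 2 * fS \<alpha> \<beta> p q x"
 "fM \<alpha> \<beta> (p * c) (q * c) x = c ^ 2 * fM \<alpha> \<beta> p q x"
 for p q x \<alpha> \<beta> c :: "'a :: comm_ring_1"
 by (simp_all add: fD_def fS_def fM_def algebra_simps power2_eq_square)

lemma form_diag: "fS a b x 1 x = 4 * rhs x" "fM a b x 1 x = (x ^ 2 - a) ^ 2 - 8 * b * x" "fD x 1 x = 0"
 by (simp_all add: fD_def fS_def fM_def rhs_def algebra_simps power2_eq_square power3_eq_cube)

text \<open>The quadratic form is never identically zero: where its first two coefficients vanish,
  x(A) = x is a root of the cubic, and the third coefficient is a nonzero multiple of (3 x^2 +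
  a)^2.\<close>

lemma form_primitive:
 assumes "xrep A p q" "fD p q x = 0" "fS a b p q x = 0"
 shows "fM a b p q x ~= 0"
proof (cases "q = 0")
 case True
 thus ?thesis using assms by (auto simp: xrep_def fD_def)
next
 case False
 have "p = x * q" using assms by (simp add: fD_def)
 hence *: "p = x * q" "q = 1 * q" by simp_all
 have "q ^ 2 * fS a b x 1 x = 0" using assms(3) by (subst (asm) *(1), subst (asm) (2) *(2)) (simp only: form_scale)
 hence 0: "rhs x = 0" using False by (simp add: form_diag)
 have "fM a b p q x = q ^ 2 * fM a b x 1 x" by (subst *(1), subst (2) *(2)) (simp only: form_scale)
 also have "fM a b x 1 x = (3 * x ^ 2 + a) ^ 2 - 8 * x * rhs x"
  unfolding form_diag rhs_def by (simp add: algebra_simps power2_eq_square power3_eq_cube)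
 finally show ?thesis using 0 nonsingular[OF 0] False by simp
qed

lemma form_root:
 assumes "A \<in> C" "B \<in> C" "B ~= Infinity" "xrep A p q" "xrep (A \<uplus> pneg B) p' q'"
 shows "fD p q (xc B) * p' ^ 2 - fS a b p q (xc B) * p' * q' + fM a b p q (xc B) * q' ^ 2 = 0"
proof (cases "A = Infinity")
 case True
 hence "q = 0" "p' = xc B * q'" using assms by (auto simp: xrep_def)
 thus ?thesis by (simp add: fD_def fS_def fM_def algebra_simps power2_eq_square)
next
 case False
 hence p: "p = xc A * q" "q = 1 * q" using assms by (auto simp: xrep_def)
 have sc: "fD p q (xc B) = q ^ 2 * fD (xc A) 1 (xc B)" "fS a b p q (xc B) = q ^ 2 * fS a b (xc A) 1 (xc B)"
  "fM a b p q (xc B) = q ^ 2 * fM a b (xc A) 1 (xc B)"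
  by (subst p(1), subst (2) p(2), simp only: form_scale)+
 let ?D = "fD (xc A) 1 (xc B)" and ?S = "fS a b (xc A) 1 (xc B)" and ?M = "fM a b (xc A) 1 (xc B)"
 have "?D * p' ^ 2 - ?S * p' * q' + ?M * q' ^ 2 = 0"
 proof (cases "xc A = xc B")
  case x: False
  hence "A ~= pneg (pneg B)" by auto
  hence "A \<uplus> pneg B ~= Infinity" using sum_affine(1)[of A "pneg B"] assms False by auto
  hence p': "p' = xc (A \<uplus> pneg B) * q'" using assms by (auto simp: xrep_def)
  show ?thesis unfolding xc_sum_diff[OF assms(1,2) False assms(3) x, symmetric] p'
   by (simp add: algebra_simps power2_eq_square)
 next
  case x: True
  hence D: "?D = 0" by (simp add: fD_def)
  consider "A = B" | "A = pneg B" "A ~= B" using same_x assms False x by blast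
  thus ?thesis
  proof cases
   case 1
   hence "q' = 0" using assms by (simp add: xrep_def)
   thus ?thesis using D by simp
  next
   case 2
   hence ne: "pneg B ~= pneg (pneg B)" by auto
   have "pneg B \<uplus> pneg B ~= Infinity" using sum_affine(1)[of "pneg B" "pneg B"] assms ne by auto
   hence p': "p' = xc (pneg B \<uplus> pneg B) * q'" using assms 2 by (auto simp: xrep_def)
   have "xc (pneg B \<uplus> pneg B) * (4 * rhs (xc B)) = (xc B ^ 2 - a) ^ 2 - 8 * b * xc B"
    using xc_double(1)[of "pneg B"] assms ne by simp
   hence "?S * xc (pneg B \<uplus> pneg B) = ?M" using x by (simp only: form_diag mult.commute)
   thus ?thesis using D p' by (simp add: algebra_simps power2_eq_square)
  qed
 qed
 hence "q ^ 2 * (?D * p' ^ 2 - ?S * p' * q' + ?M * q' ^ 2) = 0" by simp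
 thus ?thesis unfolding sc by (simp add: algebra_simps)
qed

text \<open>The hypotheses \<open>D\<close>, \<open>S\<close>, \<open>M\<close> say that the form
  factors as (q'' T - p'' U) (q' T - p' U). One root is x(A - B), so the other is x(A + B); the
  degenerate positions A = O and A = \<plusminus>B need their own check.\<close>

lemma xrep_sum:
 assumes "A \<in> C" "B \<in> C" "B ~= Infinity" "xrep A p q" "xrep (A \<uplus> pneg B) p' q'"
  and D: "fD p q (xc B) = q'' * q'" and S: "fS a b p q (xc B) = p'' * q' + p' * q''"
  and M: "fM a b p q (xc B) = p'' * p'"
 shows "xrep (A \<uplus> B) p'' q''"
proof -
 have nz: "p'' ~= 0 \<or> q'' ~= 0" using form_primitive[OF assms(4), of "xc B"] D S M by auto
 show ?thesis
 proof (cases "A = Infinity")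
  case True
  hence q: "q = 0" "p ~= 0" "p' = xc B * q'" "q' ~= 0" using assms by (auto simp: xrep_def)
  have D': "p ^ 2 = q'' * q'" using D q by (simp add: fD_def)
  have "2 * xc B * p ^ 2 = p'' * q' + xc B * q' * q''"
   using S q by (simp add: fS_def power2_eq_square algebra_simps)
  hence "(p'' - xc B * q'') * q' = 0" using D' by Groebner_Basis.algebra
  hence "p'' = xc B * q''" using q by simp
  moreover have "q'' ~= 0" using D' q by auto
  ultimately show ?thesis using True assms nz by (simp add: xrep_def)
 next
  case False
  hence p: "p = xc A * q" "q = 1 * q" "q ~= 0" using assms by (auto simp: xrep_def)
  have sc: "fD p q (xc B) = q ^ 2 * fD (xc A) 1 (xc B)" "fS a b p q (xc B) = q ^ 2 * fS a b (xc A) 1 (xc B)"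
   "fM a b p q (xc B) = q ^ 2 * fM a b (xc A) 1 (xc B)"
   by (subst p(1), subst (2) p(2), simp only: form_scale)+
  show ?thesis
  proof (cases "xc A = xc B")
   case x: False
   hence "A ~= pneg (pneg B)" "A ~= pneg B" by auto
   hence aff: "A \<uplus> pneg B ~= Infinity" "A \<uplus> B ~= Infinity"
    using sum_affine(1)[of A "pneg B"] sum_affine(1)[of A B] assms False by auto
   hence p': "p' = xc (A \<uplus> pneg B) * q'" using assms by (auto simp: xrep_def)
   have "fD p q (xc B) ~= 0" using x p sc by (simp add: fD_def)
   hence q': "q' ~= 0" "q'' ~= 0" using D by auto
   have "(xc (A \<uplus> B) + xc (A \<uplus> pneg B)) * fD p q (xc B) = fS a b p q (xc B)"
    using xc_sum_diff(1)[OF assms(1,2) False assms(3) x] unfolding sc by (simp add: mult_ac)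
   hence "q' * (xc (A \<uplus> B) * q'' - p'') = 0" unfolding D S p' by (simp add: algebra_simps)
   hence "p'' = xc (A \<uplus> B) * q''" using q' by simp
   thus ?thesis using aff q' nz by (simp add: xrep_def)
  next
   case x: True
   hence D0: "q'' * q' = 0" using D p by (simp add: fD_def)
   have S': "q ^ 2 * (4 * rhs (xc B)) = p'' * q' + p' * q''"
    using S unfolding sc x form_diag by simp
   have M': "q ^ 2 * ((xc B ^ 2 - a) ^ 2 - 8 * b * xc B) = p'' * p'"
    using M unfolding sc x form_diag by simp
   show ?thesis
   proof (cases "A = B")
    case True
    hence q': "q' = 0" "p' ~= 0" using assms by (auto simp: xrep_def)
    show ?thesis
    proof (cases "B = pneg B")
     case tt: True
     hence "yc B = 0" using assms by (cases B) auto
     hence "rhs (xc B) = 0" using in_C_eq[OF assms(2,3)] by simp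
     hence "q'' = 0" using S' q' by simp
     moreover have "A \<uplus> B = Infinity" using tt True padd_pneg(1)[of B] by simp
     ultimately show ?thesis using nz by (simp add: xrep_def)
    next
     case tt: False
     note dbl = xc_double[OF assms(2,3) tt]
     have "q'' ~= 0" using S' q' p dbl(2) by auto
     moreover have "p' * (p'' - xc (B \<uplus> B) * q'') = 0"
      using S' M' q' dbl(1) by Groebner_Basis.algebra
     hence "p'' = xc (B \<uplus> B) * q''" using q' by simp
     moreover have "B \<uplus> B ~= Infinity" using sum_affine(1)[of B B] assms tt by auto
     ultimately show ?thesis using True by (simp add: xrep_def)
    qed
   next
    case ne: False
    hence AB: "A = pneg B" using same_x assms False x by blast
    hence "pneg B ~= pneg (pneg B)" using ne by auto
    hence "pneg B \<uplus> pneg B ~= Infinity" using sum_affine(1)[of "pneg B" "pneg B"] assms by auto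
    hence "q' ~= 0" using assms AB by (auto simp: xrep_def)
    hence "q'' = 0" using D0 by simp
    thus ?thesis using AB nz by (simp add: xrep_def)
   qed
  qed
 qed
qed

text \<open>In classical notation, \<phi>_n and the square of the n-th division polynomial \<psi>_n.
  Since \<open>xrep\<close> excludes common zeros, they form a reduced fraction for x(n Z).\<close>

definition mult_polys :: "nat => 'k poly => 'k poly => bool" where
 "mult_polys n \<phi> \<psi> \<longleftrightarrow> (\<forall>Z\<in>C. Z ~= Infinity \<longrightarrow> xrep (n \<odot> Z) (poly \<phi> (xc Z)) (poly \<psi> (xc Z))) \<and>
  degree \<phi> = n ^ 2 \<and> lead_coeff \<phi> = 1 \<and> degree \<psi> = n ^ 2 - 1 \<and> lead_coeff \<psi> = of_nat (n ^ 2)"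

lemma ex_point_xc: "\<exists>Z\<in>C. Z ~= Infinity \<and> xc Z = x"
proof -
 obtain y where "y ^ 2 = rhs x" using alg_closed_sqrt[of "rhs x"] by (elim exE)
 hence "Affine x y \<in> C" by (simp add: Affine_in_C)
 thus ?thesis by force
qed

lemma mult_polys_no_common_root:
 assumes "mult_polys n \<phi> \<psi>" shows "poly \<phi> x ~= 0 \<or> poly \<psi> x ~= 0"
 using ex_point_xc[of x] assms unfolding mult_polys_def xrep_def by blast

lemma mult_polys_1: "mult_polys 1 [:0, 1:] [:1:]"
 by (simp add: mult_polys_def xrep_def)

lemma mult_polys_2: "mult_polys 2 [:a ^ 2, - 8 * b, - 2 * a, 0, 1:] (smult 4 fP)"
proof -
 have "xrep (2 \<odot> Z) (poly [:a ^ 2, - 8 * b, - 2 * a, 0, 1:] (xc Z)) (poly (smult 4 fP) (xc Z))"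
  if Z: "Z \<in> C" "Z ~= Infinity" for Z
 proof -
  have e: "poly [:a ^ 2, - 8 * b, - 2 * a, 0, 1:] (xc Z) = (xc Z ^ 2 - a) ^ 2 - 8 * b * xc Z"
   by (simp add: algebra_simps power2_eq_square)
  have "xrep (Z \<uplus> Z) ((xc Z ^ 2 - a) ^ 2 - 8 * b * xc Z) (4 * rhs (xc Z))"
  proof (rule xrep_sum[of Z Z "xc Z" 1 1 0])
   show "xrep Z (xc Z) 1" "xrep (Z \<uplus> pneg Z) 1 0" using Z by (simp_all add: xrep_def)
  qed (use Z in \<open>simp_all add: form_diag\<close>)
  moreover have "2 \<odot> Z = Z \<uplus> Z" by (simp add: numeral_2_eq_2)
  ultimately show ?thesis by (simp only: e poly_smult poly_fP)
 qed
 moreover have "Polynomial.coeff fP 3 = 1" by (simp add: fP_def numeral_3_eq_3)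
 ultimately show ?thesis by (simp add: mult_polys_def)
qed

text \<open>The form attached to x(n Z) and x(Z) has x((n - 1) Z) as a root. Because \<phi>' and
  \<psi>' are coprime, the corresponding linear factor splits off over the polynomial ring, and the
  cofactor describes x((n + 1) Z).\<close>

lemma mult_polys_step:
 assumes n: "n \<ge> 2" and 1: "mult_polys (n - 1) \<phi>' \<psi>'" and 2: "mult_polys n \<phi> \<psi>"
 shows "\<exists>\<phi>'' \<psi>''. mult_polys (n + 1) \<phi>'' \<psi>''"
proof -
 define x where "x = [:0, 1 :: 'k:]"
 define D where "D = fD \<phi> \<psi> x"
 define S where "S = fS [:a:] [:b:] \<phi> \<psi> x"
 define M where "M = fM [:a:] [:b:] \<phi> \<psi> x"
 have two: "poly 2 z = 2" "poly 4 z = 4" for z :: 'k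
  by (simp_all add: numeral_poly)
 have ev: "poly D z = fD (poly \<phi> z) (poly \<psi> z) z" "poly S z = fS a b (poly \<phi> z) (poly \<psi> z) z"
  "poly M z = fM a b (poly \<phi> z) (poly \<psi> z) z" for z
  by (simp_all add: D_def S_def M_def fD_def fS_def fM_def x_def two algebra_simps)
 have nz: "\<phi>' ~= 0" "\<psi>' ~= 0" "\<phi> ~= 0" "\<psi> ~= 0" using 1 2 n by (auto simp: mult_polys_def)
 have R1: "xrep ((n - 1) \<odot> Z) (poly \<phi>' (xc Z)) (poly \<psi>' (xc Z))" if "Z \<in> C" "Z ~= Infinity" for Z
  using 1 that by (simp add: mult_polys_def)
 have R2: "xrep (n \<odot> Z) (poly \<phi> (xc Z)) (poly \<psi> (xc Z))" if "Z \<in> C" "Z ~= Infinity" for Z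
  using 2 that by (simp add: mult_polys_def)
 have minus: "n \<odot> Z \<uplus> pneg Z = (n - 1) \<odot> Z" if "Z \<in> C" for Z
 proof -
  have "n \<odot> Z = Z \<uplus> (n - 1) \<odot> Z" using n by (cases n) auto
  thus ?thesis using that by (simp add: padd_commute padd_assoc padd_left_commute)
 qed
 have "poly (D * \<phi>' ^ 2 - S * \<phi>' * \<psi>' + M * \<psi>' ^ 2) z = 0" for z
 proof -
  obtain Z where Z: "Z \<in> C" "Z ~= Infinity" "xc Z = z" using ex_point_xc by blast
  from form_root[OF pmul_in_C[OF Z(1)] Z(1,2) R2[OF Z(1,2)], of "poly \<phi>' z" "poly \<psi>' z"]
  show ?thesis using R1[OF Z(1,2)] minus[OF Z(1)] Z by (simp add: ev)
 qed
 hence root: "D * \<phi>' ^ 2 - S * \<phi>' * \<psi>' + M * \<psi>' ^ 2 = 0"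
  using poly_all_0_iff_0 by blast
 \<comment> \<open>As in the rational root test: the identity \<open>root\<close> makes \<psi>'
   divide D \<phi>'^2 and \<phi>' divide M \<psi>'^2.\<close>
 have "\<psi>' dvd D"
 proof (rule dvd_if_no_common_root[of _ _ "\<phi>' ^ 2"])
  have "D * \<phi>' ^ 2 = \<psi>' * (S * \<phi>' - M * \<psi>')" using root by (simp add: algebra_simps power2_eq_square)
  thus "\<psi>' dvd D * \<phi>' ^ 2" by simp
 qed (use nz mult_polys_no_common_root[OF 1] in auto)
 then obtain \<psi>'' where D: "D = \<psi>'' * \<psi>'" by (metis dvdE mult.commute)
 have "\<phi>' dvd M"
 proof (rule dvd_if_no_common_root[of _ _ "\<psi>' ^ 2"])
  have "M * \<psi>' ^ 2 = \<phi>' * (S * \<psi>' - D * \<phi>')" using root by (simp add: algebra_simps power2_eq_square)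
  thus "\<phi>' dvd M * \<psi>' ^ 2" by simp
 qed (use nz mult_polys_no_common_root[OF 1] in auto)
 then obtain \<phi>'' where M: "M = \<phi>'' * \<phi>'" by (metis dvdE mult.commute)
 have "\<phi>' * \<psi>' * (\<psi>'' * \<phi>' - S + \<phi>'' * \<psi>') = 0"
  using root unfolding D M by (simp add: algebra_simps power2_eq_square)
 hence "\<psi>'' * \<phi>' - S + \<phi>'' * \<psi>' = 0" using nz by (metis mult_eq_0_iff)
 hence S: "S = \<phi>'' * \<psi>' + \<phi>' * \<psi>''" by (simp add: algebra_simps)
 have R3: "xrep ((n + 1) \<odot> Z) (poly \<phi>'' (xc Z)) (poly \<psi>'' (xc Z))" if Z: "Z \<in> C" "Z ~= Infinity" for Z
 proof -
  have "xrep (n \<odot> Z \<uplus> Z) (poly \<phi>'' (xc Z)) (poly \<psi>'' (xc Z))"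
  proof (rule xrep_sum[OF pmul_in_C[OF Z(1)] Z R2[OF Z]])
   show "xrep (n \<odot> Z \<uplus> pneg Z) (poly \<phi>' (xc Z)) (poly \<psi>' (xc Z))"
    using R1[OF Z] minus[OF Z(1)] by simp
   show "fD (poly \<phi> (xc Z)) (poly \<psi> (xc Z)) (xc Z) = poly \<psi>'' (xc Z) * poly \<psi>' (xc Z)"
    unfolding ev[symmetric] D by simp
   show "fS a b (poly \<phi> (xc Z)) (poly \<psi> (xc Z)) (xc Z) =
     poly \<phi>'' (xc Z) * poly \<psi>' (xc Z) + poly \<phi>' (xc Z) * poly \<psi>'' (xc Z)"
    unfolding ev[symmetric] S by simp
   show "fM a b (poly \<phi> (xc Z)) (poly \<psi> (xc Z)) (xc Z) = poly \<phi>'' (xc Z) * poly \<phi>' (xc Z)"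
    unfolding ev[symmetric] M by simp
  qed
  thus ?thesis using Z by (simp add: padd_commute)
 qed
 let ?N = "of_nat n :: 'k"
 have d: "degree \<phi> = n ^ 2" "lead_coeff \<phi> = 1" "degree \<psi> = n ^ 2 - 1" "lead_coeff \<psi> = ?N ^ 2"
  "degree \<phi>' = (n - 1) ^ 2" "lead_coeff \<phi>' = 1" "degree \<psi>' = (n - 1) ^ 2 - 1" "lead_coeff \<psi>' = (?N - 1) ^ 2"
  using 1 2 n by (auto simp: mult_polys_def of_nat_diff)
 have n2: "n ^ 2 \<ge> 4" using power_mono[OF n, of 2] by simp
 have N1: "?N ^ 2 ~= 1" "?N ~= 1" "?N + 1 ~= 0"
 proof -
  have "of_nat (n ^ 2) ~= (of_nat 1 :: 'k)" using n2 by (subst of_nat_eq_iff) linarith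
  thus "?N ^ 2 ~= 1" by simp
  have "of_nat n ~= (of_nat 1 :: 'k)" using n by (subst of_nat_eq_iff) linarith
  thus "?N ~= 1" by simp
  have "of_nat (n + 1) ~= (of_nat 0 :: 'k)" by (subst of_nat_eq_iff) linarith
  thus "?N + 1 ~= 0" by (simp add: add.commute)
 qed
 have lx: "degree x = 1" "lead_coeff x = 1" "x ~= 0" by (simp_all add: x_def)
 have dx: "degree (\<phi> * x) = n ^ 2 + 1" "lead_coeff (\<phi> * x) = 1"
  using nz lx d by (simp add: degree_mult_eq, simp only: lead_coeff_mult, simp)
 have dxp: "degree (x * \<psi>) = n ^ 2" "lead_coeff (x * \<psi>) = ?N ^ 2"
  using nz lx d n2 by (simp add: degree_mult_eq, simp only: lead_coeff_mult, simp)
 have "degree (\<phi> - x * \<psi>) \<le> n ^ 2" using d dxp by (intro degree_diff_le) auto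
 moreover have cf: "Polynomial.coeff (\<phi> - x * \<psi>) (n ^ 2) = 1 - ?N ^ 2"
  using d dxp by simp
 ultimately have dd: "degree (\<phi> - x * \<psi>) = n ^ 2" using N1 le_degree[of "\<phi> - x * \<psi>" "n ^ 2"] by simp
 have D_deg: "degree D = 2 * n ^ 2" "lead_coeff D = (1 - ?N ^ 2) ^ 2"
 proof -
  have "\<phi> - x * \<psi> ~= 0" using dd n2 by (metis degree_0 not_numeral_le_zero)
  thus "degree D = 2 * n ^ 2" using dd by (simp add: D_def fD_def degree_power_eq)
  show "lead_coeff D = (1 - ?N ^ 2) ^ 2"
   unfolding D_def fD_def lead_coeff_power using cf dd by simp
 qed
 have "\<psi>'' ~= 0" using D D_deg n2 by auto
 have m1: "(n - 1) ^ 2 + 2 * n = n ^ 2 + 1"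
 proof -
  obtain k where "n = Suc k" using n by (cases n) auto
  thus ?thesis by (simp add: power2_eq_square)
 qed
 have m0: "(n - 1) ^ 2 \<ge> 1" using n by simp
 have psi_deg: "degree \<psi>'' = (n + 1) ^ 2 - 1"
 proof -
  have "degree \<psi>'' + ((n - 1) ^ 2 - 1) = 2 * n ^ 2"
   using D_deg(1) d(7) \<open>\<psi>'' ~= 0\<close> nz unfolding D by (simp add: degree_mult_eq)
  moreover have "(n + 1) ^ 2 = n ^ 2 + 2 * n + 1" by (simp add: power2_eq_square)
  ultimately show ?thesis using m1 m0 by linarith
 qed
 have psi_lead: "lead_coeff \<psi>'' = of_nat ((n + 1) ^ 2)"
 proof -
  have "lead_coeff \<psi>'' * (?N - 1) ^ 2 = (1 - ?N ^ 2) ^ 2"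
   using D_deg(2) d(8) unfolding D lead_coeff_mult by simp
  also have "\<dots> = (?N + 1) ^ 2 * (?N - 1) ^ 2" by (simp add: algebra_simps power2_eq_square)
  finally show ?thesis using N1 by (simp add: algebra_simps)
 qed
 have M_deg: "degree M = 2 * n ^ 2 + 2" "lead_coeff M = 1"
 proof -
  have "degree ([:a:] * \<psi>) < degree (\<phi> * x)" using d dx n2 degree_smult_le[of a \<psi>] by simp
  hence d1: "degree (\<phi> * x + - ([:a:] * \<psi>)) = n ^ 2 + 1" "lead_coeff (\<phi> * x + - ([:a:] * \<psi>)) = 1"
   using degree_add_eq_left[of "- ([:a:] * \<psi>)" "\<phi> * x"] lead_coeff_add_le[of "- ([:a:] * \<psi>)" "\<phi> * x"] dx
   by (simp_all add: add.commute)
  define q1 where "q1 = \<phi> * x + - ([:a:] * \<psi>)"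
  note d1 = d1[folded q1_def]
  have "q1 ~= 0" using d1(1) by (intro notI) simp
  hence d2: "degree (q1 ^ 2) = 2 * n ^ 2 + 2" "lead_coeff (q1 ^ 2) = 1"
   using d1 by (simp add: degree_power_eq, simp only: lead_coeff_power, simp)
  have "degree (\<phi> + x * \<psi>) \<le> n ^ 2" using d dxp by (intro degree_add_le) auto
  have 1: "degree (4 * [:b:] * (\<phi> + x * \<psi>) * \<psi>) \<le> degree (4 * [:b:] * (\<phi> + x * \<psi>)) + degree \<psi>"
   by (rule degree_mult_le)
  have 2: "degree (4 * [:b:] * (\<phi> + x * \<psi>)) \<le> degree (4 * [:b:]) + degree (\<phi> + x * \<psi>)"
   by (rule degree_mult_le)
  have 3: "degree (4 * [:b:]) = 0" by (simp add: numeral_poly)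
  have "degree (4 * [:b:] * (\<phi> + x * \<psi>) * \<psi>) < 2 * n ^ 2 + 2"
   using 1 2 d(3) n2 \<open>degree (\<phi> + x * \<psi>) \<le> n ^ 2\<close> unfolding 3 by linarith
  hence d3: "degree (- (4 * [:b:] * (\<phi> + x * \<psi>) * \<psi>)) < degree (q1 ^ 2)"
   using d2 by simp
  have M': "M = q1 ^ 2 + - (4 * [:b:] * (\<phi> + x * \<psi>) * \<psi>)"
   by (simp add: M_def fM_def q1_def)
  show "degree M = 2 * n ^ 2 + 2" unfolding M' using degree_add_eq_left[OF d3] d2 by simp
  show "lead_coeff M = 1" unfolding M' using lead_coeff_add_le[OF d3] d2 by (simp only: add.commute)
 qed
 have "\<phi>'' ~= 0" using M M_deg by auto
 have phi_lead: "lead_coeff \<phi>'' = 1"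
  using M_deg(2) d(6) unfolding M lead_coeff_mult by simp
 have phi_deg: "degree \<phi>'' = (n + 1) ^ 2"
 proof -
  have "degree \<phi>'' + (n - 1) ^ 2 = 2 * n ^ 2 + 2"
   using M_deg(1) d(5) \<open>\<phi>'' ~= 0\<close> nz unfolding M by (simp add: degree_mult_eq)
  moreover have "(n + 1) ^ 2 = n ^ 2 + 2 * n + 1" by (simp add: power2_eq_square)
  ultimately show ?thesis using m1 by linarith
 qed
 show ?thesis using R3 phi_deg phi_lead psi_deg psi_lead unfolding mult_polys_def by blast
qed

lemma mult_polys_exist: "n \<ge> 1 ==> \<exists>\<phi> \<psi>. mult_polys n \<phi> \<psi>"
proof (induction n rule: less_induct)
 case (less n)
 show ?case
 proof (cases "n \<le> 2")
  case True
  hence "n = 1 \<or> n = 2" using less by linarith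
  thus ?thesis using mult_polys_1 mult_polys_2 by blast
 next
  case False
  obtain \<phi>' \<psi>' where 1: "mult_polys (n - 1 - 1) \<phi>' \<psi>'" using less.IH[of "n - 1 - 1"] False by fastforce
  obtain \<phi> \<psi> where 2: "mult_polys (n - 1) \<phi> \<psi>" using less.IH[of "n - 1"] False by fastforce
  show ?thesis using mult_polys_step[OF _ 1 2] False by simp
 qed
qed

lemma mult_polys_eq_iff:
 assumes "mult_polys n \<phi> \<psi>" "Z \<in> C" "Z ~= Infinity" "Y \<in> C" "Y ~= Infinity"
 shows "poly (\<phi> - smult (xc Y) \<psi>) (xc Z) = 0 \<longleftrightarrow> n \<odot> Z = Y \<or> n \<odot> Z = pneg Y"
proof -
 have x: "xrep (n \<odot> Z) (poly \<phi> (xc Z)) (poly \<psi> (xc Z))" using assms by (simp add: mult_polys_def)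
 show ?thesis
 proof
  assume *: "poly (\<phi> - smult (xc Y) \<psi>) (xc Z) = 0"
  hence nz: "poly \<psi> (xc Z) ~= 0" using x by (auto simp: xrep_def)
  hence aff: "n \<odot> Z ~= Infinity" using x by (auto simp: xrep_def)
  hence "xc (n \<odot> Z) * poly \<psi> (xc Z) = xc Y * poly \<psi> (xc Z)" using x * by (simp add: xrep_def)
  hence "xc (n \<odot> Z) = xc Y" using nz by simp
  thus "n \<odot> Z = Y \<or> n \<odot> Z = pneg Y" using same_x[of "n \<odot> Z" Y] assms aff by simp
 next
  assume "n \<odot> Z = Y \<or> n \<odot> Z = pneg Y"
  hence "n \<odot> Z ~= Infinity" "xc (n \<odot> Z) = xc Y" using assms by auto
  thus "poly (\<phi> - smult (xc Y) \<psi>) (xc Z) = 0" using x by (simp add: xrep_def)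
 qed
qed

section \<open>Fibres of multiplication by n\<close>

lemma mult_polys_fibre_degree:
 assumes "mult_polys n \<phi> \<psi>" "n \<ge> 1" shows "degree (\<phi> - smult c \<psi>) = n ^ 2"
proof -
 have "degree (- smult c \<psi>) < degree \<phi>"
 proof -
  have "degree (- smult c \<psi>) \<le> n ^ 2 - 1" using assms degree_smult_le[of c \<psi>] by (simp add: mult_polys_def)
  moreover have "n ^ 2 \<ge> 1" using assms by simp
  ultimately show ?thesis using assms by (simp add: mult_polys_def)
 qed
 thus ?thesis using degree_add_eq_left[of "- smult c \<psi>" \<phi>] assms by (simp add: mult_polys_def)
qed

lemma pmul_surj:
 assumes "n \<ge> 1" "Y \<in> C" shows "\<exists>Z\<in>C. n \<odot> Z = Y"
proof (cases "Y = Infinity")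
 case True thus ?thesis by (intro bexI[of _ Infinity]) auto
next
 case False
 obtain \<phi> \<psi> where m: "mult_polys n \<phi> \<psi>" using mult_polys_exist assms by blast
 have "degree (\<phi> - smult (xc Y) \<psi>) > 0" using mult_polys_fibre_degree[OF m] assms by simp
 then obtain z where z: "poly (\<phi> - smult (xc Y) \<psi>) z = 0" using alg_closed_imp_poly_has_root by blast
 obtain Z where Z: "Z \<in> C" "Z ~= Infinity" "xc Z = z" using ex_point_xc by blast
 have "n \<odot> Z = Y \<or> n \<odot> Z = pneg Y" using mult_polys_eq_iff[OF m Z(1,2) assms(2) False] z Z by blast
 thus ?thesis
 proof
  assume "n \<odot> Z = pneg Y"
  hence "n \<odot> pneg Z = Y" using Z by (simp add: pmul_pneg)
  thus ?thesis using Z by (intro bexI[of _ "pneg Z"]) auto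
 qed (use Z in blast)
qed

lemma finite_tors: "n \<ge> 1 ==> finite (tors n)"
proof -
 assume n: "n \<ge> 1"
 obtain \<phi> \<psi> where m: "mult_polys n \<phi> \<psi>" using mult_polys_exist n by blast
 hence "\<psi> ~= 0" using n by (auto simp: mult_polys_def)
 hence "finite (insert 0 {x. poly \<psi> x = 0})" using poly_roots_finite by blast
 note fin = finite_xc_C[OF this]
 have "tors n \<subseteq> {P \<in> C. xc P \<in> insert 0 {x. poly \<psi> x = 0}}"
 proof
  fix P assume P: "P \<in> tors n"
  hence "P ~= Infinity ==> poly \<psi> (xc P) = 0" using m by (auto simp: tors_def mult_polys_def xrep_def)
  thus "P \<in> {P \<in> C. xc P \<in> insert 0 {x. poly \<psi> x = 0}}" using P tors_in_C[OF P] by (cases "P = Infinity") auto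
 qed
 thus ?thesis using fin by (rule finite_subset)
qed

text \<open>All fibres of multiplication by n are translates of the torsion subgroup, so a general
  fibre is counted instead. Over Y it corresponds to the roots of \<phi> - x(Y) \<psi>, of degree
  n^2, which are simple unless x(Y) is a critical value of \<phi> / \<psi>.\<close>

lemma card_tors: "n \<ge> 1 ==> card (tors n) = n ^ 2"
proof -
 assume n: "n \<ge> 1"
 obtain \<phi> \<psi> where m: "mult_polys n \<phi> \<psi>" using mult_polys_exist n by blast
 \<comment> \<open>The numerator of the derivative of \<phi> / \<psi>; its zeros lead to the
   critical values \<open>bad\<close>.\<close>
 define w where "w = pderiv \<phi> * \<psi> - \<phi> * pderiv \<psi>"
 have nz: "\<psi> ~= 0" "\<phi> ~= 0" using m n by (auto simp: mult_polys_def)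
 have "w ~= 0"
 proof
  assume "w = 0"
  hence eq: "pderiv \<phi> * \<psi> = \<phi> * pderiv \<psi>" by (simp add: w_def)
  have "\<psi> dvd pderiv \<psi>"
  proof (rule dvd_if_no_common_root)
   show "\<psi> dvd pderiv \<psi> * \<phi>" using eq by (metis dvd_triv_right mult.commute)
  qed (use nz mult_polys_no_common_root[OF m] in auto)
  hence "pderiv \<psi> = 0"
   using dvd_imp_degree_le[of \<psi> "pderiv \<psi>"] degree_pderiv[of \<psi>] pderiv_eq_0_iff[of \<psi>] by fastforce
  hence "pderiv \<phi> = 0" using eq nz by simp
  thus False using pderiv_eq_0_iff[of \<phi>] m n by (simp add: mult_polys_def)
 qed
 define bad where "bad = (\<lambda>x. poly \<phi> x / poly \<psi> x) ` {x. poly w x = 0}"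
 have "finite bad" unfolding bad_def using poly_roots_finite[OF \<open>w ~= 0\<close>] by simp
 \<comment> \<open>y(Y) \<noteq> 0 separates Y from - Y, so that a point of the fibre is determined
   by its abscissa.\<close>
 have "most (\<lambda>Z. (Z ~= Infinity \<and> yc Z ~= 0) \<and> xc Z \<notin> bad)"
 proof (intro most_conj most_neq)
  show "most (\<lambda>Z. xc Z \<notin> bad)" unfolding most_def using finite_xc_C[OF \<open>finite bad\<close>] by simp
  show "most (\<lambda>Z. yc Z ~= 0)" using most_nonzero[of 0 1] by simp
 qed
 then obtain Y where Y: "Y \<in> C" "Y ~= Infinity" "yc Y ~= 0" "xc Y \<notin> bad" using most_ex by blast
 define p where "p = \<phi> - smult (xc Y) \<psi>"
 have degp: "degree p = n ^ 2" using mult_polys_fibre_degree[OF m n] by (simp add: p_def)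
 have "card {x. poly p x = 0} = n ^ 2"
 proof -
  have "p ~= 0" using degp n by auto
  moreover have "poly (pderiv p) x ~= 0" if "poly p x = 0" for x
  proof
   assume "poly (pderiv p) x = 0"
   with that have *: "poly \<phi> x = xc Y * poly \<psi> x" "poly (pderiv \<phi>) x = xc Y * poly (pderiv \<psi>) x"
    by (simp_all add: p_def pderiv_diff pderiv_smult)
   hence "poly w x = 0" by (simp add: w_def)
   moreover have "poly \<psi> x ~= 0" using * mult_polys_no_common_root[OF m, of x] by auto
   hence "xc Y = poly \<phi> x / poly \<psi> x" using * by simp
   ultimately have "xc Y \<in> bad" unfolding bad_def by blast
   thus False using Y by simp
  qed
  ultimately show ?thesis using card_roots_eq_degree[of p] degp by simp
 qed
 moreover have "bij_betw xc {Z \<in> C. n \<odot> Z = Y} {x. poly p x = 0}"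
 proof (rule bij_betwI')
  fix Z Z' assume *: "Z \<in> {Z \<in> C. n \<odot> Z = Y}" "Z' \<in> {Z \<in> C. n \<odot> Z = Y}"
  show "xc Z = xc Z' \<longleftrightarrow> Z = Z'"
  proof
   assume "xc Z = xc Z'"
   moreover have "Z ~= Infinity" "Z' ~= Infinity" using * Y by auto
   ultimately have "Z = Z' \<or> Z = pneg Z'" using same_x * by blast
   thus "Z = Z'"
   proof
    assume "Z = pneg Z'"
    hence "Y = pneg Y" using * by (auto simp: pmul_pneg)
    thus ?thesis using Y by (cases Y) auto
   qed
  qed simp
 next
  fix Z assume *: "Z \<in> {Z \<in> C. n \<odot> Z = Y}"
  hence "Z ~= Infinity" using Y by auto
  thus "xc Z \<in> {x. poly p x = 0}" using mult_polys_eq_iff[OF m, of Z Y] * Y by (auto simp: p_def)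
 next
  fix x assume "x \<in> {x. poly p x = 0}"
  moreover obtain Z where Z: "Z \<in> C" "Z ~= Infinity" "xc Z = x" using ex_point_xc by blast
  ultimately have "n \<odot> Z = Y \<or> n \<odot> Z = pneg Y" using mult_polys_eq_iff[OF m Z(1,2) Y(1,2)] by (simp add: p_def)
  thus "\<exists>Z\<in>{Z \<in> C. n \<odot> Z = Y}. x = xc Z"
  proof
   assume "n \<odot> Z = pneg Y"
   hence "n \<odot> pneg Z = Y" using Z by (simp add: pmul_pneg)
   thus ?thesis using Z by (intro bexI[of _ "pneg Z"]) auto
  qed (use Z in blast)
 qed
 hence "card {Z \<in> C. n \<odot> Z = Y} = card {x. poly p x = 0}" by (rule bij_betw_same_card)
 moreover obtain Z0 where Z0: "Z0 \<in> C" "n \<odot> Z0 = Y" using pmul_surj n Y by blast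
 have "bij_betw (\<lambda>P. Z0 \<uplus> P) (tors n) {Z \<in> C. n \<odot> Z = Y}"
 proof (rule bij_betwI')
  fix P Q assume "P \<in> tors n" "Q \<in> tors n"
  thus "Z0 \<uplus> P = Z0 \<uplus> Q \<longleftrightarrow> P = Q" using Z0 by (simp add: tors_in_C)
 next
  fix P assume "P \<in> tors n"
  thus "Z0 \<uplus> P \<in> {Z \<in> C. n \<odot> Z = Y}" using Z0 by (simp add: tors_def pmul_padd)
 next
  fix Z assume "Z \<in> {Z \<in> C. n \<odot> Z = Y}"
  hence "pneg Z0 \<uplus> Z \<in> tors n" "Z = Z0 \<uplus> (pneg Z0 \<uplus> Z)"
   using Z0 by (auto simp: tors_def pmul_padd pmul_pneg)
  thus "\<exists>P\<in>tors n. Z = Z0 \<uplus> P" by blast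
 qed
 hence "card (tors n) = card {Z \<in> C. n \<odot> Z = Y}" by (rule bij_betw_same_card)
 ultimately show ?thesis by simp
qed

end

section \<open>Chord functions and reciprocity\<close>

lemma Infinity_eq_pneg [simp]: "Infinity = pneg P \<longleftrightarrow> P = Infinity"
 by (cases P) auto

context short_weierstrass
begin

definition ln :: "'k point => 'k point => 'k point => 'k" where
 "ln A B Z = yc Z - yc A - slope A B * (xc Z - xc A)"

text \<open>The function \<open>h A B\<close> has divisor \<open>[A] + [B] - [A + B] - [O]\<close>; its value at \<open>O\<close> is a convention.\<close>

definition h :: "'k point => 'k point => 'k point => 'k" where
 "h A B Z = (if A = Infinity \<or> B = Infinity \<or> Z = Infinity then 1
  else if A = pneg B then xc Z - xc A else ln A B Z / (xc Z - xc (A \<uplus> B)))"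

lemma ln_norm:
 assumes "A \<in> C" "B \<in> C" "A ~= Infinity" "B ~= Infinity" "A ~= pneg B" "Z \<in> C" "Z ~= Infinity"
 shows "ln A B Z * ln A B (pneg Z) = - ((xc Z - xc A) * (xc Z - xc B) * (xc Z - xc (A \<uplus> B)))"
proof -
 have "ln A B Z * ln A B (pneg Z) = (yc A + slope A B * (xc Z - xc A)) ^ 2 - yc Z ^ 2"
  by (simp add: ln_def algebra_simps power2_eq_square)
 thus ?thesis using line_cubic[OF assms(1-5), of "xc Z"] in_C_eq[OF assms(6,7)] by Groebner_Basis.algebra
qed

lemma ln_zeros:
 assumes "A \<in> C" "B \<in> C" "A ~= Infinity" "B ~= Infinity" "A ~= pneg B"
 shows "ln A B A = 0" "ln A B B = 0" "ln A B (pneg (A \<uplus> B)) = 0"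
 using slope_eq[OF assms] sum_affine(3)[OF assms] by (simp_all add: ln_def)

text \<open>Vieta's formulas for the factorisation in \<open>line_cubic\<close>, obtained from the
  formula for x(A + B) and from the values at 0 and 1.\<close>

lemma line_symmetric_functions:
 assumes "A \<in> C" "B \<in> C" "A ~= Infinity" "B ~= Infinity" "A ~= pneg B"
 defines "m \<equiv> slope A B" and "c \<equiv> yc A - slope A B * xc A" and "x3 \<equiv> xc (A \<uplus> B)"
 shows "xc A + xc B + x3 = m ^ 2" "xc A * xc B + xc A * x3 + xc B * x3 = a - 2 * m * c"
  "xc A * xc B * x3 = c ^ 2 - b"
proof -
 have 0: "rhs z - (m * z + c) ^ 2 = (z - xc A) * (z - xc B) * (z - x3)" for z
 proof -
  have "m * z + c = yc A + slope A B * (z - xc A)" by (simp add: m_def c_def algebra_simps)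
  thus ?thesis using line_cubic[OF assms(1-5), of z] by (simp add: x3_def)
 qed
 show 1: "xc A + xc B + x3 = m ^ 2" using sum_affine(2)[OF assms(1-5)] by (simp add: m_def x3_def)
 show 3: "xc A * xc B * x3 = c ^ 2 - b" using 0[of 0] by (simp add: rhs_def algebra_simps)
 have "1 + a + b - (m + c) ^ 2 = (1 - xc A) * (1 - xc B) * (1 - x3)" using 0[of 1] by (simp add: rhs_def)
 thus "xc A * xc B + xc A * x3 + xc B * x3 = a - 2 * m * c" using 1 3 by Groebner_Basis.algebra
qed

text \<open>Weil reciprocity for two lines.\<close>

lemma line_reciprocity:
 assumes "A \<in> C" "B \<in> C" "A ~= Infinity" "B ~= Infinity" "A ~= pneg B"
  and "P \<in> C" "Q \<in> C" "P ~= Infinity" "Q ~= Infinity" "P ~= pneg Q"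
 shows "ln P Q A * ln P Q B * ln P Q (pneg (A \<uplus> B)) = - (ln A B P * ln A B Q * ln A B (pneg (P \<uplus> Q)))"
proof -
 define m c m' c' where mc: "m = slope A B" "c = yc A - slope A B * xc A"
  "m' = slope P Q" "c' = yc P - slope P Q * xc P"
 note s = line_symmetric_functions[OF assms(1-5), folded mc] line_symmetric_functions[OF assms(6-10), folded mc]
 have l: "ln A B Z = yc Z - (m * xc Z + c)" "ln P Q Z = yc Z - (m' * xc Z + c')" for Z
  by (simp_all add: ln_def mc algebra_simps)
 have on: "yc Z = m * xc Z + c" if "Z \<in> {A, B, pneg (A \<uplus> B)}" for Z
  using that ln_zeros[OF assms(1-5)] unfolding l by auto
 have on': "yc Z = m' * xc Z + c'" if "Z \<in> {P, Q, pneg (P \<uplus> Q)}" for Z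
  using that ln_zeros[OF assms(6-10)] unfolding l by auto
 have e: "ln P Q Z = (m - m') * xc Z + (c - c')" if "Z \<in> {A, B, pneg (A \<uplus> B)}" for Z
  using on[OF that] by (simp add: l algebra_simps)
 have e': "ln A B Z = - ((m - m') * xc Z + (c - c'))" if "Z \<in> {P, Q, pneg (P \<uplus> Q)}" for Z
  using on'[OF that] by (simp add: l algebra_simps)
 have pr: "(M * x1 + K) * (M * x2 + K) * (M * x3 + K)
   = M ^ 3 * (x1 * x2 * x3) + M ^ 2 * K * (x1 * x2 + x1 * x3 + x2 * x3) + M * K ^ 2 * (x1 + x2 + x3) + K ^ 3"
  for M K x1 x2 x3 :: 'k by (simp add: algebra_simps power2_eq_square power3_eq_cube)
 have "ln P Q A * ln P Q B * ln P Q (pneg (A \<uplus> B)) =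
  ((m - m') * xc A + (c - c')) * ((m - m') * xc B + (c - c')) * ((m - m') * xc (A \<uplus> B) + (c - c'))"
  using e by simp
 also have "\<dots> = ((m - m') * xc P + (c - c')) * ((m - m') * xc Q + (c - c')) * ((m - m') * xc (P \<uplus> Q) + (c - c'))"
  unfolding pr s by (simp add: algebra_simps power2_eq_square power3_eq_cube)
 also have "\<dots> = - (ln A B P * ln A B Q * ln A B (pneg (P \<uplus> Q)))"
  using e'[of P] e'[of Q] e'[of "pneg (P \<uplus> Q)"] by (simp del: minus_add_distrib)
 finally show ?thesis .
qed

text \<open>A finite subgroup contains the points of one divisor. Keeping A, B and A + B outside it
  makes all chord functions in the reciprocity laws finite and nonzero where they are
  evaluated.\<close>

definition subgrp :: "'k point set => bool" where
 "subgrp S \<longleftrightarrow> finite S \<and> S \<subseteq> C \<and> Infinity \<in> S \<and> (\<forall>P\<in>S. pneg P \<in> S) \<and> (\<forall>P\<in>S. \<forall>Q\<in>S. P \<uplus> Q \<in> S)"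

lemma subgrp_tors: "n \<ge> 1 ==> subgrp (tors n)"
 by (auto simp: subgrp_def finite_tors tors_in_C intro: tors_padd tors_pneg)

lemma subgrp_pmul: "subgrp S ==> P \<in> S ==> n \<odot> P \<in> S"
 by (induction n) (auto simp: subgrp_def)

lemma xc_neq_outside:
 assumes "subgrp S" "A \<in> C" "A \<notin> S" "P \<in> S" "P ~= Infinity"
 shows "xc A ~= xc P" "xc P ~= xc A"
proof -
 show "xc A ~= xc P" using same_x[of A P] assms by (auto simp: subgrp_def)
 thus "xc P ~= xc A" by simp
qed

lemma ln_nonzero:
 assumes S: "subgrp S" and "A \<in> C" "B \<in> C" "A \<notin> S" "B \<notin> S" "A \<uplus> B \<notin> S" "P \<in> S" "P ~= Infinity"
 shows "ln A B P ~= 0"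
proof -
 have ne: "A ~= Infinity" "B ~= Infinity" "A ~= pneg B" "P \<in> C" using assms by (auto simp: subgrp_def)
 have "A \<uplus> B \<in> C" using assms by simp
 hence "ln A B P * ln A B (pneg P) ~= 0"
  unfolding ln_norm[OF assms(2,3) ne assms(8)]
  using xc_neq_outside[OF S _ _ assms(7,8)] assms by simp
 thus ?thesis by auto
qed

lemma ln_nonzero':
 assumes S: "subgrp S" and "A \<in> C" "A \<notin> S" "P \<in> S" "Q \<in> S" "P ~= Infinity" "Q ~= Infinity" "P ~= pneg Q"
 shows "ln P Q A ~= 0"
proof -
 have ne: "P \<in> C" "Q \<in> C" "A ~= Infinity" "P \<uplus> Q \<in> S" using assms by (auto simp: subgrp_def)
 have "ln P Q A * ln P Q (pneg A) ~= 0"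
  unfolding ln_norm[OF ne(1,2) assms(6-8) assms(2) ne(3)]
  using xc_neq_outside[OF S assms(2,3)] assms ne sum_affine(1)[OF ne(1,2) assms(6-8)] by simp
 thus ?thesis by auto
qed

lemma h_nonzero:
 assumes S: "subgrp S" and "A \<in> C" "B \<in> C" "A \<notin> S" "B \<notin> S" "A \<uplus> B \<notin> S" "P \<in> S"
 shows "h A B P ~= 0"
proof (cases "P = Infinity")
 case False
 have "A ~= Infinity" "B ~= Infinity" "A ~= pneg B" using assms by (auto simp: subgrp_def)
 thus ?thesis using False ln_nonzero[OF assms False] xc_neq_outside(2)[OF S _ assms(6,7) False] assms
  by (simp add: h_def)
qed (simp add: h_def)

lemma h_nonzero':
 assumes S: "subgrp S" and "A \<in> C" "A \<notin> S" "P \<in> S" "Q \<in> S"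
 shows "h P Q A ~= 0"
proof -
 have ne: "A ~= Infinity" "P \<in> C" "Q \<in> C" "P \<uplus> Q \<in> S" using assms by (auto simp: subgrp_def)
 consider "P = Infinity \<or> Q = Infinity" | "P ~= Infinity" "Q ~= Infinity" "P = pneg Q"
  | "P ~= Infinity" "Q ~= Infinity" "P ~= pneg Q" by blast
 thus ?thesis
 proof cases
  case 2
  thus ?thesis using xc_neq_outside[OF S assms(2,3), of P] assms ne by (simp add: h_def)
 next
  case 3
  thus ?thesis using ln_nonzero'[OF assms 3] sum_affine(1)[OF ne(2,3) 3]
   xc_neq_outside(1)[OF S assms(2,3) ne(4)] ne by (simp add: h_def)
 qed (auto simp: h_def)
qed

text \<open>Weil reciprocity for the divisors [P] + [Q] - [P + Q] - [O] and [A] + [B] - [A + B] -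
  [O]. The common pole O contributes the sign s, which may depend on P and Q but not on A and
  B.\<close>

lemma h_reciprocity:
 assumes S: "subgrp S" and PQ: "P \<in> S" "Q \<in> S"
 obtains s :: 'k where "s = 1 \<or> s = -1"
  "\<And>A B. A \<in> C ==> B \<in> C ==> A \<notin> S ==> B \<notin> S ==> A \<uplus> B \<notin> S ==>
   h P Q A * h P Q B * h A B (P \<uplus> Q) = s * h P Q (A \<uplus> B) * h A B P * h A B Q"
proof -
 have PQC: "P \<in> C" "Q \<in> C" "P \<uplus> Q \<in> S" using assms by (auto simp: subgrp_def)
 have cond: "A ~= Infinity" "B ~= Infinity" "A ~= pneg B" "A \<uplus> B ~= Infinity"
  if "A \<in> C" "B \<in> C" "A \<notin> S" "B \<notin> S" "A \<uplus> B \<notin> S" for A B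
  using that S by (auto simp: subgrp_def)
 consider "P = Infinity \<or> Q = Infinity" | "P ~= Infinity" "Q ~= Infinity" "P = pneg Q"
  | "P ~= Infinity" "Q ~= Infinity" "P ~= pneg Q" by blast
 thus ?thesis
 proof cases
  case 1
  thus ?thesis by (intro that[of 1]) (auto simp: h_def)
 next
  case 2
  show ?thesis
  proof (rule that[of 1])
   fix A B assume *: "A \<in> C" "B \<in> C" "A \<notin> S" "B \<notin> S" "A \<uplus> B \<notin> S"
   note c = cond[OF *]
   let ?T = "A \<uplus> B"
   have x: "xc Q - xc ?T ~= 0" using xc_neq_outside[OF S _ *(5) PQ(2) 2(2)] * by simp
   have n: "ln A B P * ln A B Q = - ((xc Q - xc A) * (xc Q - xc B) * (xc Q - xc ?T))"
    using ln_norm[OF *(1,2) c(1-3) PQC(2) 2(2)] 2(3) by (simp add: mult.commute)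
   have "h A B P * h A B Q = (ln A B P * ln A B Q) / (xc Q - xc ?T) ^ 2"
    using 2 c by (simp add: h_def power2_eq_square)
   hence "h A B P * h A B Q * (xc Q - xc ?T) ^ 2 = ln A B P * ln A B Q" using x by simp
   hence "(h A B P * h A B Q * (xc Q - xc ?T)) * (xc Q - xc ?T)
     = - ((xc Q - xc A) * (xc Q - xc B)) * (xc Q - xc ?T)"
    unfolding n by (simp add: power2_eq_square mult_ac)
   hence "h A B P * h A B Q * (xc Q - xc ?T) = - ((xc Q - xc A) * (xc Q - xc B))"
    by (rule mult_right_cancel[THEN iffD1, OF x])
   moreover have "h P Q A = xc A - xc Q" "h P Q B = xc B - xc Q" "h P Q ?T = xc ?T - xc Q" "h A B (P \<uplus> Q) = 1"
    using 2 c PQC by (simp_all add: h_def)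
   ultimately show "h P Q A * h P Q B * h A B (P \<uplus> Q) = 1 * h P Q ?T * h A B P * h A B Q"
    by Groebner_Basis.algebra
  qed simp
 next
  case 3
  let ?S = "P \<uplus> Q"
  have Saff: "?S ~= Infinity" "?S \<in> C" using sum_affine(1)[OF PQC(1,2) 3] PQC S by (auto simp: subgrp_def)
  show ?thesis
  proof (rule that[of "-1"])
   fix A B assume *: "A \<in> C" "B \<in> C" "A \<notin> S" "B \<notin> S" "A \<uplus> B \<notin> S"
   note c = cond[OF *]
   let ?T = "A \<uplus> B"
   have T: "?T \<in> C" using * by simp
   have rec: "ln P Q A * ln P Q B * ln P Q (pneg ?T) = - (ln A B P * ln A B Q * ln A B (pneg ?S))"
    by (rule line_reciprocity[OF *(1,2) c(1-3) PQC(1,2) 3])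
   \<comment> \<open>Reciprocity of the two lines involves their values at -(A + B) and -(P + Q);
     the norms exchange these for values at A + B and P + Q.\<close>
   have n1: "ln P Q ?T * ln P Q (pneg ?T) = - ((xc ?T - xc P) * (xc ?T - xc Q) * (xc ?T - xc ?S))"
    by (rule ln_norm[OF PQC(1,2) 3 T c(4)])
   have n2: "ln A B ?S * ln A B (pneg ?S) = - ((xc ?S - xc A) * (xc ?S - xc B) * (xc ?S - xc ?T))"
    by (rule ln_norm[OF *(1,2) c(1-3) Saff(2,1)])
   have nz1: "ln P Q (pneg ?T) ~= 0"
   proof (rule ln_nonzero'[OF S _ _ PQ 3])
    show "pneg ?T \<in> C" using T by simp
    show "pneg ?T \<notin> S" using *(5) S pneg_pneg unfolding subgrp_def by metis
   qed
   have nz2: "ln A B (pneg ?S) ~= 0"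
    by (rule ln_nonzero[OF S *]) (use S PQC Saff in \<open>auto simp: subgrp_def\<close>)
   have x: "xc A - xc ?S ~= 0" "xc B - xc ?S ~= 0" "xc ?T - xc ?S ~= 0"
    "xc P - xc ?T ~= 0" "xc Q - xc ?T ~= 0"
    using xc_neq_outside[OF S *(1,3) PQC(3) Saff(1)] xc_neq_outside[OF S *(2,4) PQC(3) Saff(1)]
     xc_neq_outside[OF S T *(5) PQC(3) Saff(1)] xc_neq_outside[OF S T *(5) PQ(1) 3(1)]
     xc_neq_outside[OF S T *(5) PQ(2) 3(2)] by auto
   define lA lB lT lT' kP kQ kS kS' where l: "lA = ln P Q A" "lB = ln P Q B" "lT = ln P Q ?T"
    "lT' = ln P Q (pneg ?T)" "kP = ln A B P" "kQ = ln A B Q" "kS = ln A B ?S" "kS' = ln A B (pneg ?S)"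
   have hs: "h P Q A * (xc A - xc ?S) = lA" "h P Q B * (xc B - xc ?S) = lB"
    "h P Q ?T * (xc ?T - xc ?S) = lT" "h A B P * (xc P - xc ?T) = kP" "h A B Q * (xc Q - xc ?T) = kQ"
    "h A B ?S * (xc ?S - xc ?T) = kS"
    using x 3 c Saff by (simp_all add: h_def l)
   have "lT' * kS' * (lA * lB * kS * (xc ?T - xc ?S) * (xc P - xc ?T) * (xc Q - xc ?T)
     - - (lT * kP * kQ * (xc A - xc ?S) * (xc B - xc ?S) * (xc ?S - xc ?T))) = 0"
    using rec n1 n2 unfolding l[symmetric] by Groebner_Basis.algebra
   hence "lA * lB * kS * (xc ?T - xc ?S) * (xc P - xc ?T) * (xc Q - xc ?T)
     = - (lT * kP * kQ * (xc A - xc ?S) * (xc B - xc ?S) * (xc ?S - xc ?T))"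
    using nz1 nz2 unfolding l[symmetric] by (simp add: eq_neg_iff_add_eq_0)
   hence "(h P Q A * h P Q B * h A B ?S) * ((xc A - xc ?S) * (xc B - xc ?S) * (xc ?S - xc ?T)
      * (xc ?T - xc ?S) * (xc P - xc ?T) * (xc Q - xc ?T))
     = (- 1 * h P Q ?T * h A B P * h A B Q) * ((xc A - xc ?S) * (xc B - xc ?S) * (xc ?S - xc ?T)
      * (xc ?T - xc ?S) * (xc P - xc ?T) * (xc Q - xc ?T))"
    unfolding hs[symmetric] by (simp add: mult_ac)
   moreover have "xc ?S - xc ?T ~= 0" using x by auto
   ultimately show "h P Q A * h P Q B * h A B ?S = - 1 * h P Q ?T * h A B P * h A B Q"
    using x by (subst (asm) mult_right_cancel) auto
  qed simp
 qed
qed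

text \<open>Miller's function: the divisors of the factors telescope to k [P] - [k P] - (k - 1)
  [O].\<close>

definition Fm :: "nat => 'k point => 'k point => 'k" where
 "Fm k P Z = (\<Prod>i=1..<k. h P (i \<odot> P) Z)"

lemma Fm_Suc: "k \<ge> 1 ==> Fm (Suc k) P Z = Fm k P Z * h P (k \<odot> P) Z"
 by (simp add: Fm_def prod.atLeastLessThan_Suc)

lemma Fm_nonzero:
 assumes "subgrp S" "P \<in> S" "A \<in> C" "A \<notin> S" shows "Fm k P A ~= 0"
 unfolding Fm_def using h_nonzero'[OF assms(1,3,4,2) subgrp_pmul[OF assms(1,2)]] by simp

text \<open>Multiplying the laws for the factors \<open>h P (i \<odot> P)\<close> telescopes the
  values of \<open>h A B\<close> at the multiples of P.\<close>

lemma Fm_reciprocity: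
 assumes S: "subgrp S" and P: "P \<in> S" and k: "k \<ge> 1"
 obtains s :: 'k where "s = 1 \<or> s = -1"
  "\<And>A B. A \<in> C ==> B \<in> C ==> A \<notin> S ==> B \<notin> S ==> A \<uplus> B \<notin> S ==>
   Fm k P A * Fm k P B * h A B (k \<odot> P) = s * Fm k P (A \<uplus> B) * h A B P ^ k"
proof -
 have "\<exists>s::'k. (s = 1 \<or> s = -1) \<and> (\<forall>A B. A \<in> C \<longrightarrow> B \<in> C \<longrightarrow> A \<notin> S \<longrightarrow> B \<notin> S \<longrightarrow> A \<uplus> B \<notin> S \<longrightarrow>
   Fm k P A * Fm k P B * h A B (k \<odot> P) = s * Fm k P (A \<uplus> B) * h A B P ^ k)"
  using k
 proof (induction k rule: dec_induct)
  case base
  show ?case by (intro exI[of _ 1]) (auto simp: Fm_def)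
 next
  case (step k)
  then obtain s :: 'k where s: "s = 1 \<or> s = -1"
   "\<And>A B. A \<in> C ==> B \<in> C ==> A \<notin> S ==> B \<notin> S ==> A \<uplus> B \<notin> S ==>
   Fm k P A * Fm k P B * h A B (k \<odot> P) = s * Fm k P (A \<uplus> B) * h A B P ^ k" by blast
  have kP: "k \<odot> P \<in> S" using subgrp_pmul[OF S P] .
  obtain s' :: 'k where s': "s' = 1 \<or> s' = -1"
   "\<And>A B. A \<in> C ==> B \<in> C ==> A \<notin> S ==> B \<notin> S ==> A \<uplus> B \<notin> S ==>
   h P (k \<odot> P) A * h P (k \<odot> P) B * h A B (P \<uplus> k \<odot> P) = s' * h P (k \<odot> P) (A \<uplus> B) * h A B P * h A B (k \<odot> P)"
   using h_reciprocity[OF S P kP] by blast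
  have "Fm (Suc k) P A * Fm (Suc k) P B * h A B (Suc k \<odot> P) = (s * s') * Fm (Suc k) P (A \<uplus> B) * h A B P ^ Suc k"
   if *: "A \<in> C" "B \<in> C" "A \<notin> S" "B \<notin> S" "A \<uplus> B \<notin> S" for A B
  proof -
   have nz: "h A B (k \<odot> P) ~= 0" by (rule h_nonzero[OF S * kP])
   have "h A B (k \<odot> P) * (Fm (Suc k) P A * Fm (Suc k) P B * h A B (Suc k \<odot> P))
    = (Fm k P A * Fm k P B * h A B (k \<odot> P)) * (h P (k \<odot> P) A * h P (k \<odot> P) B * h A B (P \<uplus> k \<odot> P))"
    using step by (simp add: Fm_Suc mult_ac)
   also have "\<dots> = h A B (k \<odot> P) * ((s * s') * Fm (Suc k) P (A \<uplus> B) * h A B P ^ Suc k)"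
    unfolding s(2)[OF *] s'(2)[OF *] using step by (simp add: Fm_Suc mult_ac)
   finally show ?thesis using nz by (subst (asm) mult_left_cancel) auto
  qed
  moreover have "s * s' = 1 \<or> s * s' = -1" using s s' by auto
  ultimately show ?case by blast
 qed
 thus ?thesis using that by blast
qed

text \<open>If \<open>N \<cdot> P = O\<close>, then \<open>Fm N P\<close> has divisor \<open>N [P] - N [O]\<close>.
 Iterating the reciprocity law exhibits \<open>Fm N P (N Z)\<close> as an \<open>N\<close>-th power \<open>gm N P Z ^ N\<close>.\<close>

definition Hm :: "nat => 'k point => 'k point => 'k" where
 "Hm k P Z = (\<Prod>i=1..<k. h Z (i \<odot> Z) P)"

definition gm :: "nat => 'k point => 'k point => 'k" where
 "gm N P Z = Fm N P Z / Hm N P Z"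

lemma Fm_reciprocity_tors:
 assumes N: "N \<ge> 1" and P: "P \<in> tors N"
 obtains s :: 'k where "s = 1 \<or> s = -1"
  "\<And>A B. A \<in> C ==> B \<in> C ==> A \<notin> tors N ==> B \<notin> tors N ==> A \<uplus> B \<notin> tors N ==>
   Fm N P A * Fm N P B = s * Fm N P (A \<uplus> B) * h A B P ^ N"
proof -
 have "h A B (N \<odot> P) = 1" for A B using P by (simp add: h_def tors_def)
 thus ?thesis using Fm_reciprocity[OF subgrp_tors[OF N] P N] that by (metis mult.right_neutral)
qed

text \<open>At such Z neither \<open>Fm N P\<close> nor \<open>Hm N P\<close> has a zero or a pole,
  for all N-torsion points P, and N Z stays outside the torsion too.\<close>

definition goodpt :: "nat => 'k point => bool" where
 "goodpt N Z \<longleftrightarrow> Z \<in> C \<and> (\<forall>i\<in>{1..N}. i \<odot> Z \<notin> tors N)"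

lemma Hm_nonzero:
 assumes "P \<in> tors N" "goodpt N Z" "k \<le> N" shows "Hm k P Z ~= 0"
proof (cases "N = 0")
 case True thus ?thesis using assms by (simp add: Hm_def)
next
 case False
 have "h Z (i \<odot> Z) P ~= 0" if "i \<in> {1..<k}" for i
 proof (rule h_nonzero[OF subgrp_tors])
  show "N \<ge> 1" using False by simp
  have "j \<odot> Z \<notin> tors N" if "j \<in> {1, i, Suc i}" for j
   using assms that \<open>i \<in> {1..<k}\<close> unfolding goodpt_def by auto
  from this[of 1] this[of i] this[of "Suc i"]
  show "Z \<notin> tors N" "Z \<uplus> i \<odot> Z \<notin> tors N" "i \<odot> Z \<notin> tors N" by simp_all
 qed (use assms in \<open>auto simp: goodpt_def\<close>)
 thus ?thesis by (simp add: Hm_def)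
qed

lemma gm_nonzero:
 assumes "N \<ge> 1" "P \<in> tors N" "goodpt N Z" shows "gm N P Z ~= 0"
proof -
 have "Z = 1 \<odot> Z" by simp
 hence "Z \<notin> tors N" using assms unfolding goodpt_def by (metis atLeastAtMost_iff le_refl)
 thus ?thesis unfolding gm_def
  using Hm_nonzero[OF assms(2,3) le_refl] Fm_nonzero[OF subgrp_tors[OF assms(1)] assms(2)] assms(3)
  by (simp add: goodpt_def)
qed

lemma gm_power:
 assumes "odd N" "P \<in> tors N" "goodpt N Z"
 shows "gm N P Z ^ N = Fm N P (N \<odot> Z)"
proof -
 have N: "N \<ge> 1" using assms(1) by (cases N) auto
 obtain s :: 'k where s: "s = 1 \<or> s = -1"
  "\<And>A B. A \<in> C ==> B \<in> C ==> A \<notin> tors N ==> B \<notin> tors N ==> A \<uplus> B \<notin> tors N ==>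
   Fm N P A * Fm N P B = s * Fm N P (A \<uplus> B) * h A B P ^ N"
  using Fm_reciprocity_tors[OF N assms(2)] by blast
 have good: "Z \<in> C" "\<And>i. 1 \<le> i ==> i \<le> N ==> i \<odot> Z \<notin> tors N" using assms by (auto simp: goodpt_def)
 have "k \<le> N \<longrightarrow> Fm N P Z ^ k = s ^ (k - 1) * Fm N P (k \<odot> Z) * Hm k P Z ^ N" if "k \<ge> 1" for k
  using that
 proof (induction k rule: dec_induct)
  case base show ?case by (simp add: Hm_def)
 next
  case (step k)
  show ?case
  proof
   assume k: "Suc k \<le> N"
   have H: "Hm (Suc k) P Z = Hm k P Z * h Z (k \<odot> Z) P"
    using step by (simp add: Hm_def prod.atLeastLessThan_Suc)
   have 1: "Z \<notin> tors N" using good(2)[of 1] N by simp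
   have 2: "k \<odot> Z \<notin> tors N" using good(2)[of k] step k by simp
   have 3: "Z \<uplus> k \<odot> Z \<notin> tors N" using good(2)[of "Suc k"] k by simp
   have r: "Fm N P Z * Fm N P (k \<odot> Z) = s * Fm N P (Z \<uplus> k \<odot> Z) * h Z (k \<odot> Z) P ^ N"
    by (rule s(2)[OF good(1) pmul_in_C[OF good(1)] 1 2 3])
   have sk: "s ^ (Suc k - 1) = s * s ^ (k - 1)" using step by (cases k) auto
   have "Fm N P Z ^ Suc k = s ^ (k - 1) * (Fm N P Z * Fm N P (k \<odot> Z)) * Hm k P Z ^ N"
    using step k by (simp add: mult_ac)
   also have "\<dots> = s ^ (Suc k - 1) * Fm N P (Suc k \<odot> Z) * Hm (Suc k) P Z ^ N"
    unfolding r sk H by (simp add: power_mult_distrib mult_ac)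
   finally show "Fm N P Z ^ Suc k = s ^ (Suc k - 1) * Fm N P (Suc k \<odot> Z) * Hm (Suc k) P Z ^ N" .
  qed
 qed
 hence "Fm N P Z ^ N = s ^ (N - 1) * Fm N P (N \<odot> Z) * Hm N P Z ^ N" using N by blast
 \<comment> \<open>N - 1 is even, so the sign disappears; this is where oddness of the order
   enters.\<close>
 moreover have "s ^ (N - 1) = 1" using s(1) assms(1) by auto
 ultimately show ?thesis using Hm_nonzero[OF assms(2,3) le_refl] by (simp add: gm_def power_divide)
qed

end

section \<open>The Weil pairing of odd order\<close>

context short_weierstrass
begin

section \<open>Rational functions and rational maps of the curve\<close>

definition pf :: "'k poly => 'k poly => 'k point => 'k" where
 "pf u v Z = poly u (xc Z) + poly v (xc Z) * yc Z"

text \<open>The function field in the normal form (u + v y) / w. Equality is required at all but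
  finitely many points, so that values at poles do not matter.\<close>

definition ratf :: "('k point => 'k) => bool" where
 "ratf F \<longleftrightarrow> (\<exists>u v w. w ~= 0 \<and> most (\<lambda>Z. F Z * poly w (xc Z) = pf u v Z))"

lemma most_poly_neq: "w ~= 0 ==> most (\<lambda>Z. poly w (xc Z) ~= 0)"
 using most_nonzero[of w 0] by simp

lemma most_True: "(\<And>Z. Z \<in> C ==> p Z) ==> most p"
 by (rule most_mono[OF most_neq[of Infinity]])

lemma pf_mult: "Z \<in> C ==> Z ~= Infinity ==>
 pf u v Z * pf u' v' Z = pf (u * u' + fP * (v * v')) (u * v' + u' * v) Z"
 using in_C_eq[of Z] by (simp add: pf_def algebra_simps power2_eq_square)

lemma pf_0 [simp]: "pf u 0 Z = poly u (xc Z)"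
 by (simp add: pf_def)

lemma pf_zero_poly:
 assumes "\<not> finite {Z \<in> C. pf u v Z = 0}" shows "u = 0" "v = 0"
 using assms finite_zeros[of u v] by (auto simp: pf_def)

lemma infinite_if_most:
 assumes "most p" shows "infinite {Z \<in> C. p Z}"
proof
 assume "finite {Z \<in> C. p Z}"
 with assms have "finite ({Z \<in> C. p Z} \<union> {Z \<in> C. \<not> p Z})" unfolding most_def by simp
 moreover have "{Z \<in> C. p Z} \<union> {Z \<in> C. \<not> p Z} = C" by blast
 ultimately show False using infinite_C by simp
qed

lemma most_pf_zero:
 assumes "most (\<lambda>Z. pf u v Z = 0)" shows "u = 0" "v = 0"
proof -
 from infinite_if_most[OF assms]
 show "u = 0" "v = 0" using pf_zero_poly by blast+
qed

lemma most_pf_eq: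
 assumes "most (\<lambda>Z. pf u v Z = pf u' v' Z)" shows "u = u'" "v = v'"
proof -
 have "most (\<lambda>Z. pf (u - u') (v - v') Z = 0)"
  by (rule most_mono[OF assms]) (simp add: pf_def algebra_simps)
 from most_pf_zero[OF this] show "u = u'" "v = v'" by auto
qed

lemma most_poly_eq:
 assumes "most (\<lambda>Z. poly u (xc Z) = poly u' (xc Z))" shows "u = u'"
 using most_pf_eq(1)[of u 0 u' 0] assms by simp

lemma ratf_cong: "ratf F ==> most (\<lambda>Z. F Z = G Z) ==> ratf G"
proof -
 assume "ratf F" and m: "most (\<lambda>Z. F Z = G Z)"
 then obtain u v w where *: "w ~= 0" "most (\<lambda>Z. F Z * poly w (xc Z) = pf u v Z)" unfolding ratf_def by blast
 have "most (\<lambda>Z. G Z * poly w (xc Z) = pf u v Z)"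
  by (rule most_mono[OF most_conj[OF m *(2)]]) auto
 thus ?thesis unfolding ratf_def using *(1) by blast
qed

lemma ratf_pf: "ratf (pf u v)"
 unfolding ratf_def by (intro exI[of _ u] exI[of _ v] exI[of _ 1]) (auto intro: most_True)

lemma ratf_const: "ratf (\<lambda>_. c)"
 using ratf_pf[of "[:c:]" 0] by (rule ratf_cong) (auto intro: most_True)

lemma ratf_xc: "ratf xc" using ratf_pf[of "[:0, 1:]" 0] by (rule ratf_cong) (auto intro: most_True)
lemma ratf_yc: "ratf yc" using ratf_pf[of 0 1] by (rule ratf_cong) (auto intro: most_True simp: pf_def)

lemma ratf_add: assumes "ratf F" "ratf G" shows "ratf (\<lambda>Z. F Z + G Z)"
proof -
 from assms obtain u v w u' v' w' where *: "w ~= 0" "most (\<lambda>Z. F Z * poly w (xc Z) = pf u v Z)"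
  "w' ~= 0" "most (\<lambda>Z. G Z * poly w' (xc Z) = pf u' v' Z)" unfolding ratf_def by blast
 from most_conj[OF *(2,4)]
 have "most (\<lambda>Z. (F Z + G Z) * poly (w * w') (xc Z) = pf (u * w' + u' * w) (v * w' + v' * w) Z)"
 proof (rule most_mono)
  fix Z assume "F Z * poly w (xc Z) = pf u v Z \<and> G Z * poly w' (xc Z) = pf u' v' Z"
  moreover have "(F Z + G Z) * poly (w * w') (xc Z) = (F Z * poly w (xc Z)) * poly w' (xc Z) + (G Z * poly w' (xc Z)) * poly w (xc Z)"
   by (simp add: algebra_simps)
  ultimately show "(F Z + G Z) * poly (w * w') (xc Z) = pf (u * w' + u' * w) (v * w' + v' * w) Z"
   by (simp add: pf_def algebra_simps)
 qed
 moreover have "w * w' ~= 0" using * by simp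
 ultimately show ?thesis unfolding ratf_def by blast
qed

lemma ratf_mult: assumes "ratf F" "ratf G" shows "ratf (\<lambda>Z. F Z * G Z)"
proof -
 from assms obtain u v w u' v' w' where *: "w ~= 0" "most (\<lambda>Z. F Z * poly w (xc Z) = pf u v Z)"
  "w' ~= 0" "most (\<lambda>Z. G Z * poly w' (xc Z) = pf u' v' Z)" unfolding ratf_def by blast
 from most_conj[OF most_neq[of Infinity] most_conj[OF *(2,4)]]
 have "most (\<lambda>Z. (F Z * G Z) * poly (w * w') (xc Z) = pf (u * u' + fP * (v * v')) (u * v' + u' * v) Z)"
 proof (rule most_mono)
  fix Z assume Z: "Z \<in> C" "Z ~= Infinity \<and> F Z * poly w (xc Z) = pf u v Z \<and> G Z * poly w' (xc Z) = pf u' v' Z"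
  have "(F Z * G Z) * poly (w * w') (xc Z) = (F Z * poly w (xc Z)) * (G Z * poly w' (xc Z))"
   by (simp add: mult_ac)
  also have "\<dots> = pf u v Z * pf u' v' Z" using Z by simp
  finally show "(F Z * G Z) * poly (w * w') (xc Z) = pf (u * u' + fP * (v * v')) (u * v' + u' * v) Z"
   using pf_mult Z by simp
 qed
 moreover have "w * w' ~= 0" using * by simp
 ultimately show ?thesis unfolding ratf_def by blast
qed

lemma ratf_uminus: "ratf F ==> ratf (\<lambda>Z. - F Z)"
 using ratf_mult[OF ratf_const[of "-1"]] by simp

lemma ratf_diff: "ratf F ==> ratf G ==> ratf (\<lambda>Z. F Z - G Z)"
 using ratf_add[OF _ ratf_uminus, of F G] by simp

lemma pf_conj: "Z \<in> C ==> Z ~= Infinity ==> pf u v Z * pf u (- v) Z = poly (u ^ 2 - fP * v ^ 2) (xc Z)"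
 using in_C_eq[of Z] by (simp add: pf_def algebra_simps power2_eq_square)

text \<open>The conjugate u - v y turns the new denominator into a norm, a polynomial in x. The zero
  function is treated apart.\<close>

lemma ratf_inverse: assumes "ratf F" shows "ratf (\<lambda>Z. inverse (F Z))"
proof -
 from assms obtain u v w where *: "w ~= 0" "most (\<lambda>Z. F Z * poly w (xc Z) = pf u v Z)" unfolding ratf_def by blast
 show ?thesis
 proof (cases "u = 0 \<and> v = 0")
  case True
  have "most (\<lambda>Z. 0 = inverse (F Z))"
   by (rule most_mono[OF most_conj[OF *(2) most_poly_neq[OF *(1)]]]) (auto simp: True)
  thus ?thesis using ratf_const[of 0] by (rule ratf_cong[rotated])
 next
  case False
  let ?n = "u ^ 2 - fP * v ^ 2"
  have n: "?n ~= 0" using degree_norm(1)[of u v] False by blast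
  from most_conj[OF most_conj[OF most_neq[of Infinity] most_poly_neq[OF *(1)]] most_conj[OF *(2) most_poly_neq[OF n]]]
  have "most (\<lambda>Z. inverse (F Z) * poly ?n (xc Z) = pf (u * w) (- v * w) Z)"
  proof (rule most_mono)
   fix Z assume Z: "Z \<in> C" "(Z ~= Infinity \<and> poly w (xc Z) ~= 0) \<and> F Z * poly w (xc Z) = pf u v Z \<and> poly ?n (xc Z) ~= 0"
   have c: "pf u v Z * pf u (- v) Z = poly ?n (xc Z)" using pf_conj Z by blast
   have "F Z ~= 0" using Z c by auto
   moreover have "F Z * pf (u * w) (- v * w) Z = poly ?n (xc Z)"
   proof -
    have "pf (u * w) (- v * w) Z = poly w (xc Z) * pf u (- v) Z" by (simp add: pf_def algebra_simps)
    hence "F Z * pf (u * w) (- v * w) Z = (F Z * poly w (xc Z)) * pf u (- v) Z" by (simp only: mult.assoc)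
    thus ?thesis using c Z by simp
   qed
   ultimately show "inverse (F Z) * poly ?n (xc Z) = pf (u * w) (- v * w) Z"
    by (metis field_class.field_inverse mult.assoc mult.left_neutral)
  qed
  thus ?thesis unfolding ratf_def using n by blast
 qed
qed

lemma ratf_divide: "ratf F ==> ratf G ==> ratf (\<lambda>Z. F Z / G Z)"
 unfolding divide_inverse by (intro ratf_mult ratf_inverse)

lemma ratf_power: "ratf F ==> ratf (\<lambda>Z. F Z ^ n)"
 by (induction n) (auto intro: ratf_const ratf_mult)

lemma ratf_prod: "finite I ==> (\<And>i. i \<in> I ==> ratf (F i)) ==> ratf (\<lambda>Z. \<Prod>i\<in>I. F i Z)"
 by (induction I rule: finite_induct) (auto intro: ratf_const ratf_mult)

lemmas ratf_intros = ratf_const ratf_add ratf_mult ratf_diff ratf_divide ratf_power ratf_uminus ratf_xc ratf_yc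

definition ratpt :: "('k point => 'k point) => bool" where
 "ratpt \<tau> \<longleftrightarrow> most (\<lambda>Z. \<tau> Z \<in> C \<and> \<tau> Z ~= Infinity) \<and> ratf (\<lambda>Z. xc (\<tau> Z)) \<and> ratf (\<lambda>Z. yc (\<tau> Z))"

lemma ratf_poly: "ratf F ==> ratf (\<lambda>Z. poly p (F Z))"
 by (induction p) (auto intro: ratf_intros)

text \<open>The last hypothesis says that \<tau> pulls finite exceptional sets back to finite ones;
  it excludes constant maps, which satisfy \<open>ratpt\<close> as well.\<close>

lemma ratf_compose:
 assumes "ratf F" "ratpt \<tau>" "\<And>p. most p ==> most (\<lambda>Z. p (\<tau> Z))"
 shows "ratf (\<lambda>Z. F (\<tau> Z))"
proof -
 from assms obtain u v w where *: "w ~= 0" "most (\<lambda>Z. F Z * poly w (xc Z) = pf u v Z)" unfolding ratf_def by blast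
 from most_conj[OF *(2) most_poly_neq[OF *(1)]]
 have "most (\<lambda>Z. pf u v Z / poly w (xc Z) = F Z)" by (rule most_mono) (auto simp: field_simps)
 from assms(3)[OF this]
 have 1: "most (\<lambda>Z. pf u v (\<tau> Z) / poly w (xc (\<tau> Z)) = F (\<tau> Z))" .
 have "ratf (\<lambda>Z. pf u v (\<tau> Z) / poly w (xc (\<tau> Z)))"
  unfolding pf_def using assms(2) unfolding ratpt_def by (intro ratf_intros ratf_poly) auto
 thus ?thesis using 1 by (rule ratf_cong)
qed

lemma ratpt_const: "P \<in> C ==> P ~= Infinity ==> ratpt (\<lambda>_. P)"
 by (auto simp: ratpt_def intro: ratf_const most_True)

lemma ratpt_id: "ratpt (\<lambda>Z. Z)"
 unfolding ratpt_def using ratf_xc ratf_yc most_neq[of Infinity] by (auto elim: most_mono)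

lemma ratpt_pneg: "ratpt pneg"
 unfolding ratpt_def using ratf_xc ratf_uminus[OF ratf_yc] most_neq[of Infinity] by (auto elim: most_mono)

lemma ratf_slope:
 assumes "ratpt sg" "ratpt \<tau>" "most (\<lambda>Z. xc (sg Z) ~= xc (\<tau> Z))"
 shows "ratf (\<lambda>Z. slope (sg Z) (\<tau> Z))"
proof -
 have "ratf (\<lambda>Z. (yc (\<tau> Z) - yc (sg Z)) / (xc (\<tau> Z) - xc (sg Z)))"
  using assms unfolding ratpt_def by (intro ratf_intros) auto
 moreover have "most (\<lambda>Z. (yc (\<tau> Z) - yc (sg Z)) / (xc (\<tau> Z) - xc (sg Z)) = slope (sg Z) (\<tau> Z))"
  by (rule most_mono[OF assms(3)]) (simp add: slope_def)
 ultimately show ?thesis by (rule ratf_cong)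
qed

lemma ratf_slope_double: "ratf (\<lambda>Z. slope Z Z)"
 unfolding slope_def by (simp, intro ratf_intros)

text \<open>Rationality of the slope is a separate hypothesis because doubling needs the tangent
  formula, outside the reach of \<open>ratf_slope\<close>.\<close>

lemma ratpt_sum':
 assumes "ratpt sg" "ratpt \<tau>" "most (\<lambda>Z. sg Z ~= pneg (\<tau> Z))" "ratf (\<lambda>Z. slope (sg Z) (\<tau> Z))"
 shows "ratpt (\<lambda>Z. sg Z \<uplus> \<tau> Z)"
proof -
 have m: "most (\<lambda>Z. (sg Z \<in> C \<and> sg Z ~= Infinity) \<and> (\<tau> Z \<in> C \<and> \<tau> Z ~= Infinity) \<and> sg Z ~= pneg (\<tau> Z))"
 proof -
  have "most (\<lambda>Z. sg Z \<in> C \<and> sg Z ~= Infinity)" "most (\<lambda>Z. \<tau> Z \<in> C \<and> \<tau> Z ~= Infinity)"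
   using assms by (simp_all add: ratpt_def)
  from most_conj[OF this(1) most_conj[OF this(2) assms(3)]] show ?thesis .
 qed
 have 1: "most (\<lambda>Z. sg Z \<uplus> \<tau> Z \<in> C \<and> sg Z \<uplus> \<tau> Z ~= Infinity)"
  by (rule most_mono[OF m]) (auto simp: sum_affine)
 have r: "ratf (\<lambda>Z. slope (sg Z) (\<tau> Z) ^ 2 - xc (sg Z) - xc (\<tau> Z))"
  using assms by (intro ratf_intros) (auto simp: ratpt_def)
 hence 2: "ratf (\<lambda>Z. xc (sg Z \<uplus> \<tau> Z))"
  by (rule ratf_cong) (rule most_mono[OF m], auto simp: sum_affine)
 have "ratf (\<lambda>Z. - (yc (sg Z) + slope (sg Z) (\<tau> Z) * (xc (sg Z \<uplus> \<tau> Z) - xc (sg Z))))"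
  using assms 2 by (intro ratf_intros) (auto simp: ratpt_def)
 hence 3: "ratf (\<lambda>Z. yc (sg Z \<uplus> \<tau> Z))"
 proof (rule ratf_cong)
  show "most (\<lambda>Z. - (yc (sg Z) + slope (sg Z) (\<tau> Z) * (xc (sg Z \<uplus> \<tau> Z) - xc (sg Z))) = yc (sg Z \<uplus> \<tau> Z))"
   by (rule most_mono[OF m]) (metis sum_affine(3))
 qed
 show ?thesis using 1 2 3 by (simp add: ratpt_def)
qed

lemma ratpt_sum:
 assumes "ratpt sg" "ratpt \<tau>" "most (\<lambda>Z. xc (sg Z) ~= xc (\<tau> Z))"
 shows "ratpt (\<lambda>Z. sg Z \<uplus> \<tau> Z)"
 by (rule ratpt_sum'[OF assms(1,2) _ ratf_slope[OF assms]]) (rule most_mono[OF assms(3)], auto)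

lemma most_pmul:
 assumes "n \<ge> 1" "most p" shows "most (\<lambda>Z. p (n \<odot> Z))"
proof -
 have fin: "finite {Z \<in> C. n \<odot> Z = Y}" if Y: "Y \<in> C" for Y
 proof -
  obtain Z0 where Z0: "Z0 \<in> C" "n \<odot> Z0 = Y" using pmul_surj[OF assms(1) Y] by blast
  have "{Z \<in> C. n \<odot> Z = Y} \<subseteq> (\<lambda>P. Z0 \<uplus> P) ` tors n"
  proof
   fix Z assume "Z \<in> {Z \<in> C. n \<odot> Z = Y}"
   hence "pneg Z0 \<uplus> Z \<in> tors n" "Z = Z0 \<uplus> (pneg Z0 \<uplus> Z)"
    using Z0 by (auto simp: tors_def pmul_padd pmul_pneg)
   thus "Z \<in> (\<lambda>P. Z0 \<uplus> P) ` tors n" by blast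
  qed
  thus ?thesis using finite_tors[OF assms(1)] by (meson finite_imageI finite_subset)
 qed
 have "{Z \<in> C. \<not> p (n \<odot> Z)} = (\<Union>Y\<in>{Y \<in> C. \<not> p Y}. {Z \<in> C. n \<odot> Z = Y})" by auto
 moreover have "finite \<dots>" using fin assms(2) by (auto simp: most_def)
 ultimately show ?thesis by (simp add: most_def)
qed

lemma most_pneg: "most p ==> most (\<lambda>Z. p (pneg Z))"
proof -
 assume "most p"
 hence "finite (pneg ` {Z \<in> C. \<not> p Z})" by (simp add: most_def)
 moreover have "{Z \<in> C. \<not> p (pneg Z)} \<subseteq> pneg ` {Z \<in> C. \<not> p Z}"
 proof
  fix Z assume "Z \<in> {Z \<in> C. \<not> p (pneg Z)}"
  thus "Z \<in> pneg ` {Z \<in> C. \<not> p Z}" by (intro image_eqI[of _ _ "pneg Z"]) auto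
 qed
 ultimately show ?thesis unfolding most_def by (rule finite_subset[rotated])
qed

lemma most_not_in: "finite S ==> most (\<lambda>Z. Z \<notin> S)"
 unfolding most_def by (rule finite_subset[of _ S]) auto

lemma most_goodpt: "N \<ge> 1 ==> most (goodpt N)"
proof -
 assume N: "N \<ge> 1"
 have "most (\<lambda>Z. \<forall>i\<in>{1..N}. i \<odot> Z \<notin> tors N)"
  by (rule most_ball) (auto intro!: most_pmul most_not_in finite_tors N)
 thus ?thesis by (rule most_mono) (simp add: goodpt_def)
qed

lemma ratpt_translate:
 assumes "Q \<in> C" shows "ratpt (\<lambda>Z. Z \<uplus> Q)"
proof (cases "Q = Infinity")
 case True thus ?thesis using ratpt_id by simp
next
 case False
 show ?thesis by (rule ratpt_sum[OF ratpt_id ratpt_const[OF assms False]]) (rule most_xc_neq)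
qed

lemma most_translate': "Q \<in> C ==> most p ==> most (\<lambda>Z. p (Z \<uplus> Q))"
 by (rule most_mono[OF most_translate[of Q p]]) (auto simp: padd_commute)

lemma most_pmul_neq: "n \<ge> 1 ==> most (\<lambda>Z. n \<odot> Z ~= P)"
 using most_pmul[of n, OF _ most_neq[of P]] .

lemma most_xc_pmul_neq:
 assumes "n \<ge> 2" shows "most (\<lambda>Z. xc Z ~= xc (n \<odot> Z))"
proof -
 have "most (\<lambda>Z. Z ~= Infinity \<and> (n - 1) \<odot> Z ~= Infinity \<and> (n + 1) \<odot> Z ~= Infinity \<and> n \<odot> Z ~= Infinity)"
  using assms by (intro most_conj most_neq most_pmul_neq) auto
 thus ?thesis
 proof (rule most_mono)
  fix Z assume Z: "Z \<in> C" "Z ~= Infinity \<and> (n - 1) \<odot> Z ~= Infinity \<and> (n + 1) \<odot> Z ~= Infinity \<and> n \<odot> Z ~= Infinity"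
  show "xc Z ~= xc (n \<odot> Z)"
  proof
   assume "xc Z = xc (n \<odot> Z)"
   hence "Z = n \<odot> Z \<or> Z = pneg (n \<odot> Z)" using same_x[of Z "n \<odot> Z"] Z by simp
   thus False
   proof
    assume *: "Z = n \<odot> Z"
    have "n \<odot> Z = Z \<uplus> (n - 1) \<odot> Z" using assms by (cases n) auto
    hence "Z \<uplus> Infinity = Z \<uplus> (n - 1) \<odot> Z" using * by simp
    thus False using Z by (subst (asm) padd_left_inject) auto
   next
    assume *: "Z = pneg (n \<odot> Z)"
    have "(n + 1) \<odot> Z = Z \<uplus> n \<odot> Z" by simp
    also have "\<dots> = Infinity" by (subst *) simp
    finally show False using Z by simp
   qed
  qed
 qed
qed

lemma ratpt_pmul: "n \<ge> 1 ==> ratpt (\<lambda>Z. n \<odot> Z)"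
proof (induction n rule: dec_induct)
 case base show ?case using ratpt_id by simp
next
 case (step n)
 show ?case
 proof (cases "n = 1")
  case True
  have "most (\<lambda>Z. Z ~= pneg Z)" by (rule most_mono[OF most_pmul_neq[of 2 Infinity]])
   (auto simp: numeral_2_eq_2, metis padd_pneg(2))
  hence "ratpt (\<lambda>Z. Z \<uplus> Z)" by (rule ratpt_sum'[OF ratpt_id ratpt_id _ ratf_slope_double])
  thus ?thesis using True by simp
 next
  case False
  hence "ratpt (\<lambda>Z. Z \<uplus> n \<odot> Z)"
   using step by (intro ratpt_sum ratpt_id most_xc_pmul_neq) auto
  thus ?thesis by simp
 qed
qed

lemma ratf_h_fst:
 assumes "P \<in> C" "i \<ge> 1" shows "ratf (\<lambda>Z. h Z (i \<odot> Z) P)"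
proof (cases "P = Infinity")
 case True thus ?thesis by (simp add: h_def ratf_const)
next
 case False
 have sl: "ratf (\<lambda>Z. slope Z (i \<odot> Z))"
 proof (cases "i = 1")
  case True thus ?thesis using ratf_slope_double by simp
 next
  case i: False
  thus ?thesis using assms by (intro ratf_slope ratpt_id ratpt_pmul most_xc_pmul_neq) auto
 qed
 have s: "ratf (\<lambda>Z. xc (Suc i \<odot> Z))" using ratpt_pmul[of "Suc i"] by (simp add: ratpt_def del: pmul.simps)
 have 1: "ratf (\<lambda>Z. (yc P - yc Z - slope Z (i \<odot> Z) * (xc P - xc Z)) / (xc P - xc (Suc i \<odot> Z)))"
  by (intro ratf_intros sl s)
 have m: "most (\<lambda>Z. Z ~= Infinity \<and> i \<odot> Z ~= Infinity \<and> Suc i \<odot> Z ~= Infinity)"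
  using assms by (intro most_conj most_neq most_pmul_neq) auto
 have "most (\<lambda>Z. (yc P - yc Z - slope Z (i \<odot> Z) * (xc P - xc Z)) / (xc P - xc (Suc i \<odot> Z)) = h Z (i \<odot> Z) P)"
 proof (rule most_mono[OF m])
  fix Z assume Z: "Z \<in> C" "Z ~= Infinity \<and> i \<odot> Z ~= Infinity \<and> Suc i \<odot> Z ~= Infinity"
  have "Z ~= pneg (i \<odot> Z)"
  proof
   assume "Z = pneg (i \<odot> Z)"
   hence "Suc i \<odot> Z = Infinity" by (metis padd_pneg(2) pmul.simps(2))
   thus False using Z by simp
  qed
  thus "(yc P - yc Z - slope Z (i \<odot> Z) * (xc P - xc Z)) / (xc P - xc (Suc i \<odot> Z)) = h Z (i \<odot> Z) P"
   using Z False by (simp add: h_def ln_def)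
 qed
 with 1 show ?thesis by (rule ratf_cong)
qed

lemma ratf_h_snd: "ratf (h P Q)"
proof -
 consider "P = Infinity \<or> Q = Infinity" | "\<not> (P = Infinity \<or> Q = Infinity)" "P = pneg Q"
  | "\<not> (P = Infinity \<or> Q = Infinity)" "P ~= pneg Q" by blast
 thus ?thesis
 proof cases
  case 1
  show ?thesis using ratf_const[of 1] by (rule ratf_cong) (use 1 in \<open>auto intro: most_True simp: h_def\<close>)
 next
  case 2
  have "ratf (\<lambda>Z. xc Z - xc P)" by (intro ratf_intros)
  thus ?thesis by (rule ratf_cong) (rule most_mono[OF most_neq[of Infinity]], use 2 in \<open>auto simp: h_def\<close>)
 next
  case 3
  have "ratf (\<lambda>Z. (yc Z - yc P - slope P Q * (xc Z - xc P)) / (xc Z - xc (P \<uplus> Q)))" by (intro ratf_intros)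
  thus ?thesis by (rule ratf_cong) (rule most_mono[OF most_neq[of Infinity]], use 3 in \<open>auto simp: h_def ln_def\<close>)
 qed
qed

lemma ratf_Fm: "ratf (Fm k P)"
 unfolding Fm_def by (intro ratf_prod ratf_h_snd) auto

lemma ratf_gm: "P \<in> C ==> ratf (gm N P)"
 unfolding gm_def Hm_def by (intro ratf_divide ratf_Fm ratf_prod ratf_h_fst) auto

text \<open>Some value c is taken infinitely often; the numerator of F - c then has infinitely many
  zeros and vanishes identically.\<close>

lemma ratf_finite_values:
 assumes "ratf F" "finite V" "most (\<lambda>Z. F Z \<in> V)"
 shows "\<exists>c\<in>V. most (\<lambda>Z. F Z = c)"
proof -
 from assms obtain u v w where *: "w ~= 0" "most (\<lambda>Z. F Z * poly w (xc Z) = pf u v Z)" unfolding ratf_def by blast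
 note m = most_conj[OF assms(3) most_conj[OF *(2) most_poly_neq[OF *(1)]]]
 let ?G = "{Z \<in> C. F Z \<in> V \<and> F Z * poly w (xc Z) = pf u v Z \<and> poly w (xc Z) ~= 0}"
 have "infinite ?G" by (rule infinite_if_most[OF m])
 moreover have "finite (F ` ?G)" by (rule finite_subset[OF _ assms(2)]) blast
 ultimately obtain Z0 where "Z0 \<in> ?G" "infinite {Z \<in> ?G. F Z = F Z0}"
  using pigeonhole_infinite by blast
 then obtain c where c: "c \<in> V" "infinite {Z \<in> ?G. F Z = c}" by blast
 have "{Z \<in> ?G. F Z = c} \<subseteq> {Z \<in> C. pf (u - smult c w) v Z = 0}" by (auto simp: pf_def algebra_simps)
 hence "infinite {Z \<in> C. pf (u - smult c w) v Z = 0}" using c finite_subset by blast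
 hence "u - smult c w = 0" "v = 0" using pf_zero_poly by blast+
 hence uv: "u = smult c w" "v = 0" by simp_all
 have "most (\<lambda>Z. F Z = c)" by (rule most_mono[OF m]) (auto simp: uv)
 thus ?thesis using c by blast
qed

lemma finite_roots_unity: "n \<ge> 1 ==> finite {z :: 'k. z ^ n = c}"
proof -
 assume n: "n \<ge> 1"
 let ?p = "monom 1 n - [:c:] :: 'k poly"
 have "Polynomial.coeff ?p n ~= 0" using n by (cases n) auto
 hence "?p ~= 0" by (rule poly_neq_0_if_coeff)
 moreover have "{z. z ^ n = c} = {z. poly ?p z = 0}" by (auto simp: poly_monom)
 ultimately show ?thesis using poly_roots_finite by metis
qed

lemma card_roots_unity: "n \<ge> 1 ==> card {z :: 'k. z ^ n = 1} \<le> n"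
proof -
 assume n: "n \<ge> 1"
 let ?p = "monom 1 n - [:1:] :: 'k poly"
 have "Polynomial.coeff ?p n ~= 0" using n by (cases n) auto
 hence "?p ~= 0" by (rule poly_neq_0_if_coeff)
 moreover have "{z. z ^ n = 1} = {z. poly ?p z = 0}" by (auto simp: poly_monom)
 moreover have "degree ?p \<le> n" by (rule degree_diff_le) (auto simp: degree_monom_le)
 ultimately show ?thesis using card_poly_roots_bound[of ?p] by simp
qed

text \<open>Since N Q = O, the quotient g(Z + Q) / g(Z) has N-th power 1. A rational function with
  values among the roots of unity is constant.\<close>

lemma weil_const:
 assumes "odd N" "P \<in> tors N" "Q \<in> tors N"
 shows "\<exists>c. c ^ N = 1 \<and> most (\<lambda>Z. gm N P (Z \<uplus> Q) = c * gm N P Z)"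
proof -
 have N: "N \<ge> 1" using assms(1) by (cases N) auto
 have QC: "Q \<in> C" "P \<in> C" using assms tors_in_C by auto
 have r: "ratf (\<lambda>Z. gm N P (Z \<uplus> Q) / gm N P Z)"
  using ratf_gm[OF QC(2)] by (intro ratf_divide ratf_compose[OF _ ratpt_translate[OF QC(1)]] most_translate' QC) auto
 have m: "most (\<lambda>Z. goodpt N Z \<and> goodpt N (Z \<uplus> Q))"
  by (intro most_conj most_goodpt most_translate' QC N)
 have "most (\<lambda>Z. gm N P (Z \<uplus> Q) / gm N P Z \<in> {z. z ^ N = 1})"
 proof (rule most_mono[OF m])
  fix Z assume Z: "Z \<in> C" "goodpt N Z \<and> goodpt N (Z \<uplus> Q)"
  have "N \<odot> (Z \<uplus> Q) = N \<odot> Z" using assms Z QC by (simp add: pmul_padd tors_def)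
  hence "gm N P (Z \<uplus> Q) ^ N = gm N P Z ^ N" using gm_power[OF assms(1,2)] Z by simp
  thus "gm N P (Z \<uplus> Q) / gm N P Z \<in> {z. z ^ N = 1}"
   using gm_nonzero[OF N assms(2)] Z by (simp add: power_divide)
 qed
 from ratf_finite_values[OF r finite_roots_unity[OF N] this]
 obtain c where c: "c ^ N = 1" "most (\<lambda>Z. gm N P (Z \<uplus> Q) / gm N P Z = c)" by blast
 have "most (\<lambda>Z. gm N P (Z \<uplus> Q) = c * gm N P Z)"
  by (rule most_mono[OF most_conj[OF c(2) most_goodpt[OF N]]])
   (use gm_nonzero[OF N assms(2)] in \<open>auto simp: field_simps\<close>)
 thus ?thesis using c by blast
qed

text \<open>The classical description of the Weil pairing: the factor by which g, an N-th root of F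
  composed with multiplication by N, changes under translation by Q.\<close>

definition weil :: "nat => 'k point => 'k point => 'k" where
 "weil N P Q = (SOME c. c ^ N = 1 \<and> most (\<lambda>Z. gm N P (Z \<uplus> Q) = c * gm N P Z))"

lemma weil_props:
 assumes "odd N" "P \<in> tors N" "Q \<in> tors N"
 shows "weil N P Q ^ N = 1" "most (\<lambda>Z. gm N P (Z \<uplus> Q) = weil N P Q * gm N P Z)"
 using someI_ex[OF weil_const[OF assms]] unfolding weil_def by auto

lemma weil_unique:
 assumes "odd N" "P \<in> tors N" "Q \<in> tors N" "most (\<lambda>Z. gm N P (Z \<uplus> Q) = c * gm N P Z)"
 shows "weil N P Q = c"
proof -
 have N: "N \<ge> 1" using assms(1) by (cases N) auto
 from most_ex[OF most_conj[OF most_goodpt[OF N] most_conj[OF assms(4) weil_props(2)[OF assms(1-3)]]]]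
 obtain Z where "goodpt N Z" "c * gm N P Z = weil N P Q * gm N P Z" by auto
 thus ?thesis using gm_nonzero[OF N assms(2)] by auto
qed

section \<open>Bilinearity of the pairing\<close>

lemma weil_add_right:
 assumes "odd N" "P \<in> tors N" "Q \<in> tors N" "R \<in> tors N"
 shows "weil N P (Q \<uplus> R) = weil N P Q * weil N P R"
proof (rule weil_unique[OF assms(1,2) tors_padd[OF assms(3,4)]])
 have C: "Q \<in> C" "R \<in> C" using assms tors_in_C by auto
 show "most (\<lambda>Z. gm N P (Z \<uplus> (Q \<uplus> R)) = weil N P Q * weil N P R * gm N P Z)"
 proof (rule most_mono[OF most_conj[OF most_translate'[OF C(1) weil_props(2)[OF assms(1,2,4)]] weil_props(2)[OF assms(1-3)]]])
  fix Z assume "Z \<in> C" "gm N P (Z \<uplus> Q \<uplus> R) = weil N P R * gm N P (Z \<uplus> Q) \<and> gm N P (Z \<uplus> Q) = weil N P Q * gm N P Z"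
  thus "gm N P (Z \<uplus> (Q \<uplus> R)) = weil N P Q * weil N P R * gm N P Z"
   using C by (simp add: padd_assoc)
 qed
qed

text \<open>A rational function with \<open>k(A + B) = k(A) k(B)\<close> is constant: on \<open>n\<close>-torsion it takes at most
 \<open>n\<close> values, so some value is taken by \<open>n\<close> torsion points, and then by many translates of a
 general point.\<close>

lemma rational_hom_trivial:
 assumes k: "ratf k" and N: "odd N"
  and nz: "\<And>A. A \<in> C ==> A \<notin> tors N ==> k A ~= 0"
  and hom: "\<And>A B. A \<in> C ==> B \<in> C ==> A \<notin> tors N ==> B \<notin> tors N ==> A \<uplus> B \<notin> tors N ==>
   k A * k B = k (A \<uplus> B)"
 shows "\<exists>c. most (\<lambda>Z. k Z = c)"
proof -
 have N1: "N \<ge> 1" using N by (cases N) auto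
 from k obtain u v w where *: "w ~= 0" "most (\<lambda>Z. k Z * poly w (xc Z) = pf u v Z)" unfolding ratf_def by blast
 define q where "q c = (u - smult c w) ^ 2 - fP * v ^ 2" for c
 define D where "D = 2 * (degree u + degree w) + 3 + 2 * degree v"
 have dq: "degree (q c) \<le> D" for c
 proof -
  have "degree (u - smult c w) \<le> degree u + degree w"
   by (rule degree_diff_le) (auto intro: order.trans[OF degree_smult_le])
  hence "degree ((u - smult c w) ^ 2) \<le> D"
   using degree_power_le[of "u - smult c w" 2] unfolding D_def by (simp add: mult.commute)
  moreover have "degree (fP * v ^ 2) \<le> D"
   using degree_mult_le[of fP "v ^ 2"] degree_power_le[of v 2] unfolding D_def by (simp add: fP_def)
  ultimately show ?thesis unfolding q_def by (rule degree_diff_le)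
 qed
 \<comment> \<open>A power of 2 is prime to the odd N, which keeps the nonzero n-torsion outside
   \<open>tors N\<close>. It also exceeds 2 D, the largest number of points whose abscissa is a root
   of a nonzero norm \<open>q d\<close>.\<close>
 define n where "n = (2::nat) ^ (2 * D + 2)"
 have nD: "n > 2 * D + 1" "n \<ge> 2"
 proof -
  have "2 * D + 2 < n" unfolding n_def by (rule less_exp)
  thus "n > 2 * D + 1" "n \<ge> 2" by simp_all
 qed
 have cop: "coprime n N" unfolding n_def using N by (metis coprime_left_2_iff_odd coprime_power_left_iff)
 let ?T = "tors n - {Infinity}"
 have TN: "A \<notin> tors N" "A \<in> C" if "A \<in> ?T" for A
 proof -
  show "A \<in> C" using that tors_in_C by auto
  show "A \<notin> tors N"
  proof
   assume "A \<in> tors N"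
   obtain x y where xy: "n * x = N * y + 1"
    using bezout_nat[of n N] nD cop by (metis coprime_imp_gcd_eq_1 not_one_less_zero zero_neq_one le_numeral_extra(3) not_numeral_le_zero)
   have "A = (N * y + 1) \<odot> A \<uplus> pneg ((N * y) \<odot> A)"
    using \<open>A \<in> C\<close> by (simp add: padd_assoc)
   also have "(N * y) \<odot> A = Infinity" using \<open>A \<in> tors N\<close> by (simp add: mult.commute[of N] pmul_mult tors_def)
   also have "(N * y + 1) \<odot> A = Infinity"
    unfolding xy[symmetric] using that by (simp add: mult.commute[of n] pmul_mult tors_def)
   finally show False using that by simp
  qed
 qed
 have transl: "most (\<lambda>Z. k (A \<uplus> Z) = k A * k Z)" if "A \<in> ?T" for A
 proof -
  have "most (\<lambda>Z. Z \<notin> tors N \<and> A \<uplus> Z \<notin> tors N)"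
   by (intro most_conj most_translate TN that most_not_in finite_tors N1)
  thus ?thesis by (rule most_mono) (use hom[of A] TN[OF that] in auto)
 qed
 have root: "k A ^ n = 1" if "A \<in> ?T" for A
 proof -
  have "most (\<lambda>Z. k (j \<odot> A \<uplus> Z) = k A ^ j * k Z)" for j
  proof (induction j)
   case 0 show ?case by (auto intro: most_True)
  next
   case (Suc j)
   have jA: "j \<odot> A \<in> C" using TN[OF that] by simp
   show ?case
    by (rule most_mono[OF most_conj[OF Suc most_translate[OF jA transl[OF that]]]])
     (use TN[OF that] in \<open>auto simp: padd_assoc mult_ac\<close>)
  qed
  from most_conj[OF this[of n] most_not_in[OF finite_tors[OF N1]]]
  obtain Z where "Z \<in> C" "k (n \<odot> A \<uplus> Z) = k A ^ n * k Z" "Z \<notin> tors N" using most_ex by blast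
  moreover have "n \<odot> A = Infinity" using that by (simp add: tors_def)
  ultimately show ?thesis using nz by simp
 qed
 have finT: "finite ?T" using finite_tors nD by simp
 \<comment> \<open>Pigeonhole: n^2 - 1 nonzero torsion points share at most n values, the n-th roots
   of unity, and n^2 - 1 > n (n - 1).\<close>
 have "\<exists>c. card {A \<in> ?T. k A = c} \<ge> n"
 proof (rule ccontr)
  assume "\<not> ?thesis"
  hence small: "card {A \<in> ?T. k A = c} \<le> n - 1" for c by (metis not_less_eq_eq Suc_pred' le_eq_less_or_eq linorder_not_le not_less_zero One_nat_def diff_Suc_1 less_Suc_eq_le Suc_diff_1 gr_zeroI)
  have "n ^ 2 - 1 = card ?T" using card_tors nD by (simp add: card_Diff_singleton)
  also have "?T = (\<Union>c\<in>{z. z ^ n = 1}. {A \<in> ?T. k A = c})" using root by auto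
  also have "card \<dots> \<le> (\<Sum>c\<in>{z::'k. z ^ n = 1}. card {A \<in> ?T. k A = c})"
   by (rule card_UN_le) (use finite_roots_unity nD in simp)
  also have "\<dots> \<le> (\<Sum>c\<in>{z::'k. z ^ n = 1}. n - 1)" by (rule sum_mono) (rule small)
  also have "\<dots> \<le> n * (n - 1)" using card_roots_unity[of n] nD by simp
  finally have "n ^ 2 - 1 \<le> n * (n - 1)" .
  moreover have "n * n \<ge> n * 1" using nD by (intro mult_le_mono) auto
  ultimately have "n * n - 1 \<le> n * n - n" "n * n \<ge> n" by (simp_all add: power2_eq_square diff_mult_distrib2)
  thus False using nD by linarith
 qed
 then obtain c where c: "card {A \<in> ?T. k A = c} \<ge> n" by blast
 let ?U = "{A \<in> ?T. k A = c}"
 have finU: "finite ?U" using finT by simp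
 have "most (\<lambda>Z. \<forall>A\<in>?U. k (A \<uplus> Z) = c * k Z \<and> k (A \<uplus> Z) * poly w (xc (A \<uplus> Z)) = pf u v (A \<uplus> Z) \<and> A \<uplus> Z ~= Infinity)"
 proof (rule most_ball[OF finU], intro most_conj)
  fix A assume A: "A \<in> ?U"
  show "most (\<lambda>Z. k (A \<uplus> Z) = c * k Z)" using transl[of A] A by simp
  show "most (\<lambda>Z. k (A \<uplus> Z) * poly w (xc (A \<uplus> Z)) = pf u v (A \<uplus> Z))"
   by (rule most_translate[OF _ *(2)]) (use TN A in blast)
  show "most (\<lambda>Z. A \<uplus> Z ~= Infinity)"
   by (rule most_translate[OF _ most_neq]) (use TN A in blast)
 qed
 then obtain Z where Z: "Z \<in> C" "\<And>A. A \<in> ?U ==> k (A \<uplus> Z) = c * k Z \<and>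
   k (A \<uplus> Z) * poly w (xc (A \<uplus> Z)) = pf u v (A \<uplus> Z) \<and> A \<uplus> Z ~= Infinity"
  using most_ex by blast
 define d where "d = c * k Z"
 have UC: "A \<in> C" if "A \<in> ?U" for A using that TN by blast
 have zero: "poly (q d) (xc (A \<uplus> Z)) = 0" if "A \<in> ?U" for A
 proof -
  have "d * poly w (xc (A \<uplus> Z)) = pf u v (A \<uplus> Z)" using Z(2)[OF that] unfolding d_def by metis
  hence "pf (u - smult d w) v (A \<uplus> Z) = 0" by (simp add: pf_def algebra_simps)
  moreover have "A \<uplus> Z \<in> C" "A \<uplus> Z ~= Infinity" using that UC Z by auto
  ultimately show ?thesis unfolding q_def using pf_conj[of "A \<uplus> Z" "u - smult d w" v] by simp
 qed
 have "q d = 0"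
 proof (rule ccontr)
  assume q: "q d ~= 0"
  let ?R = "{x. poly (q d) x = 0}"
  have R: "finite ?R" "card ?R \<le> D" using poly_roots_finite[OF q] card_poly_roots_bound[OF q] dq[of d] by auto
  let ?V = "(\<lambda>A. A \<uplus> Z) ` ?U"
  have "card ?V = card ?U" by (rule card_image) (auto simp: inj_on_def UC Z(1))
  hence "card ?V \<ge> n" using c by simp
  have sub: "?V \<subseteq> (\<Union>x\<in>?R. {P \<in> ?V. xc P = x})" using zero by auto
  have two: "card {P \<in> ?V. xc P = x} \<le> 2" for x
  proof (cases "{P \<in> ?V. xc P = x} = {}")
   case False
   then obtain P where P: "P \<in> ?V" "xc P = x" by blast
   have "{P \<in> ?V. xc P = x} \<subseteq> {P, pneg P}"
   proof
    fix P' assume P': "P' \<in> {P \<in> ?V. xc P = x}"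
    have "P \<in> C" "P' \<in> C" "P ~= Infinity" "P' ~= Infinity" using P P' UC Z by auto
    thus "P' \<in> {P, pneg P}" using same_x[of P' P] P P' by auto
   qed
   hence "card {P \<in> ?V. xc P = x} \<le> card {P, pneg P}" by (intro card_mono) auto
   also have "\<dots> \<le> 2" by (simp add: card_insert_if)
   finally show ?thesis .
  qed (simp only: card.empty)
  have "card ?V \<le> card (\<Union>x\<in>?R. {P \<in> ?V. xc P = x})" by (rule card_mono[OF _ sub]) (use R finU in auto)
  also have "\<dots> \<le> (\<Sum>x\<in>?R. card {P \<in> ?V. xc P = x})" by (rule card_UN_le[OF R(1)])
  also have "\<dots> \<le> (\<Sum>x\<in>?R. 2)" by (rule sum_mono) (rule two)
  also have "\<dots> \<le> 2 * D" using R by simp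
  finally show False using \<open>card ?V \<ge> n\<close> nD by linarith
 qed
 hence "u - smult d w = 0 \<and> v = 0" using degree_norm(1)[of "u - smult d w" v] unfolding q_def by blast
 hence uv: "u = smult d w" "v = 0" by simp_all
 have "most (\<lambda>Z. k Z = d)" by (rule most_mono[OF most_conj[OF *(2) most_poly_neq[OF *(1)]]]) (auto simp: uv)
 thus ?thesis by blast
qed

text \<open>F_{P+P'} h_{P,P'}^N / (F_P F_{P'}) has trivial divisor. That it is constant follows here
  from the reciprocity laws, which make it multiplicative up to sign, and
  \<open>rational_hom_trivial\<close>. The matching quotient r of the functions g then has constant
  N-th power and is itself constant.\<close>

lemma weil_add_left:
 assumes "odd N" "P \<in> tors N" "P' \<in> tors N" "Q \<in> tors N"
 shows "weil N (P \<uplus> P') Q = weil N P Q * weil N P' Q"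
proof -
 have N: "N \<ge> 1" using assms(1) by (cases N) auto
 note S = subgrp_tors[OF N]
 have PP: "P \<uplus> P' \<in> tors N" using assms tors_padd by blast
 have C: "P \<in> C" "P' \<in> C" "P \<uplus> P' \<in> C" "Q \<in> C" using assms PP tors_in_C by auto
 obtain s1 :: 'k where s1: "s1 = 1 \<or> s1 = -1"
  "\<And>A B. A \<in> C ==> B \<in> C ==> A \<notin> tors N ==> B \<notin> tors N ==> A \<uplus> B \<notin> tors N ==>
   Fm N P A * Fm N P B = s1 * Fm N P (A \<uplus> B) * h A B P ^ N"
  using Fm_reciprocity_tors[OF N assms(2)] by blast
 obtain s2 :: 'k where s2: "s2 = 1 \<or> s2 = -1"
  "\<And>A B. A \<in> C ==> B \<in> C ==> A \<notin> tors N ==> B \<notin> tors N ==> A \<uplus> B \<notin> tors N ==>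
   Fm N P' A * Fm N P' B = s2 * Fm N P' (A \<uplus> B) * h A B P' ^ N"
  using Fm_reciprocity_tors[OF N assms(3)] by blast
 obtain s3 :: 'k where s3: "s3 = 1 \<or> s3 = -1"
  "\<And>A B. A \<in> C ==> B \<in> C ==> A \<notin> tors N ==> B \<notin> tors N ==> A \<uplus> B \<notin> tors N ==>
   Fm N (P \<uplus> P') A * Fm N (P \<uplus> P') B = s3 * Fm N (P \<uplus> P') (A \<uplus> B) * h A B (P \<uplus> P') ^ N"
  using Fm_reciprocity_tors[OF N PP] by blast
 obtain s4 :: 'k where s4: "s4 = 1 \<or> s4 = -1"
  "\<And>A B. A \<in> C ==> B \<in> C ==> A \<notin> tors N ==> B \<notin> tors N ==> A \<uplus> B \<notin> tors N ==>
   h P P' A * h P P' B * h A B (P \<uplus> P') = s4 * h P P' (A \<uplus> B) * h A B P * h A B P'"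
  using h_reciprocity[OF S assms(2,3)] by blast
 \<comment> \<open>This sign turns multiplicativity up to sign into k(A) k(B) = k(A + B).\<close>
 define s where "s = s1 * s2 * s3 * s4 ^ N"
 have s: "s = 1 \<or> s = -1"
 proof -
  have "s4 ^ N = s4" using s4(1) assms(1) by auto
  thus ?thesis using s1(1) s2(1) s3(1) s4(1) by (auto simp: s_def)
 qed
 have sq: "s * s = 1" "s1 * s1 = 1" "s2 * s2 = 1" using s s1(1) s2(1) by auto
 define k where "k Z = s * (Fm N (P \<uplus> P') Z * h P P' Z ^ N / (Fm N P Z * Fm N P' Z))" for Z
 have rk: "ratf k" unfolding k_def by (intro ratf_intros ratf_Fm ratf_h_snd)
 have nz: "Fm N P A ~= 0" "Fm N P' A ~= 0" "Fm N (P \<uplus> P') A ~= 0" "h P P' A ~= 0"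
  if "A \<in> C" "A \<notin> tors N" for A
  using Fm_nonzero[OF S assms(2) that] Fm_nonzero[OF S assms(3) that] Fm_nonzero[OF S PP that]
   h_nonzero'[OF S that assms(2,3)] by auto
 have "\<exists>c. most (\<lambda>Z. k Z = c)"
 proof (rule rational_hom_trivial[OF rk assms(1)])
  fix A assume "A \<in> C" "A \<notin> tors N"
  from nz[OF this] s show "k A ~= 0" by (auto simp: k_def)
 next
  fix A B assume AB: "A \<in> C" "B \<in> C" "A \<notin> tors N" "B \<notin> tors N" "A \<uplus> B \<notin> tors N"
  have "A \<uplus> B \<in> C" using AB by simp
  note nzs = nz[OF AB(1,3)] nz[OF AB(2,4)] nz[OF this AB(5)]
  have hn: "h A B P ~= 0" "h A B P' ~= 0" "h A B (P \<uplus> P') ~= 0"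
   using h_nonzero[OF S AB] assms PP by auto
  have "(h P P' A * h P P' B * h A B (P \<uplus> P')) ^ N = s4 ^ N * (h P P' (A \<uplus> B) * h A B P * h A B P') ^ N"
   unfolding s4(2)[OF AB] by (simp add: power_mult_distrib)
  hence e4: "h P P' A ^ N * h P P' B ^ N * h A B (P \<uplus> P') ^ N = s4 ^ N * (h P P' (A \<uplus> B) ^ N * h A B P ^ N * h A B P' ^ N)"
   by (simp add: power_mult_distrib)
  define x y z t u v where xyz: "x = h A B P ^ N" "y = h A B P' ^ N" "z = h A B (P \<uplus> P') ^ N"
   "t = h P P' (A \<uplus> B) ^ N" "u = h P P' A ^ N" "v = h P P' B ^ N"
  have xnz: "x ~= 0" "y ~= 0" "z ~= 0" using hn by (auto simp: xyz)
  note e4' = e4[folded xyz]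
  note e123 = s1(2)[OF AB, folded xyz] s2(2)[OF AB, folded xyz] s3(2)[OF AB, folded xyz]
  have "k A * k B = (s * s) * ((Fm N (P \<uplus> P') A * Fm N (P \<uplus> P') B) * (u * v) / ((Fm N P A * Fm N P B) * (Fm N P' A * Fm N P' B)))"
   by (simp add: k_def xyz mult_ac)
  also have "\<dots> = s3 * Fm N (P \<uplus> P') (A \<uplus> B) * (u * v * z) / (s1 * s2 * Fm N P (A \<uplus> B) * Fm N P' (A \<uplus> B) * (x * y))"
   unfolding e123 sq by (simp add: mult_ac)
  also have "\<dots> = s3 * s4 ^ N * Fm N (P \<uplus> P') (A \<uplus> B) * t * (x * y) / (s1 * s2 * Fm N P (A \<uplus> B) * Fm N P' (A \<uplus> B) * (x * y))"
   unfolding e4' by (simp add: mult_ac)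
  also have "\<dots> = s3 * s4 ^ N * Fm N (P \<uplus> P') (A \<uplus> B) * t / (s1 * s2 * Fm N P (A \<uplus> B) * Fm N P' (A \<uplus> B))"
   using xnz by simp
  also have "\<dots> = s * (Fm N (P \<uplus> P') (A \<uplus> B) * t / (Fm N P (A \<uplus> B) * Fm N P' (A \<uplus> B)))"
   using s1(1) s2(1) by (auto simp: s_def)
  finally show "k A * k B = k (A \<uplus> B)" by (simp add: k_def xyz)
 qed
 then obtain c0 where c0: "most (\<lambda>Z. k Z = c0)" by blast
 define r where "r Z = gm N (P \<uplus> P') Z * h P P' (N \<odot> Z) / (gm N P Z * gm N P' Z)" for Z
 have rr: "ratf r" unfolding r_def
  using ratf_gm C by (intro ratf_intros ratf_compose[OF ratf_h_snd ratpt_pmul[OF N]] most_pmul N) auto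
 have "most (\<lambda>Z. goodpt N Z \<and> k (N \<odot> Z) = c0)"
  by (intro most_conj most_goodpt most_pmul[OF N c0] N)
 hence "most (\<lambda>Z. r Z \<in> {z. z ^ N = s * c0})"
 proof (rule most_mono)
  fix Z assume Z: "Z \<in> C" "goodpt N Z \<and> k (N \<odot> Z) = c0"
  have "r Z ^ N = gm N (P \<uplus> P') Z ^ N * h P P' (N \<odot> Z) ^ N / (gm N P Z ^ N * gm N P' Z ^ N)"
   by (simp add: r_def power_mult_distrib power_divide)
  also have "\<dots> = Fm N (P \<uplus> P') (N \<odot> Z) * h P P' (N \<odot> Z) ^ N / (Fm N P (N \<odot> Z) * Fm N P' (N \<odot> Z))"
   using gm_power[OF assms(1,2)] gm_power[OF assms(1,3)] gm_power[OF assms(1) PP] Z by simp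
  also have "\<dots> = (s * s) * \<dots>" unfolding sq by simp
  also have "\<dots> = s * k (N \<odot> Z)" by (simp add: k_def mult_ac)
  finally show "r Z \<in> {z. z ^ N = s * c0}" using Z by simp
 qed
 from ratf_finite_values[OF rr finite_roots_unity[OF N] this]
 obtain c where c: "most (\<lambda>Z. r Z = c)" by blast
 show ?thesis
 proof (rule weil_unique[OF assms(1) PP assms(4)])
  have "most (\<lambda>Z. (goodpt N Z \<and> goodpt N (Z \<uplus> Q)) \<and> (r Z = c \<and> r (Z \<uplus> Q) = c) \<and>
   gm N P (Z \<uplus> Q) = weil N P Q * gm N P Z \<and> gm N P' (Z \<uplus> Q) = weil N P' Q * gm N P' Z)"
   by (intro most_conj most_goodpt most_translate' C N c weil_props assms)
  thus "most (\<lambda>Z. gm N (P \<uplus> P') (Z \<uplus> Q) = weil N P Q * weil N P' Q * gm N (P \<uplus> P') Z)"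
  proof (rule most_mono)
   fix Z assume Z: "Z \<in> C" "(goodpt N Z \<and> goodpt N (Z \<uplus> Q)) \<and> (r Z = c \<and> r (Z \<uplus> Q) = c) \<and>
   gm N P (Z \<uplus> Q) = weil N P Q * gm N P Z \<and> gm N P' (Z \<uplus> Q) = weil N P' Q * gm N P' Z"
   have NZ: "N \<odot> (Z \<uplus> Q) = N \<odot> Z" using assms Z C by (simp add: pmul_padd tors_def)
   have "N \<odot> Z \<notin> tors N" using Z N by (auto simp: goodpt_def)
   hence hn: "h P P' (N \<odot> Z) ~= 0" using nz(4) Z by simp
   have g: "gm N P Z ~= 0" "gm N P' Z ~= 0" "gm N P (Z \<uplus> Q) ~= 0" "gm N P' (Z \<uplus> Q) ~= 0"
    using gm_nonzero[OF N] assms Z by auto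
   have "gm N (P \<uplus> P') Z * h P P' (N \<odot> Z) = c * (gm N P Z * gm N P' Z)"
    using Z g unfolding r_def by (auto simp: divide_eq_eq)
   moreover have "gm N (P \<uplus> P') (Z \<uplus> Q) * h P P' (N \<odot> Z) = c * (gm N P (Z \<uplus> Q) * gm N P' (Z \<uplus> Q))"
    using Z g NZ unfolding r_def by (auto simp: divide_eq_eq)
   ultimately have "gm N (P \<uplus> P') (Z \<uplus> Q) * h P P' (N \<odot> Z) = (weil N P Q * weil N P' Q * gm N (P \<uplus> P') Z) * h P P' (N \<odot> Z)"
    using Z by (simp add: mult_ac)
   thus "gm N (P \<uplus> P') (Z \<uplus> Q) = weil N P Q * weil N P' Q * gm N (P \<uplus> P') Z" using hn by simp
  qed
 qed
qed

end

section \<open>Nondegeneracy\<close>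

lemma reduce_fraction:
 fixes A B :: "'a :: alg_closed_field poly"
 assumes "B ~= 0"
 obtains A' B' where "B' ~= 0" "A * B' = A' * B" "\<And>x. poly A' x ~= 0 \<or> poly B' x ~= 0"
  "degree A \<le> degree B ==> degree A' \<le> degree B'"
proof -
 have "\<exists>A' B'. B' ~= 0 \<and> A * B' = A' * B \<and> (\<forall>x. poly A' x ~= 0 \<or> poly B' x ~= 0)"
  using assms
 proof (induction "degree B" arbitrary: A B rule: less_induct)
  case less
  show ?case
  proof (cases "\<exists>c. poly A c = 0 \<and> poly B c = 0")
   case False
   thus ?thesis using less by (intro exI[of _ A] exI[of _ B]) auto
  next
   case True
   then obtain c A1 B1 where AB: "A = [:-c, 1:] * A1" "B = [:-c, 1:] * B1"
    by (auto simp: poly_eq_0_iff_dvd elim!: dvdE)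
   have "B1 ~= 0" using AB less by auto
   moreover have "degree B = Suc (degree B1)" unfolding AB(2) using \<open>B1 ~= 0\<close> by (subst degree_mult_eq) auto
   ultimately obtain A' B' where *: "B' ~= 0" "A1 * B' = A' * B1" "\<forall>x. poly A' x ~= 0 \<or> poly B' x ~= 0"
    using less.hyps[of B1 A1] by auto
   have "A * B' = A' * B" unfolding AB using *(2) by (metis mult.assoc mult.left_commute)
   thus ?thesis using * by blast
  qed
 qed
 then obtain A' B' where *: "B' ~= 0" "A * B' = A' * B" "\<And>x. poly A' x ~= 0 \<or> poly B' x ~= 0" by blast
 moreover have "degree A' \<le> degree B'" if "degree A \<le> degree B"
 proof (cases "A' = 0")
  case False
  hence "A ~= 0" using * assms by auto
  have "degree A + degree B' = degree A' + degree B"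
   using arg_cong[OF *(2), of degree] *(1) assms False \<open>A ~= 0\<close> by (simp add: degree_mult_eq)
  thus ?thesis using that by linarith
 qed simp
 ultimately show ?thesis using that by blast
qed

context short_weierstrass
begin

lemma order_dvd:
 assumes "P \<in> C" "m \<ge> 1" "m \<odot> P = Infinity" "\<And>i. 1 \<le> i ==> i < m ==> i \<odot> P ~= Infinity" "i \<odot> P = Infinity"
 shows "m dvd i"
proof (rule ccontr)
 assume "\<not> m dvd i"
 hence r: "1 \<le> i mod m" "i mod m < m" using assms(2) by (auto simp: dvd_eq_mod_eq_0)
 have "i \<odot> P = (i div m * m + i mod m) \<odot> P" by simp
 also have "\<dots> = (i mod m) \<odot> P" using assms by (simp only: pmul_add pmul_mult) simp
 finally show False using assms(4)[OF r] assms(5) by simp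
qed

text \<open>Multiplied by x - x(k P), Miller's function has its only pole at O, at the price of a
  zero at - k P. The line through P and Q = k P vanishes at Q, so the product with it is divisible
  by x - x(Q), provided Q \<noteq> - Q, and the quotient keeps a zero at -(P + Q).\<close>

lemma Fm_poly_step:
 fixes k P
 defines "Q \<equiv> k \<odot> P"
 assumes P: "P \<in> C" "P ~= Infinity" and Q: "Q ~= Infinity" "yc Q ~= 0" and k: "k \<ge> 1"
  and PQ: "P ~= pneg Q" "yc (P \<uplus> Q) ~= 0"
  and IH: "most (\<lambda>Z. Fm k P Z * (xc Z - xc Q) = pf u v Z)" "pf u v (pneg Q) = 0"
 shows "\<exists>u' v'. most (\<lambda>Z. Fm (Suc k) P Z * (xc Z - xc (P \<uplus> Q)) = pf u' v' Z) \<and> pf u' v' (pneg (P \<uplus> Q)) = 0"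
proof -
 have QC: "Q \<in> C" using P by (simp add: Q_def)
 let ?R = "P \<uplus> Q"
 have R: "?R \<in> C" "?R ~= Infinity" using sum_affine(1)[OF P(1) QC P(2) Q(1) PQ(1)] P QC by auto
 define lu where "lu = [:- yc P + slope P Q * xc P, - slope P Q:]"
 have ln: "ln P Q Z = pf lu 1 Z" for Z by (simp add: ln_def pf_def lu_def algebra_simps)
 have ln': "ln P Q (pneg Z) = pf lu (- 1) Z" for Z by (simp add: ln_def pf_def lu_def algebra_simps)
 define u2 v2 where uv2: "u2 = u * lu + fP * (v * 1)" "v2 = u * 1 + lu * v"
 have m2: "pf u2 v2 Z = pf u v Z * ln P Q Z" if "Z \<in> C" "Z ~= Infinity" for Z
  unfolding ln uv2 using pf_mult[OF that] by simp
 have z1: "pf u2 v2 Q = 0" using m2[OF QC Q(1)] ln_zeros(2)[OF P(1) QC P(2) Q(1) PQ(1)] by simp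
 have z2: "pf u2 v2 (pneg Q) = 0" using m2[of "pneg Q"] QC Q IH(2) by simp
 have e: "poly u2 (xc Q) + poly v2 (xc Q) * yc Q = 0" "poly u2 (xc Q) - poly v2 (xc Q) * yc Q = 0"
  using z1 z2 by (simp_all add: pf_def)
 have "2 * poly u2 (xc Q) = 0" using e by Groebner_Basis.algebra
 moreover have "2 * (poly v2 (xc Q) * yc Q) = 0" using e by Groebner_Basis.algebra
 ultimately have "poly u2 (xc Q) = 0" "poly v2 (xc Q) = 0" using Q by auto
 then obtain u3 v3 where uv3: "u2 = [:- xc Q, 1:] * u3" "v2 = [:- xc Q, 1:] * v3"
  by (auto simp: poly_eq_0_iff_dvd elim!: dvdE)
 have m3: "(xc Z - xc Q) * pf u3 v3 Z = pf u v Z * ln P Q Z" if "Z \<in> C" "Z ~= Infinity" for Z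
  unfolding m2[OF that, symmetric] uv3 by (simp add: pf_def algebra_simps)
 have "most (\<lambda>Z. Fm (Suc k) P Z * (xc Z - xc ?R) = pf u3 v3 Z)"
 proof (rule most_mono[OF most_conj[OF most_conj[OF most_neq[of Infinity] IH(1)] most_conj[OF most_xc_neq[of "xc Q"] most_xc_neq[of "xc ?R"]]]])
  fix Z assume Z: "Z \<in> C" "(Z ~= Infinity \<and> Fm k P Z * (xc Z - xc Q) = pf u v Z) \<and> xc Z ~= xc Q \<and> xc Z ~= xc ?R"
  have "h P Q Z * (xc Z - xc ?R) = ln P Q Z" using Z P Q PQ by (simp add: h_def)
  hence "Fm (Suc k) P Z * (xc Z - xc ?R) = Fm k P Z * ln P Q Z" using k by (simp add: Fm_Suc Q_def)
  moreover have "(xc Z - xc Q) * (Fm k P Z * ln P Q Z) = (xc Z - xc Q) * pf u3 v3 Z"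
   using m3[of Z] Z by (simp add: mult_ac)
  hence "Fm k P Z * ln P Q Z = pf u3 v3 Z" using Z by simp
  ultimately show "Fm (Suc k) P Z * (xc Z - xc ?R) = pf u3 v3 Z" by simp
 qed
 moreover have "pf u3 v3 (pneg ?R) = 0"
 proof -
  \<comment> \<open>\<open>pf U V\<close> vanishes identically. At -(P + Q) the second term of
    \<open>pfUV\<close> drops out and the line factor equals 2 y(P + Q) \<noteq> 0, which yields the
    new zero.\<close>
  define q where "q = [:- xc P, 1:] * [:- xc ?R, 1:]"
  define U V where UV: "U = u3 * lu + fP * (v3 * (- 1)) + u * q" "V = u3 * (- 1) + lu * v3 + v * q"
  have pfUV: "pf U V Z = pf u3 v3 Z * ln P Q (pneg Z) + pf u v Z * ((xc Z - xc P) * (xc Z - xc ?R))"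
   if Z: "Z \<in> C" "Z ~= Infinity" for Z
  proof -
   have "pf u3 v3 Z * ln P Q (pneg Z) = pf (u3 * lu + fP * (v3 * (- 1))) (u3 * (- 1) + lu * v3) Z"
    unfolding ln' by (rule pf_mult[OF Z])
   moreover have "poly q (xc Z) = (xc Z - xc P) * (xc Z - xc ?R)" by (simp add: q_def algebra_simps)
   moreover have "pf U V Z = pf (u3 * lu + fP * (v3 * (- 1))) (u3 * (- 1) + lu * v3) Z + pf u v Z * poly q (xc Z)"
    unfolding UV by (simp add: pf_def algebra_simps)
   ultimately show ?thesis by simp
  qed
  have "most (\<lambda>Z. pf U V Z = 0)"
  proof (rule most_mono[OF most_conj[OF most_neq[of Infinity] most_xc_neq[of "xc Q"]]])
   fix Z assume Z: "Z \<in> C" "Z ~= Infinity \<and> xc Z ~= xc Q"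
   have "(xc Z - xc Q) * pf U V Z = pf u v Z * (ln P Q Z * ln P Q (pneg Z))
     + pf u v Z * ((xc Z - xc P) * (xc Z - xc Q) * (xc Z - xc ?R))"
   proof -
    have 1: "pf U V Z = pf u3 v3 Z * ln P Q (pneg Z) + pf u v Z * ((xc Z - xc P) * (xc Z - xc ?R))"
     using pfUV Z by blast
    have 2: "(xc Z - xc Q) * pf u3 v3 Z = pf u v Z * ln P Q Z" using m3 Z by blast
    show ?thesis using 1 2 by Groebner_Basis.algebra
   qed
   also have "ln P Q Z * ln P Q (pneg Z) = - ((xc Z - xc P) * (xc Z - xc Q) * (xc Z - xc ?R))"
    using ln_norm[OF P(1) QC P(2) Q(1) PQ(1)] Z by simp
   finally show "pf U V Z = 0" using Z by simp
  qed
  hence "U = 0" "V = 0" using most_pf_zero by blast+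
  hence "pf U V (pneg ?R) = 0" by (simp add: pf_def)
  hence "pf u3 v3 (pneg ?R) * ln P Q ?R = 0" using pfUV[of "pneg ?R"] R by simp
  moreover have "ln P Q ?R = 2 * yc ?R"
   using ln_zeros(3)[OF P(1) QC P(2) Q(1) PQ(1)] by (simp add: ln_def algebra_simps)
  ultimately show ?thesis using PQ(2) by simp
 qed
 ultimately show ?thesis by blast
qed

text \<open>Odd order keeps the proper multiples of P away from the 2-torsion, as the induction step
  requires. In the norm the factors x - x(i P) cancel, and each chord contributes a sign.\<close>

lemma Fm_poly_order:
 assumes P: "P \<in> C" "P ~= Infinity" and m: "odd m" "m \<odot> P = Infinity"
  and ord: "\<And>i. 1 \<le> i ==> i < m ==> i \<odot> P ~= Infinity"
 shows "\<exists>u v. most (\<lambda>Z. Fm m P Z = pf u v Z)"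
  and "\<exists>s. (s = 1 \<or> s = -1) \<and> most (\<lambda>Z. Fm m P Z * Fm m P (pneg Z) = s * (xc Z - xc P) ^ m)"
proof -
 have m1: "m \<ge> 1" using m(1) by (cases m) auto
 have "m ~= 1" using m(2) P by auto
 hence m2: "m \<ge> 3" using m(1) m1 by (cases "m = 2") auto
 have aff: "i \<odot> P ~= Infinity \<and> yc (i \<odot> P) ~= 0" if "1 \<le> i" "i < m" for i
 proof -
  have "yc (i \<odot> P) ~= 0"
  proof
   assume "yc (i \<odot> P) = 0"
   hence "i \<odot> P = pneg (i \<odot> P)" by (cases "i \<odot> P") auto
   hence "i \<odot> P \<uplus> i \<odot> P = Infinity" by (metis padd_pneg(1))
   hence "(i + i) \<odot> P = Infinity" using P by (simp add: pmul_add)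
   hence "m dvd 2 * i" using order_dvd[OF P(1) m1 m(2) ord] by (simp add: mult_2)
   moreover have "coprime m 2" using m(1) by simp
   ultimately have "m dvd i" by (simp add: coprime_dvd_mult_right_iff)
   thus False using that by (auto dest: dvd_imp_le)
  qed
  thus ?thesis using ord that by blast
 qed
 have nopp: "P ~= pneg (k \<odot> P)" if "Suc k < m" for k
 proof
  assume "P = pneg (k \<odot> P)"
  hence "Suc k \<odot> P = Infinity" by (metis padd_pneg(2) pmul.simps(2))
  thus False using ord[of "Suc k"] that by simp
 qed
 have main: "k < m \<longrightarrow> (\<exists>u v. most (\<lambda>Z. Fm k P Z * (xc Z - xc (k \<odot> P)) = pf u v Z) \<and> pf u v (pneg (k \<odot> P)) = 0)"
  if "k \<ge> 1" for k using that
 proof (induction k rule: dec_induct)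
  case base
  show ?case
   by (intro impI exI[of _ "[:- xc P, 1:]"] exI[of _ 0]) (auto intro: most_True simp: Fm_def)
 next
  case (step k)
  show ?case
  proof
   assume k: "Suc k < m"
   then obtain u v where uv: "most (\<lambda>Z. Fm k P Z * (xc Z - xc (k \<odot> P)) = pf u v Z)" "pf u v (pneg (k \<odot> P)) = 0"
    using step by auto
   have a: "k \<odot> P ~= Infinity" "yc (k \<odot> P) ~= 0" "yc (P \<uplus> k \<odot> P) ~= 0"
    using aff[of k] aff[of "Suc k"] step k by auto
   from Fm_poly_step[OF P a(1,2) step(1) nopp[OF k] a(3) uv]
   show "\<exists>u v. most (\<lambda>Z. Fm (Suc k) P Z * (xc Z - xc (Suc k \<odot> P)) = pf u v Z) \<and> pf u v (pneg (Suc k \<odot> P)) = 0"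
    by simp
  qed
 qed
 let ?k = "m - 1"
 have k: "?k \<ge> 1" "?k < m" "Suc ?k = m" using m2 by auto
 have kP: "P = pneg (?k \<odot> P)"
 proof -
  have "P \<uplus> ?k \<odot> P = Infinity" using m(2) k(3) pmul.simps(2)[of ?k P] by simp
  hence "?k \<odot> P = pneg P" using padd_eq_Infinity P by simp
  thus ?thesis by simp
 qed
 hence xkP: "xc (?k \<odot> P) = xc P" by (metis xc_pneg)
 have last: "Fm m P Z = Fm ?k P Z * (xc Z - xc P)" if "Z ~= Infinity" for Z
  using Fm_Suc[OF k(1), of P Z] that P k(3) kP ord[of ?k] k by (simp add: h_def)
 obtain u v where "most (\<lambda>Z. Fm ?k P Z * (xc Z - xc (?k \<odot> P)) = pf u v Z)" using main[OF k(1)] k by blast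
 hence "most (\<lambda>Z. Fm m P Z = pf u v Z)"
  by (rule most_mono[OF most_conj[OF most_neq[of Infinity]]]) (auto simp: last xkP[unfolded One_nat_def])
 thus "\<exists>u v. most (\<lambda>Z. Fm m P Z = pf u v Z)" by blast
 have "k < m \<longrightarrow> (\<exists>s. (s = 1 \<or> s = -1) \<and>
  most (\<lambda>Z. Fm k P Z * Fm k P (pneg Z) * (xc Z - xc (k \<odot> P)) = s * (xc Z - xc P) ^ k))"
  if "k \<ge> 1" for k using that
 proof (induction k rule: dec_induct)
  case base
  show ?case by (intro impI exI[of _ 1]) (auto intro: most_True simp: Fm_def)
 next
  case (step k)
  show ?case
  proof
   assume k: "Suc k < m"
   then obtain s where s: "s = 1 \<or> s = -1"
    "most (\<lambda>Z. Fm k P Z * Fm k P (pneg Z) * (xc Z - xc (k \<odot> P)) = s * (xc Z - xc P) ^ k)"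
    using step by auto
   let ?Q = "k \<odot> P"
   have Q: "?Q \<in> C" "?Q ~= Infinity" using P ord step k by auto
   have "most (\<lambda>Z. Fm (Suc k) P Z * Fm (Suc k) P (pneg Z) * (xc Z - xc (Suc k \<odot> P)) = - s * (xc Z - xc P) ^ Suc k)"
   proof (rule most_mono[OF most_conj[OF most_conj[OF most_neq[of Infinity] s(2)] most_xc_neq[of "xc (P \<uplus> ?Q)"]]])
    fix Z assume Z: "Z \<in> C" "(Z ~= Infinity \<and> Fm k P Z * Fm k P (pneg Z) * (xc Z - xc ?Q) = s * (xc Z - xc P) ^ k) \<and> xc Z ~= xc (P \<uplus> ?Q)"
    have "h P ?Q Z * h P ?Q (pneg Z) * (xc Z - xc (P \<uplus> ?Q)) ^ 2 = ln P ?Q Z * ln P ?Q (pneg Z)"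
     using Z P Q nopp[OF k] by (simp add: h_def power2_eq_square)
    also have "\<dots> = - ((xc Z - xc P) * (xc Z - xc ?Q) * (xc Z - xc (P \<uplus> ?Q)))"
     using ln_norm[OF P(1) Q(1) P(2) Q(2) nopp[OF k]] Z by simp
    finally have "(xc Z - xc (P \<uplus> ?Q)) * (h P ?Q Z * h P ?Q (pneg Z) * (xc Z - xc (P \<uplus> ?Q)))
      = (xc Z - xc (P \<uplus> ?Q)) * - ((xc Z - xc P) * (xc Z - xc ?Q))" by (simp add: power2_eq_square mult_ac)
    hence hh: "h P ?Q Z * h P ?Q (pneg Z) * (xc Z - xc (P \<uplus> ?Q)) = - ((xc Z - xc P) * (xc Z - xc ?Q))"
     by (rule mult_left_cancel[THEN iffD1, rotated]) (use Z in simp)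
    have "Fm (Suc k) P Z * Fm (Suc k) P (pneg Z) * (xc Z - xc (Suc k \<odot> P))
     = Fm k P Z * Fm k P (pneg Z) * (h P ?Q Z * h P ?Q (pneg Z) * (xc Z - xc (P \<uplus> ?Q)))"
     using step by (simp add: Fm_Suc mult_ac)
    also have "\<dots> = - (Fm k P Z * Fm k P (pneg Z) * (xc Z - xc ?Q)) * (xc Z - xc P)"
     unfolding hh by (simp add: mult_ac)
    also have "\<dots> = - s * (xc Z - xc P) ^ Suc k" using Z by simp
    finally show "Fm (Suc k) P Z * Fm (Suc k) P (pneg Z) * (xc Z - xc (Suc k \<odot> P)) = - s * (xc Z - xc P) ^ Suc k" .
   qed
   moreover have "- s = 1 \<or> - s = -1" using s(1) by auto
   ultimately show "\<exists>s. (s = 1 \<or> s = -1) \<and>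
    most (\<lambda>Z. Fm (Suc k) P Z * Fm (Suc k) P (pneg Z) * (xc Z - xc (Suc k \<odot> P)) = s * (xc Z - xc P) ^ Suc k)"
    by blast
  qed
 qed
 from this[OF k(1)] obtain s where s: "s = 1 \<or> s = -1"
  "most (\<lambda>Z. Fm ?k P Z * Fm ?k P (pneg Z) * (xc Z - xc (?k \<odot> P)) = s * (xc Z - xc P) ^ ?k)" using k by blast
 have "most (\<lambda>Z. Fm m P Z * Fm m P (pneg Z) = s * (xc Z - xc P) ^ m)"
 proof (rule most_mono[OF most_conj[OF most_neq[of Infinity] s(2)]])
  fix Z assume Z: "Z \<in> C" "Z ~= Infinity \<and> Fm ?k P Z * Fm ?k P (pneg Z) * (xc Z - xc (?k \<odot> P)) = s * (xc Z - xc P) ^ ?k"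
  have "Fm m P Z * Fm m P (pneg Z) = (Fm ?k P Z * Fm ?k P (pneg Z) * (xc Z - xc (?k \<odot> P))) * (xc Z - xc P)"
   unfolding xkP using last[of Z] last[of "pneg Z"] Z by (simp add: mult_ac)
  also have "\<dots> = s * (xc Z - xc P) ^ Suc ?k" using Z by simp
  finally show "Fm m P Z * Fm m P (pneg Z) = s * (xc Z - xc P) ^ m" using k by simp
 qed
 thus "\<exists>s. (s = 1 \<or> s = -1) \<and> most (\<lambda>Z. Fm m P Z * Fm m P (pneg Z) = s * (xc Z - xc P) ^ m)" using s(1) by blast
qed

lemma Fm_period:
 assumes "P \<in> C" "m \<ge> 1" "m \<odot> P = Infinity" "j \<ge> 1"
 shows "Fm (j * m) P Z = Fm m P Z ^ j"
 using assms(4)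
proof (induction j rule: dec_induct)
 case base show ?case by simp
next
 case (step j)
 have jm: "(j * m) \<odot> P = Infinity" using assms by (simp add: pmul_mult)
 have "j * m \<ge> 1" using step(1) assms(2) by simp
 hence "{1..<Suc j * m} = {1..<j * m} \<union> {j * m..<j * m + m}"
  by (simp add: ivl_disj_un_two(3) add.commute)
 hence "Fm (Suc j * m) P Z = Fm (j * m) P Z * (\<Prod>i=j * m..<j * m + m. h P (i \<odot> P) Z)"
  unfolding Fm_def by (simp add: prod.union_disjoint)
 also have "(\<Prod>i=j * m..<j * m + m. h P (i \<odot> P) Z) = (\<Prod>i=0..<m. h P ((i + j * m) \<odot> P) Z)"
  by (rule prod.reindex_bij_witness[of _ "\<lambda>i. i + j * m" "\<lambda>i. i - j * m"]) auto
 also have "\<dots> = (\<Prod>i=0..<m. h P (i \<odot> P) Z)" using assms jm by (simp add: pmul_add)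
 also have "\<dots> = h P (0 \<odot> P) Z * (\<Prod>i=1..<m. h P (i \<odot> P) Z)"
  using assms(2) by (simp add: prod.atLeast_Suc_lessThan)
 also have "\<dots> = Fm m P Z" by (simp add: Fm_def h_def)
 finally show ?case using step by (simp add: mult.commute)
qed

lemma pf_power: "\<exists>u' v'. \<forall>Z\<in>C. Z ~= Infinity \<longrightarrow> pf u v Z ^ n = pf u' v' Z"
proof (induction n)
 case 0 show ?case by (intro exI[of _ 1] exI[of _ 0]) auto
next
 case (Suc n)
 then obtain u' v' where "\<forall>Z\<in>C. Z ~= Infinity \<longrightarrow> pf u v Z ^ n = pf u' v' Z" by blast
 hence "\<forall>Z\<in>C. Z ~= Infinity \<longrightarrow> pf u v Z ^ Suc n = pf (u * u' + fP * (v * v')) (u * v' + u' * v) Z"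
  using pf_mult by simp
 thus ?case by blast
qed

text \<open>The exact order m of P may be a proper divisor of N; then F_N is a power of F_m. The
  norm has degree N in x, which bounds the degree of u by N / 2.\<close>

lemma Fm_tors_poly:
 assumes N: "odd N" and P: "P \<in> tors N" "P ~= Infinity"
 obtains u v s where "most (\<lambda>Z. Fm N P Z = pf u v Z)" "s = 1 \<or> s = -1"
  "most (\<lambda>Z. Fm N P Z * Fm N P (pneg Z) = s * (xc Z - xc P) ^ N)" "2 * degree u \<le> N"
proof -
 have PC: "P \<in> C" using P tors_in_C by blast
 have N1: "N \<ge> 1" using N by (cases N) auto
 define m where "m = (LEAST i. 1 \<le> i \<and> i \<odot> P = Infinity)"
 have ex: "1 \<le> N \<and> N \<odot> P = Infinity" using N1 P by (simp add: tors_def)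
 have m: "1 \<le> m" "m \<odot> P = Infinity" using LeastI[of "\<lambda>i. 1 \<le> i \<and> i \<odot> P = Infinity", OF ex] by (simp_all add: m_def)
 have ord: "i \<odot> P ~= Infinity" if "1 \<le> i" "i < m" for i
  using not_less_Least[of i "\<lambda>i. 1 \<le> i \<and> i \<odot> P = Infinity"] that by (simp add: m_def)
 obtain j where j: "N = j * m" using order_dvd[OF PC m ord, of N] ex by (metis dvdE mult.commute)
 have "j \<ge> 1" using j N1 by (cases j) auto
 have om: "odd m" using N j by simp
 obtain u0 v0 where uv0: "most (\<lambda>Z. Fm m P Z = pf u0 v0 Z)" using Fm_poly_order(1)[OF PC P(2) om m(2) ord] by blast
 obtain s0 where s0: "s0 = 1 \<or> s0 = -1" "most (\<lambda>Z. Fm m P Z * Fm m P (pneg Z) = s0 * (xc Z - xc P) ^ m)"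
  using Fm_poly_order(2)[OF PC P(2) om m(2) ord] by blast
 obtain u v where uv: "\<forall>Z\<in>C. Z ~= Infinity \<longrightarrow> pf u0 v0 Z ^ j = pf u v Z" using pf_power by blast
 have per: "Fm N P Z = Fm m P Z ^ j" for Z unfolding j using Fm_period[OF PC m \<open>j \<ge> 1\<close>] .
 have 1: "most (\<lambda>Z. Fm N P Z = pf u v Z)"
  by (rule most_mono[OF most_conj[OF most_neq[of Infinity] uv0]]) (use uv in \<open>auto simp: per\<close>)
 define s where "s = s0 ^ j"
 have s: "s = 1 \<or> s = -1" using s0(1) unfolding s_def by (metis minus_one_power_iff power_one)
 have 2: "most (\<lambda>Z. Fm N P Z * Fm N P (pneg Z) = s * (xc Z - xc P) ^ N)"
 proof (rule most_mono[OF s0(2)])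
  fix Z assume *: "Fm m P Z * Fm m P (pneg Z) = s0 * (xc Z - xc P) ^ m"
  have "Fm N P Z * Fm N P (pneg Z) = (Fm m P Z * Fm m P (pneg Z)) ^ j" by (simp only: per power_mult_distrib)
  also have "\<dots> = s * (xc Z - xc P) ^ N"
   unfolding * s_def j by (simp only: power_mult_distrib mult.commute[of j m] power_mult)
  finally show "Fm N P Z * Fm N P (pneg Z) = s * (xc Z - xc P) ^ N" .
 qed
 have "most (\<lambda>Z. poly (u ^ 2 - fP * v ^ 2) (xc Z) = poly (smult s ([:- xc P, 1:] ^ N)) (xc Z))"
 proof (rule most_mono[OF most_conj[OF most_conj[OF most_neq[of Infinity] 2] most_conj[OF 1 most_pneg[OF 1]]]])
  fix Z assume Z: "Z \<in> C" "(Z ~= Infinity \<and> Fm N P Z * Fm N P (pneg Z) = s * (xc Z - xc P) ^ N) \<and>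
   Fm N P Z = pf u v Z \<and> Fm N P (pneg Z) = pf u v (pneg Z)"
  have "pf u v (pneg Z) = pf u (- v) Z" by (simp add: pf_def)
  hence "poly (u ^ 2 - fP * v ^ 2) (xc Z) = Fm N P Z * Fm N P (pneg Z)"
   using pf_conj[of Z u v] Z by metis
  also have "\<dots> = s * (xc Z - xc P) ^ N" using Z by blast
  finally show "poly (u ^ 2 - fP * v ^ 2) (xc Z) = poly (smult s ([:- xc P, 1:] ^ N)) (xc Z)"
   by simp
 qed
 hence eq: "u ^ 2 - fP * v ^ 2 = smult s ([:- xc P, 1:] ^ N)" by (rule most_poly_eq)
 have nz: "smult s ([:- xc P, 1:] ^ N) ~= 0" using s by auto
 hence "u ~= 0 \<or> v ~= 0" unfolding eq[symmetric] by auto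
 from degree_norm(3)[OF this] have "2 * degree u \<le> degree (smult s ([:- xc P, 1:] ^ N))" unfolding eq .
 also have "\<dots> \<le> N" using s by (auto simp: degree_power_eq)
 finally show ?thesis using that[OF 1 s 2] by blast
qed

section \<open>Nondegeneracy: auxiliary polynomials and the main argument\<close>

lemma poly_homogenize:
 fixes u \<phi> \<psi> :: "'k poly"
 assumes "degree u \<le> j"
 obtains U where "\<And>x x'. x' * poly \<psi> x = poly \<phi> x ==> poly u x' * poly \<psi> x ^ j = poly U x"
proof -
 define U where "U = (\<Sum>i\<le>j. smult (Polynomial.coeff u i) (\<phi> ^ i * \<psi> ^ (j - i)))"
 have "poly u x' * poly \<psi> x ^ j = poly U x" if x: "x' * poly \<psi> x = poly \<phi> x" for x x'
 proof -
  have "poly u x' = (\<Sum>i\<le>j. Polynomial.coeff u i * x' ^ i)"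
   unfolding poly_altdef using assms by (intro sum.mono_neutral_left) (auto simp: coeff_eq_0)
  hence "poly u x' * poly \<psi> x ^ j = (\<Sum>i\<le>j. Polynomial.coeff u i * x' ^ i * poly \<psi> x ^ j)"
   by (simp add: sum_distrib_right)
  also have "\<dots> = (\<Sum>i\<le>j. Polynomial.coeff u i * (poly \<phi> x ^ i * poly \<psi> x ^ (j - i)))"
  proof (rule sum.cong[OF refl])
   fix i assume "i \<in> {..j}"
   hence "poly \<psi> x ^ j = poly \<psi> x ^ i * poly \<psi> x ^ (j - i)" by (simp flip: power_add)
   thus "Polynomial.coeff u i * x' ^ i * poly \<psi> x ^ j = Polynomial.coeff u i * (poly \<phi> x ^ i * poly \<psi> x ^ (j - i))"
    unfolding x[symmetric] by (simp add: power_mult_distrib mult_ac)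
  qed
  also have "\<dots> = poly U x" by (simp add: U_def poly_sum)
  finally show ?thesis .
 qed
 thus ?thesis using that by blast
qed

text \<open>A homogenised recursion of Dickson type: for A = t (g + g')^2 B and w = t g g' it
  computes (t B)^j (g^(2j+1) + g'^(2j+1)) / (g + g').\<close>

fun power_sum_poly :: "'a :: comm_ring_1 => 'a => 'a => nat => 'a" where
 "power_sum_poly A B w 0 = 1"
| "power_sum_poly A B w (Suc 0) = A - 3 * w * B"
| "power_sum_poly A B w (Suc (Suc j)) =
  (A - 2 * w * B) * power_sum_poly A B w (Suc j) - w ^ 2 * B ^ 2 * power_sum_poly A B w j"

lemma power_sum_poly:
 fixes g g' t :: "'a :: comm_ring_1"
 assumes "A = t * (g + g') ^ 2 * B" "w = t * (g * g')"
 shows "(g + g') * power_sum_poly A B w j = (g ^ (2 * j + 1) + g' ^ (2 * j + 1)) * t ^ j * B ^ j"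
proof -
 define S where "S j \<longleftrightarrow> (g + g') * power_sum_poly A B w j = (g ^ (2 * j + 1) + g' ^ (2 * j + 1)) * t ^ j * B ^ j" for j
 have "S j \<and> S (Suc j)"
 proof (induction j)
  case 0
  have "S 0" by (simp add: S_def)
  moreover have "S 1" unfolding S_def assms by (simp add: algebra_simps power2_eq_square)
  ultimately show ?case by simp
 next
  case (Suc j)
  have "(g + g') * power_sum_poly A B w (Suc (Suc j))
   = (A - 2 * w * B) * ((g + g') * power_sum_poly A B w (Suc j)) - w ^ 2 * B ^ 2 * ((g + g') * power_sum_poly A B w j)"
   by (simp add: algebra_simps)
  also have "\<dots> = (A - 2 * w * B) * ((g ^ (2 * Suc j + 1) + g' ^ (2 * Suc j + 1)) * t ^ Suc j * B ^ Suc j)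
   - w ^ 2 * B ^ 2 * ((g ^ (2 * j + 1) + g' ^ (2 * j + 1)) * t ^ j * B ^ j)"
   using Suc unfolding S_def by simp
  also have "\<dots> = (g ^ (2 * Suc (Suc j) + 1) + g' ^ (2 * Suc (Suc j) + 1)) * t ^ Suc (Suc j) * B ^ Suc (Suc j)"
   unfolding assms by (simp add: algebra_simps power2_eq_square)
  finally have "S (Suc (Suc j))" unfolding S_def .
  thus ?case using Suc by simp
 qed
 thus ?thesis by (simp add: S_def)
qed

lemma poly_power_sum_poly:
 "poly (power_sum_poly A B w j) x = power_sum_poly (poly A x) (poly B x) (poly w x) j"
 by (induction A B w j rule: power_sum_poly.induct) (simp_all add: numeral_poly mult.assoc)

lemma power_sum_poly_0: "power_sum_poly A 0 w j = A ^ j"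
 by (induction A "0 :: 'a" w j rule: power_sum_poly.induct) (simp_all add: power2_eq_square)

lemma fP_two_roots: "\<exists>e e'. e ~= e' \<and> rhs e = 0 \<and> rhs e' = 0"
proof -
 have "card {x. poly fP x = 0} = degree fP"
 proof (rule card_roots_eq_degree)
  fix x assume "poly fP x = 0"
  hence "3 * x ^ 2 + a ~= 0" using nonsingular[of x] by simp
  moreover have "poly (pderiv fP) x = 3 * x ^ 2 + a"
   by (simp add: fP_def pderiv_pCons algebra_simps power2_eq_square)
  ultimately show "poly (pderiv fP) x ~= 0" by simp
 qed simp
 hence c: "card {x. rhs x = 0} = 3" by simp
 hence "{x. rhs x = 0} ~= {}" by (metis card.empty zero_neq_numeral)
 then obtain e where e: "rhs e = 0" by blast
 have "{x. rhs x = 0} ~= {e}" using c by (metis card_1_singleton_iff num.distinct(3) numeral_eq_one_iff One_nat_def)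
 thus ?thesis using e by blast
qed

lemma pmul_odd_two_torsion: "T \<in> C ==> T \<uplus> T = Infinity ==> odd N ==> N \<odot> T = T"
proof -
 assume T: "T \<in> C" "T \<uplus> T = Infinity" "odd N"
 obtain j where "N = Suc (j * 2)" using T(3) by (metis oddE mult.commute Suc_eq_plus1)
 moreover have "2 \<odot> T = Infinity" using T by (simp add: numeral_2_eq_2)
 ultimately show ?thesis using T(1) by (simp add: pmul_mult)
qed

text \<open>If all pairings with P were trivial, g would be invariant under E[N]. The function g +
  g' with g'(Z) = g(- Z) is a fraction A / B in x that takes one value at the N^2 abscissas of a
  coset; a bound deg B < N^2 makes it a constant k. At a 2-torsion point (e, 0), on which N acts as
  the identity, the norm g g' then gives (k/2)^2 = \<omega> (e - x(P)), impossible for two roots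
  e.\<close>

lemma weil_nondegenerate:
 assumes N: "odd N" and P: "P \<in> tors N" "P ~= Infinity"
 shows "\<exists>Q\<in>tors N. weil N P Q ~= 1"
proof (rule ccontr)
 assume "\<not> ?thesis"
 hence triv: "weil N P Q = 1" if "Q \<in> tors N" for Q using that by blast
 have PC: "P \<in> C" using P tors_in_C by blast
 have N1: "N \<ge> 1" using N by (cases N) auto
 define j where "j = (N - 1) div 2"
 have Nj: "N = 2 * j + 1" using N unfolding j_def by (metis Suc_eq_plus1 add_diff_cancel_right' mult.commute nonzero_mult_div_cancel_left oddE zero_neq_numeral)
 define g g' where g: "g = gm N P" and g': "g' = (\<lambda>Z. gm N P (pneg Z))"
 obtain a1 b1 c1 where abc: "c1 ~= 0" "most (\<lambda>Z. g Z * poly c1 (xc Z) = pf a1 b1 Z)"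
  using ratf_gm[OF PC, of N] unfolding ratf_def g by blast
 have abc': "most (\<lambda>Z. g' Z * poly c1 (xc Z) = pf a1 (- b1) Z)"
  by (rule most_mono[OF most_pneg[OF abc(2)]]) (simp add: g g' pf_def)
 obtain \<phi> \<psi> where mp: "mult_polys N \<phi> \<psi>" using mult_polys_exist[OF N1] by blast
 have dg: "degree \<phi> = N ^ 2" "degree \<psi> = N ^ 2 - 1" "\<psi> ~= 0" using mp N1 by (auto simp: mult_polys_def)
 have NZ: "most (\<lambda>Z. xc (N \<odot> Z) * poly \<psi> (xc Z) = poly \<phi> (xc Z) \<and> poly \<psi> (xc Z) ~= 0)"
 proof (rule most_mono[OF most_conj[OF most_neq[of Infinity] most_pmul_neq[OF N1, of Infinity]]])
  fix Z assume "Z \<in> C" "Z ~= Infinity \<and> N \<odot> Z ~= Infinity"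
  thus "xc (N \<odot> Z) * poly \<psi> (xc Z) = poly \<phi> (xc Z) \<and> poly \<psi> (xc Z) ~= 0"
   using mp by (auto simp: mult_polys_def xrep_def)
 qed
 obtain u v s where F: "most (\<lambda>Z. Fm N P Z = pf u v Z)" "s = 1 \<or> s = -1"
  "most (\<lambda>Z. Fm N P Z * Fm N P (pneg Z) = s * (xc Z - xc P) ^ N)" "2 * degree u \<le> N"
  by (rule Fm_tors_poly[OF N P])
 have pw: "most (\<lambda>Z. g Z ^ N = Fm N P (N \<odot> Z) \<and> g' Z ^ N = Fm N P (pneg (N \<odot> Z)))"
 proof (rule most_mono[OF most_conj[OF most_goodpt[OF N1] most_pneg[OF most_goodpt[OF N1]]]])
  fix Z assume Z: "Z \<in> C" "goodpt N Z \<and> goodpt N (pneg Z)"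
  show "g Z ^ N = Fm N P (N \<odot> Z) \<and> g' Z ^ N = Fm N P (pneg (N \<odot> Z))"
   using gm_power[OF N P(1)] Z by (simp add: g g' pmul_pneg)
 qed
 have nzg: "most (\<lambda>Z. g Z ~= 0)"
  by (rule most_mono[OF most_goodpt[OF N1]]) (use gm_nonzero[OF N1 P(1)] in \<open>auto simp: g\<close>)
 \<comment> \<open>The norm of F is \<plusminus>(x - x(P))^N, so r has constant N-th power; hence g
   g' is a constant multiple of x(N Z) - x(P).\<close>
 define r where "r Z = g Z * g' Z / (xc (N \<odot> Z) - xc P)" for Z
 have rg: "ratf g" "ratf g'" unfolding g g' using ratf_gm[OF PC]
  by (auto intro: ratf_compose[OF _ ratpt_pneg most_pneg])
 have rr: "ratf r" unfolding r_def using rg ratpt_pmul[OF N1] by (intro ratf_intros) (auto simp: ratpt_def)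
 have xN: "most (\<lambda>Z. xc (N \<odot> Z) ~= xc P)" using most_pmul[OF N1 most_xc_neq[of "xc P"]] .
 have "most (\<lambda>Z. r Z \<in> {z. z ^ N = s})"
 proof (rule most_mono[OF most_conj[OF pw most_conj[OF most_pmul[OF N1 F(3)] xN]]])
  fix Z assume Z: "Z \<in> C" "(g Z ^ N = Fm N P (N \<odot> Z) \<and> g' Z ^ N = Fm N P (pneg (N \<odot> Z))) \<and>
   Fm N P (N \<odot> Z) * Fm N P (pneg (N \<odot> Z)) = s * (xc (N \<odot> Z) - xc P) ^ N \<and> xc (N \<odot> Z) ~= xc P"
  have "r Z ^ N = (g Z ^ N * g' Z ^ N) / (xc (N \<odot> Z) - xc P) ^ N" by (simp add: r_def power_divide power_mult_distrib)
  thus "r Z \<in> {z. z ^ N = s}" using Z by simp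
 qed
 from ratf_finite_values[OF rr finite_roots_unity[OF N1] this]
 obtain \<omega> where \<omega>: "\<omega> ^ N = s" "most (\<lambda>Z. r Z = \<omega>)" by blast
 have \<omega>0: "\<omega> ~= 0" using \<omega>(1) F(2) N1 by (auto simp: power_0_left)
 define w where "w = smult \<omega> (\<phi> - smult (xc P) \<psi>)"
 have prod: "most (\<lambda>Z. poly w (xc Z) = poly \<psi> (xc Z) * (g Z * g' Z))"
 proof (rule most_mono[OF most_conj[OF \<omega>(2) most_conj[OF NZ xN]]])
  fix Z assume Z: "Z \<in> C" "r Z = \<omega> \<and> (xc (N \<odot> Z) * poly \<psi> (xc Z) = poly \<phi> (xc Z) \<and> poly \<psi> (xc Z) ~= 0) \<and> xc (N \<odot> Z) ~= xc P"
  hence "g Z * g' Z = \<omega> * (xc (N \<odot> Z) - xc P)" by (auto simp: r_def field_simps)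
  moreover have "poly \<phi> (xc Z) = xc (N \<odot> Z) * poly \<psi> (xc Z)" using Z by simp
  moreover have "poly w (xc Z) = \<omega> * (poly \<phi> (xc Z) - xc P * poly \<psi> (xc Z))" by (simp add: w_def)
  ultimately show "poly w (xc Z) = poly \<psi> (xc Z) * (g Z * g' Z)" by (simp only:) (simp add: algebra_simps)
 qed
 have I: "(a1 ^ 2 - fP * b1 ^ 2) * \<psi> = w * c1 ^ 2"
 proof (rule most_poly_eq, rule most_mono[OF most_conj[OF most_neq[of Infinity] most_conj[OF most_conj[OF abc(2) abc'] prod]]])
  fix Z assume Z: "Z \<in> C" "Z ~= Infinity \<and> (g Z * poly c1 (xc Z) = pf a1 b1 Z \<and> g' Z * poly c1 (xc Z) = pf a1 (- b1) Z) \<and>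
   poly w (xc Z) = poly \<psi> (xc Z) * (g Z * g' Z)"
  have "poly (a1 ^ 2 - fP * b1 ^ 2) (xc Z) = pf a1 b1 Z * pf a1 (- b1) Z" using pf_conj Z by simp
  also have "\<dots> = (g Z * poly c1 (xc Z)) * (g' Z * poly c1 (xc Z))" using Z by simp
  finally have "poly (a1 ^ 2 - fP * b1 ^ 2) (xc Z) = g Z * g' Z * poly c1 (xc Z) ^ 2"
   by (simp add: power2_eq_square mult_ac)
  moreover have "poly w (xc Z) = poly \<psi> (xc Z) * (g Z * g' Z)" using Z by blast
  ultimately show "poly ((a1 ^ 2 - fP * b1 ^ 2) * \<psi>) (xc Z) = poly (w * c1 ^ 2) (xc Z)"
   unfolding poly_mult poly_power by (simp only: mult_ac)
 qed
 have dw: "degree w = N ^ 2" using mult_polys_fibre_degree[OF mp N1] \<omega>0 by (simp add: w_def)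
 have "w ~= 0" using dw N1 by auto
 have ab0: "a1 ~= 0 \<or> b1 ~= 0" using I \<open>w ~= 0\<close> abc(1) by auto
 \<comment> \<open>Degrees in the norm identity show that the even part of g has no pole at
   O.\<close>
 have da1: "degree a1 \<le> degree c1"
 proof -
  have "degree (a1 ^ 2 - fP * b1 ^ 2) + (N ^ 2 - 1) = N ^ 2 + 2 * degree c1"
   using arg_cong[OF I, of degree] degree_norm(1)[OF ab0] dg dw abc(1) \<open>w ~= 0\<close>
   by (simp add: degree_mult_eq degree_power_eq)
  moreover have "N ^ 2 \<ge> 1" using N1 by simp
  ultimately show ?thesis using degree_norm(3)[OF ab0] by linarith
 qed
 obtain A B where AB: "B ~= 0" "smult 2 a1 * B = A * c1" "\<And>x. poly A x ~= 0 \<or> poly B x ~= 0" "degree A \<le> degree B"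
  using reduce_fraction[OF abc(1), of "smult 2 a1"] da1 by (metis degree_smult_le order.trans)
 have sumc: "most (\<lambda>Z. (g Z + g' Z) * poly c1 (xc Z) = 2 * poly a1 (xc Z))"
  by (rule most_mono[OF most_conj[OF abc(2) abc']]) (simp add: pf_def algebra_simps)
 have sumAB: "most (\<lambda>Z. (g Z + g' Z) * poly B (xc Z) = poly A (xc Z))"
 proof (rule most_mono[OF most_conj[OF sumc most_poly_neq[OF abc(1)]]])
  fix Z assume Z: "(g Z + g' Z) * poly c1 (xc Z) = 2 * poly a1 (xc Z) \<and> poly c1 (xc Z) ~= 0"
  have "2 * poly a1 (xc Z) * poly B (xc Z) = poly A (xc Z) * poly c1 (xc Z)"
   using arg_cong[OF AB(2), of "\<lambda>p. poly p (xc Z)"] by (simp add: mult.assoc)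
  hence "poly c1 (xc Z) * ((g Z + g' Z) * poly B (xc Z)) = poly c1 (xc Z) * poly A (xc Z)"
   using Z by (metis mult.assoc mult.commute)
  thus "(g Z + g' Z) * poly B (xc Z) = poly A (xc Z)" using Z by simp
 qed
 \<comment> \<open>A3 / B3 is \<psi> (g + g')^2 in lowest terms. It will be a polynomial by an
   integrality argument: g^N + g'^N becomes a polynomial in x on multiplication by \<psi>^j.\<close>
 obtain A3 B3 where AB3: "B3 ~= 0" "A ^ 2 * \<psi> * B3 = A3 * B ^ 2" "\<And>x. poly A3 x ~= 0 \<or> poly B3 x ~= 0"
  using reduce_fraction[of "B ^ 2" "A ^ 2 * \<psi>"] AB(1) by (metis power_not_zero)
 have A3: "most (\<lambda>Z. poly A3 (xc Z) = poly \<psi> (xc Z) * (g Z + g' Z) ^ 2 * poly B3 (xc Z))"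
 proof (rule most_mono[OF most_conj[OF sumAB most_poly_neq[OF AB(1)]]])
  fix Z assume Z: "(g Z + g' Z) * poly B (xc Z) = poly A (xc Z) \<and> poly B (xc Z) ~= 0"
  have "poly A (xc Z) ^ 2 * poly \<psi> (xc Z) * poly B3 (xc Z) = poly A3 (xc Z) * poly B (xc Z) ^ 2"
   using arg_cong[OF AB3(2), of "\<lambda>p. poly p (xc Z)"] by simp
  hence "poly B (xc Z) ^ 2 * (poly \<psi> (xc Z) * (g Z + g' Z) ^ 2 * poly B3 (xc Z)) = poly B (xc Z) ^ 2 * poly A3 (xc Z)"
   unfolding conjunct1[OF Z, symmetric] by (simp add: power_mult_distrib mult_ac)
  thus "poly A3 (xc Z) = poly \<psi> (xc Z) * (g Z + g' Z) ^ 2 * poly B3 (xc Z)" using Z by simp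
 qed
 have du: "degree u \<le> j" using F(4) Nj by linarith
 obtain U where U: "\<And>x x'. x' * poly \<psi> x = poly \<phi> x ==> poly u x' * poly \<psi> x ^ j = poly U x"
  using poly_homogenize[OF du] by blast
 define T where "T = power_sum_poly A3 B3 w j"
 have II: "A3 * T ^ 2 = smult 4 (U ^ 2 * B3 ^ (2 * j + 1) * \<psi>)"
 proof (rule most_poly_eq, rule most_mono[OF most_conj[OF most_conj[OF prod A3] most_conj[OF most_conj[OF NZ pw] most_conj[OF most_pmul[OF N1 F(1)] most_pmul[OF N1 most_pneg[OF F(1)]]]]]])
  fix Z assume Z: "Z \<in> C" "(poly w (xc Z) = poly \<psi> (xc Z) * (g Z * g' Z) \<and>
   poly A3 (xc Z) = poly \<psi> (xc Z) * (g Z + g' Z) ^ 2 * poly B3 (xc Z)) \<and>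
   ((xc (N \<odot> Z) * poly \<psi> (xc Z) = poly \<phi> (xc Z) \<and> poly \<psi> (xc Z) ~= 0) \<and>
   g Z ^ N = Fm N P (N \<odot> Z) \<and> g' Z ^ N = Fm N P (pneg (N \<odot> Z))) \<and>
   Fm N P (N \<odot> Z) = pf u v (N \<odot> Z) \<and> Fm N P (pneg (N \<odot> Z)) = pf u v (pneg (N \<odot> Z))"
  let ?x = "xc Z"
  have "g Z ^ N + g' Z ^ N = 2 * poly u (xc (N \<odot> Z))" using Z by (simp add: pf_def)
  hence s: "(g Z ^ N + g' Z ^ N) * poly \<psi> ?x ^ j = 2 * poly U ?x" using U[of "xc (N \<odot> Z)" ?x] Z by simp
  have "(g Z + g' Z) * poly T ?x = (g Z ^ N + g' Z ^ N) * poly \<psi> ?x ^ j * poly B3 ?x ^ j"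
   unfolding T_def poly_power_sum_poly Nj by (rule power_sum_poly) (use Z in auto)
  also have "\<dots> = 2 * poly U ?x * poly B3 ?x ^ j" unfolding s ..
  finally have e: "(g Z + g' Z) * poly T ?x = 2 * poly U ?x * poly B3 ?x ^ j" .
  have "poly (A3 * T ^ 2) ?x = poly \<psi> ?x * poly B3 ?x * ((g Z + g' Z) * poly T ?x) ^ 2"
   using Z by (simp add: power_mult_distrib mult_ac)
  also have "\<dots> = poly (smult 4 (U ^ 2 * B3 ^ (2 * j + 1) * \<psi>)) ?x"
   unfolding e by (simp add: power_mult_distrib power_add power_mult mult_ac power2_eq_square)
  finally show "poly (A3 * T ^ 2) ?x = poly (smult 4 (U ^ 2 * B3 ^ (2 * j + 1) * \<psi>)) ?x" .
 qed
 \<comment> \<open>At a root of B3 the right side of \<open>II\<close> is zero while T reduces to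
   A3^j, so A3 would vanish there too.\<close>
 have "degree B3 = 0"
 proof (rule ccontr)
  assume "degree B3 ~= 0"
  then obtain x where x: "poly B3 x = 0" using alg_closed_imp_poly_has_root by blast
  have "poly (A3 * T ^ 2) x = 0" unfolding II using x by simp
  moreover have "poly T x = poly A3 x ^ j" unfolding T_def poly_power_sum_poly x power_sum_poly_0 ..
  ultimately have "poly A3 x = 0" by auto
  thus False using AB3(3)[of x] x by simp
 qed
 \<comment> \<open>With A and B coprime, A^2 \<psi> / B^2 is now a polynomial, so deg B is at most
   half of N^2 - 1.\<close>
 have "B ^ 2 dvd \<psi>"
 proof (rule dvd_if_no_common_root[of _ _ "smult (Polynomial.coeff B3 0) (A ^ 2)"])
  obtain c where c: "B3 = [:c:]" "c ~= 0" using \<open>degree B3 = 0\<close> AB3(1) degree_eq_zeroE by (metis pCons_eq_0_iff)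
  have "\<psi> * smult (Polynomial.coeff B3 0) (A ^ 2) = A3 * B ^ 2" using AB3(2) unfolding c by (simp add: mult.commute)
  thus "B ^ 2 dvd \<psi> * smult (Polynomial.coeff B3 0) (A ^ 2)" by simp
  fix x assume "poly (B ^ 2) x = 0"
  hence "poly A x ~= 0" using AB(3)[of x] by auto
  thus "poly (smult (Polynomial.coeff B3 0) (A ^ 2)) x ~= 0" using c by simp
 qed (use AB(1) in simp)
 hence "2 * degree B \<le> N ^ 2 - 1" using dvd_imp_degree_le[of "B ^ 2" \<psi>] dg AB(1) by (simp add: degree_power_eq)
 moreover have "N ^ 2 \<ge> 1" using N1 by simp
 ultimately have dB: "degree B < N ^ 2" by linarith
 have inv: "most (\<lambda>Z. \<forall>Q\<in>tors N. g (Z \<uplus> Q) = g Z)"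
  using weil_props(2)[OF N P(1)] triv by (intro most_ball finite_tors N1) (auto simp: g)
 have tr: "most (\<lambda>Z. \<forall>Q\<in>tors N. (g (Z \<uplus> Q) + g' (Z \<uplus> Q)) * poly B (xc (Z \<uplus> Q)) = poly A (xc (Z \<uplus> Q)) \<and> Z \<uplus> Q ~= Infinity)"
  by (intro most_ball finite_tors N1 most_conj most_translate'[OF _ sumAB] most_translate'[OF _ most_neq]) (auto simp: tors_in_C)
 have "most (\<lambda>Z. (\<forall>Q\<in>tors N. g (Z \<uplus> Q) = g Z) \<and> (\<forall>Q\<in>tors N. g (pneg Z \<uplus> Q) = g (pneg Z)) \<and>
  (\<forall>Q\<in>tors N. (g (Z \<uplus> Q) + g' (Z \<uplus> Q)) * poly B (xc (Z \<uplus> Q)) = poly A (xc (Z \<uplus> Q)) \<and> Z \<uplus> Q ~= Infinity) \<and>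
  2 \<odot> Z \<notin> tors N)"
  by (rule most_conj[OF inv most_conj[OF most_pneg[OF inv] most_conj[OF tr most_pmul[OF _ most_not_in[OF finite_tors[OF N1]]]]]]) simp
 then obtain Z where Z: "Z \<in> C" "\<And>Q. Q \<in> tors N ==> g (Z \<uplus> Q) = g Z" "\<And>Q. Q \<in> tors N ==> g (pneg Z \<uplus> Q) = g (pneg Z)"
  "\<And>Q. Q \<in> tors N ==> (g (Z \<uplus> Q) + g' (Z \<uplus> Q)) * poly B (xc (Z \<uplus> Q)) = poly A (xc (Z \<uplus> Q)) \<and> Z \<uplus> Q ~= Infinity"
  "2 \<odot> Z \<notin> tors N" by (blast dest: most_ex)
 define k where "k = g Z + g' Z"
 have "A - smult k B = 0"
 proof (rule ccontr)
  assume nz: "A - smult k B ~= 0"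
  have root: "poly (A - smult k B) (xc (Z \<uplus> Q)) = 0" if Q: "Q \<in> tors N" for Q
  proof -
   have "g' (Z \<uplus> Q) = g (pneg Z \<uplus> pneg Q)" using Z(1) Q by (simp add: g g' pneg_padd tors_in_C)
   also have "\<dots> = g' Z" using Z(3)[OF tors_pneg[OF Q]] by (simp add: g g')
   finally show ?thesis using Z(2)[OF Q] Z(4)[OF Q] by (simp add: k_def)
  qed
  \<comment> \<open>2 Z is not N-torsion, so Z + Q and Z + Q' are never opposite and N^2 different
    abscissas arise.\<close>
  have inj: "inj_on (\<lambda>Q. xc (Z \<uplus> Q)) (tors N)"
  proof (rule inj_onI)
   fix Q Q' assume Q: "Q \<in> tors N" "Q' \<in> tors N" and x: "xc (Z \<uplus> Q) = xc (Z \<uplus> Q')"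
   have QC: "Q \<in> C" "Q' \<in> C" using Q tors_in_C by auto
   have "Z \<uplus> Q = Z \<uplus> Q' \<or> Z \<uplus> Q = pneg (Z \<uplus> Q')"
    by (rule same_x) (use Z QC Q x in auto)
   thus "Q = Q'"
   proof
    assume "Z \<uplus> Q = Z \<uplus> Q'" thus ?thesis using Z(1) QC by simp
   next
    assume *: "Z \<uplus> Q = pneg (Z \<uplus> Q')"
    have "Q \<uplus> (Z \<uplus> pneg Q) = Z" using padd_left_commute[of Q Z "pneg Q"] Z(1) QC by simp
    hence "Z \<uplus> Z = (Z \<uplus> Q) \<uplus> (Z \<uplus> pneg Q)" using Z(1) QC by (simp add: padd_assoc)
    also have "\<dots> = (pneg Q' \<uplus> pneg Z) \<uplus> (Z \<uplus> pneg Q)"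
     unfolding * using Z(1) QC by (simp add: pneg_padd padd_commute[of "pneg Z"])
    also have "\<dots> = pneg Q' \<uplus> pneg Q" using Z(1) QC by (simp add: padd_assoc)
    finally have "2 \<odot> Z = pneg Q' \<uplus> pneg Q" by (simp add: numeral_2_eq_2)
    thus ?thesis using Z(5) Q tors_padd tors_pneg by metis
   qed
  qed
  have "N ^ 2 = card ((\<lambda>Q. xc (Z \<uplus> Q)) ` tors N)" using card_image[OF inj] card_tors[OF N1] by simp
  also have "\<dots> \<le> card {x. poly (A - smult k B) x = 0}"
   by (rule card_mono[OF poly_roots_finite[OF nz]]) (use root in auto)
  also have "\<dots> \<le> degree (A - smult k B)" by (rule card_poly_roots_bound[OF nz])
  also have "\<dots> \<le> degree B" by (rule degree_diff_le) (use AB(4) degree_smult_le in auto)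
  finally show False using dB by simp
 qed
 hence "A = smult k B" by simp
 hence "B * (smult 2 a1 - smult k c1) = 0" using AB(2) by (simp add: algebra_simps)
 hence "smult 2 a1 = smult k c1" using AB(1) by simp
 hence "smult (1/2) (smult 2 a1) = smult (1/2) (smult k c1)" by (rule arg_cong)
 hence a1: "a1 = smult (k / 2) c1" by simp
 \<comment> \<open>L times a square equals f \<psi> times a square. A root e of f is simple and
   \<psi>(e) \<noteq> 0, so the parity of multiplicities forces L(e) = 0.\<close>
 define L where "L = smult ((k / 2) ^ 2) \<psi> - w"
 have c1L: "c1 ^ 2 * L = fP * b1 ^ 2 * \<psi>"
  using I unfolding a1 L_def by (simp add: algebra_simps power2_eq_square)
 obtain b2 c2 where bc: "c2 ~= 0" "b1 * c2 = b2 * c1" "\<And>x. poly b2 x ~= 0 \<or> poly c2 x ~= 0"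
  using reduce_fraction[OF abc(1), of b1] by metis
 have "c1 ^ 2 * (c2 ^ 2 * L) = c2 ^ 2 * (fP * b1 ^ 2 * \<psi>)" using c1L by (metis mult.left_commute)
 also have "\<dots> = fP * \<psi> * (b1 * c2) ^ 2" by (simp add: power_mult_distrib mult_ac)
 also have "\<dots> = c1 ^ 2 * (fP * \<psi> * b2 ^ 2)" unfolding bc(2) by (simp add: power_mult_distrib mult_ac)
 finally have c2L: "c2 ^ 2 * L = fP * \<psi> * b2 ^ 2" using abc(1) by simp
 have key: "(k / 2) ^ 2 = \<omega> * (e - xc P)" if e: "rhs e = 0" for e
 proof -
  let ?T = "Affine e 0"
  have T: "?T \<in> C" using e by (simp add: Affine_in_C)
  have "?T \<uplus> ?T = Infinity" using padd_pneg(1)[of ?T] by simp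
  hence "N \<odot> ?T = ?T" using pmul_odd_two_torsion[OF T _ N] by simp
  moreover have "xrep (N \<odot> ?T) (poly \<phi> e) (poly \<psi> e)" using mp T by (force simp: mult_polys_def)
  ultimately have pe: "poly \<psi> e ~= 0" "poly \<phi> e = e * poly \<psi> e" by (auto simp: xrep_def)
  have "poly L e = 0"
  proof (rule ccontr)
   assume Le: "poly L e ~= 0"
   have "poly (c2 ^ 2 * L) e = 0" unfolding c2L using e by simp
   hence c2e: "poly c2 e = 0" using Le by simp
   hence b2e: "poly b2 e ~= 0" using bc(3)[of e] by simp
   obtain c3 where c3: "c2 = [:-e, 1:] * c3" using c2e by (auto simp: poly_eq_0_iff_dvd elim!: dvdE)
   obtain f1 where f1: "fP = [:-e, 1:] * f1" using e poly_fP[of e] by (metis poly_eq_0_iff_dvd dvdE)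
   have "poly (pderiv fP) e = poly f1 e" unfolding f1 pderiv_mult by (simp add: pderiv_pCons)
   moreover have "poly (pderiv fP) e = 3 * e ^ 2 + a"
    by (simp add: fP_def pderiv_pCons algebra_simps power2_eq_square)
   ultimately have f1e: "poly f1 e ~= 0" using nonsingular[OF e] by simp
   have "[:-e, 1:] * ([:-e, 1:] * c3 ^ 2 * L) = [:-e, 1:] * (f1 * \<psi> * b2 ^ 2)"
    using c2L unfolding c3 f1 by (simp only: power_mult_distrib power2_eq_square mult_ac)
   hence "[:-e, 1:] * c3 ^ 2 * L = f1 * \<psi> * b2 ^ 2" by (subst (asm) mult_left_cancel) auto
   from arg_cong[OF this, of "\<lambda>p. poly p e"] show False using f1e pe b2e by simp
  qed
  hence "((k / 2) ^ 2 - \<omega> * (e - xc P)) * poly \<psi> e = 0" using pe by (simp add: L_def w_def algebra_simps)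
  thus ?thesis using pe by simp
 qed
 obtain e e' where "e ~= e'" "rhs e = 0" "rhs e' = 0" using fP_two_roots by blast
 hence "\<omega> * (e - xc P) = \<omega> * (e' - xc P)" using key by metis
 thus False using \<omega>0 \<open>e ~= e'\<close> by simp
qed

end

section \<open>Automorphisms of the algebraic numbers\<close>

text \<open>The graph of an injective homomorphism defined on a subring. Graphs make the situation
  symmetric under inversion and let Zorn's lemma work with unions.\<close>

definition piso :: "('a::field \<times> 'a) set => bool" where
 "piso G \<longleftrightarrow> (1, 1) \<in> G \<and>
  (\<forall>x y x' y'. (x, y) \<in> G \<longrightarrow> (x', y') \<in> G \<longrightarrow> (x - x', y - y') \<in> G \<and> (x * x', y * y') \<in> G) \<and>
  (\<forall>x y. (x, y) \<in> G \<longrightarrow> x = 0 \<longleftrightarrow> y = 0)"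

definition piso_field :: "('a::field \<times> 'a) set => bool" where
 "piso_field G \<longleftrightarrow> piso G \<and> (\<forall>x y. (x, y) \<in> G \<longrightarrow> (inverse x, inverse y) \<in> G)"

context
 fixes G :: "('a::field \<times> 'a) set"
 assumes G: "piso G"
begin

lemma piso_1: "(1, 1) \<in> G" using G by (simp add: piso_def)
lemma piso_diff: "(x, y) \<in> G ==> (x', y') \<in> G ==> (x - x', y - y') \<in> G" using G by (auto simp: piso_def)
lemma piso_mult: "(x, y) \<in> G ==> (x', y') \<in> G ==> (x * x', y * y') \<in> G" using G by (auto simp: piso_def)
lemma piso_zero: "(x, y) \<in> G ==> x = 0 \<longleftrightarrow> y = 0" using G by (auto simp: piso_def)
lemma piso_0: "(0, 0) \<in> G" using piso_diff[OF piso_1 piso_1] by simp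
lemma piso_add: "(x, y) \<in> G ==> (x', y') \<in> G ==> (x + x', y + y') \<in> G"
 using piso_diff[of x y "- x'" "- y'"] piso_diff[OF piso_0, of x' y'] by simp
lemma piso_sum: "(\<And>i. i \<in> I ==> (f i, g i) \<in> G) ==> (sum f I, sum g I) \<in> G"
 by (induction I rule: infinite_finite_induct) (auto intro: piso_add piso_0)
lemma piso_unique: "(x, y) \<in> G ==> (x, y') \<in> G ==> y = y'"
 using piso_zero[OF piso_diff, of x y x y'] by simp
lemma piso_unique': "(x, y) \<in> G ==> (x', y) \<in> G ==> x = x'"
 using piso_zero[OF piso_diff, of x y x' y] by simp

end

definition ppair :: "('a::field \<times> 'a) set => 'a poly => 'a poly => bool" where
 "ppair G q q' \<longleftrightarrow> (\<forall>i. (Polynomial.coeff q i, Polynomial.coeff q' i) \<in> G)"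

lemma ppair_zero_iff: assumes "piso G" "ppair G q q'" shows "q = 0 \<longleftrightarrow> q' = 0"
 using assms piso_zero[OF assms(1)] by (auto simp: ppair_def poly_eq_iff)

lemma ppair_degree: assumes "piso G" "ppair G q q'" shows "degree q = degree q'"
proof -
 have "Polynomial.coeff q i = 0 \<longleftrightarrow> Polynomial.coeff q' i = 0" for i
  using assms(2) piso_zero[OF assms(1)] unfolding ppair_def by blast
 thus ?thesis by (simp add: degree_def)
qed

lemma ppair_const: "piso G ==> (x, y) \<in> G ==> ppair G [:x:] [:y:]"
 by (auto simp: ppair_def coeff_pCons piso_0 split: nat.split)

lemma ppair_X: "piso G ==> ppair G [:0, 1:] [:0, 1:]"
 by (auto simp: ppair_def coeff_pCons piso_0 piso_1 split: nat.split)

lemma ppair_add: "piso G ==> ppair G q q' ==> ppair G r r' ==> ppair G (q + r) (q' + r')"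
 by (simp add: ppair_def piso_add)

lemma ppair_diff: "piso G ==> ppair G q q' ==> ppair G r r' ==> ppair G (q - r) (q' - r')"
 by (simp add: ppair_def piso_diff)

lemma ppair_mult: "piso G ==> ppair G q q' ==> ppair G r r' ==> ppair G (q * r) (q' * r')"
 unfolding ppair_def coeff_mult by (intro allI piso_sum piso_mult) auto

lemma ppair_0: "piso G ==> ppair G 0 0"
 by (simp add: ppair_def piso_0)

lemma ppair_monom: "piso G ==> (x, y) \<in> G ==> ppair G (monom x n) (monom y n)"
 by (auto simp: ppair_def piso_0)

text \<open>Long division is carried out on both sides at once, so the second quotient and remainder
  correspond to the first coefficientwise.\<close>

lemma ppair_division:
 assumes G: "piso_field G" and m: "ppair G m m'" "m ~= 0" and q: "ppair G q q'"
 shows "\<exists>s s' t t'. ppair G s s' \<and> ppair G t t' \<and> q = m * s + t \<and> q' = m' * s' + t' \<and> (t = 0 \<or> degree t < degree m)"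
 using q
proof (induction "degree q" arbitrary: q q' rule: less_induct)
 case less
 have pG: "piso G" using G by (simp add: piso_field_def)
 show ?case
 proof (cases "q = 0 \<or> degree q < degree m")
  case True
  thus ?thesis using less ppair_0[OF pG] by (intro exI[of _ 0] exI[of _ q] exI[of _ q']) auto
 next
  case False
  hence q0: "q ~= 0" "degree q \<ge> degree m" by auto
  define c c' where c: "c = lead_coeff q / lead_coeff m" "c' = lead_coeff q' / lead_coeff m'"
  have dm: "degree m' = degree m" "degree q' = degree q" using ppair_degree[OF pG] m less by auto
  have "(inverse (lead_coeff m), inverse (lead_coeff m')) \<in> G"
   using G m(1) dm unfolding piso_field_def ppair_def by metis
  hence cG: "(c, c') \<in> G" unfolding c divide_inverse using less(2) dm
   by (intro piso_mult[OF pG]) (auto simp: ppair_def)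
  define k where "k = degree q - degree m"
  define q1 q1' where q1: "q1 = q - m * monom c k" "q1' = q' - m' * monom c' k"
  have p1: "ppair G q1 q1'" unfolding q1 by (intro ppair_diff ppair_mult ppair_monom pG less m cG)
  have c0: "c ~= 0" using q0 m by (simp add: c)
  have "q1 = 0 \<or> degree q1 < degree q"
  proof -
   have d: "degree (m * monom c k) = degree q" using m c0 q0 by (simp add: degree_mult_eq degree_monom_eq k_def monom_eq_0_iff)
   have "lead_coeff (m * monom c k) = lead_coeff q" using m c0 by (simp only: lead_coeff_mult lead_coeff_monom) (simp add: c)
   hence "Polynomial.coeff q1 (degree q) = 0" using d by (simp add: q1)
   moreover have "degree q1 \<le> degree q" unfolding q1 by (rule degree_diff_le) (use d in auto)
   ultimately show ?thesis by (metis leading_coeff_0_iff order_le_imp_less_or_eq)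
  qed
  then consider "q1 = 0" | "degree q1 < degree q" by blast
  thus ?thesis
  proof cases
   case 1
   hence "q1' = 0" using ppair_zero_iff[OF pG p1] by simp
   thus ?thesis using 1 q1 ppair_0[OF pG] ppair_monom[OF pG cG, of k]
    by (intro exI[of _ "monom c k"] exI[of _ "monom c' k"] exI[of _ 0]) auto
  next
   case 2
   from less(1)[OF 2 p1] obtain s s' t t' where *: "ppair G s s'" "ppair G t t'" "q1 = m * s + t" "q1' = m' * s' + t'"
    "t = 0 \<or> degree t < degree m" by blast
   have "q = m * (monom c k + s) + t" "q' = m' * (monom c' k + s') + t'"
    using *(3,4) unfolding q1 by (simp_all add: algebra_simps)
   thus ?thesis using * ppair_add[OF pG ppair_monom[OF pG cG, of k] *(1)] by blast
  qed
 qed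
qed

text \<open>m is a minimal polynomial of x over the domain of G, up to a constant factor, and m' is
  its image.\<close>

definition min_pair :: "('a::field \<times> 'a) set => 'a => 'a poly => 'a poly => bool" where
 "min_pair G x m m' \<longleftrightarrow> ppair G m m' \<and> m ~= 0 \<and> poly m x = 0 \<and>
  (\<forall>q q'. ppair G q q' \<longrightarrow> q ~= 0 \<longrightarrow> poly q x = 0 \<longrightarrow> degree m \<le> degree q)"

lemma min_pair_exists:
 assumes "ppair G q q'" "q ~= 0" "poly q x = 0"
 shows "\<exists>m m'. min_pair G x m m'"
proof -
 define S where "S n \<longleftrightarrow> (\<exists>q q'. ppair G q q' \<and> q ~= 0 \<and> poly q x = 0 \<and> degree q = n)" for n
 have "S (degree q)" using assms unfolding S_def by blast
 hence L: "S (LEAST n. S n)" by (rule LeastI)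
 then obtain m m' where m: "ppair G m m'" "m ~= 0" "poly m x = 0" "degree m = (LEAST n. S n)" unfolding S_def by blast
 have "degree m \<le> degree q" if "ppair G q q'" "q ~= 0" "poly q x = 0" for q q'
  unfolding m(4) by (rule Least_le) (use that in \<open>auto simp: S_def\<close>)
 thus ?thesis using m unfolding min_pair_def by blast
qed

lemma min_pair_dvd:
 assumes "piso_field G" "min_pair G x m m'" "ppair G q q'" "poly q x = 0"
 shows "\<exists>s s'. ppair G s s' \<and> q = m * s \<and> q' = m' * s'"
proof -
 have pG: "piso G" using assms by (simp add: piso_field_def)
 from assms have m: "ppair G m m'" "m ~= 0" "poly m x = 0" by (auto simp: min_pair_def)
 from ppair_division[OF assms(1) m(1,2) assms(3)] obtain s s' t t' where
  *: "ppair G s s'" "ppair G t t'" "q = m * s + t" "q' = m' * s' + t'" "t = 0 \<or> degree t < degree m" by blast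
 have "poly t x = 0" using * assms m by simp
 hence "t = 0" using * assms unfolding min_pair_def by (metis not_less)
 hence "t' = 0" using ppair_zero_iff[OF pG *(2)] by simp
 thus ?thesis using * \<open>t = 0\<close> by auto
qed

lemma ppair_converse: "ppair G q q' \<longleftrightarrow> ppair (G\<inverse>) q' q"
 by (simp add: ppair_def)

lemma piso_converse: "piso G ==> piso (G\<inverse>)" "piso_field G ==> piso_field (G\<inverse>)"
 by (auto simp: piso_def piso_field_def)

definition adjoin_pair :: "('a::field \<times> 'a) set => 'a => 'a => ('a \<times> 'a) set" where
 "adjoin_pair G x y = {(poly q x, poly q' y) | q q'. ppair G q q'}"

text \<open>Extension of an isomorphism to a simple extension. The delicate point is that q'(y) = 0
  implies q(x) = 0: a minimal polynomial of y over the range divides m', and by minimality of m its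
  counterpart must already vanish at x.\<close>

lemma piso_adjoin:
 assumes G: "piso_field G" and m: "min_pair G x m m'" and y: "poly m' y = 0"
 shows "piso (adjoin_pair G x y)" "G \<subseteq> adjoin_pair G x y" "(x, y) \<in> adjoin_pair G x y"
proof -
 have pG: "piso G" using G by (simp add: piso_field_def)
 have m1: "ppair G m m'" "m ~= 0" "poly m x = 0" using m by (auto simp: min_pair_def)
 have zero: "poly q x = 0 \<longleftrightarrow> poly q' y = 0" if q: "ppair G q q'" for q q'
 proof
  assume "poly q x = 0"
  from min_pair_dvd[OF G m q this] y show "poly q' y = 0" by auto
 next
  assume qy: "poly q' y = 0"
  have "m' ~= 0" using ppair_zero_iff[OF pG m1(1)] m1 by simp
  then obtain t' t where t: "min_pair (G\<inverse>) y t' t" using min_pair_exists[of "G\<inverse>" m' m y] m1(1) y ppair_converse by blast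
  note G' = piso_converse(2)[OF G]
  have t1: "ppair G t t'" "t' ~= 0" "poly t' y = 0" using t ppair_converse by (auto simp: min_pair_def)
  have "t ~= 0" using ppair_zero_iff[OF pG t1(1)] t1 by simp
  from min_pair_dvd[OF G' t _ y] m1(1) obtain s s' where s: "ppair G s s'" "m = t * s"
   unfolding ppair_converse[of G] by blast
  have "degree t' > 0"
  proof (rule ccontr)
   assume "\<not> degree t' > 0"
   then obtain c where "t' = [:c:]" using degree_eq_zeroE by auto
   thus False using t1 by auto
  qed
  hence dt: "degree t > 0" using ppair_degree[OF pG t1(1)] by simp
  have s0: "s ~= 0" using s m1 by auto
  have "degree m = degree t + degree s" unfolding s(2) using \<open>t ~= 0\<close> s0 by (rule degree_mult_eq)
  hence "degree s < degree m" using dt by simp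
  hence "poly s x ~= 0" using m s(1) s0 unfolding min_pair_def by (meson not_le)
  hence tx: "poly t x = 0" using m1(3) s(2) by simp
  from min_pair_dvd[OF G' t _ qy] q obtain r where "q = t * r" unfolding ppair_converse[of G] by blast
  thus "poly q x = 0" using tx by simp
 qed
 show "piso (adjoin_pair G x y)"
  unfolding piso_def
 proof (intro conjI allI impI)
  show "(1, 1) \<in> adjoin_pair G x y" unfolding adjoin_pair_def
   using ppair_const[OF pG piso_1[OF pG]] by (intro CollectI exI[of _ "[:1:]"]) auto
  fix u v u' v' assume "(u, v) \<in> adjoin_pair G x y" "(u', v') \<in> adjoin_pair G x y"
  then obtain q q' r r' where *: "ppair G q q'" "ppair G r r'" "u = poly q x" "v = poly q' y" "u' = poly r x" "v' = poly r' y"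
   unfolding adjoin_pair_def by blast
  show "(u - u', v - v') \<in> adjoin_pair G x y" unfolding adjoin_pair_def
   using ppair_diff[OF pG *(1,2)] * by (intro CollectI exI[of _ "q - r"] exI[of _ "q' - r'"]) auto
  show "(u * u', v * v') \<in> adjoin_pair G x y" unfolding adjoin_pair_def
   using ppair_mult[OF pG *(1,2)] * by (intro CollectI exI[of _ "q * r"] exI[of _ "q' * r'"]) auto
 next
  fix u v assume "(u, v) \<in> adjoin_pair G x y"
  then obtain q q' where "u = poly q x" "v = poly q' y" "ppair G q q'" unfolding adjoin_pair_def by blast
  thus "u = 0 \<longleftrightarrow> v = 0" using zero by simp
 qed
 show "G \<subseteq> adjoin_pair G x y"
 proof (rule subrelI)
  fix u v assume "(u, v) \<in> G"
  thus "(u, v) \<in> adjoin_pair G x y" unfolding adjoin_pair_def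
   using ppair_const[OF pG] by (intro CollectI exI[of _ "[:u:]"] exI[of _ "[:v:]"]) auto
 qed
 show "(x, y) \<in> adjoin_pair G x y" unfolding adjoin_pair_def
  using ppair_X[OF pG] by (intro CollectI exI[of _ "[:0, 1:]"]) auto
qed

section \<open>Automorphisms and the extension of partial isomorphisms to them\<close>

definition field_aut :: "('a::field => 'a) => bool" where
 "field_aut sg \<longleftrightarrow> bij sg \<and> (\<forall>x y. sg (x + y) = sg x + sg y) \<and> (\<forall>x y. sg (x * y) = sg x * sg y)"

lemma aut_add: "field_aut sg ==> sg (x + y) = sg x + sg y"
 and aut_mult: "field_aut sg ==> sg (x * y) = sg x * sg y"
 by (auto simp: field_aut_def)

lemma aut_inj: "field_aut sg ==> sg x = sg y \<longleftrightarrow> x = y"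
 by (metis field_aut_def bij_pointE)

lemma aut_0: "field_aut sg ==> sg 0 = 0"
 using aut_add[of sg 0 0] by (metis add_cancel_right_right add_0)

lemma aut_eq_0: "field_aut sg ==> sg x = 0 \<longleftrightarrow> x = 0"
 using aut_inj[of sg x 0] aut_0[of sg] by simp

lemma aut_1: "field_aut sg ==> sg 1 = 1"
 using aut_mult[of sg 1 1] aut_eq_0[of sg 1] by simp

lemma aut_minus: "field_aut sg ==> sg (- x) = - sg x"
 using aut_add[of sg x "- x"] aut_0[of sg] by (simp add: eq_neg_iff_add_eq_0 add.commute)

lemma aut_diff: "field_aut sg ==> sg (x - y) = sg x - sg y"
 using aut_add[of sg x "- y"] aut_minus[of sg y] by simp

lemma aut_power: "field_aut sg ==> sg (x ^ n) = sg x ^ n"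
 by (induction n) (auto simp: aut_1 aut_mult)

lemma aut_inverse: "field_aut sg ==> sg (inverse x) = inverse (sg x)"
proof (cases "x = 0")
 case False
 assume s: "field_aut sg"
 have "sg x * sg (inverse x) = 1" using aut_mult[OF s, of x "inverse x"] aut_1[OF s] False by simp
 thus ?thesis by (metis inverse_unique)
qed (simp add: aut_0)

lemma aut_divide: "field_aut sg ==> sg (x / y) = sg x / sg y"
 by (simp add: divide_inverse aut_mult aut_inverse)

lemma aut_of_nat: "field_aut sg ==> sg (of_nat n) = of_nat n"
 by (induction n) (auto simp: aut_0 aut_1 aut_add)

lemma aut_numeral: "field_aut sg ==> sg (numeral n) = numeral n"
 using aut_of_nat[of sg "numeral n"] by simp

lemmas aut_simps = aut_add aut_mult aut_0 aut_1 aut_minus aut_diff aut_power aut_inverse aut_divide aut_numeral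

lemma aut_prod: "field_aut sg ==> sg (prod f I) = (\<Prod>i\<in>I. sg (f i))"
 by (induction I rule: infinite_finite_induct) (auto simp: aut_simps)

lemma aut_comp: "field_aut sg ==> field_aut \<tau> ==> field_aut (sg \<circ> \<tau>)"
 by (auto simp: field_aut_def intro: bij_comp)

lemma aut_inv: assumes "field_aut sg" shows "field_aut (inv_into UNIV sg)"
proof -
 let ?i = "inv_into UNIV sg"
 have b: "bij sg" using assms by (simp add: field_aut_def)
 have *: "?i y = x \<longleftrightarrow> y = sg x" for x y using b by (metis bij_inv_eq_iff)
 have s: "sg (?i x) = x" for x using b by (metis bij_inv_eq_iff)
 show ?thesis unfolding field_aut_def
  using b by (auto simp: * s aut_add[OF assms] aut_mult[OF assms] bij_imp_bij_inv)
qed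

lemma aut_id: "field_aut id"
 by (simp add: field_aut_def)

lemma aut_funpow: "field_aut sg ==> field_aut (sg ^^ n)"
 by (induction n) (auto simp: aut_id[unfolded id_def] id_def intro: aut_comp aut_id)

lemma aut_rat:
 fixes sg :: "qbar => qbar" assumes "field_aut sg" shows "sg (to_ac q) = to_ac q"
proof -
 have i: "sg (of_int n) = of_int n" for n
 proof (cases n rule: int_cases2)
  case (nonneg k) thus ?thesis using aut_of_nat[OF assms] by simp
 next
  case (nonpos k) thus ?thesis using aut_of_nat[OF assms] aut_minus[OF assms] by simp
 qed
 obtain a b where "q = of_int a / of_int b" by (metis Rat_cases Fract_of_int_quotient)
 thus ?thesis using i aut_divide[OF assms] by simp
qed

definition rat_graph :: "(qbar \<times> qbar) set" where
 "rat_graph = range (\<lambda>q. (to_ac q, to_ac q))"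

lemma rat_graph_piso: "piso_field rat_graph"
 unfolding piso_field_def piso_def rat_graph_def
 by (auto simp: image_iff simp flip: to_ac_diff to_ac_mult to_ac_inverse)

lemma rat_graph_least: assumes "piso_field G" shows "rat_graph \<subseteq> G"
proof
 fix z assume "z \<in> rat_graph"
 then obtain q where z: "z = (to_ac q, to_ac q)" by (auto simp: rat_graph_def)
 have pG: "piso G" using assms by (simp add: piso_field_def)
 have n: "(of_nat k, of_nat k) \<in> G" for k by (induction k) (auto intro: piso_0 piso_1 piso_add pG)
 have i: "(of_int k, of_int k) \<in> G" for k
 proof (cases k rule: int_cases2)
  case (nonpos j) thus ?thesis using piso_diff[OF pG piso_0[OF pG] n[of j]] by simp
 qed (use n in simp)
 obtain a b where "q = of_int a / of_int b" by (metis Rat_cases Fract_of_int_quotient)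
 thus "z \<in> G" unfolding z using piso_mult[OF pG i[of a], of "inverse (of_int b)" "inverse (of_int b)"] i[of b] assms
  by (auto simp: divide_inverse piso_field_def)
qed

lemma ppair_rat: "piso_field (G :: (qbar \<times> qbar) set) ==> ppair G (map_poly to_ac p) (map_poly to_ac p)"
 using rat_graph_least[of G] by (auto simp: ppair_def coeff_map_poly rat_graph_def)

text \<open>A maximal partial isomorphism is closed under fractions, and it is total because every
  element is algebraic. It is onto because it maps the finite root set of each rational polynomial
  injectively to itself.\<close>

lemma piso_extend_aut:
 fixes G :: "(qbar \<times> qbar) set"
 assumes "piso G"
 shows "\<exists>sg. field_aut sg \<and> (\<forall>(x, y)\<in>G. sg x = y)"
proof -
 define A where "A = {H. piso H \<and> G \<subseteq> H}"
 have "\<exists>M\<in>A. \<forall>H\<in>A. M \<subseteq> H \<longrightarrow> H = M"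
 proof (rule subset_Zorn_nonempty)
  show "A ~= {}" using assms by (auto simp: A_def)
  fix \<C> assume c: "\<C> ~= {}" "subset.chain A \<C>"
  have each: "piso H \<and> G \<subseteq> H" if "H \<in> \<C>" for H using that c(2) unfolding A_def subset_chain_def by blast
  have two: "\<exists>H\<in>\<C>. z \<in> H \<and> z' \<in> H" if "z \<in> \<Union>\<C>" "z' \<in> \<Union>\<C>" for z z'
  proof -
   from that obtain H H' where H: "H \<in> \<C>" "z \<in> H" "H' \<in> \<C>" "z' \<in> H'" by blast
   hence "H \<subseteq> H' \<or> H' \<subseteq> H" using c(2) unfolding subset_chain_def by blast
   thus ?thesis using H by blast
  qed
  have "piso (\<Union>\<C>)"
   unfolding piso_def
  proof (intro conjI allI impI)
   obtain H where "H \<in> \<C>" using c(1) by blast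
   thus "(1, 1) \<in> \<Union>\<C>" using each piso_1[of H] by blast
   fix x y x' y' assume "(x, y) \<in> \<Union>\<C>" "(x', y') \<in> \<Union>\<C>"
   then obtain H where H: "H \<in> \<C>" "(x, y) \<in> H" "(x', y') \<in> H" using two by blast
   show "(x - x', y - y') \<in> \<Union>\<C>" "(x * x', y * y') \<in> \<Union>\<C>"
    using H each piso_diff[of H] piso_mult[of H] by blast+
  next
   fix x y assume "(x, y) \<in> \<Union>\<C>"
   thus "x = 0 \<longleftrightarrow> y = 0" using each piso_zero by blast
  qed
  thus "\<Union>\<C> \<in> A" using c each by (auto simp: A_def)
 qed
 then obtain M where M: "piso M" "G \<subseteq> M" and max: "\<And>H. piso H ==> M \<subseteq> H ==> H = M" by (auto simp: A_def)
 have MF: "piso_field M"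
 proof -
  define H where "H = {(x / u, y / v) | x y u v. (x, y) \<in> M \<and> (u, v) \<in> M \<and> u ~= 0}"
  have HI: "(x / u, y / v) \<in> H" if "(x, y) \<in> M" "(u, v) \<in> M" "u ~= 0" for x y u v using that by (auto simp: H_def)
  have "piso H" unfolding piso_def
  proof (intro conjI allI impI)
   show "(1, 1) \<in> H" using HI[OF piso_1[OF M(1)] piso_1[OF M(1)]] by simp
   fix x y x' y' assume "(x, y) \<in> H" "(x', y') \<in> H"
   then obtain p q u v p' q' u' v' where *: "x = p / u" "y = q / v" "(p, q) \<in> M" "(u, v) \<in> M" "u ~= 0"
    "x' = p' / u'" "y' = q' / v'" "(p', q') \<in> M" "(u', v') \<in> M" "u' ~= 0" unfolding H_def by blast
   have v: "v ~= 0" "v' ~= 0" using * piso_zero[OF M(1)] by blast+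
   have "((p * u' - p' * u) / (u * u'), (q * v' - q' * v) / (v * v')) \<in> H"
    by (intro HI piso_diff[OF M(1)] piso_mult[OF M(1)]) (use * in auto)
   thus "(x - x', y - y') \<in> H" using * v by (simp add: diff_frac_eq)
   have "((p * p') / (u * u'), (q * q') / (v * v')) \<in> H"
    by (intro HI piso_mult[OF M(1)]) (use * in auto)
   thus "(x * x', y * y') \<in> H" using * by simp
  next
   fix x y assume "(x, y) \<in> H"
   then obtain p q u v where *: "x = p / u" "y = q / v" "(p, q) \<in> M" "(u, v) \<in> M" "u ~= 0" unfolding H_def by blast
   thus "x = 0 \<longleftrightarrow> y = 0" using piso_zero[OF M(1) *(3)] piso_zero[OF M(1) *(4)] by auto
  qed
  moreover have "M \<subseteq> H"
  proof (rule subrelI)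
   fix x y assume "(x, y) \<in> M"
   from HI[OF this piso_1[OF M(1)]] show "(x, y) \<in> H" by simp
  qed
  ultimately have HM: "H = M" by (rule max)
  have "(inverse x, inverse y) \<in> M" if "(x, y) \<in> M" for x y
  proof (cases "x = 0")
   case True thus ?thesis using that piso_zero[OF M(1) that] by simp
  next
   case False
   from HI[OF piso_1[OF M(1)] that False] show ?thesis unfolding HM by (simp add: divide_inverse)
  qed
  thus ?thesis using M by (simp add: piso_field_def)
 qed
 have total: "\<exists>y. (x, y) \<in> M" for x
 proof -
  obtain p :: "rat poly" where p: "p ~= 0" "poly (map_poly to_ac p) x = 0" using alg_closure_algebraic by blast
  have "map_poly to_ac p ~= 0" using p(1) by (simp add: map_poly_eq_0_iff)
  then obtain m m' where m: "min_pair M x m m'" using min_pair_exists[OF ppair_rat[OF MF] _ p(2)] by blast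
  have m1: "ppair M m m'" "m ~= 0" "poly m x = 0" using m by (auto simp: min_pair_def)
  have "degree m > 0"
  proof (rule ccontr)
   assume "\<not> degree m > 0"
   then obtain c where "m = [:c:]" using degree_eq_zeroE by auto
   thus False using m1 by auto
  qed
  hence "degree m' > 0" using ppair_degree[OF M(1) m1(1)] by simp
  then obtain y where "poly m' y = 0" using alg_closed_imp_poly_has_root by blast
  from piso_adjoin[OF MF m this] max have "(x, y) \<in> M" by metis
  thus ?thesis by blast
 qed
 define sg where "sg x = (THE y. (x, y) \<in> M)" for x
 have sg: "sg x = y \<longleftrightarrow> (x, y) \<in> M" for x y
 proof -
  obtain z where z: "(x, z) \<in> M" using total by blast
  have "sg x = z" unfolding sg_def by (rule the_equality) (use z piso_unique[OF M(1)] in blast)+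
  thus ?thesis using z piso_unique[OF M(1)] by blast
 qed
 have add: "sg (x + y) = sg x + sg y" and mult: "sg (x * y) = sg x * sg y" for x y
  unfolding sg by (intro piso_add[OF M(1)] piso_mult[OF M(1)]; simp flip: sg)+
 have one: "sg 1 = 1" and zero: "sg 0 = 0" unfolding sg using piso_1[OF M(1)] piso_0[OF M(1)] by auto
 have inj: "inj sg" by (rule injI) (metis sg piso_unique'[OF M(1)])
 have surj: "\<exists>x. sg x = z" for z
 proof -
  obtain p :: "rat poly" where p: "p ~= 0" "poly (map_poly to_ac p) z = 0" using alg_closure_algebraic by blast
  let ?p = "map_poly to_ac p" and ?R = "{x. poly (map_poly to_ac p) x = 0}"
  have nz: "?p ~= 0" using p(1) by (simp add: map_poly_eq_0_iff)
  have rat: "sg (to_ac q) = to_ac q" for q unfolding sg using rat_graph_least[OF MF] by (auto simp: rat_graph_def)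
  have pow: "sg (x ^ n) = sg x ^ n" for x n by (induction n) (auto simp: one mult)
  have sum: "sg (sum f I) = (\<Sum>i\<in>I. sg (f i))" for f and I :: "nat set"
   by (induction I rule: infinite_finite_induct) (auto simp: zero add)
  have "sg (poly ?p x) = poly ?p (sg x)" for x
   unfolding poly_altdef sum by (simp add: mult pow rat coeff_map_poly)
  hence "sg ` ?R \<subseteq> ?R" using zero by auto (metis)
  moreover have "finite ?R" by (rule poly_roots_finite[OF nz])
  ultimately have "sg ` ?R = ?R" using inj by (meson endo_inj_surj inj_on_subset subset_UNIV)
  thus ?thesis using p(2) by (metis (mono_tags, lifting) imageE mem_Collect_eq)
 qed
 have "bij sg" using inj surj by (metis bijI surjI surj_def)
 hence "field_aut sg" using add mult by (auto simp: field_aut_def)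
 moreover have "\<forall>(x, y)\<in>G. sg x = y" using sg M(2) by auto
 ultimately show ?thesis by blast
qed

section \<open>Conjugates and the fixed field of all automorphisms\<close>

definition min_rat_poly :: "qbar => rat poly => bool" where
 "min_rat_poly x m \<longleftrightarrow> m ~= 0 \<and> poly (map_poly to_ac m) x = 0 \<and>
  (\<forall>q. q ~= 0 \<longrightarrow> poly (map_poly to_ac q) x = 0 \<longrightarrow> degree m \<le> degree q)"

lemma min_rat_poly_exists: "\<exists>m. min_rat_poly x m"
proof -
 obtain p :: "rat poly" where p: "p ~= 0" "poly (map_poly to_ac p) x = 0" using alg_closure_algebraic by blast
 define S where "S n \<longleftrightarrow> (\<exists>q :: rat poly. q ~= 0 \<and> poly (map_poly to_ac q) x = 0 \<and> degree q = n)" for n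
 have "S (degree p)" using p unfolding S_def by blast
 hence "S (LEAST n. S n)" by (rule LeastI)
 then obtain m :: "rat poly" where m: "m ~= 0" "poly (map_poly to_ac m) x = 0" "degree m = (LEAST n. S n)" unfolding S_def by blast
 have "degree m \<le> degree q" if "q ~= 0" "poly (map_poly to_ac q) x = 0" for q :: "rat poly"
  unfolding m(3) by (rule Least_le) (use that in \<open>auto simp: S_def\<close>)
 thus ?thesis using m unfolding min_rat_poly_def by blast
qed

lemma map_poly_to_ac_simps:
 "map_poly to_ac (p + q) = map_poly to_ac p + map_poly to_ac q"
 "map_poly to_ac (p * q) = map_poly to_ac p * map_poly to_ac q"
 "degree (map_poly to_ac p) = degree p"
 "map_poly to_ac (pderiv p) = pderiv (map_poly to_ac p)"
 for p q :: "'a::field poly"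
proof -
 show "map_poly to_ac (p + q) = map_poly to_ac p + map_poly to_ac q"
  by (rule poly_eqI) (simp add: coeff_map_poly)
 show "map_poly to_ac (p * q) = map_poly to_ac p * map_poly to_ac q"
  by (rule poly_eqI) (simp add: coeff_map_poly coeff_mult to_ac_sum)
 show "degree (map_poly to_ac p) = degree p" by (rule degree_map_poly) simp
 show "map_poly to_ac (pderiv p) = pderiv (map_poly to_ac p)"
  by (rule poly_eqI) (simp add: coeff_map_poly coeff_pderiv)
qed

lemma aut_to_conjugate:
 assumes m: "min_rat_poly x m" and y: "poly (map_poly to_ac m) y = 0"
 shows "\<exists>sg. field_aut sg \<and> sg x = y"
proof -
 have pr: "\<exists>p. q = map_poly to_ac p \<and> q' = map_poly to_ac p" if "ppair rat_graph q q'" for q q'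
 proof -
  have *: "\<exists>r. Polynomial.coeff q i = to_ac r \<and> Polynomial.coeff q' i = to_ac r" for i
   using that by (auto simp: ppair_def rat_graph_def)
  have "q = map_poly to_ac (map_poly of_ac q)" "q' = map_poly to_ac (map_poly of_ac q)"
   by (rule poly_eqI, simp add: coeff_map_poly, metis * of_ac_to_ac)+
  thus ?thesis by blast
 qed
 have "min_pair rat_graph x (map_poly to_ac m) (map_poly to_ac m)"
  unfolding min_pair_def
 proof (intro conjI allI impI)
  show "ppair rat_graph (map_poly to_ac m) (map_poly to_ac m)" by (rule ppair_rat[OF rat_graph_piso])
  show "map_poly to_ac m ~= 0" "poly (map_poly to_ac m) x = 0" using m by (auto simp: min_rat_poly_def map_poly_eq_0_iff)
  fix q q' assume q: "ppair rat_graph q q'" "q ~= 0" "poly q x = 0"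
  then obtain p where "q = map_poly to_ac p" using pr by blast
  moreover from this have "p ~= 0" using q by auto
  ultimately show "degree (map_poly to_ac m) \<le> degree q" using m q by (auto simp: min_rat_poly_def map_poly_to_ac_simps)
 qed
 note pa = piso_adjoin[OF rat_graph_piso this y]
 obtain sg where "field_aut sg" "\<forall>(u, v)\<in>adjoin_pair rat_graph x y. sg u = v"
  using piso_extend_aut[OF pa(1)] by blast
 with pa show ?thesis by fastforce
qed

text \<open>All roots of the minimal polynomial are conjugates of x, hence equal to x. In degree
  above 1 this would make x a double root, and the derivative would be a smaller annihilating
  polynomial.\<close>

lemma fixed_imp_rational:
 fixes x :: qbar
 assumes "\<And>sg. field_aut sg ==> sg x = x"
 shows "\<exists>q. x = to_ac q"
proof -
 obtain m where m: "min_rat_poly x m" using min_rat_poly_exists by blast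
 let ?m = "map_poly to_ac m"
 have m1: "m ~= 0" "poly ?m x = 0" using m by (auto simp: min_rat_poly_def)
 obtain q where q: "?m = [:-x, 1:] * q" using m1(2) by (auto simp: poly_eq_0_iff_dvd elim!: dvdE)
 have "q ~= 0" using q m1 by (auto simp: map_poly_eq_0_iff)
 have "degree ([:-x, 1:] * q) = Suc (degree q)" using \<open>q ~= 0\<close> by (subst degree_mult_eq) auto
 hence dm: "degree m = Suc (degree q)" unfolding q[symmetric] by (simp only: map_poly_to_ac_simps)
 have "degree q = 0"
 proof (rule ccontr)
  assume "degree q ~= 0"
  then obtain y where y: "poly q y = 0" using alg_closed_imp_poly_has_root by blast
  have "poly ?m y = 0" using q y by simp
  then obtain sg where "field_aut sg" "sg x = y" using aut_to_conjugate[OF m] by blast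
  hence "y = x" using assms by auto
  have "poly (map_poly to_ac (pderiv m)) x = 0"
   unfolding map_poly_to_ac_simps q pderiv_mult using y \<open>y = x\<close> by simp
  moreover have "pderiv m ~= 0" using dm by (simp add: pderiv_eq_0_iff)
  ultimately have "degree m \<le> degree (pderiv m)" using m unfolding min_rat_poly_def by blast
  thus False using dm by (simp add: degree_pderiv)
 qed
 hence "degree m = 1" using dm by simp
 define a b where "a = Polynomial.coeff m 1" and "b = Polynomial.coeff m 0"
 have ab: "m = [:b, a:]"
  by (rule poly_eqI) (use \<open>degree m = 1\<close> in \<open>auto simp: a_def b_def coeff_pCons coeff_eq_0 split: nat.split\<close>)
 have a0: "a ~= 0" unfolding a_def using \<open>degree m = 1\<close> m1(1) by (metis leading_coeff_0_iff)
 have "to_ac b + x * to_ac a = 0" using m1(2) unfolding ab by (simp add: map_poly_pCons)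
 hence "x = to_ac (- b / a)" using a0 by (simp add: field_simps eq_neg_iff_add_eq_0)
 thus ?thesis by blast
qed

section \<open>Roots of unity of prime power order\<close>

lemma primitive_root_power_eq_1:
 fixes \<zeta> :: "'a::field"
 assumes "primitive_root_of_unity n \<zeta>"
 shows "\<zeta> ^ i = 1 \<longleftrightarrow> n dvd i"
proof
 have n: "n > 0" "\<zeta> ^ n = 1" and pr: "\<And>k. 0 < k ==> k < n ==> \<zeta> ^ k ~= 1"
  using assms by (auto simp: primitive_root_of_unity_def)
 assume i: "\<zeta> ^ i = 1"
 have "\<zeta> ^ i = \<zeta> ^ (n * (i div n) + i mod n)" by simp
 also have "\<dots> = \<zeta> ^ (i mod n)" by (simp only: power_add power_mult n power_one mult_1)
 finally have "\<zeta> ^ (i mod n) = 1" using i by simp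
 hence "i mod n = 0" using pr[of "i mod n"] n by (cases "i mod n = 0") auto
 thus "n dvd i" by auto
next
 assume "n dvd i"
 thus "\<zeta> ^ i = 1" using assms by (auto simp: primitive_root_of_unity_def power_mult elim!: dvdE)
qed

lemma primitive_root_power_eq:
 fixes \<zeta> :: "'a::field"
 assumes "primitive_root_of_unity n \<zeta>"
 shows "\<zeta> ^ i = \<zeta> ^ j \<longleftrightarrow> i mod n = j mod n"
proof -
 have z: "\<zeta> ~= 0" using assms by (auto simp: primitive_root_of_unity_def power_0_left)
 have "\<zeta> ^ i = \<zeta> ^ j \<longleftrightarrow> i mod n = j mod n" if "i \<le> j" for i j
 proof -
  have "\<zeta> ^ j = \<zeta> ^ i * \<zeta> ^ (j - i)" using that by (simp flip: power_add)
  hence "\<zeta> ^ i = \<zeta> ^ j \<longleftrightarrow> \<zeta> ^ (j - i) = 1" using z by auto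
  also have "\<dots> \<longleftrightarrow> n dvd j - i" by (rule primitive_root_power_eq_1[OF assms])
  also have "\<dots> \<longleftrightarrow> i mod n = j mod n" using that mod_eq_dvd_iff_nat[of i j n] by auto
  finally show ?thesis .
 qed
 thus ?thesis by (metis linear)
qed

lemma primitive_root_all:
 fixes \<zeta> z :: "'a::field"
 assumes "primitive_root_of_unity n \<zeta>" "z ^ n = 1"
 shows "\<exists>i<n. z = \<zeta> ^ i"
proof (rule ccontr)
 assume no: "\<not> ?thesis"
 have n: "n > 0" "\<zeta> ^ n = 1" using assms by (auto simp: primitive_root_of_unity_def)
 let ?p = "monom 1 n - [:1:] :: 'a poly"
 have "Polynomial.coeff ?p n ~= 0" using n by (cases n) auto
 hence nz: "?p ~= 0" by (rule poly_neq_0_if_coeff)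
 have "degree ?p \<le> n" by (rule degree_diff_le) (auto simp: degree_monom_le)
 have inj: "inj_on (\<lambda>i. \<zeta> ^ i) {..<n}" by (rule inj_onI) (simp add: primitive_root_power_eq[OF assms(1)])
 have "card (insert z ((\<lambda>i. \<zeta> ^ i) ` {..<n})) = Suc n"
  using no card_image[OF inj] by (subst card_insert_disjoint) auto
 moreover have "insert z ((\<lambda>i. \<zeta> ^ i) ` {..<n}) \<subseteq> {x. poly ?p x = 0}"
  using assms(2) n by (auto simp: poly_monom power_mult[symmetric] mult.commute[of _ n]) (simp add: power_mult)
 hence "card (insert z ((\<lambda>i. \<zeta> ^ i) ` {..<n})) \<le> card {x. poly ?p x = 0}"
  by (rule card_mono[OF poly_roots_finite[OF nz]])
 ultimately show False using card_poly_roots_bound[OF nz] \<open>degree ?p \<le> n\<close> by linarith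
qed

text \<open>The ring Z[z].\<close>

definition int_adjoin :: "'a::field_char_0 => 'a set" where
 "int_adjoin z = range (\<lambda>f :: int poly. poly (map_poly of_int f) z)"

lemma map_poly_of_int_hom:
 "map_poly of_int (f * g) = map_poly of_int f * (map_poly of_int g :: 'a::field_char_0 poly)"
 "map_poly of_int (f + g) = map_poly of_int f + (map_poly of_int g :: 'a::field_char_0 poly)"
 "map_poly of_int (- f) = - (map_poly of_int f :: 'a::field_char_0 poly)"
 by (rule poly_eqI, simp add: coeff_map_poly coeff_mult)+

lemma int_adjoin_mult: "x \<in> int_adjoin z ==> y \<in> int_adjoin z ==> x * y \<in> int_adjoin z"
 unfolding int_adjoin_def by (auto simp: image_iff) (metis map_poly_of_int_hom(1) poly_mult)

lemma int_adjoin_power_base: "z ^ k \<in> int_adjoin z"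
 unfolding int_adjoin_def by (rule range_eqI[of _ _ "monom 1 k"]) (simp add: map_poly_monom poly_monom)

lemma int_adjoin_1: "1 \<in> int_adjoin z"
 using int_adjoin_power_base[of z 0] by simp

lemma int_adjoin_add: "x \<in> int_adjoin z ==> y \<in> int_adjoin z ==> x + y \<in> int_adjoin z"
 unfolding int_adjoin_def by (auto simp: image_iff) (metis map_poly_of_int_hom(2) poly_add)

lemma int_adjoin_uminus: "x \<in> int_adjoin z ==> - x \<in> int_adjoin z"
 unfolding int_adjoin_def by (auto simp: image_iff) (metis map_poly_of_int_hom(3) poly_minus)

lemma int_adjoin_0: "0 \<in> int_adjoin z"
 unfolding int_adjoin_def by (rule range_eqI[of _ _ 0]) simp

lemma int_adjoin_sum: "(\<And>i. i \<in> I ==> f i \<in> int_adjoin z) ==> sum f I \<in> int_adjoin z"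
 by (induction I rule: infinite_finite_induct) (auto intro: int_adjoin_add int_adjoin_0)

lemma int_adjoin_pow: "x \<in> int_adjoin z ==> x ^ k \<in> int_adjoin z"
 by (induction k) (auto intro: int_adjoin_mult int_adjoin_1)

lemma rat_in_Ints_if_bounded_denominator:
 fixes r :: rat and D :: int
 assumes "D ~= 0" "\<And>e. of_int D * r ^ e \<in> \<int>"
 shows "r \<in> \<int>"
proof -
 obtain a b where ab: "quotient_of r = (a, b)" by (cases "quotient_of r")
 have b: "b > 0" "coprime a b" "r = of_int a / of_int b"
  using ab quotient_of_denom_pos quotient_of_coprime quotient_of_div by auto
 have "b ^ e dvd D" for e
 proof -
  obtain c :: int where "of_int D * r ^ e = of_int c" using assms(2)[of e] by (auto elim: Ints_cases)
  hence "of_int (D * a ^ e) = (of_int (c * b ^ e) :: rat)" using b by (simp add: power_divide field_simps)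
  hence "D * a ^ e = c * b ^ e" by (simp only: of_int_eq_iff)
  hence "b ^ e dvd D * a ^ e" by simp
  moreover have "coprime (b ^ e) (a ^ e)" using b(2) by (simp add: coprime_commute)
  ultimately show ?thesis by (simp add: coprime_dvd_mult_left_iff)
 qed
 hence le: "b ^ e \<le> \<bar>D\<bar>" for e using assms(1) zdvd_imp_le[of "b ^ e" "\<bar>D\<bar>"] by auto
 have "b = 1"
 proof (rule ccontr)
  assume "b ~= 1"
  hence "2 \<le> b" using b(1) by simp
  hence "2 ^ nat \<bar>D\<bar> \<le> b ^ nat \<bar>D\<bar>" by (intro power_mono) auto
  also have "\<dots> \<le> \<bar>D\<bar>" by (rule le)
  finally have "(2::int) ^ nat \<bar>D\<bar> \<le> int (nat \<bar>D\<bar>)" by simp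
  moreover have "int (nat \<bar>D\<bar>) < 2 ^ nat \<bar>D\<bar>" using less_exp[of "nat \<bar>D\<bar>"] by (metis of_nat_less_iff of_nat_numeral of_nat_power)
  ultimately show False by simp
 qed
 thus ?thesis using b by simp
qed

text \<open>Modulo the minimal polynomial the powers of \<zeta> repeat with period n, so one
  denominator D clears the constant coefficients of all of them. Applied to every power of r, this
  leaves no room for a denominator of r.\<close>

lemma to_ac_in_int_adjoin:
 fixes \<zeta> :: qbar
 assumes z: "primitive_root_of_unity n \<zeta>" and r: "to_ac r \<in> int_adjoin \<zeta>"
 shows "r \<in> \<int>"
proof -
 have n: "n > 0" using z by (simp add: primitive_root_of_unity_def)
 obtain m where m: "min_rat_poly \<zeta> m" using min_rat_poly_exists by blast
 have m0: "m ~= 0" "poly (map_poly to_ac m) \<zeta> = 0" using m by (auto simp: min_rat_poly_def)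
 define \<rho> where "\<rho> i = Polynomial.coeff (monom 1 i mod m) 0" for i :: nat
 have ev: "poly (map_poly to_ac (q mod m)) \<zeta> = poly (map_poly to_ac q) \<zeta>" for q
 proof -
  have "q = q div m * m + q mod m" by simp
  hence "poly (map_poly to_ac q) \<zeta> = poly (map_poly to_ac (q div m * m + q mod m)) \<zeta>" by simp
  thus ?thesis using m0 by (simp only: map_poly_to_ac_simps poly_add poly_mult) simp
 qed
 have mod0: "q mod m = 0" if "poly (map_poly to_ac q) \<zeta> = 0" for q
 proof (rule ccontr)
  assume "q mod m ~= 0"
  moreover from this have "degree (q mod m) < degree m" using degree_mod_less[OF m0(1), of q] by simp
  ultimately show False using m ev[of q] that unfolding min_rat_poly_def by (metis not_le)
 qed
 have mon: "poly (map_poly to_ac (monom 1 i)) \<zeta> = \<zeta> ^ i" for i by (simp add: map_poly_monom poly_monom)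
 have per: "\<rho> i = \<rho> (i mod n)" for i
 proof -
  have "poly (map_poly to_ac (monom 1 i - monom 1 (i mod n))) \<zeta> = \<zeta> ^ i - \<zeta> ^ (i mod n)"
  proof -
   have "map_poly to_ac (monom (1::rat) i - monom 1 (i mod n)) = map_poly to_ac (monom 1 i) - map_poly to_ac (monom 1 (i mod n))"
    by (rule poly_eqI) (simp add: coeff_map_poly)
   thus ?thesis by (simp add: mon)
  qed
  also have "\<dots> = 0" using primitive_root_power_eq[OF z] by simp
  finally have "(monom 1 i - monom 1 (i mod n)) mod m = 0" by (rule mod0)
  hence "monom 1 i mod m = monom 1 (i mod n) mod m" by (simp add: poly_mod_diff_left)
  thus ?thesis by (simp add: \<rho>_def)
 qed
 define D where "D = (\<Prod>i<n. snd (quotient_of (\<rho> i)))"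
 have D0: "D ~= 0" unfolding D_def by (subst prod_zero_iff) (use quotient_of_denom_pos' in \<open>auto simp: order_less_imp_not_eq2\<close>)
 have DZ: "of_int D * \<rho> i \<in> \<int>" for i
 proof -
  let ?j = "i mod n"
  have "?j \<in> {..<n}" using n by simp
  hence "snd (quotient_of (\<rho> ?j)) dvd D" unfolding D_def by (intro dvd_prodI) auto
  then obtain c where c: "D = snd (quotient_of (\<rho> ?j)) * c" by blast
  have "\<rho> ?j = of_int (fst (quotient_of (\<rho> ?j))) / of_int (snd (quotient_of (\<rho> ?j)))"
   by (rule quotient_of_div) simp
  moreover have "snd (quotient_of (\<rho> ?j)) ~= 0" using quotient_of_denom_pos'[of "\<rho> ?j"] by simp
  ultimately have "of_int D * \<rho> ?j = of_int (c * fst (quotient_of (\<rho> ?j)))" unfolding c by (simp add: field_simps)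
  thus ?thesis unfolding per[of i] by (metis Ints_of_int)
 qed
 have lin: "of_int D * Polynomial.coeff ((\<Sum>i\<in>I. smult (of_int (c i)) (monom 1 i)) mod m) 0 \<in> \<int>" for I :: "nat set" and c
 proof (induction I rule: infinite_finite_induct)
  case (insert x F)
  have "of_int D * Polynomial.coeff ((\<Sum>i\<in>insert x F. smult (of_int (c i)) (monom 1 i)) mod m) 0
   = of_int (c x) * (of_int D * \<rho> x) + of_int D * Polynomial.coeff ((\<Sum>i\<in>F. smult (of_int (c i)) (monom 1 i)) mod m) 0"
   unfolding sum.insert[OF insert(1,2)] poly_mod_add_left mod_smult_left \<rho>_def coeff_add coeff_smult
   by (simp only: distrib_left mult.left_commute)
  moreover have "of_int (c x) * (of_int D * \<rho> x) \<in> \<int>" by (intro Ints_mult Ints_of_int DZ)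
  ultimately show ?case using Ints_add[OF _ insert(3)] by simp
 qed auto
 have key: "of_int D * q \<in> \<int>" if q: "to_ac q \<in> int_adjoin \<zeta>" for q
 proof -
  obtain f :: "int poly" where f: "to_ac q = poly (map_poly of_int f) \<zeta>" using q by (auto simp: int_adjoin_def)
  define F where "F = (\<Sum>i\<le>degree f. smult (of_int (Polynomial.coeff f i)) (monom 1 i) :: rat poly)"
  have co: "Polynomial.coeff F i = of_int (Polynomial.coeff f i)" for i
   unfolding F_def by (simp add: coeff_sum if_distrib cong: if_cong) (auto simp: coeff_eq_0)
  have "map_poly to_ac F = map_poly of_int f" by (rule poly_eqI) (simp add: coeff_map_poly co)
  hence "poly (map_poly to_ac (F - [:q:])) \<zeta> = 0"
  proof -
   have "map_poly to_ac (F - [:q:]) = map_poly to_ac F - [:to_ac q:]"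
    by (rule poly_eqI) (simp add: coeff_map_poly coeff_pCons split: nat.split)
   thus ?thesis using f \<open>map_poly to_ac F = map_poly of_int f\<close> by simp
  qed
  hence "(F - [:q:]) mod m = 0" by (rule mod0)
  hence "F mod m = [:q:] mod m" by (simp add: poly_mod_diff_left)
  moreover have "degree m > 0"
  proof (rule ccontr)
   assume "\<not> degree m > 0"
   then obtain c where "m = [:c:]" using degree_eq_zeroE by auto
   thus False using m0 by (auto simp: map_poly_pCons)
  qed
  hence "[:q:] mod m = [:q:]" by (intro mod_poly_less) simp
  ultimately have "Polynomial.coeff (F mod m) 0 = q" by simp
  thus ?thesis using lin[of "\<lambda>i. Polynomial.coeff f i" "{..degree f}"] unfolding F_def by simp
 qed
 show ?thesis
 proof (rule rat_in_Ints_if_bounded_denominator[OF D0])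
  fix e have "to_ac (r ^ e) \<in> int_adjoin \<zeta>" using int_adjoin_pow[OF r, of e] by simp
  thus "of_int D * r ^ e \<in> \<int>" by (rule key)
 qed
qed

lemma one_minus_power_dvd: "\<exists>y\<in>int_adjoin z. 1 - z ^ (i * j) = (1 - z ^ i) * y"
proof (intro bexI)
 show "1 - z ^ (i * j) = (1 - z ^ i) * (\<Sum>k<j. (z ^ i) ^ k)"
  by (simp add: one_diff_power_eq power_mult)
 show "(\<Sum>k<j. (z ^ i) ^ k) \<in> int_adjoin z"
  by (intro int_adjoin_sum int_adjoin_pow int_adjoin_power_base)
qed

text \<open>With q = p^(k-1), the sum of x^(q i) for i < p is monic and has exactly the \<zeta>^j
  with j prime to p as roots; both sides are its value at 1.\<close>

lemma prime_power_cyclotomic_norm: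
 fixes \<zeta> :: "'a::field_char_0"
 assumes p: "Factorial_Ring.prime (p::nat)" and k: "k \<ge> 1" and z: "primitive_root_of_unity (p ^ k) \<zeta>"
 shows "(\<Prod>j\<in>totatives (p ^ k). 1 - \<zeta> ^ j) = of_nat p"
proof -
 let ?n = "p ^ k" and ?q = "p ^ (k - 1)" and ?U = "totatives (p ^ k)"
 have nq: "?n = ?q * p" using k by (cases k) auto
 have p1: "p > 1" using p by (rule prime_gt_1_nat)
 have card: "card ?U = ?q * (p - 1)"
  using totient_prime_power[OF p, of k] k by (simp add: totient_def)
 define \<Phi> where "\<Phi> = (\<Sum>i<p. monom 1 (?q * i) :: 'a poly)"
 define pU where "pU = (\<Prod>j\<in>?U. [:- (\<zeta> ^ j), 1:])"
 have inj: "inj_on (\<lambda>j. \<zeta> ^ j) ?U"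
 proof (rule inj_onI)
  fix i j assume "i \<in> ?U" "j \<in> ?U" "\<zeta> ^ i = \<zeta> ^ j"
  moreover from this have "i mod ?n = j mod ?n" by (simp add: primitive_root_power_eq[OF z])
  moreover have "i < ?n" if "i \<in> ?U" for i
  proof -
   have "?n > 1" using p1 k by (intro one_less_power) auto
   thus ?thesis using that totatives_less by blast
  qed
  ultimately show "i = j" by simp
 qed
 have dP: "degree pU = card ?U" "lead_coeff pU = 1"
 proof -
  show "degree pU = card ?U" unfolding pU_def by (subst degree_prod_eq_sum_degree) auto
  show "lead_coeff pU = 1" unfolding pU_def lead_coeff_prod by simp
 qed
 have cP: "Polynomial.coeff \<Phi> (card ?U) = 1"
 proof -
  have "Polynomial.coeff \<Phi> (card ?U) = (\<Sum>i<p. if i = p - 1 then 1 else 0)"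
   unfolding \<Phi>_def coeff_sum card by (rule sum.cong) (use p1 in auto)
  thus ?thesis using p1 by simp
 qed
 have "\<Phi> = pU"
 proof (rule poly_eqI_degree_lead_coeff[where A = "(\<lambda>j. \<zeta> ^ j) ` ?U" and n = "card ?U"])
  show "Polynomial.coeff \<Phi> (card ?U) = Polynomial.coeff pU (card ?U)" using dP cP by simp
  show "card ?U \<le> card ((\<lambda>j. \<zeta> ^ j) ` ?U)" using card_image[OF inj] by simp
  show "degree pU \<le> card ?U" using dP by simp
  show "degree \<Phi> \<le> card ?U" unfolding \<Phi>_def card
  proof (rule degree_sum_le)
   fix i assume "i \<in> {..<p}"
   hence "?q * i \<le> ?q * (p - 1)" by (intro mult_le_mono) auto
   thus "degree (monom 1 (?q * i) :: 'a poly) \<le> ?q * (p - 1)" using degree_monom_le order.trans by blast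
  qed simp
  fix x assume "x \<in> (\<lambda>j. \<zeta> ^ j) ` ?U"
  then obtain j where j: "j \<in> ?U" "x = \<zeta> ^ j" by blast
  have "poly pU x = 0" unfolding pU_def poly_prod using j by (intro prod_zero) auto
  moreover have "poly \<Phi> x = 0"
  proof -
   let ?w = "\<zeta> ^ (j * ?q)"
   have "poly \<Phi> x = (\<Sum>i<p. ?w ^ i)" unfolding \<Phi>_def j(2)
    by (simp add: poly_sum poly_monom power_mult[symmetric] mult.assoc)
   moreover have "?w ~= 1"
   proof
    assume "?w = 1"
    hence "?q * p dvd ?q * j" unfolding primitive_root_power_eq_1[OF z] nq by (simp add: mult.commute)
    hence "p dvd j" using p1 by simp
    moreover have "coprime j ?n" using j by (simp add: totatives_def)
    hence "coprime j p" using k by simp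
    ultimately show False using p1 by (metis coprime_common_divisor_nat dvd_refl less_irrefl)
   qed
   moreover have "?w ^ p = 1"
   proof -
    have "?w ^ p = \<zeta> ^ (j * ?n)" unfolding nq by (simp add: power_mult[symmetric] mult.assoc)
    thus ?thesis by (simp add: primitive_root_power_eq_1[OF z])
   qed
   ultimately show ?thesis using one_diff_power_eq[of ?w p] by simp
  qed
  ultimately show "poly \<Phi> x = poly pU x" by simp
 qed
 hence "poly \<Phi> 1 = poly pU 1" by simp
 thus ?thesis by (simp add: \<Phi>_def pU_def poly_sum poly_prod poly_monom)
qed

text \<open>With \<open>\<lambda> = 1 - \<zeta>\<close>, the prime \<open>p\<close> is associated to \<open>\<lambda> ^ \<phi>(p ^ k)\<close> and the rational number
 \<open>\<Prod>h\<in>H. 1 - \<zeta> ^ h\<close> to \<open>\<lambda> ^ card H\<close>, where \<open>H\<close> is the set of exponents of all conjugates of \<open>\<zeta>\<close>.\<close>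

lemma cyclotomic_aut:
 fixes \<zeta> :: qbar
 assumes p: "Factorial_Ring.prime (p::nat)" and k: "k \<ge> 1" and z: "primitive_root_of_unity (p ^ k) \<zeta>" and g: "coprime \<gamma> p"
 shows "\<exists>sg. field_aut sg \<and> sg \<zeta> = \<zeta> ^ \<gamma>"
proof -
 let ?n = "p ^ k" and ?U = "totatives (p ^ k)"
 have p1: "p > 1" using p by (rule prime_gt_1_nat)
 have n1: "?n > 1" using p1 k by (intro one_less_power) auto
 have Un: "j < ?n" if "j \<in> ?U" for j using that totatives_less n1 by blast
 have exp: "\<exists>j\<in>?U. sg \<zeta> = \<zeta> ^ j" if s: "field_aut sg" for sg
 proof -
  have "(sg \<zeta>) ^ ?n = 1" using z aut_power[OF s, of \<zeta> ?n] aut_1[OF s] by (simp add: primitive_root_of_unity_def)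
  then obtain j where j: "j < ?n" "sg \<zeta> = \<zeta> ^ j" using primitive_root_all[OF z] by blast
  have "coprime j ?n"
  proof (rule ccontr)
   assume "\<not> coprime j ?n"
   hence "p dvd j" using p k by (metis coprime_power_right_iff prime_imp_coprime_nat coprime_commute not_one_le_zero)
   then obtain c where c: "j = p * c" by blast
   have nq: "?n = p * p ^ (k - 1)" using k by (cases k) auto
   have "sg (\<zeta> ^ p ^ (k - 1)) = \<zeta> ^ (j * p ^ (k - 1))" using aut_power[OF s] j by (simp add: power_mult)
   also have "j * p ^ (k - 1) = ?n * c" unfolding c nq by simp
   also have "\<zeta> ^ (?n * c) = 1" by (simp add: primitive_root_power_eq_1[OF z])
   finally have "\<zeta> ^ p ^ (k - 1) = 1" using aut_inj[OF s] aut_1[OF s] by metis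
   hence "?n dvd p ^ (k - 1)" by (simp add: primitive_root_power_eq_1[OF z])
   hence "?n \<le> p ^ (k - 1)" using p1 by (intro dvd_imp_le) auto
   thus False using p1 k by (simp add: power_increasing_iff)
  qed
  moreover have "j > 0" using \<open>coprime j ?n\<close> n1 by (cases j) auto
  ultimately show ?thesis using j by (intro bexI[of _ j]) (auto simp: totatives_def)
 qed
 define H where "H = {j \<in> ?U. \<exists>sg. field_aut sg \<and> sg \<zeta> = \<zeta> ^ j}"
 have finH: "finite H" "H \<subseteq> ?U" by (auto simp: H_def)
 have modU: "i * j mod ?n \<in> ?U" if "i \<in> ?U" "j \<in> ?U" for i j
 proof -
  have "coprime (i * j mod ?n) ?n"
   using that p1 by (subst coprime_mod_left_iff) (auto simp: totatives_def simp del: coprime_power_right_iff)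
  moreover from this have "i * j mod ?n > 0" using n1 by (cases "i * j mod ?n = 0") auto
  ultimately show ?thesis using p1 by (auto simp: totatives_def intro: less_imp_le)
 qed
 have pm: "\<zeta> ^ (i mod ?n) = \<zeta> ^ i" for i by (simp add: primitive_root_power_eq[OF z])
 define N where "N = (\<Prod>j\<in>H. 1 - \<zeta> ^ j)"
 have "\<tau> N = N" if t: "field_aut \<tau>" for \<tau>
 proof -
  obtain i where i: "i \<in> ?U" "\<tau> \<zeta> = \<zeta> ^ i" using exp[OF t] by blast
  have ij: "\<tau> (\<zeta> ^ j) = \<zeta> ^ (i * j mod ?n)" for j using aut_power[OF t] i pm by (simp add: power_mult)
  have sub: "(\<lambda>j. i * j mod ?n) ` H \<subseteq> H"
  proof
   fix x assume "x \<in> (\<lambda>j. i * j mod ?n) ` H"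
   then obtain j sg where j: "j \<in> ?U" "field_aut sg" "sg \<zeta> = \<zeta> ^ j" "x = i * j mod ?n" unfolding H_def by blast
   have "field_aut (\<tau> \<circ> sg)" "(\<tau> \<circ> sg) \<zeta> = \<zeta> ^ x" using aut_comp[OF t j(2)] ij j by auto
   thus "x \<in> H" unfolding H_def using modU[OF i(1) j(1)] j(4) by blast
  qed
  have inj: "inj_on (\<lambda>j. i * j mod ?n) H"
  proof (rule inj_onI)
   fix x y assume xy: "x \<in> H" "y \<in> H" "i * x mod ?n = i * y mod ?n"
   hence "[i * x = i * y] (mod ?n)" by (simp add: cong_def)
   hence "[x = y] (mod ?n)" using i(1) by (subst (asm) cong_mult_lcancel_nat) (auto simp: totatives_def simp del: coprime_power_right_iff)
   thus "x = y" using xy finH Un by (auto simp: cong_def subset_iff)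
  qed
  have im: "(\<lambda>j. i * j mod ?n) ` H = H" using endo_inj_surj[OF finH(1) sub inj] .
  have "\<tau> N = (\<Prod>j\<in>H. 1 - \<zeta> ^ (i * j mod ?n))"
   unfolding N_def aut_prod[OF t] using aut_diff[OF t] aut_1[OF t] ij by simp
  also have "\<dots> = (\<Prod>j\<in>(\<lambda>j. i * j mod ?n) ` H. 1 - \<zeta> ^ j)" using prod.reindex[OF inj, of "\<lambda>j. 1 - \<zeta> ^ j"] by simp
  finally show ?thesis unfolding im N_def .
 qed
 then obtain r where r: "N = to_ac r" using fixed_imp_rational by blast
 let ?l = "1 - \<zeta>"
 have l0: "1 - \<zeta> ^ j ~= 0" if "j \<in> ?U" for j
 proof -
  have "\<not> ?n dvd j" using Un[OF that] that by (auto simp: totatives_def dest: dvd_imp_le)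
  thus ?thesis using primitive_root_power_eq_1[OF z, of j] by auto
 qed
 have a: "\<exists>y\<in>int_adjoin \<zeta>. 1 - \<zeta> ^ j = ?l * y" for j using one_minus_power_dvd[of \<zeta> 1 j] by simp
 have b: "\<exists>y\<in>int_adjoin \<zeta>. ?l = (1 - \<zeta> ^ j) * y" if j: "j \<in> ?U" for j
 proof -
  have "coprime j ?n" using j by (simp add: totatives_def)
  then obtain j' where "[j * j' = 1] (mod ?n)" by (auto simp: coprime_iff_invertible_nat simp del: coprime_power_right_iff)
  hence "\<zeta> ^ (j * j') = \<zeta> ^ 1" unfolding primitive_root_power_eq[OF z] by (simp add: cong_def)
  thus ?thesis using one_minus_power_dvd[of \<zeta> j j'] by simp
 qed
 have prodA: "\<exists>y\<in>int_adjoin \<zeta>. (\<Prod>j\<in>V. 1 - \<zeta> ^ j) = ?l ^ card V * y" if "finite V" for V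
  using that
 proof (induction V rule: finite_induct)
  case (insert x F)
  obtain y where y: "y \<in> int_adjoin \<zeta>" "(\<Prod>j\<in>F. 1 - \<zeta> ^ j) = ?l ^ card F * y" using insert by blast
  obtain w where w: "w \<in> int_adjoin \<zeta>" "1 - \<zeta> ^ x = ?l * w" using a by blast
  show ?case using insert y w by (intro bexI[of _ "w * y"] int_adjoin_mult) auto
 qed (use int_adjoin_1 in auto)
 have prodB: "\<exists>y\<in>int_adjoin \<zeta>. ?l ^ card V = (\<Prod>j\<in>V. 1 - \<zeta> ^ j) * y" if "finite V" "V \<subseteq> ?U" for V
  using that
 proof (induction V rule: finite_induct)
  case (insert x F)
  obtain y where y: "y \<in> int_adjoin \<zeta>" "?l ^ card F = (\<Prod>j\<in>F. 1 - \<zeta> ^ j) * y" using insert by blast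
  obtain w where w: "w \<in> int_adjoin \<zeta>" "?l = (1 - \<zeta> ^ x) * w" using b[of x] insert by blast
  have "?l ^ card (insert x F) = ?l * ?l ^ card F" using insert by simp
  also have "\<dots> = ((1 - \<zeta> ^ x) * w) * ((\<Prod>j\<in>F. 1 - \<zeta> ^ j) * y)" using w(2) y(2) by metis
  also have "\<dots> = (\<Prod>j\<in>insert x F. 1 - \<zeta> ^ j) * (w * y)" using insert by (simp add: mult_ac)
  finally show ?case using y w int_adjoin_mult by blast
 qed (use int_adjoin_1 in auto)
 let ?f = "card ?U" and ?h = "card H"
 obtain A where A: "A \<in> int_adjoin \<zeta>" "N = ?l ^ ?h * A" using prodA[OF finH(1)] unfolding N_def by blast
 obtain B where B: "B \<in> int_adjoin \<zeta>" "?l ^ ?h = N * B" using prodB[OF finH] unfolding N_def by blast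
 have pU': "(\<Prod>j\<in>?U. 1 - \<zeta> ^ j) = of_nat p" by (rule prime_power_cyclotomic_norm[OF p k z])
 obtain A' where A': "A' \<in> int_adjoin \<zeta>" "of_nat p = ?l ^ ?f * A'" using prodA[OF finite_totatives[of ?n]] unfolding pU' by (elim bexE) (rule that)
 obtain B' where B': "B' \<in> int_adjoin \<zeta>" "?l ^ ?f = of_nat p * B'" using prodB[OF finite_totatives[of ?n] subset_refl] unfolding pU' by (elim bexE) (rule that)
 have e1: "N ^ ?f = of_nat p ^ ?h * (B' ^ ?h * A ^ ?f)"
 proof -
  have "N ^ ?f = (?l ^ ?f) ^ ?h * A ^ ?f" unfolding A(2) by (simp add: power_mult_distrib power_mult[symmetric] mult.commute)
  thus ?thesis unfolding B'(2) by (simp add: power_mult_distrib)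
 qed
 have e2: "of_nat p ^ ?h = N ^ ?f * (B ^ ?f * A' ^ ?h)"
 proof -
  have "of_nat p ^ ?h = (?l ^ ?h) ^ ?f * A' ^ ?h" unfolding A'(2) by (simp add: power_mult_distrib power_mult[symmetric] mult.commute)
  thus ?thesis unfolding B(2) by (simp add: power_mult_distrib)
 qed
 have N0: "N ~= 0" unfolding N_def using finH l0 by auto
 have p0: "(of_nat p :: qbar) ~= 0" using p1 by simp
 \<comment> \<open>With f = \<open>?f\<close> and h = \<open>?h\<close>, N^f and p^h are both
   associated to (1 - \<zeta>)^(f h) in Z[\<zeta>]. Their quotient and its inverse are therefore
   rational elements of Z[\<zeta>], hence integers, hence \<plusminus>1.\<close>
 define \<epsilon> where "\<epsilon> = r ^ ?f / of_nat p ^ ?h"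
 have r0: "r ~= 0" using N0 r by auto
 have eps: "to_ac \<epsilon> = B' ^ ?h * A ^ ?f" "to_ac (1 / \<epsilon>) = B ^ ?f * A' ^ ?h"
 proof -
  have "to_ac \<epsilon> = N ^ ?f / of_nat p ^ ?h" by (simp add: \<epsilon>_def r)
  thus "to_ac \<epsilon> = B' ^ ?h * A ^ ?f" unfolding e1 using p0 by simp
  have "to_ac (1 / \<epsilon>) = of_nat p ^ ?h / N ^ ?f" by (simp add: \<epsilon>_def r)
  thus "to_ac (1 / \<epsilon>) = B ^ ?f * A' ^ ?h" unfolding e2 using N0 by simp
 qed
 have i1: "\<epsilon> \<in> \<int>" by (rule to_ac_in_int_adjoin[OF z]) (unfold eps, intro int_adjoin_mult int_adjoin_pow A B A' B')
 have i2: "1 / \<epsilon> \<in> \<int>" by (rule to_ac_in_int_adjoin[OF z]) (unfold eps, intro int_adjoin_mult int_adjoin_pow A B A' B')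
 have "1 + - (\<zeta> ^ 1) \<in> int_adjoin \<zeta>"
  by (intro int_adjoin_add int_adjoin_1 int_adjoin_uminus int_adjoin_power_base)
 hence l: "?l \<in> int_adjoin \<zeta>" by simp
 have ir: "r \<in> \<int>"
  by (rule to_ac_in_int_adjoin[OF z]) (unfold r[symmetric] A(2), intro int_adjoin_mult int_adjoin_pow A l)
 obtain e1' e2' :: int where e12: "\<epsilon> = of_int e1'" "1 / \<epsilon> = of_int e2'" using i1 i2 by (metis Ints_cases)
 have "\<epsilon> ~= 0" using r0 p1 by (simp add: \<epsilon>_def)
 hence "\<epsilon> * (1 / \<epsilon>) = 1" by simp
 moreover have "of_int (e1' * e2') = \<epsilon> * (1 / \<epsilon>)" by (simp only: of_int_mult e12(1)[symmetric] e12(2)[symmetric])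
 ultimately have "of_int (e1' * e2') = (1 :: rat)" by simp
 hence "e1' * e2' = 1" by (metis of_int_eq_1_iff)
 hence "\<bar>e1'\<bar> = 1" using abs_zmult_eq_1[of e1' e2'] by simp
 obtain s :: int where s: "r = of_int s" using ir by (metis Ints_cases)
 have "r ^ ?f = \<epsilon> * of_nat p ^ ?h" using p1 by (simp add: \<epsilon>_def)
 hence "of_int (s ^ ?f) = (of_int (e1' * int p ^ ?h) :: rat)" unfolding s e12 by simp
 hence "s ^ ?f = e1' * int p ^ ?h" by (simp only: of_int_eq_iff)
 hence "\<bar>s\<bar> ^ ?f = int p ^ ?h" using \<open>\<bar>e1'\<bar> = 1\<close> by (simp add: abs_mult power_abs[symmetric])
 hence "int (nat \<bar>s\<bar> ^ ?f) = int (p ^ ?h)" by simp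
 hence sp: "nat \<bar>s\<bar> ^ ?f = p ^ ?h" by (simp only: of_nat_eq_iff)
 have f0: "?f > 0" using p1 by (simp add: totient_def[symmetric])
 \<comment> \<open>From s^f = \<plusminus>p^h follows that f divides h; as h > 0, all f exponents
   prime to p occur among the conjugates.\<close>
 have "?f * multiplicity p (nat \<bar>s\<bar>) = ?h"
 proof -
  have "nat \<bar>s\<bar> ~= 0"
  proof
   assume "nat \<bar>s\<bar> = 0"
   hence "p ^ ?h = 0" using sp f0 by (simp only: zero_power)
   thus False using p1 by simp
  qed
  hence "multiplicity p (nat \<bar>s\<bar> ^ ?f) = ?f * multiplicity p (nat \<bar>s\<bar>)"
   using p by (intro prime_elem_multiplicity_power_distrib) auto
  moreover have "multiplicity p (p ^ ?h) = ?h" using p by (intro multiplicity_same_power) auto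
  ultimately show ?thesis using sp by simp
 qed
 moreover have "1 \<in> H" unfolding H_def using n1 aut_id by (auto simp: totatives_def intro!: exI[of _ id])
 hence "?h > 0" using finH by (auto simp: card_gt_0_iff)
 ultimately have "?f \<le> ?h" by (metis dvd_imp_le dvd_triv_left)
 hence "H = ?U" using finH card_seteq[of ?U H] by simp
 moreover have "\<gamma> mod ?n \<in> ?U"
 proof -
  have "coprime (\<gamma> mod ?n) ?n" using g p1 by (subst coprime_mod_left_iff) auto
  moreover from this have "\<gamma> mod ?n > 0" using n1 by (cases "\<gamma> mod ?n = 0") auto
  ultimately show ?thesis using p1 by (auto simp: totatives_def intro: less_imp_le)
 qed
 ultimately have "\<gamma> mod ?n \<in> H" by simp
 thus ?thesis unfolding H_def by (auto simp: pm)
qed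

section \<open>Odd primes\<close>

lemma funpow_coprime_fixed:
 assumes "(f ^^ m) x = x" "(f ^^ p) x = x" "coprime m (p::nat)" "m > 0"
 shows "f x = x"
proof -
 have it: "(f ^^ (k * j)) x = x" if "(f ^^ k) x = x" for k j
  using that by (induction j) (simp_all add: funpow_add)
 obtain u v where uv: "m * u = p * v + 1" using bezout_nat[of m p] assms(3,4) by auto
 have "f ((f ^^ (p * v)) x) = (f ^^ (m * u)) x" unfolding uv by simp
 thus ?thesis using it[OF assms(1), of u] it[OF assms(2), of v] by simp
qed

text \<open>A point moved by f has an orbit of exactly p elements, because p is prime, and these
  orbits partition the moved points.\<close>

lemma card_nonfixed_prime_order:
 assumes p: "Factorial_Ring.prime (p::nat)" and fin: "finite S"
  and closed: "\<And>x. x \<in> S ==> f x \<in> S" and per: "\<And>x. x \<in> S ==> (f ^^ p) x = x"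
 shows "p dvd card {x \<in> S. f x ~= x}"
proof -
 let ?T = "{x \<in> S. f x ~= x}"
 define orb where "orb x = (\<lambda>k. (f ^^ k) x) ` {..<p}" for x
 have p0: "p > 0" using p prime_gt_0_nat by blast
 have fS: "(f ^^ k) x \<in> S" if "x \<in> S" for k x using that closed by (induction k) auto
 have fmod: "(f ^^ k) x = (f ^^ (k mod p)) x" if "x \<in> S" for k x
 proof (induction k rule: less_induct)
  case (less k)
  show ?case
  proof (cases "k < p")
   case False
   hence "k = (k - p) + p" by simp
   hence "(f ^^ k) x = (f ^^ (k - p)) ((f ^^ p) x)" by (metis funpow_add comp_apply)
   also have "\<dots> = (f ^^ ((k - p) mod p)) x" using per that less[of "k - p"] False p0 by simp
   finally show ?thesis using False by (simp add: le_mod_geq)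
  qed simp
 qed
 have orb_in: "(f ^^ k) x \<in> orb x" if "x \<in> S" for k x
  unfolding orb_def using fmod[OF that, of k] p0 by (intro image_eqI[of _ _ "k mod p"]) auto
 have orb_sub: "orb z \<subseteq> orb x" if x: "x \<in> S" "z \<in> orb x" for x z
 proof
  obtain i where i: "z = (f ^^ i) x" using x by (auto simp: orb_def)
  fix w assume "w \<in> orb z"
  then obtain j where "w = (f ^^ j) z" by (auto simp: orb_def)
  hence "w = (f ^^ (j + i)) x" using i by (simp add: funpow_add)
  thus "w \<in> orb x" using orb_in[OF x(1)] by simp
 qed
 have orb_eq: "orb z = orb x" if x: "x \<in> S" "z \<in> orb x" for x z
 proof -
  obtain i where i: "i < p" "z = (f ^^ i) x" using x by (auto simp: orb_def)
  have "(f ^^ (p - i)) z = (f ^^ (p - i + i)) x" unfolding i by (simp only: funpow_add comp_apply)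
  hence "x = (f ^^ (p - i)) z" using i per x by simp
  moreover have "z \<in> S" using i fS x by auto
  ultimately have "x \<in> orb z" using orb_in by metis
  thus ?thesis using orb_sub x \<open>z \<in> S\<close> by blast
 qed
 have orbT: "orb x \<subseteq> ?T" if x: "x \<in> ?T" for x
 proof
  fix z assume z: "z \<in> orb x"
  obtain i where i: "i < p" "z = (f ^^ i) x" using z by (auto simp: orb_def)
  have zS: "z \<in> S" using i fS x by auto
  have "f z ~= z"
  proof
   assume "f z = z"
   hence "(f ^^ k) z = z" for k by (induction k) auto
   hence "orb z \<subseteq> {z}" by (auto simp: orb_def)
   moreover have "x \<in> orb x" "f x \<in> orb x" using orb_in[of x 0] orb_in[of x 1] x by auto
   ultimately show False using orb_eq[of x z] z x by auto
  qed
  thus "z \<in> ?T" using zS by simp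
 qed
 have card: "card (orb x) = p" if x: "x \<in> ?T" for x
 proof -
  have "inj_on (\<lambda>k. (f ^^ k) x) {..<p}"
  proof (rule linorder_inj_onI)
   fix i j assume ij: "i < j" "i \<in> {..<p}" "j \<in> {..<p}"
   show "(f ^^ i) x ~= (f ^^ j) x"
   proof
    assume eq: "(f ^^ i) x = (f ^^ j) x"
    have "(f ^^ (j - i)) x = (f ^^ (p + (j - i))) x" using fmod[of x "p + (j - i)"] fmod[of x "j - i"] x by simp
    also have "p + (j - i) = (p - i) + j" using ij by simp
    also have "(f ^^ \<dots>) x = (f ^^ (p - i)) ((f ^^ i) x)" unfolding eq by (simp add: funpow_add)
    also have "\<dots> = (f ^^ (p - i + i)) x" by (simp only: funpow_add comp_apply)
    also have "\<dots> = x" using ij per x by simp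
    finally have "(f ^^ (j - i)) x = x" .
    moreover have "coprime (j - i) p" using p ij
     by (intro prime_imp_coprime_nat[THEN coprime_commute[THEN iffD1]]) (auto dest: dvd_imp_le)
    ultimately have "f x = x" using funpow_coprime_fixed[of "j - i" f x p] per x ij by simp
    thus False using x by simp
   qed
  qed auto
  thus ?thesis unfolding orb_def by (simp add: card_image)
 qed
 have U: "?T = \<Union> (orb ` ?T)"
 proof
  show "?T \<subseteq> \<Union> (orb ` ?T)" using orb_in[of _ 0] by force
  show "\<Union> (orb ` ?T) \<subseteq> ?T" using orbT by blast
 qed
 have finT: "finite ?T" using fin by simp
 have "p * card (orb ` ?T) = card (\<Union> (orb ` ?T))"
 proof (rule card_partition)
  show "finite (orb ` ?T)" using fin by simp
  show "finite (\<Union> (orb ` ?T))" by (rule subst[of _ _ finite, OF U finT])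
  fix c assume "c \<in> orb ` ?T" thus "card c = p" using card by auto
 next
  fix c d assume cd: "c \<in> orb ` ?T" "d \<in> orb ` ?T" "c ~= d"
  then obtain x y where xy: "x \<in> S" "y \<in> S" "c = orb x" "d = orb y" by auto
  show "c \<inter> d = {}"
  proof (rule ccontr)
   assume "c \<inter> d ~= {}"
   then obtain z where "z \<in> orb x" "z \<in> orb y" using xy by auto
   thus False using orb_eq xy cd(3) by metis
  qed
 qed
 from trans[OF arg_cong[OF U, of card] this[symmetric]] show ?thesis by (rule dvdI)
qed

text \<open>Differences modulo p are written with natural numbers as i + (p - j).\<close>

lemma mod_sub_eq_0:
 assumes "i < p" "j < (p::nat)" "(i + (p - j)) mod p = 0" shows "i = j"
proof -
 obtain q where q: "i + (p - j) = p * q" using assms(3) by (auto simp: mod_eq_0_iff_dvd elim!: dvdE)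
 have "q ~= 0" using q assms by (intro notI) simp
 moreover have "q < 2"
 proof (rule ccontr)
  assume "\<not> q < 2"
  hence "p * 2 \<le> p * q" by (intro mult_le_mono) auto
  thus False using q assms by linarith
 qed
 ultimately have "q = 1" by simp
 thus ?thesis using q assms by simp
qed

lemma primitive_root_prime_power:
 fixes w :: "'a::field"
 assumes p: "Factorial_Ring.prime (p::nat)" and w: "w ^ (p ^ Suc n) = 1" "w ^ (p ^ n) ~= 1"
 shows "primitive_root_of_unity (p ^ Suc n) w"
proof -
 define k where "k = (LEAST k. k > 0 \<and> w ^ k = 1)"
 have p0: "p > 0" using p prime_gt_0_nat by blast
 have "\<exists>k. k > 0 \<and> w ^ k = 1" using w p0 by (intro exI[of _ "p ^ Suc n"]) auto
 hence k: "k > 0" "w ^ k = 1" unfolding k_def by (metis (mono_tags, lifting) LeastI)+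
 have "primitive_root_of_unity k w" unfolding primitive_root_of_unity_def using k not_less_Least k_def by blast
 note pk = primitive_root_power_eq_1[OF this]
 have "k dvd p ^ Suc n" using w pk by blast
 then obtain j where j: "j \<le> Suc n" "k = p ^ j" using divides_primepow_nat[OF p] by blast
 have "j = Suc n"
 proof (rule ccontr)
  assume "j ~= Suc n"
  hence "k dvd p ^ n" using j by (simp add: le_imp_power_dvd)
  thus False using w pk by blast
 qed
 thus ?thesis using \<open>primitive_root_of_unity k w\<close> j by simp
qed

section \<open>The Galois action on points and on the pairing\<close>

locale rational_curve = short_weierstrass a b for a b :: qbar +
 assumes a_fixed: "field_aut sg ==> sg a = a" and b_fixed: "field_aut sg ==> sg b = b"
begin

abbreviation act :: "(qbar => qbar) => qbar point => qbar point" where "act \<equiv> map_point"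

lemma act_xc: "field_aut sg ==> xc (act sg P) = sg (xc P)"
 and act_yc: "field_aut sg ==> yc (act sg P) = sg (yc P)"
 by (cases P; simp add: aut_0)+

lemma act_eq_Infinity: "act sg P = Infinity \<longleftrightarrow> P = Infinity"
 by (cases P) auto

lemma act_pneg: "field_aut sg ==> act sg (pneg P) = pneg (act sg P)"
 by (cases P) (auto simp: aut_minus)

lemma act_inj: "field_aut sg ==> act sg P = act sg Q \<longleftrightarrow> P = Q"
 by (cases P; cases Q) (auto simp: aut_inj)

lemma act_in_C: "field_aut sg ==> P \<in> C ==> act sg P \<in> C"
proof (cases P)
 case (Affine x y)
 assume s: "field_aut sg" and "P \<in> C"
 hence "y ^ 2 = x ^ 3 + a * x + b" using Affine by (simp add: Affine_in_C rhs_def)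
 hence "sg (y ^ 2) = sg (x ^ 3 + a * x + b)" by simp
 hence "sg y ^ 2 = sg x ^ 3 + a * sg x + b" by (simp add: aut_simps[OF s] a_fixed[OF s] b_fixed[OF s])
 thus ?thesis using Affine by (simp add: Affine_in_C rhs_def)
qed simp

lemma act_slope: "field_aut sg ==> slope (act sg P) (act sg Q) = sg (slope P Q)"
 by (simp add: slope_def act_xc act_yc aut_inj aut_simps a_fixed)

lemma act_padd:
 assumes s: "field_aut sg" and PQ: "P \<in> C" "Q \<in> C"
 shows "act sg (P \<uplus> Q) = act sg P \<uplus> act sg Q"
proof -
 consider "P = Infinity \<or> Q = Infinity" | "P = pneg Q" | "P ~= Infinity" "Q ~= Infinity" "P ~= pneg Q" by blast
 thus ?thesis
 proof cases
  case 2 thus ?thesis by (simp add: act_pneg[OF s])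
 next
  case 3
  have "act sg P ~= pneg (act sg Q)" using 3 act_inj[OF s] by (simp flip: act_pneg[OF s])
  thus ?thesis using 3 padd_affine[OF PQ 3]
    padd_affine[of "act sg P" "act sg Q", OF act_in_C[OF s PQ(1)] act_in_C[OF s PQ(2)]]
   by (simp add: act_eq_Infinity act_slope[OF s] act_xc[OF s] act_yc[OF s] aut_simps[OF s])
 qed auto
qed

lemma act_pmul: "field_aut sg ==> P \<in> C ==> act sg (n \<odot> P) = n \<odot> act sg P"
 by (induction n) (auto simp: act_padd)

lemma act_tors: "field_aut sg ==> P \<in> tors n ==> act sg P \<in> tors n"
 by (simp add: tors_def act_in_C flip: act_pmul)

lemma act_comp: "act (sg \<circ> \<tau>) P = act sg (act \<tau> P)"
 by (cases P) auto

lemma act_funpow: "act (sg ^^ n) P = (act sg ^^ n) P"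
proof (induction n)
 case (Suc n)
 have "act (sg ^^ Suc n) P = act sg (act (sg ^^ n) P)" unfolding act_comp[symmetric] by simp
 also have "\<dots> = (act sg ^^ Suc n) P" by (simp add: Suc)
 finally show ?case .
qed (cases P, auto)

lemma act_h: "field_aut sg ==> P \<in> C ==> Q \<in> C ==> h (act sg P) (act sg Q) (act sg Z) = sg (h P Q Z)"
 by (simp add: h_def ln_def act_eq_Infinity act_slope act_xc act_yc aut_simps act_inj
   flip: act_pneg act_padd)

lemma act_gm:
 assumes s: "field_aut sg" and PZ: "P \<in> C" "Z \<in> C"
 shows "gm N (act sg P) (act sg Z) = sg (gm N P Z)"
 unfolding gm_def Fm_def Hm_def using PZ
 by (simp add: aut_divide[OF s] aut_prod[OF s] act_h[OF s] flip: act_pmul[OF s])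

lemma act_inv: "field_aut sg ==> act sg (act (inv_into UNIV sg) P) = P"
 by (cases P) (auto simp: field_aut_def bij_def surj_f_inv_f)

lemma most_act:
 assumes s: "field_aut sg" and m: "most p"
 shows "most (\<lambda>Z. p (act (inv_into UNIV sg) Z))"
proof -
 let ?i = "act (inv_into UNIV sg)"
 have "{Z \<in> C. \<not> p (?i Z)} \<subseteq> act sg ` {Z \<in> C. \<not> p Z}"
 proof
  fix Z assume Z: "Z \<in> {Z \<in> C. \<not> p (?i Z)}"
  have "Z = act sg (?i Z)" by (simp add: act_inv[OF s])
  moreover have "?i Z \<in> C" using Z act_in_C[OF aut_inv[OF s]] by simp
  ultimately show "Z \<in> act sg ` {Z \<in> C. \<not> p Z}" using Z by blast
 qed
 thus ?thesis unfolding most_def using m unfolding most_def by (rule finite_subset[OF _ finite_imageI])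
qed

text \<open>Transport of structure: a general Z is first moved back by the inverse automorphism,
  which preserves finiteness of exceptional sets.\<close>

lemma act_weil:
 assumes s: "field_aut sg" and N: "odd N" and PQ: "P \<in> tors N" "Q \<in> tors N"
 shows "weil N (act sg P) (act sg Q) = sg (weil N P Q)"
proof (rule weil_unique[OF N act_tors[OF s PQ(1)] act_tors[OF s PQ(2)]])
 have C: "P \<in> C" "Q \<in> C" using PQ tors_in_C by auto
 let ?i = "act (inv_into UNIV sg)"
 show "most (\<lambda>Z. gm N (act sg P) (Z \<uplus> act sg Q) = sg (weil N P Q) * gm N (act sg P) Z)"
 proof (rule most_mono[OF most_act[OF s weil_props(2)[OF N PQ]]])
  fix Z assume Z: "Z \<in> C" and e: "gm N P (?i Z \<uplus> Q) = weil N P Q * gm N P (?i Z)"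
  have iC: "?i Z \<in> C" using Z act_in_C[OF aut_inv[OF s]] by simp
  have "sg (gm N P (?i Z \<uplus> Q)) = sg (weil N P Q) * sg (gm N P (?i Z))" unfolding e by (rule aut_mult[OF s])
  thus "gm N (act sg P) (Z \<uplus> act sg Q) = sg (weil N P Q) * gm N (act sg P) Z"
   using iC C by (simp add: act_gm[OF s, symmetric] act_padd[OF s] act_inv[OF s])
 qed
qed

lemma weil_Infinity:
 assumes "odd N" "P \<in> tors N" shows "weil N P Infinity = 1" "weil N Infinity P = 1"
proof -
 have nz: "weil N P Q ~= 0" if "P \<in> tors N" "Q \<in> tors N" for P Q
  using weil_props(1)[OF assms(1) that] assms(1) by (cases N) auto
 show "weil N P Infinity = 1" using weil_add_right[OF assms(1,2), of Infinity Infinity] nz[OF assms(2), of Infinity] by simp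
 show "weil N Infinity P = 1" using weil_add_left[OF assms(1) _ _ assms(2), of Infinity Infinity] nz[OF _ assms(2), of Infinity] by simp
qed

lemma weil_pmul:
 assumes "odd N" "P \<in> tors N" "Q \<in> tors N"
 shows "weil N (n \<odot> P) Q = weil N P Q ^ n" "weil N P (n \<odot> Q) = weil N P Q ^ n"
 using assms by (induction n) (auto simp: weil_Infinity weil_add_left weil_add_right tors_pmul)

text \<open>For P outside E[p^n], nondegeneracy at p^n P provides a Q whose pairing with P has exact
  order p^(n+1).\<close>

lemma ex_weil_primitive:
 assumes p: "Factorial_Ring.prime (p::nat)" "odd p"
 shows "\<exists>P\<in>tors (p ^ Suc n). \<exists>Q\<in>tors (p ^ Suc n). primitive_root_of_unity (p ^ Suc n) (weil (p ^ Suc n) P Q)"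
proof -
 let ?N = "p ^ Suc n"
 have p1: "p > 1" using p prime_gt_1_nat by blast
 have N: "odd ?N" "?N \<ge> 1" "p ^ n \<ge> 1" using p p1 by auto
 have "card (tors (p ^ n)) < card (tors ?N)" unfolding card_tors[OF N(2)] card_tors[OF N(3)]
  using p1 by (intro power_strict_mono power_strict_increasing) auto
 hence "\<not> tors ?N \<subseteq> tors (p ^ n)" using card_mono[OF finite_tors[OF N(3)]] by (meson leD)
 then obtain P where P: "P \<in> tors ?N" "P \<notin> tors (p ^ n)" by blast
 have "p ^ n \<odot> P ~= Infinity" using P by (auto simp: tors_def)
 then obtain Q where Q: "Q \<in> tors ?N" "weil ?N (p ^ n \<odot> P) Q ~= 1"
  using weil_nondegenerate[OF N(1) tors_pmul[OF P(1)]] by blast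
 have "weil ?N P Q ^ (p ^ n) ~= 1" using Q weil_pmul(1)[OF N(1) P(1) Q(1)] by simp
 hence "primitive_root_of_unity ?N (weil ?N P Q)"
  using weil_props(1)[OF N(1) P(1) Q(1)] by (intro primitive_root_prime_power[OF p(1)])
 thus ?thesis using P Q by blast
qed

text \<open>sg P differs from P by a p-torsion point S, which sg fixes, so the j-th iterate of sg
  adds j S.\<close>

lemma funpow_fixes_next:
 assumes s: "field_aut sg" and k: "k \<ge> 1" and fx: "\<And>P. P \<in> tors (p ^ k) ==> act sg P = P"
  and X: "P \<in> tors (p ^ Suc k)"
 shows "(act sg ^^ p) P = P"
proof -
 have PC: "P \<in> C" using X tors_in_C by blast
 define S where "S = pneg P \<uplus> act sg P"
 have SC: "S \<in> C" unfolding S_def using PC act_in_C[OF s] by simp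
 have aP: "act sg P = P \<uplus> S" unfolding S_def using PC act_in_C[OF s PC] by simp
 have "p \<odot> P \<in> tors (p ^ k)" using X by (simp add: tors_def mult.commute[of p] flip: pmul_mult)
 hence "act sg (p \<odot> P) = p \<odot> P" by (rule fx)
 hence "p \<odot> act sg P = p \<odot> P" using act_pmul[OF s PC] by simp
 hence "p \<odot> S = Infinity" unfolding S_def using PC act_in_C[OF s PC] by (simp add: pmul_padd pmul_pneg)
 hence "S \<in> tors p" using SC by (simp add: tors_def)
 hence "S \<in> tors (p ^ k)" using k by (rule_tac tors_mono) (auto simp: dvd_power)
 hence aS: "act sg S = S" by (rule fx)
 have "(act sg ^^ j) P = P \<uplus> j \<odot> S" for j
  by (induction j) (use PC SC in \<open>simp_all add: act_padd[OF s] act_pmul[OF s] aS aP padd_ac\<close>)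
 thus ?thesis using \<open>p \<odot> S = Infinity\<close> by simp
qed

lemma funpow_fixes_tors:
 assumes s: "field_aut sg" and fx: "\<And>P. P \<in> tors p ==> act sg P = P" and P: "P \<in> tors (p ^ Suc n)"
 shows "act (sg ^^ (p ^ n)) P = P"
 using P
proof (induction n arbitrary: P)
 case (Suc n)
 have "(act (sg ^^ p ^ n) ^^ p) P = P"
  by (rule funpow_fixes_next[OF aut_funpow[OF s], of "Suc n"]) (use Suc in auto)
 moreover have "((act (sg ^^ p ^ n)) ^^ p) P = act (sg ^^ p ^ Suc n) P"
  unfolding act_funpow[symmetric] by (simp add: funpow_mult mult.commute)
 ultimately show ?case by simp
qed (use fx in simp)

lemma pmul_cong:
 assumes P: "P \<in> tors p" and ij: "[i = j] (mod p)" shows "i \<odot> P = j \<odot> P"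
proof -
 have "i \<odot> P = (i mod p) \<odot> P" for i
 proof -
  have "i \<odot> P = (i div p * p + i mod p) \<odot> P" by simp
  also have "\<dots> = (i mod p) \<odot> P" unfolding pmul_add[OF tors_in_C[OF P]] pmul_mult[OF tors_in_C[OF P]]
   using P by (simp add: tors_def)
  finally show ?thesis .
 qed
 thus ?thesis using ij by (metis cong_def)
qed

text \<open>The p^2 combinations with i, j < p are distinct, and E[p] has only p^2 elements.\<close>

lemma tors_span:
 assumes p: "Factorial_Ring.prime (p::nat)" and P: "P \<in> tors p" "P ~= Infinity" and R: "R \<in> tors p" "\<And>i. R ~= i \<odot> P"
  and Q: "Q \<in> tors p"
 shows "\<exists>i j. Q = i \<odot> P \<uplus> j \<odot> R"
proof -
 let ?f = "\<lambda>(i, j). i \<odot> P \<uplus> j \<odot> R"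
 have C: "P \<in> C" "R \<in> C" using P R tors_in_C by auto
 have p0: "p \<ge> 1" using p prime_gt_0_nat by (simp add: Suc_leI)
 have RP: "j = 0" if e: "j \<odot> R = i \<odot> P" "j < p" for i j
 proof (rule ccontr)
  assume "j ~= 0"
  hence "coprime j p" using p e by (intro prime_imp_coprime_nat[THEN coprime_commute[THEN iffD1]]) (auto dest: dvd_imp_le)
  then obtain u where u: "[j * u = 1] (mod p)" using cong_solve_coprime_nat by auto
  have "(j * u) \<odot> R = 1 \<odot> R" by (rule pmul_cong[OF R(1) u])
  hence "u \<odot> j \<odot> R = R" using C by (simp add: pmul_mult pmul_left_commute)
  hence "R = (u * i) \<odot> P" unfolding e(1) using C by (simp add: pmul_mult)
  thus False using R(2) by blast
 qed
 have PP: "i = 0" if e: "i \<odot> P = Infinity" "i < p" for i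
 proof (rule ccontr)
  assume "i ~= 0"
  hence "coprime i p" using p e by (intro prime_imp_coprime_nat[THEN coprime_commute[THEN iffD1]]) (auto dest: dvd_imp_le)
  then obtain u where u: "[i * u = 1] (mod p)" using cong_solve_coprime_nat by auto
  have "(i * u) \<odot> P = 1 \<odot> P" by (rule pmul_cong[OF P(1) u])
  hence "u \<odot> i \<odot> P = P" using C by (simp add: pmul_mult pmul_left_commute)
  thus False using e P by simp
 qed
 have sub: "(i + (p - i')) \<odot> P \<uplus> i' \<odot> P = i \<odot> P" if "i' < p" "P \<in> tors p" for i i' P
 proof -
  have "(i + (p - i')) \<odot> P \<uplus> i' \<odot> P = (i + (p - i') + i') \<odot> P" by (rule pmul_add[symmetric]) (rule tors_in_C[OF that(2)])
  also have "\<dots> = i \<odot> P" by (rule pmul_cong[OF that(2)]) (use that in \<open>simp add: cong_def\<close>)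
  finally show ?thesis .
 qed
 have inj: "inj_on ?f ({..<p} \<times> {..<p})"
 proof (rule inj_onI, clarsimp)
  fix i j i' j' assume lt: "i < p" "j < p" "i' < p" "j' < p" and e: "i \<odot> P \<uplus> j \<odot> R = i' \<odot> P \<uplus> j' \<odot> R"
  let ?u = "i + (p - i')" and ?v = "j' + (p - j)"
  have "?u \<odot> P \<uplus> (i' \<odot> P \<uplus> j \<odot> R) = i \<odot> P \<uplus> j \<odot> R"
   using sub[OF lt(3) P(1), of i] C by (simp flip: padd_assoc)
  also have "\<dots> = i' \<odot> P \<uplus> (?v \<odot> R \<uplus> j \<odot> R)" unfolding e using sub[OF lt(2) R(1), of j'] by simp
  also have "\<dots> = ?v \<odot> R \<uplus> (i' \<odot> P \<uplus> j \<odot> R)" using C by (simp only: padd_left_commute pmul_in_C)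
  finally have eq: "?v \<odot> R = ?u \<odot> P" using C by (simp add: padd_in_C)
  have "(?v mod p) \<odot> R = ?u \<odot> P" using pmul_cong[OF R(1), of "?v mod p" ?v] eq by (simp add: cong_def)
  hence v0: "?v mod p = 0" by (rule RP) (use p0 in simp)
  have "?v mod p = 0 ==> j = j'" using mod_sub_eq_0[OF lt(4,2)] by simp
  hence j: "j = j'" using v0 by blast
  hence "?v \<odot> R = Infinity" using pmul_cong[OF R(1), of ?v 0] v0 by (simp add: cong_def)
  hence "(?u mod p) \<odot> P = Infinity" using eq pmul_cong[OF P(1), of "?u mod p" ?u] by (simp add: cong_def)
  hence u0: "?u mod p = 0" by (rule PP) (use p0 in simp)
  have "i \<odot> P = i' \<odot> P" using sub[OF lt(3) P(1), of i] pmul_cong[OF P(1), of ?u 0] u0 by (simp add: cong_def)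
  have "?u mod p = 0 ==> i = i'" using mod_sub_eq_0[OF lt(1,3)] by simp
  thus "i = i' \<and> j = j'" using u0 j by blast
 qed
 have "?f ` ({..<p} \<times> {..<p}) = tors p"
 proof (rule card_subset_eq[OF finite_tors[OF p0]])
  show "?f ` ({..<p} \<times> {..<p}) \<subseteq> tors p" using P R by (auto intro!: tors_padd tors_pmul)
  show "card (?f ` ({..<p} \<times> {..<p})) = card (tors p)"
   using card_image[OF inj] by (simp add: card_cartesian_product card_tors[OF p0] power2_eq_square)
 qed
 with Q have "Q \<in> ?f ` ({..<p} \<times> {..<p})" by simp
 thus ?thesis by auto
qed

lemma act_pmul_eigen:
 assumes "field_aut sg" "P \<in> C" "act sg P = c \<odot> P" shows "(act sg ^^ k) P = (c ^ k) \<odot> P"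
 by (induction k) (use assms in \<open>simp_all add: act_pmul pmul_mult mult.commute[of c]\<close>)

text \<open>The root of unity forces p to divide the order \<open>o'\<close> of sg on E[p]. A power
  of sg of order p then fixes some P \<noteq> O, which yields the triangular shape. Distinct
  diagonal entries would make sg diagonalisable, and its order would divide p - 1.\<close>

lemma cyclotomic_not_fixed:
 assumes p: "Factorial_Ring.prime (p::nat)" "odd p" and n: "n \<ge> 1" and z: "primitive_root_of_unity (p ^ Suc n) \<zeta>"
  and fx: "\<And>sg. field_aut sg ==> (\<And>P. P \<in> tors (p ^ n) ==> act sg P = P) ==> sg \<zeta> = \<zeta>"
 shows False
proof -
 have p1: "p > 1" "p \<ge> 1" using prime_gt_1_nat[OF p(1)] by auto
 obtain g where g: "\<forall>k>0. residue_primroot (p ^ k) g" using residue_primroot_odd_prime_power_exists[OF p] by blast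
 have gp: "residue_primroot p g" using g[rule_format, of 1] by simp
 hence cop: "coprime g p" by (simp add: residue_primroot_def coprime_commute)
 obtain sg where s: "field_aut sg" and sz: "sg \<zeta> = \<zeta> ^ g" using cyclotomic_aut[OF p(1) _ z cop] by auto
 have sk: "(sg ^^ k) \<zeta> = \<zeta> ^ (g ^ k)" for k
  by (induction k) (simp_all add: sz aut_power[OF s] power_mult[symmetric] mult.commute)
 \<comment> \<open>\<open>g\<close> has order (p - 1) p^n modulo p^(n+1), so the iterate k p^(n-1)
   can fix \<zeta> only if p divides k.\<close>
 have ord: "p dvd k" if e: "(sg ^^ (k * p ^ (n - 1))) \<zeta> = \<zeta>" for k
 proof -
  have "\<zeta> ^ (g ^ (k * p ^ (n - 1))) = \<zeta> ^ 1" using e sk by simp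
  hence "[g ^ (k * p ^ (n - 1)) = 1] (mod p ^ Suc n)" unfolding primitive_root_power_eq[OF z] cong_def .
  hence "ord (p ^ Suc n) g dvd k * p ^ (n - 1)" by (simp only: ord_divides)
  hence "totient (p ^ Suc n) dvd k * p ^ (n - 1)" using g[rule_format, of "Suc n"] by (simp add: residue_primroot_def)
  hence "p ^ n * (p - 1) dvd k * p ^ (n - 1)" using totient_prime_power_Suc[OF p(1), of n] by simp
  hence "p ^ n dvd k * p ^ (n - 1)" using dvd_mult_left by blast
  moreover have "p ^ n = p * p ^ (n - 1)" using n by (cases n) auto
  ultimately show ?thesis using p1 by simp
 qed
 have fixV: "p dvd k" if "\<And>P. P \<in> tors p ==> (act sg ^^ k) P = P" for k
 proof (rule ord)
  have "act ((sg ^^ k) ^^ p ^ (n - 1)) P = P" if "P \<in> tors (p ^ n)" for P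
   by (rule funpow_fixes_tors[OF aut_funpow[OF s]]) (use that n \<open>\<And>P. P \<in> tors p ==> (act sg ^^ k) P = P\<close> in \<open>auto simp: act_funpow\<close>)
  thus "(sg ^^ (k * p ^ (n - 1))) \<zeta> = \<zeta>"
   using fx[OF aut_funpow[OF s], of "k * p ^ (n - 1)"] by (simp add: funpow_mult mult.commute)
 qed
 define o' where "o' = (LEAST k. k > 0 \<and> (\<forall>P\<in>tors p. (act sg ^^ k) P = P))"
 have finV: "finite (tors p)" by (rule finite_tors[OF p1(2)])
 have "\<exists>k>0. \<forall>P\<in>tors p. (act sg ^^ k) P = P"
 proof -
  have cl: "(act sg ^^ k) P \<in> tors p" if "P \<in> tors p" for k P using that by (induction k) (auto intro: act_tors[OF s])
  have ij: "inj ((act sg ^^ k))" for k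
  proof (induction k)
   case (Suc k) have "inj (act sg)" using act_inj[OF s] by (auto simp: inj_def)
   thus ?case by (simp only: funpow.simps inj_compose Suc)
  qed simp
  let ?F = "\<lambda>k. restrict (act sg ^^ k) (tors p)"
  have "range ?F \<subseteq> tors p \<rightarrow>\<^sub>E tors p" using cl by auto
  hence "finite (range ?F)" by (rule finite_subset) (simp add: finV finite_PiE)
  hence "\<not> inj ?F" using finite_imageD by (metis infinite_UNIV_nat)
  then obtain i j where ne: "?F i = ?F j" "i < j" unfolding inj_def by (metis linorder_neqE_nat)
  have "(act sg ^^ (j - i)) P = P" if P: "P \<in> tors p" for P
  proof -
   have "(act sg ^^ i) ((act sg ^^ (j - i)) P) = (act sg ^^ (i + (j - i))) P" by (simp only: funpow_add comp_apply)
   also have "\<dots> = (act sg ^^ i) P" using ne P by (metis add_diff_inverse_nat less_imp_le_nat not_less restrict_apply')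
   finally show ?thesis using ij[of i] by (simp add: inj_eq)
  qed
  thus ?thesis using ne by (intro exI[of _ "j - i"]) auto
 qed
 from LeastI_ex[OF this] have "o' > 0 \<and> (\<forall>P\<in>tors p. (act sg ^^ o') P = P)" unfolding o'_def .
 hence o1: "o' > 0" "\<And>P. P \<in> tors p ==> (act sg ^^ o') P = P" by blast+
 have omin: "o' \<le> k" if "k > 0" "\<And>P. P \<in> tors p ==> (act sg ^^ k) P = P" for k
  unfolding o'_def by (rule Least_le) (use that in blast)
 have "p dvd o'" by (rule fixV[OF o1(2)])
 then obtain m where m: "o' = m * p" by (metis dvdE mult.commute)
 have m0: "m > 0" "m < o'" using m o1(1) p1 by auto
 \<comment> \<open>\<psi> has order p on E[p]. The number of its fixed points is divisible by p and
   positive because of O, so some P \<noteq> O is fixed.\<close>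
 define \<psi> where "\<psi> = act sg ^^ m"
 have psi_aut: "\<psi> P = act (sg ^^ m) P" for P by (simp add: \<psi>_def act_funpow)
 have sm: "field_aut (sg ^^ m)" by (rule aut_funpow[OF s])
 let ?F = "{P \<in> tors p. \<psi> P = P}"
 have "p dvd card {P \<in> tors p. \<psi> P ~= P}"
 proof (rule card_nonfixed_prime_order[OF p(1) finV])
  fix P assume P: "P \<in> tors p"
  show "\<psi> P \<in> tors p" unfolding psi_aut by (rule act_tors[OF sm P])
  show "(\<psi> ^^ p) P = P" unfolding \<psi>_def funpow_mult using o1(2)[OF P] m by (simp add: mult.commute)
 qed
 moreover have "card (?F \<union> {P \<in> tors p. \<psi> P ~= P}) = card ?F + card {P \<in> tors p. \<psi> P ~= P}"
  by (rule card_Un_disjoint) (use finV in auto)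
 moreover have un: "?F \<union> {P \<in> tors p. \<psi> P ~= P} = tors p" by blast
 moreover have "p dvd card (tors p)" unfolding card_tors[OF p1(2)] by (simp add: power2_eq_square)
 ultimately have "p dvd card ?F + card {P \<in> tors p. \<psi> P ~= P}" by simp
 hence "p dvd card ?F" using \<open>p dvd card {P \<in> tors p. \<psi> P ~= P}\<close> by (simp only: dvd_add_left_iff)
 moreover have "\<psi> Infinity = Infinity" by (simp add: psi_aut)
 hence "?F ~= {}" using tors_Infinity[of p] by blast
 hence "card ?F > 0" using finV by (simp only: card_gt_0_iff) simp
 ultimately have "card ?F \<ge> p" by (intro dvd_imp_le)
 have "\<exists>P\<in>?F. P ~= Infinity"
 proof (rule ccontr)
  assume "\<not> ?thesis"
  hence "?F \<subseteq> {Infinity}" by blast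
  hence "card ?F \<le> 1" using card_mono[of "{Infinity}" ?F] by simp
  thus False using \<open>card ?F \<ge> p\<close> p1 by simp
 qed
 then obtain P where P: "P \<in> tors p" "\<psi> P = P" "P ~= Infinity" by blast
 have PC: "P \<in> C" using P tors_in_C by blast
 \<comment> \<open>sg commutes with \<psi>, so \<psi> fixes sg P too. Were sg P no multiple of P,
   the two would span E[p] and \<psi> would be trivial there, against the minimality of
   \<open>o'\<close>.\<close>
 have eigen: "\<exists>c. act sg P = c \<odot> P"
 proof (rule ccontr)
  assume "\<not> ?thesis"
  hence ne: "\<And>i. act sg P ~= i \<odot> P" by blast
  have "\<psi> (act sg P) = act sg (\<psi> P)" unfolding \<psi>_def by (metis funpow_swap1)
  hence fix2: "\<psi> (act sg P) = act sg P" using P by simp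
  have "\<psi> Q = Q" if Q: "Q \<in> tors p" for Q
  proof -
   obtain i j where "Q = i \<odot> P \<uplus> j \<odot> act sg P" using tors_span[OF p(1) P(1,3) act_tors[OF s P(1)] ne Q] by blast
   thus ?thesis using P(2) fix2 PC act_in_C[OF s PC] unfolding psi_aut by (simp add: act_padd[OF sm] act_pmul[OF sm])
  qed
  thus False using omin[OF m0(1)] m0(2) unfolding \<psi>_def by (meson leD)
 qed
 then obtain a' where a': "act sg P = a' \<odot> P" by blast
 have "\<not> tors p \<subseteq> (\<lambda>i. i \<odot> P) ` {..<p}"
 proof
  assume "tors p \<subseteq> (\<lambda>i. i \<odot> P) ` {..<p}"
  hence "card (tors p) \<le> card ((\<lambda>i. i \<odot> P) ` {..<p})" by (intro card_mono) auto
  also have "\<dots> \<le> p" using card_image_le[of "{..<p}" "\<lambda>i. i \<odot> P"] by simp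
  finally show False using card_tors[OF p1(2)] p1 by (simp add: power2_eq_square)
 qed
 then obtain R where R: "R \<in> tors p" "R \<notin> (\<lambda>i. i \<odot> P) ` {..<p}" by blast
 have Rne: "R ~= i \<odot> P" for i
 proof
  assume "R = i \<odot> P"
  hence "R = (i mod p) \<odot> P" using pmul_cong[OF P(1), of i "i mod p"] by (simp add: cong_def)
  thus False using R(2) p1 by auto
 qed
 have RC: "R \<in> C" using R tors_in_C by blast
 obtain x c where xc: "act sg R = x \<odot> P \<uplus> c \<odot> R" using tors_span[OF p(1) P(1,3) R(1) Rne act_tors[OF s R(1)]] by blast
 have nz: "\<not> p dvd c" if "Q \<in> tors p" "Q ~= Infinity" "act sg Q = c \<odot> Q" for Q c
 proof
  assume "p dvd c"
  hence "c \<odot> Q = 0 \<odot> Q" by (intro pmul_cong[OF that(1)]) (simp add: cong_0_iff)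
  thus False using that act_eq_Infinity[of sg Q] by simp
 qed
 have fermat: "(act sg ^^ (p - 1)) Q = Q" if Q: "Q \<in> tors p" "act sg Q = c \<odot> Q" for Q c
 proof (cases "Q = Infinity")
  case False
  have "(act sg ^^ (p - 1)) Q = (c ^ (p - 1)) \<odot> Q" by (rule act_pmul_eigen[OF s tors_in_C[OF Q(1)] Q(2)])
  also have "\<dots> = 1 \<odot> Q" by (rule pmul_cong[OF Q(1) fermat_theorem[OF p(1) nz[OF Q(1) False Q(2)]]])
  finally show ?thesis by simp
 next
  case True
  have "(act sg ^^ k) Infinity = Infinity" for k by (induction k) auto
  thus ?thesis using True by simp
 qed
 have "[a' = c] (mod p)"
 proof (rule ccontr)
  assume ne: "\<not> ?thesis"
  \<comment> \<open>e represents a' - c modulo p, and the y below solves y (a' - c) = - x, so that y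
    P + R is an eigenvector with eigenvalue c.\<close>
  define e where "e = a' + (p - 1) * c"
  have ec: "[e + c = a'] (mod p)"
  proof -
   have "e + c = a' + p * c" unfolding e_def using p1 by (cases p) (simp_all add: algebra_simps)
   thus ?thesis by (simp add: cong_def)
  qed
  have "\<not> p dvd e"
  proof
   assume "p dvd e"
   hence "[e + c = 0 + c] (mod p)" by (intro cong_add cong_refl) (simp add: cong_0_iff)
   thus False using ne ec by (metis add_0 cong_sym cong_trans)
  qed
  hence "coprime e p" using p(1) prime_imp_coprime_nat coprime_commute by blast
  then obtain u where u: "[e * u = 1] (mod p)" using cong_solve_coprime_nat by auto
  define y where "y = u * ((p - 1) * x)"
  have y: "[x + y * a' = y * c] (mod p)"
  proof -
   have "[x + y * a' = x + y * (e + c)] (mod p)" by (intro cong_add cong_mult cong_refl cong_sym[OF ec])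
   also have "x + y * (e + c) = x + (e * u) * ((p - 1) * x) + y * c" unfolding y_def by (simp only: distrib_left mult_ac add.assoc)
   also have "[\<dots> = x + 1 * ((p - 1) * x) + y * c] (mod p)" by (intro cong_add cong_mult cong_refl u)
   also have "x + 1 * ((p - 1) * x) + y * c = p * x + y * c" using p1 by (cases p) (simp_all add: algebra_simps)
   also have "[p * x + y * c = y * c] (mod p)" by (simp add: cong_def)
   finally show ?thesis .
  qed
  define R' where "R' = y \<odot> P \<uplus> R"
  have R't: "R' \<in> tors p" unfolding R'_def using P R by (intro tors_padd tors_pmul)
  have "act sg R' = (y * a') \<odot> P \<uplus> (x \<odot> P \<uplus> c \<odot> R)"
   unfolding R'_def using PC RC by (simp add: act_padd[OF s] act_pmul[OF s] a' xc pmul_mult)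
  also have "\<dots> = (x + y * a') \<odot> P \<uplus> c \<odot> R" using PC RC by (simp add: pmul_add padd_ac)
  also have "(x + y * a') \<odot> P = (c * y) \<odot> P" using pmul_cong[OF P(1) y] by (simp add: mult.commute)
  also have "(c * y) \<odot> P \<uplus> c \<odot> R = c \<odot> R'" unfolding R'_def using PC RC by (simp add: pmul_mult pmul_padd)
  finally have aR': "act sg R' = c \<odot> R'" .
  define \<tau> where "\<tau> = sg ^^ (p - 1)"
  have aut1: "field_aut \<tau>" unfolding \<tau>_def by (rule aut_funpow[OF s])
  have fP: "act \<tau> P = P" "act \<tau> R' = R'"
   using fermat[OF P(1) a'] fermat[OF R't aR'] by (simp_all add: act_funpow \<tau>_def)
  have fR: "act \<tau> R = R"
  proof -
   have "R = pneg (y \<odot> P) \<uplus> R'" unfolding R'_def using PC RC by simp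
   moreover have "act \<tau> (pneg (y \<odot> P) \<uplus> R') = pneg (y \<odot> P) \<uplus> R'"
    using PC tors_in_C[OF R't] fP by (simp add: act_padd[OF aut1] act_pneg[OF aut1] act_pmul[OF aut1])
   ultimately show ?thesis by simp
  qed
  have "(act sg ^^ (p - 1)) Q = Q" if Q: "Q \<in> tors p" for Q
  proof -
   obtain i j where "Q = i \<odot> P \<uplus> j \<odot> R" using tors_span[OF p(1) P(1,3) R(1) Rne Q] by blast
   thus ?thesis using fP(1) fR PC RC unfolding act_funpow[symmetric] \<tau>_def[symmetric] by (simp add: act_padd[OF aut1] act_pmul[OF aut1])
  qed
  hence "o' \<le> p - 1" using p1 by (intro omin) auto
  moreover have "p \<le> o'" using \<open>p dvd o'\<close> o1(1) by (rule dvd_imp_le)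
  ultimately show False using p1 by simp
 qed
 hence aR: "act sg R = x \<odot> P \<uplus> a' \<odot> R" unfolding xc using pmul_cong[OF R(1), of a' c] by simp
 have pp: "odd p" by (rule p(2))
 have root: "[g = a' ^ 2] (mod p)" if w: "w ^ p = 1" "w ~= 1" "sg w = w ^ (a' * a')" for w
 proof -
  have "w ^ (p ^ Suc n) = 1" using w(1) by (simp add: power_mult)
  then obtain i where i: "w = \<zeta> ^ i" using primitive_root_all[OF z] by blast
  have "sg w = w ^ g" unfolding i aut_power[OF s] sz by (simp add: power_mult[symmetric] mult.commute)
  moreover have "primitive_root_of_unity p w" using primitive_root_prime_power[OF p(1), of w 0] w by simp
  ultimately show ?thesis using w(3) primitive_root_power_eq[of p w g "a' * a'"] by (simp add: cong_def power2_eq_square)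
 qed
 \<comment> \<open>sg raises e(P, P), and e(P, R) in case e(P, P) = 1, to the power a'^2. One of
   them is not 1, because P pairs nontrivially with some point in the span of P and R.\<close>
 have "[g = a' ^ 2] (mod p)"
 proof (cases "weil p P P = 1")
  case False
  have "sg (weil p P P) = weil p P P ^ (a' * a')"
   using act_weil[OF s pp P(1) P(1)] P(1) by (simp add: a' weil_pmul[OF pp] tors_pmul power_mult)
  thus ?thesis using root[OF weil_props(1)[OF pp P(1) P(1)] False] by blast
 next
  case True
  have "weil p P R ~= 1"
  proof
   assume e: "weil p P R = 1"
   obtain Q where Q: "Q \<in> tors p" "weil p P Q ~= 1" using weil_nondegenerate[OF pp P(1,3)] by blast
   obtain i j where "Q = i \<odot> P \<uplus> j \<odot> R" using tors_span[OF p(1) P(1,3) R(1) Rne Q(1)] by blast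
   thus False using Q(2) P(1) R(1) by (simp add: weil_add_right[OF pp] weil_pmul[OF pp] tors_pmul e True)
  qed
  moreover have "sg (weil p P R) = weil p P R ^ (a' * a')"
   using act_weil[OF s pp P(1) R(1)] P(1) R(1)
   by (simp add: a' aR weil_add_right[OF pp] weil_pmul[OF pp] tors_pmul True tors_padd power_mult)
  ultimately show ?thesis using root[OF weil_props(1)[OF pp P(1) R(1)]] by blast
 qed
 hence "[g ^ ((p - 1) div 2) = (a' ^ 2) ^ ((p - 1) div 2)] (mod p)" by (rule cong_pow)
 also have "(a' ^ 2) ^ ((p - 1) div 2) = a' ^ (p - 1)" unfolding power_mult[symmetric] using p(2) by simp
 also have "[a' ^ (p - 1) = 1] (mod p)" by (rule fermat_theorem[OF p(1) nz[OF P(1,3) a']])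
 finally have "p - 1 dvd (p - 1) div 2" using gp unfolding ord_divides by (simp add: residue_primroot_def totient_prime[OF p(1)])
 moreover have "(p - 1) div 2 > 0" using p(2) p1 by (cases "p = 2") auto
 ultimately have "p - 1 \<le> (p - 1) div 2" by (rule dvd_imp_le)
 thus False using p1 by simp
qed

text \<open>The pairing on E[p^(n+1)] takes a primitive p^(n+1)-th root of unity as a value, which
  is then fixed along with the torsion. Thus a coincidence of fields is reduced to the containment
  of roots of unity.\<close>

lemma cyclotomic_fixed_if_tors_fixed:
 assumes p: "Factorial_Ring.prime (p::nat)" "odd p" and n: "n \<ge> 1"
  and fx: "\<And>sg P. field_aut sg ==> (\<And>P. P \<in> tors (p ^ n) ==> act sg P = P) ==> P \<in> tors (p ^ Suc n) ==> act sg P = P"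
 shows False
proof -
 obtain P Q where PQ: "P \<in> tors (p ^ Suc n)" "Q \<in> tors (p ^ Suc n)" "primitive_root_of_unity (p ^ Suc n) (weil (p ^ Suc n) P Q)"
  using ex_weil_primitive[OF p] by blast
 show False
 proof (rule cyclotomic_not_fixed[OF p n PQ(3)])
  fix sg assume s: "field_aut sg" and f: "\<And>P. P \<in> tors (p ^ n) ==> act sg P = P"
  have "act sg P = P" "act sg Q = Q" using fx[OF s f] PQ by blast+
  thus "sg (weil (p ^ Suc n) P Q) = weil (p ^ Suc n) P Q"
   using act_weil[OF s _ PQ(1,2)] p(2) by simp
 qed
qed

end

section \<open>Rational points on quartics\<close>

lemma coprime_mult_eq_square:
 fixes a b :: nat
 assumes "coprime a b" "a * b = c ^ 2"
 shows "\<exists>m n. a = m ^ 2 \<and> b = n ^ 2 \<and> c = m * n"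
proof -
 have "is_nth_power 2 (a * b)" using assms(2) by (auto simp: is_nth_power_def)
 hence "is_nth_power 2 a" "is_nth_power 2 b" using is_nth_power_mult_coprime_nat_iff[OF assms(1), of 2] by auto
 then obtain m n where mn: "a = m ^ 2" "b = n ^ 2" by (auto simp: is_nth_power_def)
 hence "(m * n) ^ 2 = c ^ 2" using assms(2) by (simp add: power_mult_distrib)
 hence "c = m * n" by (simp add: power2_eq_iff_nonneg)
 with mn show ?thesis by blast
qed

lemma odd_square_mod_4: "odd (x::nat) ==> x ^ 2 mod 4 = 1"
proof -
 assume "odd x"
 then obtain k where k: "x = 2 * k + 1" by (elim oddE)
 have "x ^ 2 = 1 + 4 * (k ^ 2 + k)" unfolding k by (simp add: power2_eq_square algebra_simps)
 thus ?thesis by (metis mod_mult_self2 mod_less one_less_numeral_iff semiring_norm(76))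
qed

lemma even_square_mod_4: "even (x::nat) ==> x ^ 2 mod 4 = 0"
 by (auto elim!: evenE simp: power_mult_distrib)

lemma square_mod_4: "(x::nat) ^ 2 mod 4 ~= 2" "(x::nat) ^ 2 mod 4 ~= 3"
 using odd_square_mod_4[of x] even_square_mod_4[of x] by (cases "odd x"; simp)+

text \<open>For odd x the halves of z + x and z - x are coprime integers with product (y/2)^2, hence
  squares.\<close>

lemma pythagorean_param:
 fixes x y z :: nat
 assumes eq: "x ^ 2 + y ^ 2 = z ^ 2" and cop: "coprime x y" and x: "odd x"
 shows "even y \<and> (\<exists>m n. z = m ^ 2 + n ^ 2 \<and> x + n ^ 2 = m ^ 2 \<and> y = 2 * m * n \<and> coprime m n)"
proof -
 have ey: "even y"
 proof (rule ccontr)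
  assume "odd y"
  have "z ^ 2 mod 4 = (x ^ 2 mod 4 + y ^ 2 mod 4) mod 4" unfolding eq[symmetric] by (simp add: mod_add_eq)
  hence "z ^ 2 mod 4 = 2" using odd_square_mod_4[OF x] odd_square_mod_4[OF \<open>odd y\<close>] by simp
  thus False using square_mod_4 by blast
 qed
 have "odd (z ^ 2)" unfolding eq[symmetric] using x ey by simp
 hence oz: "odd z" by simp
 have "x ^ 2 \<le> z ^ 2" unfolding eq[symmetric] by (rule le_add1)
 hence xz: "x \<le> z" by (rule power2_le_imp_le) simp
 obtain k where k: "y = 2 * k" using ey by blast
 define A B where "A = (z + x) div 2" and "B = (z - x) div 2"
 have AB: "2 * A = z + x" "2 * B = z - x" unfolding A_def B_def using x oz xz by auto
 hence zx: "z = A + B" "A = B + x" using xz by auto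
 have "z = B + x + B" using zx by simp
 hence "x ^ 2 + 4 * (A * B) = z ^ 2" unfolding zx(2) by (simp add: power2_eq_square algebra_simps)
 hence "4 * (A * B) = y ^ 2" using eq by simp
 hence prod: "A * B = k ^ 2" unfolding k by (simp add: power_mult_distrib)
 have "coprime A B"
 proof (rule coprimeI)
  fix c assume c: "c dvd A" "c dvd B"
  hence cx: "c dvd x" using zx(2) by (metis dvd_add_right_iff)
  have "c dvd k ^ 2" using c prod by (metis dvd_mult)
  hence "c dvd y ^ 2" unfolding k by (simp add: power_mult_distrib)
  moreover have "coprime c (y ^ 2)" using coprime_divisors[OF cx dvd_refl cop] by simp
  ultimately show "is_unit c" using coprime_absorb_left by blast
 qed
 then obtain m n where mn: "A = m ^ 2" "B = n ^ 2" "k = m * n" using coprime_mult_eq_square[OF _ prod] by blast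
 hence "coprime m n" using \<open>coprime A B\<close> by simp
 thus ?thesis using mn zx k ey by (metis add.commute mult.assoc)
qed

text \<open>Fermat's descent on z: once common factors are removed, two successive parametrisations
  of Pythagorean triples yield a smaller solution.\<close>

lemma fermat_quartic_sum:
 fixes x y z :: nat
 assumes "x ^ 4 + y ^ 4 = z ^ 2" "x > 0" "y > 0"
 shows False
 using assms
proof (induction z arbitrary: x y rule: less_induct)
 case (less z)
 have z0: "z > 0" using less.prems by (cases z) auto
 show False
 proof (cases "coprime x y")
  case False
  define g where "g = gcd x y"
  have "g ~= 1" using False unfolding g_def coprime_iff_gcd_eq_1 .
  moreover have "g ~= 0" using less.prems by (simp add: g_def)
  ultimately have g1: "g > 1" by linarith
  have "g dvd x" "g dvd y" by (simp_all add: g_def)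
  then obtain x' y' where xy: "x = g * x'" "y = g * y'" by (elim dvdE)
  have "(g ^ 2) ^ 2 * (x' ^ 4 + y' ^ 4) = z ^ 2" using less.prems(1) unfolding xy by (simp add: power_mult_distrib distrib_left flip: power_mult)
  moreover from this have "(g ^ 2) ^ 2 dvd z ^ 2" by (metis dvd_triv_left)
  hence "g ^ 2 dvd z" by (simp only: pow_divides_pow_iff[OF pos2])
  then obtain z' where z': "z = g ^ 2 * z'" by blast
  ultimately have "(g ^ 2) ^ 2 * (x' ^ 4 + y' ^ 4) = (g ^ 2) ^ 2 * z' ^ 2" by (simp add: power_mult_distrib)
  hence e: "x' ^ 4 + y' ^ 4 = z' ^ 2" using g1 by simp
  have "z' > 0" using z0 z' by (cases z') auto
  moreover have "1 < g ^ 2" using g1 by (intro one_less_power) auto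
  ultimately have "z' < z" using z' by simp
  moreover have "x' > 0" "y' > 0" using less.prems xy by auto
  ultimately show False using less.IH[OF _ e] by blast
 next
  case cop: True
  have main: False if eq: "x ^ 4 + y ^ 4 = z ^ 2" and cop: "coprime x y" and x: "odd x" "x > 0" and y: "y > 0" for x y
  proof -
   have "(x ^ 2) ^ 2 + (y ^ 2) ^ 2 = z ^ 2" using eq by (simp flip: power_mult)
   from pythagorean_param[OF this] cop x obtain m n where ey: "even (y ^ 2)"
    and mn: "z = m ^ 2 + n ^ 2" "x ^ 2 + n ^ 2 = m ^ 2" "y ^ 2 = 2 * m * n" "coprime m n" by auto
   have n0: "n > 0" "m > 0" using mn(3) y by (auto intro: gr0I)
   have "coprime x n"
   proof (rule coprimeI)
    fix c assume c: "c dvd x" "c dvd n"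
    have "c dvd y ^ 2" unfolding mn(3) using c by simp
    moreover have "coprime c (y ^ 2)" using coprime_divisors[OF c(1) dvd_refl cop] by simp
    ultimately show "is_unit c" using coprime_absorb_left by blast
   qed
   from pythagorean_param[OF mn(2) this x(1)] obtain a b where en: "even n"
    and ab: "m = a ^ 2 + b ^ 2" "x + b ^ 2 = a ^ 2" "n = 2 * a * b" "coprime a b" by auto
   obtain y' where y': "y = 2 * y'" using ey by auto
   have "m * (a * b) = y' ^ 2" using mn(3) unfolding ab(3) y' by (simp add: power_mult_distrib)
   moreover have "coprime m (a * b)" using mn(4) unfolding ab(3) by simp
   ultimately obtain k l where kl: "m = k ^ 2" "a * b = l ^ 2" using coprime_mult_eq_square by blast
   obtain \<alpha> \<beta> where al: "a = \<alpha> ^ 2" "b = \<beta> ^ 2" using coprime_mult_eq_square[OF ab(4) kl(2)] by blast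
   have e: "\<alpha> ^ 4 + \<beta> ^ 4 = k ^ 2" using kl(1) ab(1) unfolding al by (simp flip: power_mult)
   have "\<alpha> > 0" "\<beta> > 0" using n0(1) unfolding ab(3) al by auto
   moreover have "k < z"
   proof -
    have "k \<le> k ^ 2" by (simp add: power2_eq_square)
    also have "\<dots> = m" using kl by simp
    also have "m \<le> m ^ 2" by (simp add: power2_eq_square)
    also have "\<dots> < z" using mn(1) n0 by simp
    finally show ?thesis .
   qed
   ultimately show False using less.IH[OF _ e] by blast
  qed
  have "odd x \<or> odd y" using coprime_common_divisor[OF cop, of 2] by auto
  thus False using main[OF less.prems(1) cop] main[of y x] less.prems cop by (auto simp: add.commute coprime_commute)
 qed
qed

text \<open>For coprime k and l with k even, reduction modulo 4 gives a contradiction. For odd k,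
  the triple x, 2 l^2, k^2 is Pythagorean with parameters that are squares, so k^2 is a sum of two
  fourth powers.\<close>

lemma fermat_quartic_diff_4:
 fixes k l x :: nat
 assumes "k ^ 4 = x ^ 2 + 4 * l ^ 4" "l > 0"
 shows False
proof -
 define g where "g = gcd k l"
 have g0: "g > 0" using assms(2) by (simp add: g_def)
 obtain k' l' where kl: "k = g * k'" "l = g * l'" "coprime k' l'"
  using gcd_coprime_exists[of k l] g0 unfolding g_def by (auto simp: mult.commute)
 have e: "(g ^ 2) ^ 2 * k' ^ 4 = x ^ 2 + (g ^ 2) ^ 2 * (4 * l' ^ 4)"
  using assms(1) unfolding kl by (simp add: power_mult_distrib mult.left_commute flip: power_mult)
 hence "(g ^ 2) ^ 2 dvd x ^ 2" by (metis dvd_add_left_iff dvd_triv_left)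
 hence "g ^ 2 dvd x" by (simp only: pow_divides_pow_iff[OF pos2])
 then obtain x' where x': "x = g ^ 2 * x'" by blast
 have "(g ^ 2) ^ 2 * k' ^ 4 = (g ^ 2) ^ 2 * (x' ^ 2 + 4 * l' ^ 4)" using e unfolding x' by (simp only: power_mult_distrib distrib_left)
 hence eq: "k' ^ 4 = x' ^ 2 + 4 * l' ^ 4" using g0 by simp
 have l0: "l' > 0" using kl assms(2) by auto
 show False
 proof (cases "even k'")
  case True
  then obtain k2 where k2: "k' = 2 * k2" by blast
  have "even (x' ^ 2)" using arg_cong[OF eq, of even] True by simp
  then obtain x2 where x2: "x' = 2 * x2" by auto
  have "4 * k2 ^ 4 = x2 ^ 2 + (l' ^ 2) ^ 2" using eq unfolding k2 x2 by (simp add: power_mult_distrib flip: power_mult)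
  hence "(x2 ^ 2 mod 4 + (l' ^ 2) ^ 2 mod 4) mod 4 = 0" by (metis mod_add_eq mod_mult_self1_is_0)
  moreover have "odd l'" using coprime_common_divisor[OF kl(3), of 2] True by auto
  hence "(l' ^ 2) ^ 2 mod 4 = 1" using odd_square_mod_4[of "l' ^ 2"] by simp
  moreover have "x2 ^ 2 mod 4 = 0 \<or> x2 ^ 2 mod 4 = 1" using odd_square_mod_4 even_square_mod_4 by blast
  ultimately show False by (auto simp flip: numeral_2_eq_2)
 next
  case False
  have eq2: "x' ^ 2 + (2 * l' ^ 2) ^ 2 = (k' ^ 2) ^ 2" using eq by (simp add: power_mult_distrib flip: power_mult)
  have "odd (x' ^ 2)" using arg_cong[OF eq, of even] False by simp
  hence ox: "odd x'" by simp
  have "coprime x' l'"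
  proof (rule coprimeI)
   fix c assume c: "c dvd x'" "c dvd l'"
   have "c dvd x' ^ 2 + 4 * l' ^ 4" using c by (simp add: eval_nat_numeral)
   hence "c dvd k' ^ 4" unfolding eq .
   moreover have "coprime c (k' ^ 4)" using coprime_divisors[OF dvd_refl c(2) kl(3)] by (simp add: coprime_commute)
   ultimately show "is_unit c" using coprime_absorb_left by blast
  qed
  hence "coprime x' (2 * l' ^ 2)" using ox by simp
  from pythagorean_param[OF eq2 this ox] obtain a b
   where ab: "k' ^ 2 = a ^ 2 + b ^ 2" "2 * l' ^ 2 = 2 * a * b" "coprime a b" by auto
  then obtain \<alpha> \<beta> where al: "a = \<alpha> ^ 2" "b = \<beta> ^ 2" using coprime_mult_eq_square[of a b l'] by auto
  have "\<alpha> ^ 4 + \<beta> ^ 4 = k' ^ 2" using ab(1) unfolding al by (simp flip: power_mult)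
  moreover have "\<alpha> > 0" "\<beta> > 0" using ab(2) l0 unfolding al by (auto intro!: gr0I)
  ultimately show False using fermat_quartic_sum by blast
 qed
qed

lemma rat_square_int:
 fixes r :: rat
 assumes "r ^ 2 = of_int n" shows "\<exists>m. r = of_int m"
proof -
 obtain a b where ab: "quotient_of r = (a, b)" by (cases "quotient_of r")
 have b: "b > 0" "coprime a b" "r = of_int a / of_int b"
  using ab quotient_of_denom_pos quotient_of_coprime quotient_of_div by auto
 have "of_int (a ^ 2) = (of_int (n * b ^ 2) :: rat)" using assms b by (simp add: power_divide field_simps)
 hence "a ^ 2 = n * b ^ 2" by (simp only: of_int_eq_iff)
 hence "b dvd a ^ 2" by (simp add: power2_eq_square)
 moreover have "coprime b (a ^ 2)" using b(2) by (simp add: coprime_commute)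
 ultimately have "is_unit b" using coprime_absorb_left by blast
 hence "b = 1" using b(1) by simp
 thus ?thesis using b by auto
qed

lemma rat_common_denominator:
 fixes x y :: rat
 shows "\<exists>a b q. q > 0 \<and> x = of_int a / of_int q \<and> y = of_int b / of_int q"
proof -
 obtain a c where ac: "quotient_of x = (a, c)" by (cases "quotient_of x")
 obtain b d where bd: "quotient_of y = (b, d)" by (cases "quotient_of y")
 have "c > 0" "x = of_int a / of_int c" "d > 0" "y = of_int b / of_int d"
  using ac bd quotient_of_denom_pos quotient_of_div by auto
 thus ?thesis by (intro exI[of _ "a * d"] exI[of _ "b * c"] exI[of _ "c * d"]) auto
qed

lemma rat_quartic_sum:
 fixes x y z :: rat
 assumes "x ^ 4 + y ^ 4 = z ^ 2" "x ~= 0" "y ~= 0"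
 shows False
proof -
 obtain a b q where q: "q > 0" "x = of_int a / of_int q" "y = of_int b / of_int q" using rat_common_denominator by blast
 have e0: "(z * of_int q ^ 2) ^ 2 = (x ^ 4 + y ^ 4) * of_int q ^ 4" unfolding assms(1) by (simp add: power_mult_distrib flip: power_mult)
 have "of_int a = x * of_int q" "of_int b = y * of_int q" using q by auto
 hence aq: "(x ^ 4 + y ^ 4) * of_int q ^ 4 = of_int (a ^ 4 + b ^ 4)" by (simp add: power_mult_distrib distrib_right)
 with e0 have e: "(z * of_int q ^ 2) ^ 2 = of_int (a ^ 4 + b ^ 4)" by simp
 then obtain m where "z * of_int q ^ 2 = of_int m" using rat_square_int by blast
 hence "of_int (m ^ 2) = (of_int (a ^ 4 + b ^ 4) :: rat)" using e by simp
 hence m: "m ^ 2 = a ^ 4 + b ^ 4" by (simp only: of_int_eq_iff)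
 have "int (nat \<bar>a\<bar> ^ 4 + nat \<bar>b\<bar> ^ 4) = int (nat \<bar>m\<bar> ^ 2)" using m by simp
 hence "nat \<bar>a\<bar> ^ 4 + nat \<bar>b\<bar> ^ 4 = nat \<bar>m\<bar> ^ 2" by (simp only: of_nat_eq_iff)
 moreover have "a ~= 0" "b ~= 0" using assms q by auto
 ultimately show False using fermat_quartic_sum[of "nat \<bar>a\<bar>" "nat \<bar>b\<bar>"] by auto
qed

lemma rat_quartic_diff_4:
 fixes x y z :: rat
 assumes "x ^ 4 - 4 * y ^ 4 = z ^ 2" "y ~= 0"
 shows False
proof -
 obtain a b q where q: "q > 0" "x = of_int a / of_int q" "y = of_int b / of_int q" using rat_common_denominator by blast
 have e0: "(z * of_int q ^ 2) ^ 2 = (x ^ 4 - 4 * y ^ 4) * of_int q ^ 4" unfolding assms(1) by (simp add: power_mult_distrib flip: power_mult)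
 have "of_int a = x * of_int q" "of_int b = y * of_int q" using q by auto
 hence aq: "(x ^ 4 - 4 * y ^ 4) * of_int q ^ 4 = of_int (a ^ 4 - 4 * b ^ 4)" by (simp add: power_mult_distrib left_diff_distrib)
 with e0 have e: "(z * of_int q ^ 2) ^ 2 = of_int (a ^ 4 - 4 * b ^ 4)" by simp
 then obtain m where "z * of_int q ^ 2 = of_int m" using rat_square_int by blast
 hence "of_int (m ^ 2) = (of_int (a ^ 4 - 4 * b ^ 4) :: rat)" using e by simp
 hence m: "m ^ 2 = a ^ 4 - 4 * b ^ 4" by (simp only: of_int_eq_iff)
 have "int (nat \<bar>a\<bar> ^ 4) = int (nat \<bar>m\<bar> ^ 2 + 4 * nat \<bar>b\<bar> ^ 4)" using m by simp
 hence "nat \<bar>a\<bar> ^ 4 = nat \<bar>m\<bar> ^ 2 + 4 * nat \<bar>b\<bar> ^ 4" by (simp only: of_nat_eq_iff)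
 moreover have "b ~= 0" using assms q by auto
 ultimately show False using fermat_quartic_diff_4[of "nat \<bar>a\<bar>" _ "nat \<bar>b\<bar>"] by auto
qed

lemma square_mod_16: "(N::int) ^ 2 mod 16 \<in> {0, 1, 4, 9}"
proof -
 have "N mod 16 \<in> {0..15}" by auto
 hence c: "N mod 16 \<in> {0,1,2,3,4,5,6,7,8,9,10,11,12,13,14,15}" by (simp only: atLeastAtMost_iff insert_iff empty_iff) presburger
 have "N ^ 2 mod 16 = (N mod 16) ^ 2 mod 16" by (simp add: power_mod)
 thus ?thesis using c by (elim insertE emptyE) auto
qed

text \<open>An obstruction at 2: for x = a / q in lowest terms the equation forces first q and then
  a to be even.\<close>

lemma rat_quartic_even:
 fixes x y e :: rat
 assumes "1 - 4 * x ^ 4 = 2 * e * y ^ 2" "e = 1 \<or> e = - 1"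
 shows False
proof -
 obtain a q where aq: "quotient_of x = (a, q)" by (cases "quotient_of x")
 have q: "q > 0" "coprime a q" "x = of_int a / of_int q"
  using aq quotient_of_denom_pos quotient_of_coprime quotient_of_div by auto
 obtain f :: int where f: "e = of_int f" "f = 1 \<or> f = - 1" using assms(2) by (metis of_int_1 of_int_minus)
 have ff: "e * e = 1" using assms(2) by auto
 have "(2 * y * of_int q ^ 2) ^ 2 = 2 * e * (2 * e * y ^ 2) * of_int q ^ 4"
  using ff by (simp add: power_mult_distrib flip: power_mult)
 also have "\<dots> = of_int (f * (2 * q ^ 4 - 8 * a ^ 4))"
 proof -
  have "of_int a = x * of_int q" "of_int f = e" using q f by auto
  thus ?thesis unfolding assms(1)[symmetric] by (simp add: power_mult_distrib algebra_simps)
 qed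
 finally have e: "(2 * y * of_int q ^ 2) ^ 2 = of_int (f * (2 * q ^ 4 - 8 * a ^ 4))" .
 then obtain m where "2 * y * of_int q ^ 2 = of_int m" using rat_square_int by blast
 hence "of_int (m ^ 2) = (of_int (f * (2 * q ^ 4 - 8 * a ^ 4)) :: rat)" using e by simp
 hence m: "m ^ 2 = f * (2 * q ^ 4 - 8 * a ^ 4)" by (simp only: of_int_eq_iff)
 have "even (m ^ 2)" unfolding m by simp
 then obtain k where k: "m = 2 * k" by auto
 have k2: "2 * k ^ 2 = f * (q ^ 4 - 4 * a ^ 4)" using m unfolding k by (simp add: power_mult_distrib algebra_simps)
 hence "even (f * (q ^ 4 - 4 * a ^ 4))" by (metis dvd_triv_left)
 hence eq: "even q" using f(2) by auto
 then obtain c where c: "q = 2 * c" by blast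
 have k3: "k ^ 2 = f * (8 * c ^ 4 - 2 * a ^ 4)" using k2 unfolding c by (simp add: power_mult_distrib algebra_simps)
 hence "even (k ^ 2)" by simp
 then obtain l where l: "k = 2 * l" by auto
 have "2 * l ^ 2 = f * (4 * c ^ 4 - a ^ 4)" using k3 unfolding l by (simp add: power_mult_distrib algebra_simps)
 hence "even (f * (4 * c ^ 4 - a ^ 4))" by (metis dvd_triv_left)
 hence "even a" using f(2) by auto
 thus False using coprime_common_divisor[OF q(2), of 2] eq by auto
qed

section \<open>General Weierstrass equations\<close>

text \<open>This is - c4 / 48, and \<open>short_B\<close> is - c6 / 864, in the usual notation for
  Weierstrass equations.\<close>

definition short_A :: "'a::field weierstrass => 'a" where
 "short_A E = - ((wc_a1 E ^ 2 + 4 * wc_a2 E) ^ 2 - 24 * (2 * wc_a4 E + wc_a1 E * wc_a3 E)) / 48"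

definition short_B :: "'a::field weierstrass => 'a" where
 "short_B E = ((wc_a1 E ^ 2 + 4 * wc_a2 E) ^ 3
   - 36 * (wc_a1 E ^ 2 + 4 * wc_a2 E) * (2 * wc_a4 E + wc_a1 E * wc_a3 E)
   + 216 * (wc_a3 E ^ 2 + 4 * wc_a6 E)) / 864"

lemma discriminant_short:
 fixes E :: "'a::field_char_0 weierstrass"
 shows "wc_discriminant E = - 16 * (4 * short_A E ^ 3 + 27 * short_B E ^ 2)"
 unfolding wc_discriminant_def short_A_def short_B_def Let_def by (cases E) (simp add: field_simps, simp add: algebra_simps eval_nat_numeral)

lemma wc_isomorphic_short:
 fixes E :: "rat weierstrass"
 assumes "u ~= 0" "u ^ 4 * A = short_A E" "u ^ 6 * B = short_B E"
 shows "wc_isomorphic E (Weierstrass 0 0 0 A B)"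
proof -
 define c1 c3 \<rho> where "c1 = wc_a1 E / 2" and "c3 = wc_a3 E / 2" and "\<rho> = (wc_a1 E ^ 2 + 4 * wc_a2 E) / 12"
 have a: "wc_a1 E = 2 * c1" "wc_a3 E = 2 * c3" "wc_a2 E = 3 * \<rho> - c1 ^ 2"
  by (simp_all add: c1_def c3_def \<rho>_def power_divide)
 have A: "short_A E = wc_a4 E + 2 * c1 * c3 - 3 * \<rho> ^ 2"
  unfolding short_A_def a by (simp add: field_simps)
 have B: "short_B E = 2 * \<rho> ^ 3 - \<rho> * (wc_a4 E + 2 * c1 * c3) + c3 ^ 2 + wc_a6 E"
  unfolding short_B_def a by (simp add: field_simps)
 \<comment> \<open>The witnesses complete the square in y and remove the x^2 term: r = - b2 / 12, s
   = - a1 / 2, and t is then determined by a3.\<close>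
 show ?thesis unfolding wc_isomorphic_def weierstrass.sel a
  by (rule exI[of _ u], rule exI[of _ "- \<rho>"], rule exI[of _ "- c1"], rule exI[of _ "\<rho> * c1 - c3"], intro conjI assms(1))
   (use assms(2,3)[unfolded A B] in \<open>simp_all add: algebra_simps eval_nat_numeral\<close>)
qed

fun to_short :: "'a::field weierstrass => 'a point => 'a point" where
 "to_short E Infinity = Infinity"
| "to_short E (Affine x y) = Affine (x + (wc_a1 E ^ 2 + 4 * wc_a2 E) / 12) (y + (wc_a1 E * x + wc_a3 E) / 2)"

lemma wc_poly_short:
 fixes E :: "'a::field_char_0 weierstrass"
 shows "wc_poly E x y = (y + (wc_a1 E * x + wc_a3 E) / 2) ^ 2
  - ((x + (wc_a1 E ^ 2 + 4 * wc_a2 E) / 12) ^ 3 + short_A E * (x + (wc_a1 E ^ 2 + 4 * wc_a2 E) / 12) + short_B E)"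
 unfolding wc_poly_def short_A_def short_B_def by (cases E) (simp add: field_simps, simp add: algebra_simps eval_nat_numeral)

locale weierstrass_short = fixes E :: "'k::{alg_closed_field,field_char_0} weierstrass"
 assumes disc: "wc_discriminant E ~= 0"

sublocale weierstrass_short \<subseteq> short_weierstrass "short_A E" "short_B E"
proof
 show "4 * short_A E ^ 3 + 27 * short_B E ^ 2 ~= 0"
 proof
  assume "4 * short_A E ^ 3 + 27 * short_B E ^ 2 = 0"
  hence "wc_discriminant E = 0" unfolding discriminant_short by simp
  thus False using disc by simp
 qed
qed

context weierstrass_short
begin

lemma to_short_in_C: "to_short E P \<in> C \<longleftrightarrow> on_curve E P"
 by (cases P) (simp_all add: Affine_in_C rhs_def wc_poly_short)

lemma to_short_inj: "to_short E P = to_short E Q \<longleftrightarrow> P = Q"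
 by (cases P; cases Q) auto

lemma to_short_surj: "\<exists>Q. to_short E Q = P"
proof (cases P)
 case (Affine x y)
 let ?x = "x - (wc_a1 E ^ 2 + 4 * wc_a2 E) / 12"
 show ?thesis by (rule exI[of _ "Affine ?x (y - (wc_a1 E * ?x + wc_a3 E) / 2)"]) (simp add: Affine)
qed (auto intro: exI[of _ Infinity])

lemma to_short_add:
 assumes "on_curve E P" "on_curve E Q"
 shows "to_short E (point_add E P Q) = padd (to_short E P) (to_short E Q)"
proof (cases "P = Infinity \<or> Q = Infinity")
 case True thus ?thesis by (cases P; cases Q) auto
next
 case False
 then obtain x1 y1 x2 y2 where PQ: "P = Affine x1 y1" "Q = Affine x2 y2" by (cases P; cases Q) auto
 define \<beta> where "\<beta> = (wc_a1 E ^ 2 + 4 * wc_a2 E) / 12"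
 let ?P = "to_short E P" and ?Q = "to_short E Q"
 have C: "?P \<in> C" "?Q \<in> C" using assms to_short_in_C by auto
 have neg: "?P = pneg ?Q \<longleftrightarrow> x1 = x2 \<and> y1 + y2 + wc_a1 E * x2 + wc_a3 E = 0"
 proof -
  have sum: "y1 + (wc_a1 E * x1 + wc_a3 E) / 2 + (y2 + (wc_a1 E * x2 + wc_a3 E) / 2) = y1 + y2 + wc_a1 E * x2 + wc_a3 E" if "x1 = x2"
   unfolding that by (simp add: field_simps)
  have "?P = pneg ?Q \<longleftrightarrow> x1 = x2 \<and> y1 + (wc_a1 E * x1 + wc_a3 E) / 2 + (y2 + (wc_a1 E * x2 + wc_a3 E) / 2) = 0"
   unfolding PQ to_short.simps pneg.simps point.inject eq_neg_iff_add_eq_0 by simp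
  also have "\<dots> \<longleftrightarrow> x1 = x2 \<and> y1 + y2 + wc_a1 E * x2 + wc_a3 E = 0"
   by (rule conj_cong[OF refl]) (drule sum, simp only:)
  finally show ?thesis .
 qed
 show ?thesis
 proof (cases "?P = pneg ?Q")
  case True
  hence cond: "x1 = x2 \<and> y1 + y2 + wc_a1 E * x2 + wc_a3 E = 0" using neg by blast
  have "point_add E P Q = Infinity" unfolding PQ point_add.simps using cond by (simp only: if_True simp_thms)
  moreover have "padd ?P ?Q = Infinity" unfolding True by simp
  ultimately show ?thesis by simp
 next
  case ne: False
  define l where "l = (if x1 = x2 then (3 * x1 ^ 2 + 2 * wc_a2 E * x1 + wc_a4 E - wc_a1 E * y1)
             / (2 * y1 + wc_a1 E * x1 + wc_a3 E) else (y2 - y1) / (x2 - x1))"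
  have sl: "slope ?P ?Q = l + wc_a1 E / 2"
  proof (cases "x1 = x2")
   case x: True
   have "?P = ?Q" using same_x[OF C] ne x unfolding PQ by auto
   hence "?P ~= pneg ?P" using ne by simp
   hence nz: "2 * y1 + wc_a1 E * x1 + wc_a3 E ~= 0"
   proof -
    have "2 * y1 + wc_a1 E * x1 + wc_a3 E = 2 * (y1 + (wc_a1 E * x1 + wc_a3 E) / 2)" by (simp add: field_simps)
    thus ?thesis using \<open>?P ~= pneg ?P\<close> unfolding PQ by (auto simp: eq_neg_iff_add_eq_0 algebra_simps)
   qed
   have "slope ?P ?Q = (3 * (x1 + \<beta>) ^ 2 + short_A E) / (2 * y1 + wc_a1 E * x1 + wc_a3 E)"
    unfolding slope_def PQ \<beta>_def using x by (simp add: algebra_simps)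
   also have "3 * (x1 + \<beta>) ^ 2 + short_A E = (3 * x1 ^ 2 + 2 * wc_a2 E * x1 + wc_a4 E - wc_a1 E * y1)
     + wc_a1 E / 2 * (2 * y1 + wc_a1 E * x1 + wc_a3 E)"
    unfolding \<beta>_def short_A_def by (simp add: field_simps eval_nat_numeral)
   also have "\<dots> / (2 * y1 + wc_a1 E * x1 + wc_a3 E) = l + wc_a1 E / 2"
    using nz x unfolding l_def add_divide_distrib by (simp only: if_True nonzero_mult_div_cancel_right not_False_eq_True simp_thms)
   finally show ?thesis .
  next
   case x: False
   thus ?thesis unfolding slope_def PQ l_def by (simp add: divide_simps) (simp add: algebra_simps)
  qed
  have add: "point_add E P Q = Affine (l ^ 2 + wc_a1 E * l - wc_a2 E - x1 - x2)
   (- (l + wc_a1 E) * (l ^ 2 + wc_a1 E * l - wc_a2 E - x1 - x2) - (y1 - l * x1) - wc_a3 E)"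
  proof -
   have "\<not> (x1 = x2 \<and> y1 + y2 + wc_a1 E * x2 + wc_a3 E = 0)" using ne neg by blast
   thus ?thesis unfolding PQ point_add.simps l_def Let_def by (simp only: if_False)
  qed
  have "padd ?P ?Q = Affine ((l + wc_a1 E / 2) ^ 2 - xc ?P - xc ?Q)
   (- (yc ?P + (l + wc_a1 E / 2) * (((l + wc_a1 E / 2) ^ 2 - xc ?P - xc ?Q) - xc ?P)))"
   using padd_affine[OF C _ _ ne, unfolded sl] by (simp add: PQ)
  moreover define c1 c3 where "c1 = wc_a1 E / 2" and "c3 = wc_a3 E / 2"
  have coeffs: "wc_a1 E = 2 * c1" "wc_a3 E = 2 * c3" "wc_a2 E = 3 * \<beta> - c1 ^ 2"
   by (simp_all add: c1_def c3_def \<beta>_def power_divide field_simps)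
  have red: "to_short E (Affine x y) = Affine (x + \<beta>) (y + c1 * x + c3)" for x y
   by (simp add: \<beta>_def c1_def c3_def add_divide_distrib)
  ultimately have P: "padd ?P ?Q = Affine ((l + c1) ^ 2 - xc ?P - xc ?Q)
   (- (yc ?P + (l + c1) * (((l + c1) ^ 2 - xc ?P - xc ?Q) - xc ?P)))" by (simp only: c1_def)
  show ?thesis unfolding P add unfolding PQ red xc.simps yc.simps coeffs point.inject
   by (intro conjI) (simp_all add: algebra_simps power2_eq_square)
 qed
qed

lemma to_short_mult:
 assumes "on_curve E P"
 shows "to_short E (point_mult E n P) = pmul n (to_short E P) \<and> on_curve E (point_mult E n P)"
proof (induction n)
 case (Suc n)
 have "to_short E (point_mult E (Suc n) P) = pmul (Suc n) (to_short E P)" using Suc assms by (simp add: to_short_add)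
 moreover have "pmul (Suc n) (to_short E P) \<in> C" using assms to_short_in_C by (intro pmul_in_C) simp
 ultimately show ?case unfolding to_short_in_C[symmetric] by (simp only: simp_thms)
qed auto

lemma to_short_torsion: "on_curve E P \<and> point_mult E n P = Infinity \<longleftrightarrow> to_short E P \<in> tors n"
proof -
 have "to_short E R = Infinity \<longleftrightarrow> R = Infinity" for R by (cases R) auto
 from this[of "point_mult E n P"] show ?thesis
  unfolding tors_def mem_Collect_eq to_short_in_C using to_short_mult[of P n] by auto
qed

end

section \<open>Division fields and the automorphisms fixing torsion\<close>

lemma aut_fixes_rat_adjoin:
 assumes s: "field_aut sg" and fx: "\<And>x. x \<in> S ==> sg x = x" and x: "x \<in> rat_adjoin S"
 shows "sg x = x"
proof -
 interpret R: field "ring_of_type_algebra :: qbar ring" by (rule field_from_type_algebra)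
 note d = ring_of_type_algebra_def
 show ?thesis using x unfolding rat_adjoin_def
 proof (induction rule: generate_field.induct)
  case one thus ?case using aut_1[OF s] by (simp add: d)
 next
  case (incl h) thus ?case by (rule fx)
 next
  case (a_inv h)
  have "h + (\<ominus>\<^bsub>ring_of_type_algebra\<^esub> h) = 0" using R.r_neg[of h] by (simp add: d)
  hence e: "\<ominus>\<^bsub>ring_of_type_algebra\<^esub> h = - h" by (simp add: add_eq_0_iff)
  show ?case unfolding e using a_inv aut_minus[OF s] by simp
 next
  case (m_inv h)
  have h: "h ~= 0" using m_inv by (simp add: d)
  have "h \<in> Units ring_of_type_algebra" using h by (subst R.field_Units) (simp add: d)
  hence "h * (inv\<^bsub>ring_of_type_algebra\<^esub> h) = 1" using R.Units_r_inv[of h] by (simp add: d)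
  hence e: "inv\<^bsub>ring_of_type_algebra\<^esub> h = inverse h" using h by (simp add: field_simps)
  show ?case unfolding e using m_inv aut_inverse[OF s] by simp
 next
  case (eng_add g h) thus ?case using aut_add[OF s] by (simp add: d)
 next
  case (eng_mult g h) thus ?case using aut_mult[OF s] by (simp add: d)
 qed
qed

locale rational_weierstrass = fixes E :: "rat weierstrass" assumes ell: "elliptic_curve E"
begin

abbreviation Eb :: "qbar weierstrass" where "Eb \<equiv> map_weierstrass to_ac E"

lemma Eb_simps: "wc_a1 Eb = to_ac (wc_a1 E)" "wc_a2 Eb = to_ac (wc_a2 E)" "wc_a3 Eb = to_ac (wc_a3 E)"
 "wc_a4 Eb = to_ac (wc_a4 E)" "wc_a6 Eb = to_ac (wc_a6 E)"
 by (cases E; simp)+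

lemma short_Eb: "short_A Eb = to_ac (short_A E)" "short_B Eb = to_ac (short_B E)"
 by (simp_all add: short_A_def short_B_def Eb_simps)

end

sublocale rational_weierstrass \<subseteq> S: weierstrass_short "map_weierstrass to_ac E"
proof
 have "wc_discriminant (map_weierstrass to_ac E) = to_ac (wc_discriminant E)"
  unfolding discriminant_short short_Eb by simp
 thus "wc_discriminant (map_weierstrass to_ac E) ~= 0" using ell by (simp add: elliptic_curve_def)
qed

sublocale rational_weierstrass \<subseteq> R: rational_curve "short_A (map_weierstrass to_ac E)" "short_B (map_weierstrass to_ac E)"
 by standard (simp_all add: short_Eb aut_rat)

context rational_weierstrass
begin

lemma act_to_short: "field_aut sg ==> map_point sg (to_short Eb P) = to_short Eb (map_point sg P)"
 by (cases P) (simp_all add: aut_simps Eb_simps aut_rat)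

lemma torsion_points_short: "P \<in> torsion_points E N \<longleftrightarrow> to_short Eb P \<in> S.tors N"
 using S.to_short_torsion[of P N] by (simp add: torsion_points_def Let_def)

lemma fixes_torsion_iff:
 assumes s: "field_aut sg"
 shows "(\<forall>P\<in>S.tors N. map_point sg P = P) \<longleftrightarrow> (\<forall>x\<in>(\<Union>P\<in>torsion_points E N. point_coords P). sg x = x)"
proof -
 have pc: "map_point sg P = P \<longleftrightarrow> (\<forall>x\<in>point_coords P. sg x = x)" for P by (cases P) auto
 have "(\<forall>P\<in>S.tors N. map_point sg P = P) \<longleftrightarrow> (\<forall>P\<in>torsion_points E N. map_point sg P = P)"
  by (metis S.to_short_surj S.to_short_inj torsion_points_short act_to_short[OF s])
 thus ?thesis by (auto simp: pc)
qed

lemma fixes_division_field: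
 assumes "field_aut sg" "\<And>P. P \<in> S.tors N ==> map_point sg P = P" "x \<in> division_field E N"
 shows "sg x = x"
 using aut_fixes_rat_adjoin[OF assms(1) _ assms(3)[unfolded division_field_def]] fixes_torsion_iff[OF assms(1)] assms(2)
 by blast

text \<open>An equality of division fields enters the proof only in this form.\<close>

lemma fixes_tors_if_division_field_eq:
 assumes eq: "division_field E M = division_field E N" and s: "field_aut sg"
  and fx: "\<And>P. P \<in> S.tors N ==> map_point sg P = P" and P: "P \<in> S.tors M"
 shows "map_point sg P = P"
proof -
 have "sg x = x" if "x \<in> (\<Union>P\<in>torsion_points E M. point_coords P)" for x
 proof (rule fixes_division_field[OF s fx])
  show "x \<in> division_field E N" unfolding eq[symmetric] unfolding division_field_def rat_adjoin_def
   using that by (rule generate_field.incl)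
 qed
 thus ?thesis using fixes_torsion_iff[OF s, of M] P by blast
qed

lemma odd_prime_division_field_neq:
 assumes p: "Factorial_Ring.prime p" "odd p" and n: "n \<ge> 1"
 shows "division_field E (p ^ (n + 1)) ~= division_field E (p ^ n)"
proof
 assume eq: "division_field E (p ^ (n + 1)) = division_field E (p ^ n)"
 show False
  by (rule R.cyclotomic_fixed_if_tors_fixed[OF p n]) (use fixes_tors_if_division_field_eq[OF eq] in auto)
qed

lemma odd_prime_root_of_unity_notin:
 assumes p: "Factorial_Ring.prime p" "odd p" and n: "n \<ge> 1" and z: "primitive_root_of_unity (p ^ (n + 1)) \<zeta>"
 shows "\<zeta> \<notin> division_field E (p ^ n)"
proof
 assume mem: "\<zeta> \<in> division_field E (p ^ n)"
 show False
  by (rule R.cyclotomic_not_fixed[OF p n, of \<zeta>]) (use fixes_division_field[OF _ _ mem] z in auto)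
qed

end

section \<open>Halving points\<close>

text \<open>Together with the abscissas of the 2-torsion, these generate the coordinates of
  E[4].\<close>

definition rad4 :: "qbar set => qbar set" where
 "rad4 S = {\<rho>. \<exists>u\<in>S. \<exists>v\<in>S. u ~= v \<and> \<rho> ^ 2 = u - v}"

text \<open>The half of (u, 0) has abscissa u + r s, whose differences to u, v, w are r s, r (r + s)
  and s (r + s); their square roots are needed to halve once more.\<close>

definition rad8 :: "qbar set => qbar set" where
 "rad8 S = {\<rho>. \<exists>u\<in>S. \<exists>v\<in>S. \<exists>w\<in>S. u ~= v \<and> u ~= w \<and> v ~= w \<and>
  (\<exists>r s. r ^ 2 = u - v \<and> s ^ 2 = u - w \<and> (\<rho> ^ 2 = r * s \<or> \<rho> ^ 2 = r * (r + s)))}"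

context rational_curve
begin

definition roots2 :: "qbar set" where "roots2 = {x. rhs x = 0}"

lemma tors_2: "tors 2 = insert Infinity ((\<lambda>e. Affine e 0) ` roots2)"
proof -
 have "P \<in> tors 2 \<longleftrightarrow> P = Infinity \<or> (\<exists>e\<in>roots2. P = Affine e 0)" for P
 proof (cases P)
  case (Affine x y)
  have "P \<in> tors 2 \<longleftrightarrow> P \<in> C \<and> P \<uplus> P = Infinity" by (simp add: tors_def numeral_2_eq_2)
  also have "\<dots> \<longleftrightarrow> P \<in> C \<and> P = pneg P" using padd_eq_Infinity by blast
  also have "\<dots> \<longleftrightarrow> rhs x = 0 \<and> y = 0" using Affine by (auto simp: Affine_in_C eq_neg_iff_add_eq_0)
  finally show ?thesis using Affine by (auto simp: roots2_def)
 qed simp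
 thus ?thesis by blast
qed

lemma card_roots2: "card roots2 = 3"
proof -
 have fin: "finite ((\<lambda>e::qbar. Affine e 0) ` roots2)" using finite_tors[of 2] unfolding tors_2 by simp
 have inj: "inj_on (\<lambda>e::qbar. Affine e 0) roots2" by (auto simp: inj_on_def)
 have "card (tors 2) = Suc (card ((\<lambda>e::qbar. Affine e 0) ` roots2))" unfolding tors_2 using fin by (subst card_insert_disjoint) auto
 thus ?thesis using card_tors[of 2] card_image[OF inj] by simp
qed

lemma roots2_factor:
 assumes "u \<in> roots2" "v \<in> roots2" "w \<in> roots2" "u ~= v" "u ~= w" "v ~= w"
 shows "u + v + w = 0" "a = u * v + u * w + v * w" "b = - (u * v * w)" "rhs x = (x - u) * (x - v) * (x - w)"
proof -
 have r: "u ^ 3 + a * u + b = 0" "v ^ 3 + a * v + b = 0" "w ^ 3 + a * w + b = 0" using assms by (auto simp: roots2_def rhs_def)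
 have "(u - v) * (u ^ 2 + u * v + v ^ 2 + a) = (u ^ 3 + a * u + b) - (v ^ 3 + a * v + b)"
  by (simp add: algebra_simps eval_nat_numeral)
 hence 1: "u ^ 2 + u * v + v ^ 2 + a = 0" using r assms by simp
 have "(u - w) * (u ^ 2 + u * w + w ^ 2 + a) = (u ^ 3 + a * u + b) - (w ^ 3 + a * w + b)"
  by (simp add: algebra_simps eval_nat_numeral)
 hence 2: "u ^ 2 + u * w + w ^ 2 + a = 0" using r assms by simp
 have "(v - w) * (u + v + w) = (u ^ 2 + u * v + v ^ 2 + a) - (u ^ 2 + u * w + w ^ 2 + a)"
  by (simp add: algebra_simps eval_nat_numeral)
 thus s: "u + v + w = 0" using 1 2 assms by simp
 hence w: "w = - u - v" by (simp add: eq_neg_iff_add_eq_0 algebra_simps)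
 have "a = - (u ^ 2 + u * v + v ^ 2)" using 1 by (simp add: eq_neg_iff_add_eq_0 algebra_simps)
 thus a: "a = u * v + u * w + v * w" unfolding w by (simp add: algebra_simps eval_nat_numeral)
 have "b = - (u ^ 3 + a * u)" using r(1) by (simp add: eq_neg_iff_add_eq_0 algebra_simps)
 thus b: "b = - (u * v * w)" unfolding a w by (simp add: algebra_simps eval_nat_numeral)
 show "rhs x = (x - u) * (x - v) * (x - w)" unfolding rhs_def unfolding a b w by (simp add: algebra_simps eval_nat_numeral)
qed

lemma aut_roots2: assumes s: "field_aut sg" and x: "x \<in> roots2" shows "sg x \<in> roots2"
proof -
 have "sg (rhs x) = rhs (sg x)" by (simp add: rhs_def aut_simps[OF s] a_fixed[OF s] b_fixed[OF s])
 thus ?thesis using x aut_0[OF s] by (simp add: roots2_def)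
qed

text \<open>The half of (x, r s t) selected by the square roots r, s, t of x - u, x - v, x -
  w.\<close>

definition half :: "qbar => qbar => qbar => qbar => qbar point" where
 "half x r s t = Affine (x + r * s + r * t + s * t) ((r + s) * (r + t) * (s + t))"

text \<open>The abscissa X' satisfies X' - u = (r + s) (r + t) and its analogues, which gives the
  tangent slope r + s + t. Conversely s + t = Y' / (X' - u), so the half determines the three
  roots.\<close>

lemma half_properties:
 assumes e: "u \<in> roots2" "v \<in> roots2" "w \<in> roots2" "u ~= v" "u ~= w" "v ~= w"
  and r: "r ^ 2 = x - u" "s ^ 2 = x - v" "t ^ 2 = x - w"
 shows "half x r s t \<in> C" "half x r s t \<uplus> half x r s t = Affine x (r * s * t)"
  "r + s ~= 0" "r + t ~= 0" "s + t ~= 0"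
  "\<And>sg. field_aut sg ==> sg u = u ==> sg v = v ==> sg w = w ==> act sg (half x r s t) = half x r s t
   ==> sg r = r \<and> sg s = s \<and> sg t = t"
proof -
 define X' Y' where "X' = x + r * s + r * t + s * t" and "Y' = (r + s) * (r + t) * (s + t)"
 have H: "half x r s t = Affine X' Y'" by (simp add: half_def X'_def Y'_def)
 have u: "u = x - r ^ 2" "v = x - s ^ 2" "w = x - t ^ 2" using r by auto
 have d: "X' - u = (r + s) * (r + t)" "X' - v = (r + s) * (s + t)" "X' - w = (r + t) * (s + t)"
  unfolding X'_def u by (simp_all add: algebra_simps power2_eq_square)
 show C: "half x r s t \<in> C" unfolding H Affine_in_C roots2_factor(4)[OF e] d Y'_def by (simp add: power2_eq_square)
 have ne: "r ^ 2 ~= s ^ 2" "r ^ 2 ~= t ^ 2" "s ^ 2 ~= t ^ 2" using e r by auto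
 show nz: "r + s ~= 0" "r + t ~= 0" "s + t ~= 0" using ne by (auto simp: eq_neg_iff_add_eq_0[symmetric])
 have Y0: "Y' ~= 0" using nz by (simp add: Y'_def)
 have "slope (Affine X' Y') (Affine X' Y') = (3 * X' ^ 2 + a) / (2 * Y')" by (simp add: slope_def)
 also have "3 * X' ^ 2 + a = (X' - u) * (X' - v) + (X' - u) * (X' - w) + (X' - v) * (X' - w) + 2 * (u + v + w) * X'"
  unfolding roots2_factor(2)[OF e] by (simp add: algebra_simps power2_eq_square)
 also have "\<dots> = (2 * Y') * (r + s + t)" unfolding d roots2_factor(1)[OF e] Y'_def by (simp add: algebra_simps)
 also have "\<dots> / (2 * Y') = r + s + t" using Y0 by simp
 finally have sl: "slope (Affine X' Y') (Affine X' Y') = r + s + t" .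
 have sx: "3 * x = r ^ 2 + s ^ 2 + t ^ 2"
 proof -
  have "r ^ 2 + s ^ 2 + t ^ 2 = 3 * x - (u + v + w)" unfolding r by simp
  thus ?thesis using roots2_factor(1)[OF e] by simp
 qed
 have x3: "(r + s + t) ^ 2 - X' - X' = x"
 proof -
  have "(r + s + t) ^ 2 - X' - X' = (r ^ 2 + s ^ 2 + t ^ 2) - 2 * x" unfolding X'_def by (simp add: algebra_simps power2_eq_square)
  thus ?thesis unfolding sx[symmetric] by simp
 qed
 have "Affine X' Y' ~= pneg (Affine X' Y')" using Y0 by (simp add: eq_neg_iff_add_eq_0)
 from padd_affine[OF C[unfolded H] C[unfolded H] _ _ this]
 have "half x r s t \<uplus> half x r s t = Affine x (- (Y' + (r + s + t) * (x - X')))" unfolding sl H by (simp add: x3)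
 also have "- (Y' + (r + s + t) * (x - X')) = r * s * t" unfolding X'_def Y'_def by (simp add: algebra_simps)
 finally show "half x r s t \<uplus> half x r s t = Affine x (r * s * t)" .
 fix sg assume s: "field_aut sg" and f: "sg u = u" "sg v = v" "sg w = w" and h: "act sg (half x r s t) = half x r s t"
 have XY: "sg X' = X'" "sg Y' = Y'" using h unfolding H by auto
 have q: "s + t = Y' / (X' - u)" "r + t = Y' / (X' - v)" "r + s = Y' / (X' - w)" unfolding d Y'_def using nz by (simp_all add: nonzero_eq_divide_eq mult_ac)
 have 1: "sg (s + t) = s + t" "sg (r + t) = r + t" "sg (r + s) = r + s" unfolding q by (simp_all only: aut_divide[OF s] aut_diff[OF s] XY f)
 have 2: "r = ((r + s) + (r + t) - (s + t)) / 2" "s = ((r + s) + (s + t) - (r + t)) / 2" "t = ((r + t) + (s + t) - (r + s)) / 2" by simp_all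
 have "sg (((r + s) + (r + t) - (s + t)) / 2) = ((r + s) + (r + t) - (s + t)) / 2"
  unfolding aut_divide[OF s] aut_diff[OF s] aut_add[OF s, of "r + s" "r + t"] 1 aut_numeral[OF s] ..
 moreover have "sg (((r + s) + (s + t) - (r + t)) / 2) = ((r + s) + (s + t) - (r + t)) / 2"
  unfolding aut_divide[OF s] aut_diff[OF s] aut_add[OF s, of "r + s" "s + t"] 1 aut_numeral[OF s] ..
 moreover have "sg (((r + t) + (s + t) - (r + s)) / 2) = ((r + t) + (s + t) - (r + s)) / 2"
  unfolding aut_divide[OF s] aut_diff[OF s] aut_add[OF s, of "r + t" "s + t"] 1 aut_numeral[OF s] ..
 ultimately show "sg r = r \<and> sg s = s \<and> sg t = t" unfolding 2[symmetric] by blast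
qed

text \<open>Galois form of the inclusion of Q(E[2^(n+1)]) in Q(E[2^n]).\<close>

definition coincide :: "nat => bool" where
 "coincide n \<longleftrightarrow> (\<forall>sg. field_aut sg \<longrightarrow> (\<forall>P\<in>tors (2 ^ n). act sg P = P) \<longrightarrow> (\<forall>P\<in>tors (2 ^ Suc n). act sg P = P))"

lemma tors_double: "P \<in> C ==> P \<uplus> P \<in> tors n \<longleftrightarrow> P \<in> tors (2 * n)"
proof -
 assume P: "P \<in> C"
 have "P \<uplus> P = 2 \<odot> P" by (simp add: numeral_2_eq_2)
 thus ?thesis using P pmul_mult[OF P, of n 2] by (simp add: tors_def mult.commute[of 2 n] del: pmul.simps)
qed

text \<open>If sg fixes E[2^(n-1)], its square fixes E[2^n], hence E[2^(n+1)] by the coincidence at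
  n. For 2 R = P one has sg R = R + U with U in E[4], which is fixed since n - 1 \<ge> 2. The square
  of sg adds 2 U to R, so 2 U = O and sg P = P.\<close>

lemma coincide_descend:
 assumes n: "n \<ge> 3" and c: "coincide n" shows "coincide (n - 1)"
proof -
 obtain k where k: "n = Suc k" "k \<ge> 2" using n by (cases n) auto
 have "act sg P = P" if s: "field_aut sg" and fx: "\<forall>P\<in>tors (2 ^ k). act sg P = P" and P: "P \<in> tors (2 ^ n)" for sg P
 proof -
  have sub: "X' \<in> tors (2 ^ k)" if "X' \<in> tors 4" for X'
   by (rule tors_mono[OF that]) (use k le_imp_power_dvd[of 2 k "2::nat"] in simp)
  have move: "act sg (act sg Z) = Z \<uplus> (U \<uplus> U)" if "Z \<in> C" "U \<in> C" "act sg Z = Z \<uplus> U" "act sg U = U" for Z U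
   using that by (simp add: act_padd[OF s] padd_assoc)
  have PC: "P \<in> C" using P tors_in_C by blast
  have s2: "field_aut (sg \<circ> sg)" by (rule aut_comp[OF s s])
  have "act (sg \<circ> sg) Z = Z" if Z: "Z \<in> tors (2 ^ n)" for Z
  proof -
   have ZC: "Z \<in> C" using Z tors_in_C by blast
   define V where "V = pneg Z \<uplus> act sg Z"
   have VC: "V \<in> C" unfolding V_def using ZC act_in_C[OF s] by simp
   have aZ: "act sg Z = Z \<uplus> V" unfolding V_def using ZC act_in_C[OF s ZC] by simp
   have "Z \<uplus> Z \<in> tors (2 ^ k)" using tors_double[OF ZC, of "2 ^ k"] Z k by simp
   hence "act sg (Z \<uplus> Z) = Z \<uplus> Z" using fx by blast
   hence "(Z \<uplus> Z) \<uplus> (V \<uplus> V) = (Z \<uplus> Z) \<uplus> Infinity"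
    using ZC VC by (simp add: act_padd[OF s] aZ padd_ac)
   hence VV: "V \<uplus> V = Infinity" using ZC VC by (simp del: padd_Infinity)
   hence "V \<in> tors 2" using VC by (simp add: tors_def numeral_2_eq_2)
   hence "V \<in> tors 4" by (rule tors_mono) simp
   hence "act sg V = V" using sub fx by blast
   thus ?thesis unfolding act_comp using move[OF ZC VC aZ] VV by simp
  qed
  hence all: "act (sg \<circ> sg) Z = Z" if "Z \<in> tors (2 ^ Suc n)" for Z using c s2 that unfolding coincide_def by blast
  obtain R where R: "R \<in> C" "2 \<odot> R = P" using pmul_surj[of 2 P] PC by auto
  have RP: "R \<uplus> R = P" using R by (simp add: numeral_2_eq_2)
  have Rt: "R \<in> tors (2 ^ Suc n)" using tors_double[OF R(1), of "2 ^ n"] RP P by simp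
  define U where "U = pneg R \<uplus> act sg R"
  have UC: "U \<in> C" unfolding U_def using R act_in_C[OF s] by simp
  have aR: "act sg R = R \<uplus> U" unfolding U_def using R act_in_C[OF s R(1)] by simp
  have aP: "act sg P = P \<uplus> (U \<uplus> U)" unfolding RP[symmetric] using R(1) UC by (simp add: act_padd[OF s] aR padd_ac)
  have "P \<uplus> P \<in> tors (2 ^ k)" using tors_double[OF PC, of "2 ^ k"] P k by simp
  hence "act sg (P \<uplus> P) = P \<uplus> P" using fx by blast
  hence "(P \<uplus> P) \<uplus> ((U \<uplus> U) \<uplus> (U \<uplus> U)) = (P \<uplus> P) \<uplus> Infinity"
   using PC UC by (simp add: act_padd[OF s] aP padd_ac)
  hence "(U \<uplus> U) \<uplus> (U \<uplus> U) = Infinity" using PC UC by (simp del: padd_Infinity)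
  hence "U \<uplus> U \<in> tors 2" using UC by (simp add: tors_def numeral_2_eq_2)
  hence "U \<in> tors 4" using tors_double[OF UC, of 2] by simp
  hence "act sg U = U" using sub fx by blast
  from move[OF R(1) UC aR this] all[OF Rt] have "R \<uplus> (U \<uplus> U) = R \<uplus> Infinity" by (simp add: act_comp)
  hence "U \<uplus> U = Infinity" using R(1) UC by (simp del: padd_Infinity)
  thus ?thesis using aP by simp
 qed
 thus ?thesis unfolding coincide_def using k by simp
qed

lemma coincide_2: assumes "n \<ge> 2" "coincide n" shows "coincide 2"
 using assms
proof (induction n)
 case (Suc n)
 show ?case
 proof (cases "Suc n = 2")
  case False
  hence "coincide n" using coincide_descend[of "Suc n"] Suc.prems by simp
  thus ?thesis using Suc False by simp
 qed (use Suc in \<open>simp add: numeral_2_eq_2\<close>)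
qed simp

lemma other_root: "u \<in> roots2 ==> v \<in> roots2 ==> u ~= v ==> \<exists>w\<in>roots2. w ~= u \<and> w ~= v"
proof (rule ccontr)
 assume "u \<in> roots2" "v \<in> roots2" "u ~= v" "\<not> (\<exists>w\<in>roots2. w ~= u \<and> w ~= v)"
 hence "roots2 = {u, v}" by blast
 thus False using card_roots2 \<open>u ~= v\<close> by simp
qed

lemma fixes_tors_2: "\<forall>x\<in>roots2. sg x = x ==> field_aut sg ==> P \<in> tors 2 ==> act sg P = P"
 unfolding tors_2 by (auto simp: aut_0)

lemma coincide_1_radicals:
 assumes c: "coincide 1" and s: "field_aut sg" and fx: "\<forall>x\<in>roots2. sg x = x" and r: "r \<in> rad4 roots2"
 shows "sg r = r"
proof -
 obtain u v where uv: "u \<in> roots2" "v \<in> roots2" "u ~= v" "r ^ 2 = u - v" using r by (auto simp: rad4_def)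
 obtain w where w: "w \<in> roots2" "w ~= u" "w ~= v" using other_root[OF uv(1-3)] by blast
 obtain t where t: "t ^ 2 = u - w" using alg_closed_sqrt by blast
 note h = half_properties[OF uv(1,2) w(1) uv(3) w(2)[symmetric] w(3)[symmetric] _ uv(4) t, of 0]
 have "half u 0 r t \<uplus> half u 0 r t \<in> tors 2" unfolding tors_2 using h(2) uv by simp
 hence "half u 0 r t \<in> tors (2 ^ Suc 1)" using tors_double[OF h(1), of 2] by simp
 moreover have "\<forall>P\<in>tors (2 ^ 1). act sg P = P" using fixes_tors_2[OF fx s] by simp
 ultimately have "act sg (half u 0 r t) = half u 0 r t" using c s unfolding coincide_def by blast
 thus ?thesis using h(6)[OF _ s] fx uv w by auto
qed

lemma coincide_2_radicals:
 assumes c: "coincide 2" and s: "field_aut sg" and fx: "\<forall>x\<in>roots2. sg x = x" and f4: "\<forall>r\<in>rad4 roots2. sg r = r"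
  and r: "\<rho> \<in> rad8 roots2"
 shows "sg \<rho> = \<rho>"
proof -
 have hfix: "act sg (half u 0 r t) = half u 0 r t" if "u \<in> roots2" "v \<in> roots2" "w \<in> roots2" "u ~= v" "u ~= w" "r ^ 2 = u - v" "t ^ 2 = u - w" for u v w r t
 proof -
  have "r \<in> rad4 roots2" "t \<in> rad4 roots2" using that by (auto simp: rad4_def)
  thus ?thesis using that fx f4 by (simp add: half_def aut_simps[OF s])
 qed
 have f2: "act sg P = P" if "P \<in> tors 2" for P by (rule fixes_tors_2[OF fx s that])
 \<comment> \<open>Fixing \<open>rad4\<close> suffices for E[4]: a point of order 4 is a
   \<open>half\<close> of a point of order 2 plus a 2-torsion point.\<close>
 have f4t: "act sg P = P" if P: "P \<in> tors (2 ^ 2)" for P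
 proof -
  have PC: "P \<in> C" using P tors_in_C by blast
  have "P \<uplus> P \<in> tors 2" using tors_double[OF PC, of 2] P by simp
  then consider "P \<uplus> P = Infinity" | u where "u \<in> roots2" "P \<uplus> P = Affine u 0" unfolding tors_2 by auto
  thus ?thesis
  proof cases
   case 1
   hence "P \<in> tors 2" using PC by (simp add: tors_def numeral_2_eq_2)
   thus ?thesis by (rule f2)
  next
   case 2
   obtain v where v: "v \<in> roots2" "v ~= u"
   proof -
    have "\<not> roots2 \<subseteq> {u}" using card_roots2 card_mono[of "{u}" roots2] by auto
    thus ?thesis using that by blast
   qed
   obtain w where w: "w \<in> roots2" "w ~= u" "w ~= v" using other_root[OF 2(1) v(1) v(2)[symmetric]] by blast
   obtain r t where rt: "r ^ 2 = u - v" "t ^ 2 = u - w" using alg_closed_sqrt by metis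
   let ?R = "half u 0 r t"
   note h = half_properties[OF 2(1) v(1) w(1) v(2)[symmetric] w(2)[symmetric] w(3)[symmetric] _ rt, of 0]
   have RR: "?R \<uplus> ?R = P \<uplus> P" using h(2) 2 by simp
   have RC: "?R \<in> C" using h(1) by simp
   define T where "T = pneg ?R \<uplus> P"
   have TC: "T \<in> C" unfolding T_def using RC PC by simp
   have PR: "P = ?R \<uplus> T" unfolding T_def using RC PC by simp
   have "(?R \<uplus> ?R) \<uplus> (T \<uplus> T) = P \<uplus> P" unfolding PR using RC TC by (simp add: padd_ac)
   hence "(?R \<uplus> ?R) \<uplus> (T \<uplus> T) = (?R \<uplus> ?R) \<uplus> Infinity" unfolding RR by simp
   hence "T \<uplus> T = Infinity" using RC TC by (simp del: padd_Infinity)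
   hence "T \<in> tors 2" using TC by (simp add: tors_def numeral_2_eq_2)
   hence "act sg T = T" by (rule f2)
   moreover have "act sg ?R = ?R" using hfix[OF 2(1) v(1) w(1)] v w rt by auto
   ultimately have "act sg (?R \<uplus> T) = ?R \<uplus> T" using act_padd[OF s RC TC] by simp
   thus ?thesis by (simp only: PR[symmetric])
  qed
 qed
 obtain u v w r s' where e: "u \<in> roots2" "v \<in> roots2" "w \<in> roots2" "u ~= v" "u ~= w" "v ~= w"
  and rs: "r ^ 2 = u - v" "s' ^ 2 = u - w" and cs: "\<rho> ^ 2 = r * s' \<or> \<rho> ^ 2 = r * (r + s')"
  using r unfolding rad8_def by blast
 note h = half_properties[OF e _ rs, of 0]
 define x where "x = u + r * s'"
 have hx: "half u 0 r s' = Affine x (r * s' * (r + s'))" by (simp add: half_def x_def)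
 have "half u 0 r s' \<uplus> half u 0 r s' \<in> tors 2" unfolding tors_2 using h(2) e by simp
 hence ht: "half u 0 r s' \<in> tors 4" using tors_double[OF h(1), of 2] by simp
 \<comment> \<open>The product \<alpha> \<beta> \<gamma> is the ordinate of the given half or its
   negative; in both cases the new half lies in E[8].\<close>
 have key: "sg \<alpha> = \<alpha> \<and> sg \<beta> = \<beta>" if ab: "\<alpha> ^ 2 = r * s'" "\<beta> ^ 2 = r * (r + s')" for \<alpha> \<beta>
 proof -
  obtain \<gamma> where g: "\<gamma> ^ 2 = s' * (s' + r)" using alg_closed_sqrt by blast
  have d: "\<alpha> ^ 2 = x - u" "\<beta> ^ 2 = x - v" "\<gamma> ^ 2 = x - w"
   unfolding ab g x_def using rs by (simp_all add: power2_eq_square algebra_simps)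
  note h' = half_properties[OF e d]
  have "(\<alpha> * \<beta> * \<gamma>) ^ 2 = (r * s' * (r + s')) ^ 2" unfolding power_mult_distrib ab g by (simp add: power2_eq_square algebra_simps)
  hence "\<alpha> * \<beta> * \<gamma> = r * s' * (r + s') \<or> \<alpha> * \<beta> * \<gamma> = - (r * s' * (r + s'))" by (simp only: power2_eq_iff)
  hence "half x \<alpha> \<beta> \<gamma> \<uplus> half x \<alpha> \<beta> \<gamma> = half u 0 r s' \<or> half x \<alpha> \<beta> \<gamma> \<uplus> half x \<alpha> \<beta> \<gamma> = pneg (half u 0 r s')"
   unfolding h'(2) hx by auto
  hence "half x \<alpha> \<beta> \<gamma> \<uplus> half x \<alpha> \<beta> \<gamma> \<in> tors 4" using ht tors_pneg by metis
  hence "half x \<alpha> \<beta> \<gamma> \<in> tors (2 ^ Suc 2)" using tors_double[OF h'(1), of 4] by simp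
  hence "act sg (half x \<alpha> \<beta> \<gamma>) = half x \<alpha> \<beta> \<gamma>" using c s f4t unfolding coincide_def by blast
  thus ?thesis using h'(6)[OF s] fx e by blast
 qed
 obtain \<alpha> \<beta> where ab: "\<alpha> ^ 2 = r * s'" "\<beta> ^ 2 = r * (r + s')" using alg_closed_sqrt by metis
 show ?thesis using cs key[OF _ ab(2)] key[OF ab(1)] by blast
qed

end

section \<open>Square classes over the eighth cyclotomic field\<close>

lemma aut_sqrt_sign:
 fixes x :: qbar
 assumes "field_aut sg" "sg (x ^ 2) = y ^ 2" shows "sg x = y \<or> sg x = - y"
 using assms(2) unfolding aut_power[OF assms(1)] by (simp only: power2_eq_iff)

locale eighth_root =
 fixes ii q2 :: qbar
 assumes ii2: "ii ^ 2 = - 1" and q22: "q2 ^ 2 = 2"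
begin

lemma ii_mult [simp]: "ii * ii = - 1" "ii * (ii * x) = - x"
 using ii2 by (simp_all add: power2_eq_square mult.assoc[symmetric])

lemma q2_mult [simp]: "q2 * q2 = 2" "q2 * (q2 * x) = 2 * x"
 using q22 by (simp_all add: power2_eq_square mult.assoc[symmetric])

lemma ii_nz [simp]: "ii ~= 0" "q2 ~= 0" "1 + ii ~= 0"
proof -
 show "ii ~= 0" "q2 ~= 0" using ii2 q22 by auto
 have "(1 + ii) * (1 - ii) = 2" by (simp add: algebra_simps)
 thus "1 + ii ~= 0" by auto
qed

lemma ii_neq_uminus [simp]: "x ~= 0 ==> x ~= - (x::qbar)" "x ~= 0 ==> - x ~= x"
 by (simp_all add: eq_neg_iff_add_eq_0 neg_eq_iff_add_eq_0)

lemma aut_ii: "field_aut sg ==> sg ii = ii \<or> sg ii = - ii"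
 by (rule aut_sqrt_sign) (simp_all add: ii2 aut_simps)

lemma aut_q2: "field_aut sg ==> sg q2 = q2 \<or> sg q2 = - q2"
 by (rule aut_sqrt_sign) (simp_all add: q22 aut_simps)

text \<open>(1 + ii) / q2 is a primitive eighth root of unity; raising it to the powers 7, 5 and 3
  gives the three automorphisms.\<close>

lemma aut_signs: "\<exists>sg. field_aut sg \<and> sg ii = - ii \<and> sg q2 = q2" "\<exists>sg. field_aut sg \<and> sg ii = ii \<and> sg q2 = - q2"
 "\<exists>sg. field_aut sg \<and> sg ii = - ii \<and> sg q2 = - q2"
proof -
 define \<zeta> where "\<zeta> = (1 + ii) / q2"
 have z2: "\<zeta> * \<zeta> = ii" by (simp add: \<zeta>_def algebra_simps)
 have zq: "q2 = \<zeta> * (1 - ii)" by (simp add: \<zeta>_def field_simps)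
 have z2': "\<zeta> * (\<zeta> * x) = ii * x" for x using z2 by (simp add: mult.assoc[symmetric])
 have "\<zeta> ^ 4 = - 1" by (simp add: eval_nat_numeral z2' z2)
 moreover have "\<zeta> ^ 8 = 1" by (simp add: eval_nat_numeral z2' z2)
 ultimately have "primitive_root_of_unity (2 ^ Suc 2) \<zeta>"
  by (intro primitive_root_prime_power[OF two_is_prime_nat]) simp_all
 hence pr: "primitive_root_of_unity (2 ^ 3) \<zeta>" by (simp add: numeral_3_eq_3)
 have ex: "\<exists>sg. field_aut sg \<and> sg ii = (\<zeta> ^ g) * (\<zeta> ^ g) \<and> sg q2 = \<zeta> ^ g * (1 - (\<zeta> ^ g) * (\<zeta> ^ g))" if og: "odd g" for g
 proof -
  obtain sg where s: "field_aut sg" "sg \<zeta> = \<zeta> ^ g" using cyclotomic_aut[of 2 3 \<zeta> g] pr og by auto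
  have "sg ii = \<zeta> ^ g * \<zeta> ^ g" unfolding z2[symmetric] aut_mult[OF s(1)] s(2) ..
  moreover from this have "sg q2 = \<zeta> ^ g * (1 - (\<zeta> ^ g) * (\<zeta> ^ g))" unfolding zq by (simp add: aut_simps[OF s(1)] s(2))
  ultimately show ?thesis using s by blast
 qed
 have e: "\<zeta> ^ 7 = - (ii * \<zeta>)" "\<zeta> ^ 5 = - \<zeta>" "\<zeta> ^ 3 = ii * \<zeta>" by (simp_all add: eval_nat_numeral z2' z2 mult.commute)
 have c: "ii * \<zeta> * (ii * \<zeta>) = - ii" using z2 by (simp add: mult_ac z2')
 have v: "\<zeta> ^ 7 * \<zeta> ^ 7 = - ii" "\<zeta> ^ 5 * \<zeta> ^ 5 = ii" "\<zeta> ^ 3 * \<zeta> ^ 3 = - ii"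
  unfolding e using c z2 by simp_all
 have "\<zeta> ^ 7 * (1 - - ii) = q2" "\<zeta> ^ 5 * (1 - ii) = - q2" "\<zeta> ^ 3 * (1 - - ii) = - q2"
  unfolding e zq by (simp_all add: algebra_simps)
 thus "\<exists>sg. field_aut sg \<and> sg ii = - ii \<and> sg q2 = q2" "\<exists>sg. field_aut sg \<and> sg ii = ii \<and> sg q2 = - q2"
  "\<exists>sg. field_aut sg \<and> sg ii = - ii \<and> sg q2 = - q2"
  using ex[of 7] ex[of 5] ex[of 3] unfolding v by auto
qed

text \<open>The square classes of 1, -1, 2 and -2, which are those that become trivial over the
  eighth cyclotomic field.\<close>

definition cls :: "rat => bool" where "cls q \<longleftrightarrow> (\<exists>x. q = x ^ 2 \<or> q = - (x ^ 2) \<or> q = 2 * x ^ 2 \<or> q = - (2 * x ^ 2))"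

lemma cls_square_mult: "cls (x ^ 2 * q) ==> x ~= 0 ==> cls q"
proof -
 assume "cls (x ^ 2 * q)" and x: "x ~= 0"
 then obtain y where y: "x ^ 2 * q = y ^ 2 \<or> x ^ 2 * q = - (y ^ 2) \<or> x ^ 2 * q = 2 * y ^ 2 \<or> x ^ 2 * q = - (2 * y ^ 2)" by (auto simp: cls_def)
 show "cls q" unfolding cls_def by (rule exI[of _ "y / x"]) (use x y in \<open>auto simp: power_divide field_simps\<close>)
qed

lemma cls_mult: assumes "cls p" "cls q" shows "cls (p * q)"
proof -
 obtain x where x: "p = x ^ 2 \<or> p = - (x ^ 2) \<or> p = 2 * x ^ 2 \<or> p = - (2 * x ^ 2)" using assms by (auto simp: cls_def)
 obtain y where y: "q = y ^ 2 \<or> q = - (y ^ 2) \<or> q = 2 * y ^ 2 \<or> q = - (2 * y ^ 2)" using assms by (auto simp: cls_def)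
 have "\<exists>z. p * q = z ^ 2 \<or> p * q = - (z ^ 2) \<or> p * q = 2 * z ^ 2 \<or> p * q = - (2 * z ^ 2)"
 proof (cases "p * q = 4 * (x * y) ^ 2 \<or> p * q = - (4 * (x * y) ^ 2)")
  case True thus ?thesis by (intro exI[of _ "2 * (x * y)"]) (auto simp: power_mult_distrib)
 next
  case False thus ?thesis using x y by (intro exI[of _ "x * y"]) (elim disjE; simp add: power_mult_distrib)
 qed
 thus ?thesis by (simp add: cls_def)
qed

lemma cls_numeral: "cls 2" "cls (- 1)" "cls 1"
 unfolding cls_def by (rule exI[of _ 1]; simp)+

lemma cls_divide: assumes "cls p" "cls q" "q ~= 0" shows "cls (p / q)"
proof -
 have "cls (q ^ 2 * (p / q))" using cls_mult[OF assms(1,2)] assms(3) by (simp add: power2_eq_square mult.commute)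
 thus ?thesis using cls_square_mult assms(3) by blast
qed

text \<open>\<xi> changes at most by a sign that depends on the action on \<open>ii\<close> and
  \<open>q2\<close>; multiplying it by these elements as needed makes it rational.\<close>

lemma cls_if_fixed:
 assumes x: "\<xi> ^ 2 = to_ac q" and fx: "\<And>sg. field_aut sg ==> sg ii = ii ==> sg q2 = q2 ==> sg \<xi> = \<xi>"
 shows "cls q"
proof -
 have sg: "sg \<xi> = \<xi> \<or> sg \<xi> = - \<xi>" if "field_aut sg" for sg
  by (rule aut_sqrt_sign[OF that]) (simp add: x aut_rat[OF that])
 obtain g1 where g1: "field_aut g1" "g1 ii = - ii" "g1 q2 = q2" using aut_signs(1) by blast
 obtain g2 where g2: "field_aut g2" "g2 ii = ii" "g2 q2 = - q2" using aut_signs(2) by blast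
 define c1 c2 where "c1 = (if g1 \<xi> = \<xi> then 1 else ii)" and "c2 = (if g2 \<xi> = \<xi> then 1 else q2)"
 define y where "y = \<xi> * c1 * c2"
 have y1: "g1 y = y" unfolding y_def c1_def c2_def using sg[OF g1(1)] g1 by (auto simp: aut_simps[OF g1(1)])
 have y2: "g2 y = y" unfolding y_def c1_def c2_def using sg[OF g2(1)] g2 by (auto simp: aut_simps[OF g2(1)])
 have base: "sg y = y" if s: "field_aut sg" "sg ii = ii" "sg q2 = q2" for sg
  unfolding y_def c1_def c2_def using fx[OF s] s by (auto simp: aut_simps[OF s(1)])
 have step: "sg y = y" if s: "field_aut sg" "sg ii = ii" for sg
 proof (cases "sg q2 = q2")
  case False
  hence "sg q2 = - q2" using aut_q2[OF s(1)] by blast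
  hence "g2 (sg y) = y" using base[OF aut_comp[OF g2(1) s(1)]] s g2 by (simp add: aut_minus[OF g2(1)])
  thus ?thesis using aut_inj[OF g2(1)] y2 by metis
 qed (use base s in blast)
 have "sg y = y" if s: "field_aut sg" for sg
 proof (cases "sg ii = ii")
  case False
  hence "sg ii = - ii" using aut_ii[OF s] by blast
  hence "g1 (sg y) = y" using step[OF aut_comp[OF g1(1) s]] g1 by (simp add: aut_minus[OF g1(1)])
  thus ?thesis using aut_inj[OF g1(1)] y1 by metis
 qed (use step s in blast)
 then obtain z where z: "y = to_ac z" using fixed_imp_rational by blast
 have "y ^ 2 = to_ac q * (c1 * c1) * (c2 * c2)" unfolding y_def x[symmetric] by (simp add: power2_eq_square mult_ac)
 hence "to_ac (z ^ 2) = to_ac q \<or> to_ac (z ^ 2) = to_ac (- q) \<or> to_ac (z ^ 2) = to_ac (q * 2) \<or> to_ac (z ^ 2) = to_ac (- q * 2)"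
  unfolding z c1_def c2_def by (auto split: if_splits)
 hence zz: "z ^ 2 = q \<or> z ^ 2 = - q \<or> z ^ 2 = q * 2 \<or> z ^ 2 = - q * 2" by (simp only: to_ac_eq_iff)
 hence "q = z ^ 2 \<or> q = - (z ^ 2) \<or> q = 2 * (z / 2) ^ 2 \<or> q = - (2 * (z / 2) ^ 2)" by (auto simp: power_divide)
 thus ?thesis unfolding cls_def by blast
qed

lemma rat_square_neq: "(y::rat) ^ 2 ~= 2" "(y::rat) ^ 2 ~= 27"
proof -
 have "m ^ 2 ~= 2" "m ^ 2 ~= 27" for m :: int using square_mod_16[of m] by auto
 hence "of_int (m ^ 2) ~= (of_int 2 :: rat)" "of_int (m ^ 2) ~= (of_int 27 :: rat)" for m :: int by (simp_all only: of_int_eq_iff not_False_eq_True)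
 thus "y ^ 2 ~= 2" "y ^ 2 ~= 27" using rat_square_int[of y 2] rat_square_int[of y 27] by auto
qed

text \<open>Squares of elements of \<open>cls\<close> are x^4 or 4 x^4, so the circle turns into one
  of the quartics without nontrivial points.\<close>

lemma no_unit_circle:
 assumes "X' ^ 2 + Y' ^ 2 = 1" "cls X'" "cls Y'" "X' ~= 0" "Y' ~= 0" shows False
proof -
 have sq: "\<exists>x. x ~= 0 \<and> (Z ^ 2 = x ^ 4 \<or> Z ^ 2 = 4 * x ^ 4)" if Z: "cls Z" "Z ~= 0" for Z
 proof -
  obtain x where x: "Z = x ^ 2 \<or> Z = - (x ^ 2) \<or> Z = 2 * x ^ 2 \<or> Z = - (2 * x ^ 2)" using Z(1) by (auto simp: cls_def)
  thus ?thesis using Z(2) by (intro exI[of _ x]) (auto simp: power_mult_distrib simp flip: power_mult)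
 qed
 obtain x where x: "x ~= 0" "X' ^ 2 = x ^ 4 \<or> X' ^ 2 = 4 * x ^ 4" using sq assms by blast
 obtain y where y: "y ~= 0" "Y' ^ 2 = y ^ 4 \<or> Y' ^ 2 = 4 * y ^ 4" using sq assms by blast
 have "x ^ 4 + y ^ 4 = 1 ^ 2 \<or> 1 ^ 4 - 4 * y ^ 4 = (x ^ 2) ^ 2 \<or> 1 ^ 4 - 4 * x ^ 4 = (y ^ 2) ^ 2 \<or> x ^ 4 + y ^ 4 = (1 / 2) ^ 2"
  using x(2) y(2) assms(1) by (elim disjE) (simp_all add: power2_eq_square eval_nat_numeral)
 thus False using rat_quartic_sum[OF _ x(1) y(1)] rat_quartic_diff_4[OF _ y(1)] rat_quartic_diff_4[OF _ x(1)] by blast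
qed

text \<open>The product of the equations is 1 - \<omega>^2 = d (x y)^2. If \<omega>^2 = z^4, it
  makes a sum of two fourth powers a square; if \<omega>^2 = 4 z^4, it fails at 2. So x y = 0, and x
  = 0 would make 2 a square.\<close>

lemma quartic_degenerate:
 assumes d: "d = 2 \<or> d = - 2" and e: "1 - \<omega> = d * x ^ 2" "1 + \<omega> = y ^ 2" "cls \<omega>" "\<omega> ~= 0"
 shows "d = 2 \<and> y = 0"
proof -
 obtain z where z: "\<omega> = z ^ 2 \<or> \<omega> = - (z ^ 2) \<or> \<omega> = 2 * z ^ 2 \<or> \<omega> = - (2 * z ^ 2)" using e(3) by (auto simp: cls_def)
 have z0: "z ~= 0" using z e(4) by auto
 have pr: "1 - \<omega> ^ 2 = d * (x * y) ^ 2"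
 proof -
  have "1 - \<omega> ^ 2 = (1 - \<omega>) * (1 + \<omega>)" by (simp add: power2_eq_square algebra_simps)
  thus ?thesis unfolding e by (simp add: power_mult_distrib)
 qed
 have w2: "\<omega> ^ 2 = z ^ 4 \<or> \<omega> ^ 2 = 4 * z ^ 4" using z by (elim disjE) (simp_all add: power_mult_distrib flip: power_mult)
 have "x * y = 0"
 proof (rule ccontr)
  assume nz: "x * y ~= 0"
  show False using w2
  proof
   assume "\<omega> ^ 2 = z ^ 4"
   hence eq: "1 - z ^ 4 = d * (x * y) ^ 2" using pr by simp
   have "((1 + z ^ 4) / 2) ^ 2 = ((1 - z ^ 4) ^ 2 + 4 * z ^ 4) / 4" by (simp add: power2_eq_square algebra_simps)
   also have "\<dots> = (d ^ 2 * (x * y) ^ 4 + 4 * z ^ 4) / 4" unfolding eq by (simp add: power_mult_distrib flip: power_mult)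
   also have "d ^ 2 = 4" using d by auto
   finally have "z ^ 4 + (x * y) ^ 4 = ((1 + z ^ 4) / 2) ^ 2" by simp
   thus False using rat_quartic_sum z0 nz by blast
  next
   assume "\<omega> ^ 2 = 4 * z ^ 4"
   hence "1 - 4 * z ^ 4 = 2 * (d / 2) * (x * y) ^ 2" using pr by simp
   moreover have "d / 2 = 1 \<or> d / 2 = - 1" using d by auto
   ultimately show False by (rule rat_quartic_even)
  qed
 qed
 moreover have "x ~= 0"
 proof
  assume "x = 0"
  hence "y ^ 2 = 2" using e by simp
  thus False using rat_square_neq by blast
 qed
 ultimately have y: "y = 0" by simp
 hence "d * x ^ 2 = 2" using e by (simp add: add_eq_0_iff)
 moreover have "x ^ 2 \<ge> 0" by simp
 ultimately have "d ~= - 2" by (intro notI) simp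
 thus ?thesis using d y by blast
qed

end

section \<open>Square roots of differences of three conjugates\<close>

lemma permutation_3:
 assumes "a \<in> {x, y, z}" "b \<in> {x, y, z}" "c \<in> {x, y, z}" "a ~= b" "a ~= c" "b ~= c"
 shows "(a = x \<and> b = y \<and> c = z) \<or> (a = y \<and> b = z \<and> c = x) \<or> (a = z \<and> b = x \<and> c = y) \<or>
  (a = x \<and> b = z \<and> c = y) \<or> (a = z \<and> b = y \<and> c = x) \<or> (a = y \<and> b = x \<and> c = z)"
 using assms by auto

locale galois_triple = eighth_root +
 fixes S :: "qbar set"
 assumes card_S: "card S = 3" and perm: "field_aut sg ==> x \<in> S ==> sg x \<in> S"
begin

text \<open>\<open>V\<close> is the kernel of the permutation action on \<open>S\<close>; the indices in \<open>tri\<close> are chosen so that the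
 cyclic rotation of \<open>u, v, w\<close> rotates \<open>r1, r2, r3\<close>, and \<open>r1\<^sup>2 + r2\<^sup>2 + r3\<^sup>2 = 0\<close>.\<close>

definition V :: "(qbar => qbar) => bool" where "V sg \<longleftrightarrow> field_aut sg \<and> (\<forall>x\<in>S. sg x = x)"

definition tri :: "qbar => qbar => qbar => qbar => qbar => qbar => bool" where
 "tri u v w r1 r2 r3 \<longleftrightarrow> S = {u, v, w} \<and> u ~= v \<and> u ~= w \<and> v ~= w \<and> r1 ^ 2 = v - w \<and> r2 ^ 2 = w - u \<and> r3 ^ 2 = u - v"

lemma V_aut: "V sg ==> field_aut sg" by (simp add: V_def)

lemma V_comp: "V sg ==> V \<tau> ==> V (sg \<circ> \<tau>)"
 by (simp add: V_def aut_comp)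

lemma aut_inv_apply: "field_aut \<tau> ==> inv_into UNIV \<tau> (\<tau> x) = x" "field_aut \<tau> ==> \<tau> (inv_into UNIV \<tau> x) = x"
 by (simp_all add: field_aut_def bij_def surj_f_inv_f)

lemma V_conj: assumes s: "V sg" and t: "field_aut \<tau>" shows "V (inv_into UNIV \<tau> \<circ> sg \<circ> \<tau>)"
proof -
 have "field_aut (inv_into UNIV \<tau> \<circ> sg \<circ> \<tau>)" by (intro aut_comp aut_inv t V_aut[OF s])
 moreover have "\<forall>x\<in>S. (inv_into UNIV \<tau> \<circ> sg \<circ> \<tau>) x = x"
  using s perm[OF t] by (simp add: V_def aut_inv_apply[OF t])
 ultimately show ?thesis by (simp only: V_def simp_thms)
qed

lemma tri_cycle: "tri u v w r1 r2 r3 ==> tri v w u r2 r3 r1"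
 unfolding tri_def by auto

text \<open>Exchanging v and w negates the differences, hence the factor \<open>ii\<close>.\<close>

lemma tri_swap: "tri u v w r1 r2 r3 ==> tri u w v (ii * r1) (ii * r3) (ii * r2)"
 unfolding tri_def by (auto simp: power_mult_distrib ii2)

lemma tri_aut: assumes t: "tri u v w r1 r2 r3" and s: "field_aut sg"
 shows "tri (sg u) (sg v) (sg w) (sg r1) (sg r2) (sg r3)"
proof -
 have "{sg u, sg v, sg w} \<subseteq> S" using perm[OF s] t by (auto simp: tri_def)
 moreover have "card {sg u, sg v, sg w} = card S" using t card_S by (simp add: tri_def aut_inj[OF s])
 moreover have "finite S" using t by (simp add: tri_def)
 ultimately have "{sg u, sg v, sg w} = S" by (intro card_subset_eq)
 moreover have "sg r1 ^ 2 = sg v - sg w" "sg r2 ^ 2 = sg w - sg u" "sg r3 ^ 2 = sg u - sg v"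
  using t unfolding tri_def by (simp_all only: aut_power[OF s, symmetric] aut_diff[OF s])
 ultimately show ?thesis using t unfolding tri_def by (simp only: aut_inj[OF s] simp_thms)
qed

lemma tri_exists: assumes "S = {u, v, w}" "u ~= v" "u ~= w" "v ~= w" shows "\<exists>r1 r2 r3. tri u v w r1 r2 r3"
 using assms alg_closed_sqrt[of "v - w"] alg_closed_sqrt[of "w - u"] alg_closed_sqrt[of "u - v"] unfolding tri_def by blast

lemma S_cases: "\<exists>u v w. S = {u, v, w} \<and> u ~= v \<and> u ~= w \<and> v ~= w"
 using card_S unfolding card_3_iff by metis

text \<open>Among the permutations of three letters, those that are not transpositions have trivial
  cube.\<close>

lemma perm_type:
 assumes s: "field_aut sg"
 shows "V (sg \<circ> sg \<circ> sg) \<or> (\<exists>u v w. S = {u, v, w} \<and> u ~= v \<and> u ~= w \<and> v ~= w \<and> sg u = u \<and> sg v = w \<and> sg w = v)"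
proof -
 obtain x y z where S: "S = {x, y, z}" "x ~= y" "x ~= z" "y ~= z" using S_cases by blast
 have m: "sg x \<in> {x, y, z}" "sg y \<in> {x, y, z}" "sg z \<in> {x, y, z}" using perm[OF s] S(1) by auto
 have n: "sg x ~= sg y" "sg x ~= sg z" "sg y ~= sg z" using S aut_inj[OF s] by auto
 have V3: "V (sg \<circ> sg \<circ> sg)" if "sg (sg (sg x)) = x" "sg (sg (sg y)) = y" "sg (sg (sg z)) = z"
 proof -
  have "\<forall>a\<in>S. (sg \<circ> sg \<circ> sg) a = a" using that S(1) by auto
  moreover have "field_aut (sg \<circ> sg \<circ> sg)" using s by (intro aut_comp)
  ultimately show ?thesis by (simp only: V_def simp_thms)
 qed
 consider "sg x = x" "sg y = y" "sg z = z" | "sg x = y" "sg y = z" "sg z = x" | "sg x = z" "sg y = x" "sg z = y"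
  | "sg x = x" "sg y = z" "sg z = y" | "sg x = z" "sg y = y" "sg z = x" | "sg x = y" "sg y = x" "sg z = z"
  using permutation_3[OF m n] by blast
 thus ?thesis
 proof cases
  case 1 thus ?thesis using V3 by simp
 next
  case 2 thus ?thesis using V3 by simp
 next
  case 3 thus ?thesis using V3 by simp
 next
  case 4 thus ?thesis using S by blast
 next
  case 5
  hence "S = {y, x, z} \<and> y ~= x \<and> y ~= z \<and> x ~= z \<and> sg y = y \<and> sg x = z \<and> sg z = x" using S by auto
  thus ?thesis by blast
 next
  case 6
  hence "S = {z, x, y} \<and> z ~= x \<and> z ~= y \<and> x ~= y \<and> sg z = z \<and> sg x = y \<and> sg y = x" using S by auto
  thus ?thesis by blast
 qed
qed

lemma two_transpositions:
 assumes g: "field_aut g" "S = {u, v, w}" "u ~= v" "u ~= w" "v ~= w" "g u = u" "g v = w" "g w = v"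
  and h: "field_aut h" "S = {u', v', w'}" "u' ~= v'" "u' ~= w'" "v' ~= w'" "h u' = u'" "h v' = w'" "h w' = v'"
 shows "V ((h \<circ> g) \<circ> (h \<circ> g) \<circ> (h \<circ> g))"
proof -
 have m: "u' \<in> {u, v, w}" "v' \<in> {u, v, w}" "w' \<in> {u, v, w}" using g(2) h(2) by auto
 consider "h u = u" "h v = w" "h w = v" | "h v = v" "h u = w" "h w = u" | "h w = w" "h u = v" "h v = u"
  using permutation_3[OF m h(3-5)] h(6-8) by (elim disjE conjE; simp)
 hence "h (g (h (g (h (g x))))) = x" if "x \<in> {u, v, w}" for x using that g(6-8) by cases auto
 hence "\<forall>x\<in>S. ((h \<circ> g) \<circ> (h \<circ> g) \<circ> (h \<circ> g)) x = x" using g(2) by simp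
 moreover have "field_aut ((h \<circ> g) \<circ> (h \<circ> g) \<circ> (h \<circ> g))" using g(1) h(1) by (intro aut_comp)
 ultimately show ?thesis by (simp only: V_def simp_thms)
qed

context
 fixes u v w r1 r2 r3
 assumes t: "tri u v w r1 r2 r3"
begin

lemma tri_facts: "r1 ^ 2 = v - w" "r2 ^ 2 = w - u" "r3 ^ 2 = u - v" "r1 ~= 0" "r2 ~= 0" "r3 ~= 0"
 "r1 ^ 2 + r2 ^ 2 + r3 ^ 2 = 0" "u \<in> S" "v \<in> S" "w \<in> S" "u ~= v" "u ~= w" "v ~= w" "S = {u, v, w}"
 using t by (auto simp: tri_def)

lemma V_sign: assumes "V sg"
 shows "sg r1 = r1 \<or> sg r1 = - r1" "sg r2 = r2 \<or> sg r2 = - r2" "sg r3 = r3 \<or> sg r3 = - r3"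
proof -
 note s = V_aut[OF assms]
 have "sg u = u" "sg v = v" "sg w = w" using assms tri_facts(8-10) by (simp_all add: V_def)
 thus "sg r1 = r1 \<or> sg r1 = - r1" "sg r2 = r2 \<or> sg r2 = - r2" "sg r3 = r3 \<or> sg r3 = - r3"
  by (intro aut_sqrt_sign[OF s]; simp add: tri_facts aut_diff[OF s])+
qed

lemma rad4_cases: assumes "\<rho> \<in> rad4 S"
 shows "\<exists>r\<in>{r1, r2, r3}. \<rho> = r \<or> \<rho> = - r \<or> \<rho> = ii * r \<or> \<rho> = - (ii * r)"
proof -
 have c: "\<rho> = r \<or> \<rho> = - r" if "\<rho> ^ 2 = r ^ 2" for r using that by (simp only: power2_eq_iff)
 have i: "(ii * r) ^ 2 = - (r ^ 2)" for r by (simp add: power_mult_distrib ii2)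
 obtain x y where xy: "x \<in> {u, v, w}" "y \<in> {u, v, w}" "x ~= y" "\<rho> ^ 2 = x - y" using assms tri_facts(14) by (auto simp: rad4_def)
 hence "\<rho> ^ 2 = r1 ^ 2 \<or> \<rho> ^ 2 = r2 ^ 2 \<or> \<rho> ^ 2 = r3 ^ 2 \<or> \<rho> ^ 2 = (ii * r1) ^ 2 \<or> \<rho> ^ 2 = (ii * r2) ^ 2 \<or> \<rho> ^ 2 = (ii * r3) ^ 2"
  unfolding i tri_facts(1-3) by auto
 thus ?thesis using c[of r1] c[of r2] c[of r3] c[of "ii * r1"] c[of "ii * r2"] c[of "ii * r3"] by auto
qed

lemma V_rad4: assumes s: "field_aut sg" and f: "sg ii = ii" "sg r1 = r1" "sg r2 = r2" "sg r3 = r3"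
 shows "\<forall>r\<in>rad4 S. sg r = r"
proof
 fix r assume "r \<in> rad4 S"
 from rad4_cases[OF this] obtain x where "x \<in> {r1, r2, r3}" "r = x \<or> r = - x \<or> r = ii * x \<or> r = - (ii * x)" by blast
 moreover from this f have "sg x = x" by auto
 ultimately show "sg r = r" using f(1) by (elim disjE) (simp_all only: aut_minus[OF s] aut_mult[OF s])
qed

lemma swap_action:
 assumes s: "field_aut \<tau>" "\<tau> u = u" "\<tau> v = w" "\<tau> w = v"
 shows "\<tau> r1 = ii * r1 \<or> \<tau> r1 = - (ii * r1)" "\<tau> r2 = ii * r3 \<or> \<tau> r2 = - (ii * r3)" "\<tau> r3 = ii * r2 \<or> \<tau> r3 = - (ii * r2)"
 by (rule aut_sqrt_sign[OF s(1)]; simp add: tri_facts aut_diff[OF s(1)] s power_mult_distrib ii2)+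

end

end

text \<open>\<open>H2\<close> is what a coincidence at level 4 says about the iterated square roots;
  the locale turns out to be contradictory.\<close>

locale eight_coincidence = galois_triple +
 assumes H2: "field_aut sg ==> \<forall>x\<in>S. sg x = x ==> \<forall>r\<in>rad4 S. sg r = r ==> \<rho> \<in> rad8 S ==> sg \<rho> = \<rho>"
begin

context
 fixes u v w r1 r2 r3
 assumes t: "tri u v w r1 r2 r3"
begin

lemma rad8_intros:
 "m ^ 2 = ii * r2 * r3 ==> m \<in> rad8 S" "n ^ 2 = r3 * (r3 + ii * r2) ==> n \<in> rad8 S" "n ^ 2 = (ii * r2) * (ii * r2 + r3) ==> n \<in> rad8 S"
proof -
 note f = tri_facts[OF t]
 have i: "(ii * r2) ^ 2 = u - w" using f by (simp add: power_mult_distrib ii2)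
 have in8: "x \<in> rad8 S" if "x ^ 2 = r3 * (ii * r2) \<or> x ^ 2 = r3 * (r3 + ii * r2)" for x
  unfolding rad8_def mem_Collect_eq
  by (rule bexI[OF _ f(8)], rule bexI[OF _ f(9)], rule bexI[OF _ f(10)], intro conjI f(11-13),
    rule exI[of _ r3], rule exI[of _ "ii * r2"], intro conjI f(3) i that)
 have in8': "x \<in> rad8 S" if "x ^ 2 = ii * r2 * (ii * r2 + r3)" for x
  unfolding rad8_def mem_Collect_eq
  by (rule bexI[OF _ f(8)], rule bexI[OF _ f(10)], rule bexI[OF _ f(9)], intro conjI f(11,12) f(13)[symmetric],
    rule exI[of _ "ii * r2"], rule exI[of _ r3], intro conjI f(3) i disjI2 that)
 show "m \<in> rad8 S" if "m ^ 2 = ii * r2 * r3" for m by (rule in8) (simp add: that mult_ac)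
 show "n \<in> rad8 S" if "n ^ 2 = r3 * (r3 + ii * r2)" for n by (rule in8) (simp add: that)
 show "n \<in> rad8 S" if "n ^ 2 = (ii * r2) * (ii * r2 + r3)" for n by (rule in8') (simp add: that)
qed

lemma fix8: "V sg ==> sg ii = ii ==> sg r1 = r1 ==> sg r2 = r2 ==> sg r3 = r3 ==> \<rho> \<in> rad8 S ==> sg \<rho> = \<rho>"
 using H2[of sg \<rho>] V_rad4[OF t, of sg] by (simp add: V_def)

text \<open>V acts on the r_k and on \<open>ii\<close> by signs, so squares act trivially there, and
  then on \<open>rad8\<close> by \<open>H2\<close>.\<close>

lemma V_involution: assumes s: "V sg" and r: "\<rho> \<in> rad8 S" shows "sg (sg \<rho>) = \<rho>"
proof -
 note a = V_aut[OF s]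
 have "(sg \<circ> sg) \<rho> = \<rho>"
  by (rule fix8[OF V_comp[OF s s] _ _ _ _ r])
   (use V_sign[OF t s] aut_ii[OF a] in \<open>auto simp: aut_minus[OF a]\<close>)
 thus ?thesis by simp
qed

text \<open>Otherwise a square root m of ii r2 r3 would be multiplied by
  \<plusminus>\<open>ii\<close>, and applying sg twice would give - m.\<close>

lemma sign_product:
 assumes s: "V sg" and i: "sg ii = ii" shows "sg (r2 * r3) = r2 * r3"
proof (rule ccontr)
 note a = V_aut[OF s]
 assume "sg (r2 * r3) ~= r2 * r3"
 hence ne: "sg (r2 * r3) = - (r2 * r3)" using V_sign[OF t s] by (auto simp: aut_mult[OF a])
 obtain m where m: "m ^ 2 = ii * r2 * r3" using alg_closed_sqrt by blast
 have m0: "m ~= 0" using m tri_facts[OF t] by auto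
 have "sg (m ^ 2) = (ii * m) ^ 2" unfolding power_mult_distrib m ii2 using ne i by (simp add: aut_mult[OF a] mult.assoc)
 hence "sg m = ii * m \<or> sg m = - (ii * m)" by (rule aut_sqrt_sign[OF a])
 hence "sg (sg m) = - m" by (elim disjE) (simp_all add: aut_mult[OF a] aut_minus[OF a] i)
 thus False using V_involution[OF s rad8_intros(1)[OF m]] m0 by simp
qed

text \<open>For n^2 = r3 (r3 + ii r2), the product of n and its image is \<plusminus>ii r3 r1. It is
  invariant because sg is an involution on n, while \<open>ii\<close> changes sign.\<close>

lemma sign_product_ii:
 assumes s: "V sg" and i: "sg ii = - ii" and p: "sg (r2 * r3) = r2 * r3" shows "sg (r3 * r1) = - (r3 * r1)"
proof -
 note a = V_aut[OF s] and f = tri_facts[OF t]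
 obtain n where n: "n ^ 2 = r3 * (r3 + ii * r2)" using alg_closed_sqrt by blast
 have n': "(sg n) ^ 2 = r3 * (r3 - ii * r2)"
 proof -
  have r33: "sg r3 * sg r3 = r3 * r3" using V_sign(3)[OF t s] by auto
  have r32: "sg r3 * sg r2 = r3 * r2" using p by (simp add: aut_mult[OF a] mult.commute)
  have "(sg n) ^ 2 = sg r3 * sg r3 - ii * (sg r3 * sg r2)" unfolding aut_power[OF a, symmetric] n by (simp add: aut_simps[OF a] i algebra_simps)
  thus ?thesis unfolding r33 r32 by (simp add: algebra_simps)
 qed
 have "(n * sg n) ^ 2 = r3 ^ 2 * (r3 ^ 2 + r2 ^ 2)" unfolding power_mult_distrib n n' by (simp add: power2_eq_square algebra_simps)
 also have "r3 ^ 2 + r2 ^ 2 = - (r1 ^ 2)" using f(7) by (simp add: eq_neg_iff_add_eq_0 add_ac)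
 also have "r3 ^ 2 * - (r1 ^ 2) = (ii * (r3 * r1)) ^ 2" by (simp add: power_mult_distrib ii2)
 finally have c: "n * sg n = ii * (r3 * r1) \<or> n * sg n = - (ii * (r3 * r1))" by (simp only: power2_eq_iff)
 have "sg (n * sg n) = n * sg n" using V_involution[OF s rad8_intros(2)[OF n]] by (simp add: aut_mult[OF a] mult.commute)
 hence "sg (ii * (r3 * r1)) = ii * (r3 * r1)" using c by (auto simp: aut_minus[OF a])
 hence "ii * (- sg (r3 * r1)) = ii * (r3 * r1)" by (simp add: aut_mult[OF a] i)
 hence "- sg (r3 * r1) = r3 * r1" by (simp only: mult_cancel_left ii_nz simp_thms)
 thus ?thesis by (metis minus_minus)
qed

text \<open>(1 + ii) m1 m2 m3 / (r1 r2 r3) is a square root of 2.\<close>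

lemma fix_q2:
 assumes s: "field_aut sg" and i: "sg ii = ii" and m: "m1 ^ 2 = ii * r2 * r3" "m2 ^ 2 = ii * r3 * r1" "m3 ^ 2 = ii * r1 * r2"
  and fx: "sg (m1 * m2 * m3) * (r1 * r2 * r3) = m1 * m2 * m3 * sg (r1 * r2 * r3)"
 shows "sg q2 = q2"
proof -
 note f = tri_facts[OF t]
 define z where "z = m1 * m2 * m3 / (r1 * r2 * r3)"
 have "(m1 * m2 * m3) ^ 2 = - ii * (r1 * r2 * r3) ^ 2" unfolding power_mult_distrib m by (simp add: power2_eq_square mult_ac)
 hence "z ^ 2 = - ii" unfolding z_def power_divide using f by simp
 hence "((1 + ii) * z) ^ 2 = q2 ^ 2" unfolding power_mult_distrib q22 by (simp add: power2_eq_square algebra_simps)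
 hence c: "(1 + ii) * z = q2 \<or> (1 + ii) * z = - q2" by (simp only: power2_eq_iff)
 have "sg (r1 * r2 * r3) ~= 0" using f aut_eq_0[OF s] by simp
 hence "sg z = z" unfolding z_def aut_divide[OF s] using fx f by (simp add: divide_eq_eq eq_divide_eq)
 hence "sg ((1 + ii) * z) = (1 + ii) * z" by (simp add: aut_simps[OF s] i)
 thus ?thesis using c by (auto simp: aut_minus[OF s])
qed

lemma index_exists: assumes s: "V sg"
 shows "sg (r2 * r3) = r2 * r3 \<or> sg (r3 * r1) = r3 * r1 \<or> sg (r1 * r2) = r1 * r2"
 using V_sign[OF t s] by (auto simp: aut_mult[OF V_aut[OF s]])

end

lemma V_fixed_q2: assumes t: "tri u v w r1 r2 r3" and s: "V sg" and i: "sg ii = ii" and r: "sg r1 = r1" "sg r2 = r2" "sg r3 = r3"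
 shows "sg q2 = q2"
proof -
 obtain m1 m2 m3 where m: "m1 ^ 2 = ii * r2 * r3" "m2 ^ 2 = ii * r3 * r1" "m3 ^ 2 = ii * r1 * r2" using alg_closed_sqrt by metis
 have "m1 \<in> rad8 S" "m2 \<in> rad8 S" "m3 \<in> rad8 S"
  using rad8_intros(1)[OF t m(1)] rad8_intros(1)[OF tri_cycle[OF t] m(2)] rad8_intros(1)[OF tri_cycle[OF tri_cycle[OF t]] m(3)] .
 hence "sg m1 = m1" "sg m2 = m2" "sg m3 = m3" using fix8[OF t s i r] by auto
 thus ?thesis by (intro fix_q2[OF t V_aut[OF s] i m]) (simp add: aut_mult[OF V_aut[OF s]] r)
qed

lemma V_all_signs: assumes t: "tri u v w r1 r2 r3" and s: "V sg" and i: "sg ii = ii"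
 shows "(sg r1 = r1 \<and> sg r2 = r2 \<and> sg r3 = r3) \<or> (sg r1 = - r1 \<and> sg r2 = - r2 \<and> sg r3 = - r3)"
 using V_sign[OF t s] sign_product[OF t s i] sign_product[OF tri_cycle[OF t] s i] tri_facts[OF t]
 by (auto simp: aut_mult[OF V_aut[OF s]])

end

section \<open>No coincidence at level 4\<close>

lemma neg_flip: "- x = y \<longleftrightarrow> x = - (y :: qbar)"
 by auto

lemma sign_factor: "y = x \<or> y = - x ==> \<exists>e :: qbar. (e = 1 \<or> e = - 1) \<and> y = e * x"
 by (metis mult_1 mult_minus1)

lemma (in eighth_root) ii_cancel: "ii * x = - (ii * y) \<longleftrightarrow> x = - y"
 by (metis mult_cancel_left ii_nz(1) mult_minus_right)

context eight_coincidence
begin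

text \<open>The square of \<tau> lies in V and fixes \<open>ii\<close>, hence r1 r2; this equates
  the two signs e.\<close>

lemma swap_signs_equal:
 assumes t: "tri u v w r1 r2 r3" and s: "field_aut \<tau>" "\<tau> u = u" "\<tau> v = w" "\<tau> w = v"
 shows "\<exists>e f. (e = 1 \<or> e = - 1) \<and> (f = 1 \<or> f = - 1) \<and> \<tau> r1 = f * (ii * r1) \<and> \<tau> r2 = e * (ii * r3) \<and> \<tau> r3 = e * (ii * r2)"
proof -
 note F = tri_facts[OF t] and A = aut_simps[OF s(1)]
 obtain f where f: "f = 1 \<or> f = - 1" "\<tau> r1 = f * (ii * r1)" using sign_factor[OF swap_action(1)[OF t s]] by blast
 obtain e where e: "e = 1 \<or> e = - 1" "\<tau> r2 = e * (ii * r3)" using sign_factor[OF swap_action(2)[OF t s]] by blast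
 obtain e' where e': "e' = 1 \<or> e' = - 1" "\<tau> r3 = e' * (ii * r2)" using sign_factor[OF swap_action(3)[OF t s]] by blast
 have fx: "\<tau> f = f" "\<tau> e = e" "\<tau> e' = e'" using f(1) e(1) e'(1) by (auto simp: A)
 have "\<forall>x\<in>S. (\<tau> \<circ> \<tau>) x = x" using F(14) s by auto
 hence V2: "V (\<tau> \<circ> \<tau>)" using aut_comp[OF s(1) s(1)] by (simp only: V_def simp_thms)
 have i2: "(\<tau> \<circ> \<tau>) ii = ii" using aut_ii[OF s(1)] by (auto simp: A)
 have "(\<tau> \<circ> \<tau>) (r1 * r2) = r1 * r2" by (rule sign_product[OF tri_cycle[OF tri_cycle[OF t]] V2 i2])
 moreover have "(\<tau> \<circ> \<tau>) (r1 * r2) = f * f * (e * e') * (\<tau> ii * ii * (\<tau> ii * ii)) * (r1 * r2)"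
 proof -
  have "\<tau> ii * \<tau> ii = - 1" using aut_ii[OF s(1)] by auto
  thus ?thesis by (simp add: A f(2) e(2) e'(2) fx mult_ac)
 qed
 moreover have "\<tau> ii * ii * (\<tau> ii * ii) = 1" using aut_ii[OF s(1)] by (elim disjE) simp_all
 moreover have "f * f = 1" using f(1) by auto
 ultimately have "e * e' * (r1 * r2) = 1 * (r1 * r2)" by simp
 hence "e * e' = 1" using F by (simp only: mult_cancel_right) simp
 hence "e = e'" using e(1) e'(1) by auto
 thus ?thesis using f e e' by blast
qed

text \<open>The conjugate of sg by \<tau> also negates the r_k and fixes \<open>ii\<close>, so its
  composition with sg is trivial on \<open>rad8\<close>. Hence sg has the same sign on \<rho> and on
  \<tau> \<rho>.\<close>

lemma conj_sign:
 assumes t: "tri u v w r1 r2 r3" and s: "V sg" "sg ii = ii" "sg r1 = - r1" "sg r2 = - r2" "sg r3 = - r3"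
  and ta: "field_aut \<tau>" "\<tau> u = u" "\<tau> v = w" "\<tau> w = v" "\<tau> ii = - ii" and r: "\<rho> \<in> rad8 S" "sg \<rho> = \<rho> \<or> sg \<rho> = - \<rho>"
 shows "(sg \<rho> = \<rho> \<and> sg (\<tau> \<rho>) = \<tau> \<rho>) \<or> (sg \<rho> = - \<rho> \<and> sg (\<tau> \<rho>) = - \<tau> \<rho>)"
proof -
 note a = V_aut[OF s(1)] and ST = aut_simps[OF ta(1)]
 note A = aut_simps[OF a]
 obtain e f where ef: "e = 1 \<or> e = - 1" "f = 1 \<or> f = - 1" "\<tau> r1 = f * (ii * r1)" "\<tau> r2 = e * (ii * r3)" "\<tau> r3 = e * (ii * r2)"
  using swap_signs_equal[OF t ta(1-4)] by blast
 have fx: "sg e = e" "sg f = f" using ef(1,2) by (auto simp: A)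
 let ?c = "inv_into UNIV \<tau> \<circ> sg \<circ> \<tau>"
 have Vc: "V ?c" by (rule V_conj[OF s(1) ta(1)])
 have c: "?c x = - x" if "sg (\<tau> x) = - \<tau> x" for x
 proof -
  have "?c x = inv_into UNIV \<tau> (\<tau> (- x))" using that by (simp add: ST)
  thus ?thesis by (simp add: aut_inv_apply[OF ta(1)])
 qed
 have ci: "?c ii = ii" using s(2) ta(5) by (simp add: A) (metis aut_inv_apply(1)[OF ta(1)] ta(5))
 have cr: "?c r1 = - r1" "?c r2 = - r2" "?c r3 = - r3"
  by (rule c, simp add: ef(3-5) A fx s)+
 have "(?c \<circ> sg) \<rho> = \<rho>"
  by (rule fix8[OF t V_comp[OF Vc s(1)] _ _ _ _ r(1)])
   (use ci cr s in \<open>simp_all add: aut_minus[OF V_aut[OF Vc]] del: comp_apply add: comp_apply[of ?c sg]\<close>)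
 hence 1: "?c (sg \<rho>) = \<rho>" by simp
 have 2: "\<tau> (?c x) = sg (\<tau> x)" for x by (simp add: aut_inv_apply[OF ta(1)])
 show ?thesis using r(2)
 proof
  assume "sg \<rho> = \<rho>"
  thus ?thesis using 1 2[of \<rho>] by simp
 next
  assume n: "sg \<rho> = - \<rho>"
  have "- ?c \<rho> = \<rho>" using 1 unfolding n aut_minus[OF V_aut[OF Vc]] .
  hence "?c \<rho> = - \<rho>" by (metis minus_minus)
  thus ?thesis using n 2[of \<rho>] ST by metis
 qed
qed

text \<open>For P^2 = r3 (r3 + ii r2) and Q^2 = ii r2 (ii r2 + r3), \<tau> maps P to \<plusminus>Q,
  so sg fixes P Q = \<plusminus>m1 (r3 + ii r2), whose second factor it negates. Likewise m2 and m3
  receive equal signs, and \<open>fix_q2\<close> applies.\<close>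

lemma transposition_signs:
 assumes t: "tri u v w r1 r2 r3" and s: "V sg" "sg ii = ii" "sg r1 = - r1" "sg r2 = - r2" "sg r3 = - r3"
  and ta: "field_aut \<tau>" "\<tau> u = u" "\<tau> v = w" "\<tau> w = v" "\<tau> ii = - ii" and m1: "m1 ^ 2 = ii * r2 * r3"
 shows "sg m1 = - m1" "sg q2 = q2"
proof -
 note F = tri_facts[OF t] and a = V_aut[OF s(1)]
 note A = aut_simps[OF a] and ST = aut_simps[OF ta(1)]
 obtain e f where ef: "e = 1 \<or> e = - 1" "f = 1 \<or> f = - 1" "\<tau> r1 = f * (ii * r1)" "\<tau> r2 = e * (ii * r3)" "\<tau> r3 = e * (ii * r2)"
  using swap_signs_equal[OF t ta(1-4)] by blast
 have ee: "e * e = 1" using ef(1) by auto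
 obtain P Q where PQ: "P ^ 2 = r3 * (r3 + ii * r2)" "Q ^ 2 = (ii * r2) * (ii * r2 + r3)" using alg_closed_sqrt by metis
 have P8: "P \<in> rad8 S" "Q \<in> rad8 S" using rad8_intros(2,3)[OF t] PQ by blast+
 have sP: "sg P = P \<or> sg P = - P" by (rule aut_sqrt_sign[OF a]) (simp add: PQ A s algebra_simps)
 have "\<tau> (P ^ 2) = (e * e) * ((ii * r2) * (ii * r2 + r3))"
  unfolding PQ by (simp add: ST ef(4,5) ta(5) algebra_simps)
 hence "\<tau> (P ^ 2) = Q ^ 2" unfolding ee PQ by simp
 hence tP: "\<tau> P = Q \<or> \<tau> P = - Q" by (rule aut_sqrt_sign[OF ta(1)])
 have "(sg P = P \<and> sg (\<tau> P) = \<tau> P) \<or> (sg P = - P \<and> sg (\<tau> P) = - \<tau> P)" by (rule conj_sign[OF t s ta P8(1) sP])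
 hence PQf: "sg (P * Q) = P * Q" using tP by (auto simp: A neg_flip)
 have "(P * Q) ^ 2 = (m1 * (r3 + ii * r2)) ^ 2" unfolding power_mult_distrib PQ m1 by (simp add: power2_eq_square algebra_simps)
 hence "P * Q = m1 * (r3 + ii * r2) \<or> P * Q = - (m1 * (r3 + ii * r2))" by (simp only: power2_eq_iff)
 hence "sg (m1 * (r3 + ii * r2)) = m1 * (r3 + ii * r2)" using PQf by (auto simp: aut_minus[OF a])
 hence "- sg m1 * (r3 + ii * r2) = m1 * (r3 + ii * r2)" by (simp add: A s algebra_simps)
 moreover have "r3 + ii * r2 ~= 0"
 proof
  assume "r3 + ii * r2 = 0"
  hence "(r3 + ii * r2) * (r3 - ii * r2) = 0" by simp
  hence "r3 ^ 2 + r2 ^ 2 = 0" by (simp add: power2_eq_square algebra_simps)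
  thus False using F(4,7) by (simp add: add_ac)
 qed
 ultimately have "- sg m1 = m1" by (simp only: mult_cancel_right simp_thms)
 thus sm1: "sg m1 = - m1" by (metis minus_minus)
 obtain m2 m3 where m: "m2 ^ 2 = ii * r3 * r1" "m3 ^ 2 = ii * r1 * r2" using alg_closed_sqrt by metis
 have m28: "m2 \<in> rad8 S" using rad8_intros(1)[OF tri_cycle[OF t] m(1)] .
 have s2: "sg m2 = m2 \<or> sg m2 = - m2" by (rule aut_sqrt_sign[OF a]) (simp add: m A s)
 have "\<tau> (m2 ^ 2) = e * f * m3 ^ 2" unfolding m by (simp add: ST ef(3,5) ta(5) mult_ac)
 moreover have "e * f = 1 \<or> e * f = - 1" using ef(1,2) by auto
 ultimately have "\<tau> (m2 ^ 2) = m3 ^ 2 \<or> \<tau> (m2 ^ 2) = (ii * m3) ^ 2" by (auto simp: power_mult_distrib ii2)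
 hence t2: "\<tau> m2 = m3 \<or> \<tau> m2 = - m3 \<or> \<tau> m2 = ii * m3 \<or> \<tau> m2 = - (ii * m3)" using aut_sqrt_sign[OF ta(1)] by blast
 have "(sg m2 = m2 \<and> sg (\<tau> m2) = \<tau> m2) \<or> (sg m2 = - m2 \<and> sg (\<tau> m2) = - \<tau> m2)" by (rule conj_sign[OF t s ta m28 s2])
 hence "(sg m2 = m2 \<and> sg m3 = m3) \<or> (sg m2 = - m2 \<and> sg m3 = - m3)" using t2 by (auto simp: A s(2) neg_flip ii_cancel)
 hence "sg (m1 * m2 * m3) = - (m1 * m2 * m3)" by (auto simp: A sm1)
 thus "sg q2 = q2" by (intro fix_q2[OF t a s(2) m1 m]) (simp add: A s)
qed

lemma V_fixes_q2:
 assumes t: "tri u v w r1 r2 r3" and s: "V sg" "sg ii = ii"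
  and ta: "field_aut \<tau>" "\<tau> u = u" "\<tau> v = w" "\<tau> w = v" "\<tau> ii = - ii"
 shows "sg q2 = q2"
proof -
 obtain m1 where m1: "m1 ^ 2 = ii * r2 * r3" using alg_closed_sqrt by blast
 show ?thesis using V_all_signs[OF t s] V_fixed_q2[OF t s] transposition_signs(2)[OF t s _ _ _ ta m1] by blast
qed

text \<open>If V fixed \<open>ii\<close>, an automorphism moving \<open>ii\<close> would act as a
  transposition, and so would one that fixes \<open>ii\<close> and moves \<open>q2\<close>. The cube
  of their product lies in V but moves \<open>ii\<close>.\<close>

lemma ex_V_moving_ii: "\<exists>c. V c \<and> c ii = - ii"
proof (rule ccontr)
 assume "\<not> ?thesis"
 hence all: "sg ii = ii" if "V sg" for sg using that aut_ii[OF V_aut[OF that]] by blast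
 obtain g where g: "field_aut g" "g ii = - ii" using aut_signs(1) by blast
 obtain h where h: "field_aut h" "h ii = ii" "h q2 = - q2" using aut_signs(2) by blast
 have "\<not> V (g \<circ> g \<circ> g)" using all[of "g \<circ> g \<circ> g"] g by (auto simp: aut_simps[OF g(1)])
 then obtain u v w where g': "S = {u, v, w}" "u ~= v" "u ~= w" "v ~= w" "g u = u" "g v = w" "g w = v" using perm_type[OF g(1)] by blast
 obtain r1 r2 r3 where t: "tri u v w r1 r2 r3" using tri_exists[OF g'(1-4)] by blast
 have "\<not> V (h \<circ> h \<circ> h)"
 proof
  assume Vh: "V (h \<circ> h \<circ> h)"
  have "(h \<circ> h \<circ> h) q2 = q2" by (rule V_fixes_q2[OF t Vh all[OF Vh] g(1) g'(5-7) g(2)])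
  thus False using h by (simp add: aut_simps[OF h(1)])
 qed
 then obtain u' v' w' where h': "S = {u', v', w'}" "u' ~= v'" "u' ~= w'" "v' ~= w'" "h u' = u'" "h v' = w'" "h w' = v'"
  using perm_type[OF h(1)] by blast
 have "V ((h \<circ> g) \<circ> (h \<circ> g) \<circ> (h \<circ> g))" by (rule two_transpositions[OF g(1) g' h(1) h'])
 from all[OF this] show False using g h by (simp add: aut_simps[OF g(1)] aut_simps[OF h(1)])
qed

lemma ii_product_signs:
 assumes t: "tri u v w r1 r2 r3" and s: "V sg" and i: "sg ii = - ii" and p: "sg (r2 * r3) = r2 * r3"
 shows "sg (r3 * r1) = - (r3 * r1)" "sg (r1 * r2) = - (r1 * r2)"
proof -
 note A = aut_simps[OF V_aut[OF s]]
 show "sg (r3 * r1) = - (r3 * r1)" by (rule sign_product_ii[OF t s i p])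
 have "sg ((ii * r2) * (ii * r1)) = - ((ii * r2) * (ii * r1))"
  by (rule sign_product_ii[OF tri_swap[OF t] s i]) (use p in \<open>simp add: A i mult_ac\<close>)
 thus "sg (r1 * r2) = - (r1 * r2)" by (simp add: A i mult_ac neg_flip)
qed

text \<open>An element \<open>c\<close> of \<open>V\<close> that moves \<open>ii\<close> fixes exactly one of the products \<open>r2 r3, r3 r1, r1 r2\<close>. The product
 of \<open>c\<close> with a conjugate of \<open>c\<close> fixes \<open>ii\<close>, hence all three, so the distinguished root is rational.\<close>

lemma index_fixed:
 assumes t: "tri u v w r1 r2 r3" and c: "V c" "c ii = - ii" "c (r2 * r3) = r2 * r3" and s: "field_aut sg"
 shows "sg u = u"
proof (rule ccontr)
 assume ne: "sg u ~= u"
 note F = tri_facts[OF t]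
 let ?i = "inv_into UNIV sg"
 have ai: "field_aut ?i" by (rule aut_inv[OF s])
 define c' where "c' = inv_into UNIV ?i \<circ> c \<circ> ?i"
 have inv2: "inv_into UNIV ?i = sg" using s by (simp add: field_aut_def inv_inv_eq)
 have Vc': "V c'" unfolding c'_def by (rule V_conj[OF c(1) ai])
 have c'x: "c' (sg x) = sg (c x)" for x unfolding c'_def inv2 by (simp add: aut_inv_apply[OF s])
 have ci: "c' ii = - ii"
 proof -
  have "sg ii = ii \<or> sg ii = - ii" by (rule aut_ii[OF s])
  thus ?thesis using c'x[of ii] c(2) by (auto simp: aut_minus[OF s] aut_minus[OF V_aut[OF Vc']] neg_flip)
 qed
 have cP: "c' (sg r2 * sg r3) = sg r2 * sg r3" using c'x[of "r2 * r3"] c(3) by (simp add: aut_mult[OF s])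
 have t': "tri (sg u) (sg v) (sg w) (sg r1) (sg r2) (sg r3)" by (rule tri_aut[OF t s])
 note F' = tri_facts[OF t']
 have mem: "sg u \<in> {u, v, w}" "sg v \<in> {u, v, w}" "sg w \<in> {u, v, w}" using F'(8-10) F(14) by auto
 have sq: "(sg r2 * sg r3) ^ 2 = (sg w - sg u) * (sg u - sg v)" unfolding power_mult_distrib F'(2,3) ..
 have other: "c' (r2 * r3) = - (r2 * r3)"
 proof (cases "sg u = v")
  case True
  have "(sg v = u \<and> sg w = w) \<or> (sg v = w \<and> sg w = u)" using permutation_3[OF mem F'(11-13)] True F(11-13) by auto
  moreover have e: "(r3 * r1) ^ 2 = (u - v) * (v - w)" unfolding power_mult_distrib F(1,3) ..
  ultimately have "(sg r2 * sg r3) ^ 2 = (r3 * r1) ^ 2" unfolding sq e True by (elim disjE conjE) (simp_all add: algebra_simps)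
  hence "sg r2 * sg r3 = r3 * r1 \<or> sg r2 * sg r3 = - (r3 * r1)" by (simp only: power2_eq_iff)
  hence "c' (r3 * r1) = r3 * r1" using cP by (auto simp: aut_minus[OF V_aut[OF Vc']])
  thus ?thesis by (rule ii_product_signs(2)[OF tri_cycle[OF t] Vc' ci])
 next
  case False
  hence uw: "sg u = w" using ne mem by blast
  have "(sg v = u \<and> sg w = v) \<or> (sg v = v \<and> sg w = u)" using permutation_3[OF mem F'(11-13)] uw F(11-13) by auto
  moreover have e: "(r1 * r2) ^ 2 = (v - w) * (w - u)" unfolding power_mult_distrib F(1,2) ..
  ultimately have "(sg r2 * sg r3) ^ 2 = (r1 * r2) ^ 2" unfolding sq e uw by (elim disjE conjE) (simp_all add: algebra_simps)
  hence "sg r2 * sg r3 = r1 * r2 \<or> sg r2 * sg r3 = - (r1 * r2)" by (simp only: power2_eq_iff)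
  hence "c' (r1 * r2) = r1 * r2" using cP by (auto simp: aut_minus[OF V_aut[OF Vc']])
  thus ?thesis by (rule ii_product_signs(1)[OF tri_cycle[OF tri_cycle[OF t]] Vc' ci])
 qed
 have "(c \<circ> c') (r2 * r3) = r2 * r3"
  by (rule sign_product[OF t V_comp[OF c(1) Vc']]) (simp add: ci c(2) aut_minus[OF V_aut[OF c(1)]])
 hence "c (- (r2 * r3)) = r2 * r3" using other by simp
 thus False using c(3) F(5,6) by (simp add: aut_minus[OF V_aut[OF c(1)]])
qed

lemma normalized_triple: "\<exists>u v w r1 r2 r3 c. tri u v w r1 r2 r3 \<and> V c \<and> c ii = - ii \<and> c (r2 * r3) = r2 * r3"
proof -
 obtain c where c: "V c" "c ii = - ii" using ex_V_moving_ii by blast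
 obtain u v w r1 r2 r3 where t: "tri u v w r1 r2 r3" using S_cases tri_exists by metis
 from index_exists[OF t c(1)] show ?thesis
  using t c tri_cycle[OF t] tri_cycle[OF tri_cycle[OF t]] by blast
qed

end

context eight_coincidence
begin

context
 fixes u v w r1 r2 r3 c
 assumes t: "tri u v w r1 r2 r3" and c: "V c" "c ii = - ii" "c (r2 * r3) = r2 * r3"
begin

text \<open>If sg moves \<open>ii\<close>, composition with c reduces to the case where
  \<open>ii\<close> is fixed. The three products thus lie in the field generated by S.\<close>

lemma V_products: assumes s: "V sg"
 shows "sg (r2 * r3) = r2 * r3" "sg (ii * (r1 * r2)) = ii * (r1 * r2)" "sg (ii * (r3 * r1)) = ii * (r3 * r1)"
proof -
 note a = V_aut[OF s] and ac = V_aut[OF c(1)]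
 have "sg (r2 * r3) = r2 * r3 \<and> sg (ii * (r1 * r2)) = ii * (r1 * r2) \<and> sg (ii * (r3 * r1)) = ii * (r3 * r1)"
 proof (cases "sg ii = ii")
  case True
  thus ?thesis using sign_product[OF t s True] sign_product[OF tri_cycle[OF t] s True] sign_product[OF tri_cycle[OF tri_cycle[OF t]] s True]
   by (simp add: aut_mult[OF a])
 next
  case False
  hence i: "sg ii = - ii" using aut_ii[OF a] by blast
  have ci: "(c \<circ> sg) ii = ii" using i c(2) by (simp add: aut_minus[OF ac])
  note V' = V_comp[OF c(1) s]
  have "c (sg (r2 * r3)) = c (r2 * r3)" using sign_product[OF t V' ci] c(3) by simp
  hence p: "sg (r2 * r3) = r2 * r3" by (simp only: aut_inj[OF ac])
  show ?thesis using p ii_product_signs[OF t s i p] by (simp add: aut_mult[OF a] i)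
 qed
 thus "sg (r2 * r3) = r2 * r3" "sg (ii * (r1 * r2)) = ii * (r1 * r2)" "sg (ii * (r3 * r1)) = ii * (r3 * r1)" by blast+
qed

text \<open>With rational 2-torsion the products become rational numbers p, b, d satisfying (p/b)^2
  + (p/d)^2 = 1, and the roots m_k put p, b and d into \<open>cls\<close>.\<close>

lemma split_case:
 assumes all: "\<And>sg. field_aut sg ==> V sg" shows False
proof -
 note F = tri_facts[OF t]
 obtain p where p: "r2 * r3 = to_ac p" using fixed_imp_rational V_products(1)[OF all] by blast
 obtain b where b: "ii * (r1 * r2) = to_ac b" using fixed_imp_rational V_products(2)[OF all] by blast
 obtain d where d: "ii * (r3 * r1) = to_ac d" using fixed_imp_rational V_products(3)[OF all] by blast
 have nz: "p ~= 0" "b ~= 0" "d ~= 0" using p b d F(4-6) by auto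
 obtain h where h: "field_aut h" "h ii = ii" "h q2 = - q2" using aut_signs(2) by blast
 \<comment> \<open>h moves \<open>q2\<close>, so it must negate all r_k. Composition with h then
   shows that whatever fixes \<open>ii\<close> and \<open>q2\<close> fixes the r_k.\<close>
 have hr: "h r1 = - r1 \<and> h r2 = - r2 \<and> h r3 = - r3"
  using V_all_signs[OF t all[OF h(1)] h(2)] V_fixed_q2[OF t all[OF h(1)] h(2)] h(3) by auto
 have fx: "sg \<rho> = \<rho>" if s: "field_aut sg" "sg ii = ii" "sg q2 = q2" and r: "\<rho> \<in> rad8 S" for sg \<rho>
 proof -
  have "sg r1 = r1 \<and> sg r2 = r2 \<and> sg r3 = r3"
  proof (rule ccontr)
   assume "\<not> ?thesis"
   hence m: "sg r1 = - r1 \<and> sg r2 = - r2 \<and> sg r3 = - r3" using V_all_signs[OF t all[OF s(1)] s(2)] by blast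
   have "(h \<circ> sg) q2 = q2"
    by (rule V_fixed_q2[OF t all[OF aut_comp[OF h(1) s(1)]]]) (use m hr s h in \<open>simp_all add: aut_minus[OF h(1)]\<close>)
   thus False using s h by simp
  qed
  thus ?thesis using fix8[OF t all[OF s(1)] s(2)] r by blast
 qed
 obtain m1 m2 m3 where m: "m1 ^ 2 = ii * r2 * r3" "m2 ^ 2 = ii * r3 * r1" "m3 ^ 2 = ii * r1 * r2" using alg_closed_sqrt by metis
 have m8: "m1 \<in> rad8 S" "m2 \<in> rad8 S" "m3 \<in> rad8 S"
  using rad8_intros(1)[OF t m(1)] rad8_intros(1)[OF tri_cycle[OF t] m(2)] rad8_intros(1)[OF tri_cycle[OF tri_cycle[OF t]] m(3)] .
 have cd: "cls d" by (rule cls_if_fixed[of m2]) (use m(2) d fx m8 in \<open>simp_all add: mult.assoc\<close>)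
 have cb: "cls b" by (rule cls_if_fixed[of m3]) (use m(3) b fx m8 in \<open>simp_all add: mult.assoc\<close>)
 \<comment> \<open>m1^2 = ii p is not rational; division by (1 + ii)^2 = 2 ii removes the factor
   \<open>ii\<close>.\<close>
 have cp: "cls (p / 2)"
 proof (rule cls_if_fixed[of "m1 / (1 + ii)"])
  have "(m1 / (1 + ii)) ^ 2 = ii * to_ac p / (2 * ii)" unfolding power_divide m(1) p[symmetric] by (simp add: power2_eq_square algebra_simps)
  thus "(m1 / (1 + ii)) ^ 2 = to_ac (p / 2)" by simp
 qed (use fx m8(1) in \<open>simp add: aut_simps\<close>)
 have "cls (2 * (p / 2))" by (rule cls_mult[OF cls_numeral(1) cp])
 hence cp': "cls p" by simp
 have "to_ac ((p / b) ^ 2 + (p / d) ^ 2) = (r3 / (ii * r1)) ^ 2 + (r2 / (ii * r1)) ^ 2"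
 proof -
  have "to_ac (p / b) = r3 / (ii * r1)" using F(4-6) by (simp add: p[symmetric] b[symmetric])
  moreover have "to_ac (p / d) = r2 / (ii * r1)" using F(4-6) by (simp add: p[symmetric] d[symmetric])
  ultimately show ?thesis by simp
 qed
 also have "\<dots> = (r3 ^ 2 + r2 ^ 2) / - (r1 ^ 2)" by (simp add: power_divide power_mult_distrib ii2 add_divide_distrib)
 also have "r3 ^ 2 + r2 ^ 2 = - (r1 ^ 2)" using F(7) by (simp add: eq_neg_iff_add_eq_0 add_ac)
 also have "- (r1 ^ 2) / - (r1 ^ 2) = to_ac 1" using F(4) by simp
 finally have "(p / b) ^ 2 + (p / d) ^ 2 = 1" by (simp only: to_ac_eq_iff)
 thus False using no_unit_circle[OF _ cls_divide[OF cp' cb nz(2)] cls_divide[OF cp' cd nz(3)]] nz by simp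
qed

text \<open>Here \<open>v\<close> and \<open>w\<close> are conjugate over \<open>\<rat>(D)\<close> with \<open>D\<^sup>2 = d = \<plusminus>2\<close>, and \<open>r2 r3 = \<pi> D\<close>, \<open>r1\<^sup>2 = \<beta> D\<close>. The
 descent leaves only \<open>r2 = \<plusminus>r3\<close>, which an automorphism with \<open>ii \<mapsto> -ii\<close> and \<open>q2 \<mapsto> -q2\<close> excludes.\<close>

lemma swap_case:
 assumes ex: "\<not> (\<forall>sg. field_aut sg \<longrightarrow> V sg)" shows False
proof -
 note F = tri_facts[OF t]
 have swap: "sg u = u \<and> sg v = w \<and> sg w = v" if s: "field_aut sg" "\<not> V sg" for sg
 proof -
  note F' = tri_facts[OF tri_aut[OF t s(1)]]
  have u: "sg u = u" by (rule index_fixed[OF t c s(1)])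
  have mem: "sg u \<in> {u, v, w}" "sg v \<in> {u, v, w}" "sg w \<in> {u, v, w}" using F'(8-10) F(14) by auto
  have "(sg v = v \<and> sg w = w) \<or> (sg v = w \<and> sg w = v)" using permutation_3[OF mem F'(11-13)] u F(11-13) by auto
  moreover have "\<not> (sg v = v \<and> sg w = w)"
  proof
   assume "sg v = v \<and> sg w = w"
   hence "\<forall>x\<in>S. sg x = x" using u F(14) by auto
   thus False using s by (simp only: V_def simp_thms)
  qed
  ultimately show ?thesis using u by blast
 qed
 have VI: "V sg" if "field_aut sg" "sg u = u" "sg v = v" "sg w = w" for sg
 proof -
  have "\<forall>x\<in>S. sg x = x" using that F(14) by auto
  thus ?thesis using that(1) by (simp only: V_def simp_thms)
 qed
 have VE: "sg u = u" "sg v = v" "sg w = w" if "V sg" for sg using that F(8-10) by (simp_all add: V_def)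
 have swap_swap: "V (sg \<circ> \<tau>)" if "field_aut sg" "\<not> V sg" "field_aut \<tau>" "\<not> V \<tau>" for sg \<tau>
  using swap[OF that(1,2)] swap[OF that(3,4)] by (intro VI aut_comp that) auto
 have swap_V: "\<not> V (sg \<circ> \<tau>)" "\<not> V (\<tau> \<circ> sg)" if "field_aut sg" "\<not> V sg" "V \<tau>" for sg \<tau>
  using swap[OF that(1,2)] VE[OF that(3)] VE[of "sg \<circ> \<tau>"] VE[of "\<tau> \<circ> sg"] F(13) by auto
 obtain sg0 where s0: "field_aut sg0" "\<not> V sg0" using ex by blast
 have "\<exists>\<tau>. field_aut \<tau> \<and> \<not> V \<tau> \<and> \<tau> ii = - ii"
 proof (cases "sg0 ii = ii")
  case True
  have "field_aut (c \<circ> sg0)" "\<not> V (c \<circ> sg0)" "(c \<circ> sg0) ii = - ii"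
   using aut_comp[OF V_aut[OF c(1)] s0(1)] swap_V(2)[OF s0 c(1)] True c(2) by auto
  thus ?thesis by blast
 next
  case False thus ?thesis using s0 aut_ii[OF s0(1)] by blast
 qed
 then obtain \<tau> where ta: "field_aut \<tau>" "\<not> V \<tau>" "\<tau> ii = - ii" by blast
 have tau: "\<tau> u = u" "\<tau> v = w" "\<tau> w = v" using swap[OF ta(1,2)] by auto
 have Vq2: "sg q2 = q2" if "V sg" "sg ii = ii" for sg by (rule V_fixes_q2[OF t that ta(1) tau ta(3)])
 note ac = V_aut[OF c(1)]
 \<comment> \<open>c moves \<open>ii\<close>, so it fixes exactly one of \<open>q2\<close> and
   \<open>ii * q2\<close>. This D is fixed by V, and automorphisms outside V negate it.\<close>
 define D where "D = (if c q2 = q2 then q2 else ii * q2)"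
 define d :: rat where "d = (if c q2 = q2 then 2 else - 2)"
 have D2: "D * D = to_ac d" "D ~= 0" "d = 2 \<or> d = - 2" by (auto simp: D_def d_def mult_ac)
 have cD: "c D = D" unfolding D_def using aut_q2[OF ac] by (auto simp: aut_mult[OF ac] c(2))
 have VD1: "sg D = D" if "V sg" "sg ii = ii" for sg
  unfolding D_def using Vq2[OF that] that(2) by (simp add: aut_mult[OF V_aut[OF that(1)]])
 have VD: "sg D = D" if s: "V sg" for sg
 proof (cases "sg ii = ii")
  case False
  hence "sg ii = - ii" using aut_ii[OF V_aut[OF s]] by blast
  hence "c (sg D) = c D" using VD1[OF V_comp[OF c(1) s]] c(2) cD by (simp add: aut_minus[OF ac])
  thus ?thesis by (simp only: aut_inj[OF ac])
 qed (use VD1 s in blast)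
 obtain h where h: "field_aut h" "h ii = ii" "h q2 = - q2" using aut_signs(2) by blast
 have hV: "\<not> V h" using Vq2[of h] h by auto
 have hD: "h D = - D" unfolding D_def using h by (simp add: aut_mult[OF h(1)])
 have sD: "sg D = - D" if s: "field_aut sg" "\<not> V sg" for sg
  using VD[OF swap_swap[OF s h(1) hV]] hD by (simp add: aut_minus[OF s(1)] neg_flip)
 have rat_quot: "\<exists>q. x = to_ac q * D" if "\<And>sg. V sg ==> sg x = x" "\<And>sg. field_aut sg ==> \<not> V sg ==> sg x = - x" for x
 proof -
  have "sg (x / D) = x / D" if s: "field_aut sg" for sg
   using \<open>\<And>sg. V sg ==> sg x = x\<close>[of sg] \<open>\<And>sg. field_aut sg ==> \<not> V sg ==> sg x = - x\<close>[OF s] VD[of sg] sD[OF s]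
   by (cases "V sg") (simp_all add: aut_divide[OF s])
  then obtain q where "x / D = to_ac q" using fixed_imp_rational by blast
  thus ?thesis using D2(2) by (auto simp: field_simps)
 qed
 have act: "\<exists>e f. (e = 1 \<or> e = - 1) \<and> (f = 1 \<or> f = - 1) \<and> sg r1 = f * (ii * r1) \<and> sg r2 = e * (ii * r3) \<and> sg r3 = e * (ii * r2)"
  if "field_aut sg" "\<not> V sg" for sg
  using swap_signs_equal[OF t that(1)] swap[OF that] by blast
 define P Q R where "P = r2 * r3" and "Q = ii * (r1 * r2)" and "R = ii * (r3 * r1)"
 have nz: "P ~= 0" "Q ~= 0" "R ~= 0" using F(4-6) by (auto simp: P_def Q_def R_def)
 have "\<exists>q. P = to_ac q * D"
 proof (rule rat_quot)
  fix sg assume "V sg" thus "sg P = P" unfolding P_def by (rule V_products)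
 next
  fix sg assume s: "field_aut sg" "\<not> V sg"
  obtain e where e: "e = 1 \<or> e = - 1" "sg r2 = e * (ii * r3)" "sg r3 = e * (ii * r2)" using act[OF s] by blast
  have "sg P = (e * e) * (- P)" unfolding P_def by (simp add: aut_mult[OF s(1)] e(2,3) mult_ac)
  thus "sg P = - P" using e(1) by auto
 qed
 then obtain \<pi> where pi: "P = to_ac \<pi> * D" by blast
 have "\<exists>q. r1 ^ 2 = to_ac q * D"
 proof (rule rat_quot)
  fix sg assume s: "V sg" show "sg (r1 ^ 2) = r1 ^ 2" unfolding F(1) using VE[OF s] by (simp add: aut_diff[OF V_aut[OF s]])
 next
  fix sg assume s: "field_aut sg" "\<not> V sg"
  show "sg (r1 ^ 2) = - (r1 ^ 2)" unfolding F(1) using swap[OF s] by (simp add: aut_diff[OF s(1)])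
 qed
 then obtain \<beta> where be: "r1 ^ 2 = to_ac \<beta> * D" by blast
 have nz': "\<pi> ~= 0" "\<beta> ~= 0" using pi be nz F(4) by auto
 obtain e f where ef: "e = 1 \<or> e = - 1" "f = 1 \<or> f = - 1" "h r1 = f * (ii * r1)" "h r2 = e * (ii * r3)" "h r3 = e * (ii * r2)"
  using act[OF h(1) hV] by blast
 \<comment> \<open>Automorphisms outside V map Q to \<kappa> R and \<kappa> R to Q. Hence Q +
   \<kappa> R is rational and Q - \<kappa> R is a rational multiple of D, which gives x and
   y.\<close>
 obtain \<kappa> :: rat where k: "\<kappa> = 1 \<or> \<kappa> = - 1" "to_ac \<kappa> = - (e * f)"
 proof -
  have "e * f = 1 \<or> e * f = - 1" using ef(1,2) by auto
  thus ?thesis using that[of "- 1"] that[of 1] by auto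
 qed
 have hQ: "h Q = to_ac \<kappa> * R" unfolding Q_def R_def k(2) by (simp add: aut_mult[OF h(1)] h(2) ef(3,4) mult_ac)
 have VQ: "sg Q = Q" "sg R = R" if "V sg" for sg unfolding Q_def R_def using V_products[OF that] by auto
 have sQ: "sg Q = to_ac \<kappa> * R" if s: "field_aut sg" "\<not> V sg" for sg
 proof -
  have "V (inv_into UNIV h \<circ> sg)"
  proof (rule ccontr)
   assume n: "\<not> V (inv_into UNIV h \<circ> sg)"
   have "V (h \<circ> (inv_into UNIV h \<circ> sg))" by (rule swap_swap[OF h(1) hV aut_comp[OF aut_inv[OF h(1)] s(1)] n])
   moreover have "h \<circ> (inv_into UNIV h \<circ> sg) = sg" by (simp add: fun_eq_iff aut_inv_apply[OF h(1)])
   ultimately show False using s by simp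
  qed
  hence "inv_into UNIV h (sg Q) = Q" using VQ(1) by fastforce
  hence "sg Q = h Q" using aut_inv_apply(2)[OF h(1), of "sg Q"] by simp
  thus ?thesis using hQ by simp
 qed
 have sR: "sg (to_ac \<kappa> * R) = Q" if s: "field_aut sg" "\<not> V sg" for sg
  using VQ(1)[OF swap_swap[OF s h(1) hV]] hQ by simp
 have VR: "sg (to_ac \<kappa> * R) = to_ac \<kappa> * R" if "V sg" for sg
  using VQ[OF that] by (simp add: aut_mult[OF V_aut[OF that]] aut_rat[OF V_aut[OF that]])
 have "sg (Q + to_ac \<kappa> * R) = Q + to_ac \<kappa> * R" if s: "field_aut sg" for sg
  using VQ[of sg] VR[of sg] sQ[OF s] sR[OF s] by (cases "V sg") (simp_all add: aut_add[OF s])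
 then obtain x where x: "Q + to_ac \<kappa> * R = to_ac x" using fixed_imp_rational by blast
 have "\<exists>q. Q - to_ac \<kappa> * R = to_ac q * D"
 proof (rule rat_quot)
  fix sg assume s: "V sg" show "sg (Q - to_ac \<kappa> * R) = Q - to_ac \<kappa> * R"
   using VQ[OF s] VR[OF s] by (simp add: aut_diff[OF V_aut[OF s]])
 next
  fix sg assume s: "field_aut sg" "\<not> V sg"
  show "sg (Q - to_ac \<kappa> * R) = - (Q - to_ac \<kappa> * R)" using sQ[OF s] sR[OF s] by (simp add: aut_diff[OF s(1)])
 qed
 then obtain y where y: "Q - to_ac \<kappa> * R = to_ac y * D" by blast
 have kk: "\<kappa> * \<kappa> = 1" using k(1) by auto
 have kk': "to_ac \<kappa> * to_ac \<kappa> = 1" using kk by (metis to_ac_mult to_ac_1)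
 have r23: "r2 ^ 2 + r3 ^ 2 = - (r1 ^ 2)" using F(7) by (simp add: eq_neg_iff_add_eq_0 add_ac)
 have QR: "Q ^ 2 + R ^ 2 = to_ac (\<beta> ^ 2 * d)"
 proof -
  have "Q ^ 2 + R ^ 2 = - (r1 ^ 2) * (r2 ^ 2 + r3 ^ 2)" unfolding Q_def R_def power_mult_distrib ii2 by (simp add: algebra_simps)
  also have "\<dots> = (r1 ^ 2) * (r1 ^ 2)" unfolding r23 by simp
  also have "\<dots> = to_ac \<beta> * to_ac \<beta> * (D * D)" unfolding be by (simp add: mult_ac)
  finally show ?thesis unfolding D2 by (simp add: power2_eq_square)
 qed
 have QR': "Q * R = to_ac (- (\<beta> * \<pi> * d))"
 proof -
  have "Q * R = - (r1 ^ 2 * P)" unfolding Q_def R_def P_def by (simp add: power2_eq_square mult_ac)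
  also have "\<dots> = - (to_ac \<beta> * to_ac \<pi> * (D * D))" unfolding be pi by (simp add: mult_ac)
  finally show ?thesis unfolding D2 by simp
 qed
 have xx: "x ^ 2 = \<beta> ^ 2 * d - 2 * \<kappa> * (\<beta> * \<pi> * d)"
 proof -
  have "to_ac (x ^ 2) = Q ^ 2 + (to_ac \<kappa> * to_ac \<kappa>) * R ^ 2 + 2 * to_ac \<kappa> * (Q * R)"
   by (simp add: x[symmetric] power2_eq_square algebra_simps)
  also have "\<dots> = (Q ^ 2 + R ^ 2) + 2 * to_ac \<kappa> * (Q * R)" unfolding kk' by simp
  also have "\<dots> = to_ac (\<beta> ^ 2 * d - 2 * \<kappa> * (\<beta> * \<pi> * d))" unfolding QR QR' by simp
  finally show ?thesis by (simp only: to_ac_eq_iff)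
 qed
 have yy: "y ^ 2 * d = \<beta> ^ 2 * d + 2 * \<kappa> * (\<beta> * \<pi> * d)"
 proof -
  have "to_ac (y ^ 2 * d) = (to_ac y * D) * (to_ac y * D)" by (simp add: D2(1)[symmetric] power2_eq_square mult_ac)
  also have "\<dots> = Q ^ 2 + (to_ac \<kappa> * to_ac \<kappa>) * R ^ 2 - 2 * to_ac \<kappa> * (Q * R)"
   unfolding y[symmetric] by (simp add: power2_eq_square algebra_simps)
  also have "\<dots> = (Q ^ 2 + R ^ 2) - 2 * to_ac \<kappa> * (Q * R)" unfolding kk' by simp
  also have "\<dots> = to_ac (\<beta> ^ 2 * d + 2 * \<kappa> * (\<beta> * \<pi> * d))" unfolding QR QR' by simp
  finally show ?thesis by (simp only: to_ac_eq_iff)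
 qed
 \<comment> \<open>Dividing x^2 and y^2 d by \<beta>^2 d leaves 1 - \<omega> and 1 + \<omega>, the
   shape treated in \<open>quartic_degenerate\<close>.\<close>
 define \<omega> where "\<omega> = 2 * \<kappa> * \<pi> / \<beta>"
 have d0: "d ~= 0" using D2(3) by auto
 have w1: "1 - \<omega> = d * (x / (\<beta> * d)) ^ 2" unfolding \<omega>_def power_divide xx using nz' d0 by (simp add: field_simps power2_eq_square)
 have w2: "1 + \<omega> = (y / \<beta>) ^ 2"
 proof -
  have "y ^ 2 * d = (\<beta> ^ 2 * (1 + \<omega>)) * d" unfolding yy \<omega>_def using nz' by (simp add: field_simps power2_eq_square)
  hence "y ^ 2 = \<beta> ^ 2 * (1 + \<omega>)" using d0 by simp
  thus ?thesis using nz' by (simp add: power_divide)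
 qed
 obtain m1 where m1: "m1 ^ 2 = ii * r2 * r3" using alg_closed_sqrt by blast
 have "cls (\<beta> * \<pi> * (d / 2))"
 proof (rule cls_if_fixed[of "r1 * m1 / (1 + ii)"])
  have "(r1 * m1 / (1 + ii)) ^ 2 = (r1 ^ 2 * (ii * P)) / (2 * ii)" unfolding power_divide power_mult_distrib m1 P_def by (simp add: power2_eq_square algebra_simps)
  also have "\<dots> = to_ac \<beta> * to_ac \<pi> * (D * D) / 2" unfolding be pi by (simp add: mult_ac)
  finally show "(r1 * m1 / (1 + ii)) ^ 2 = to_ac (\<beta> * \<pi> * (d / 2))" unfolding D2 by simp
 next
  fix sg assume s: "field_aut sg" "sg ii = ii" "sg q2 = q2"
  have "sg D = D" unfolding D_def using s by (simp add: aut_mult)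
  hence Vs: "V sg" using sD[OF s(1)] D2(2) by (metis ii_neq_uminus(1))
  have "sg (r1 * m1) = r1 * m1" using V_all_signs[OF t Vs s(2)]
  proof
   assume r: "sg r1 = r1 \<and> sg r2 = r2 \<and> sg r3 = r3"
   hence "sg m1 = m1" using fix8[OF t Vs s(2) _ _ _ rad8_intros(1)[OF t m1]] by blast
   thus ?thesis using r by (simp add: aut_mult[OF s(1)])
  next
   assume r: "sg r1 = - r1 \<and> sg r2 = - r2 \<and> sg r3 = - r3"
   hence "sg m1 = - m1" using transposition_signs(1)[OF t Vs s(2) _ _ _ ta(1) tau ta(3) m1] by blast
   thus ?thesis using r by (simp add: aut_mult[OF s(1)])
  qed
  thus "sg (r1 * m1 / (1 + ii)) = r1 * m1 / (1 + ii)" by (simp add: aut_divide[OF s(1)] aut_add[OF s(1)] aut_1[OF s(1)] s(2))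
 qed
 moreover have "cls (2 * \<kappa> * (d / 2))"
  unfolding cls_def by (rule exI[of _ 1]) (use k(1) D2(3) in auto)
 ultimately have "cls ((2 * \<kappa> * (d / 2)) * (\<beta> * \<pi> * (d / 2)))" by (rule cls_mult[rotated])
 moreover have "(2 * \<kappa> * (d / 2)) * (\<beta> * \<pi> * (d / 2)) = (\<beta> * (d / 2)) ^ 2 * \<omega>"
  unfolding \<omega>_def using nz' by (simp add: power2_eq_square field_simps)
 ultimately have cw: "cls \<omega>" using cls_square_mult[of "\<beta> * (d / 2)" \<omega>] nz' d0 by simp
 have "\<omega> ~= 0" unfolding \<omega>_def using nz' k(1) by auto
 from quartic_degenerate[OF D2(3) w1 w2 cw this] have d2: "d = 2" and "y / \<beta> = 0" by auto
 hence "y = 0" using nz' by simp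
 hence "Q = to_ac \<kappa> * R" using y by simp
 hence "r1 * (ii * r2) = r1 * (ii * (to_ac \<kappa> * r3))" unfolding Q_def R_def by (simp add: mult_ac)
 hence r2: "r2 = to_ac \<kappa> * r3" using F(4) by (simp only: mult_cancel_left ii_nz simp_thms)
 have Dq: "D = q2" using d2 unfolding d_def D_def by (auto split: if_splits)
 obtain g where g: "field_aut g" "g ii = - ii" "g q2 = - q2" using aut_signs(3) by blast
 have gV: "\<not> V g" using VD[of g] g(3) Dq by auto
 obtain e' f' where ef': "e' = 1 \<or> e' = - 1" "f' = 1 \<or> f' = - 1" "g r1 = f' * (ii * r1)" "g r2 = e' * (ii * r3)" "g r3 = e' * (ii * r2)"
  using act[OF g(1) gV] by blast
 have gg: "(g \<circ> g) ii = ii" "(g \<circ> g) r1 = r1" "(g \<circ> g) r2 = r2" "(g \<circ> g) r3 = r3"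
  using ef'(1,2) by (auto simp: aut_simps[OF g(1)] g(2) ef'(3-5))
 obtain n where n: "n ^ 2 = r3 * (r3 + ii * r2)" using alg_closed_sqrt by blast
 have ggn: "g (g n) = n" using fix8[OF t swap_swap[OF g(1) gV g(1) gV] gg rad8_intros(2)[OF t n]] by simp
 have r22: "r2 * r2 = r3 * r3" unfolding r2 using kk' by (simp add: mult_ac)
 have ee: "e' * e' = 1" using ef'(1) by auto
 have gn: "(g n) ^ 2 = - (r3 * (r3 - ii * r2))"
 proof -
  have "(g n) ^ 2 = (e' * e') * (- (r2 * (r2 - ii * r3)))" unfolding aut_power[OF g(1), symmetric] n
   by (simp add: aut_simps[OF g(1)] g(2) ef'(4,5) algebra_simps)
  also have "\<dots> = - (r2 * r2 - ii * (r2 * r3))" unfolding ee by (simp add: algebra_simps)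
  finally show ?thesis unfolding r22 by (simp add: algebra_simps)
 qed
 have "(n * g n) ^ 2 = - (r3 * r3 * (r3 * r3 + r2 * r2))" unfolding power_mult_distrib n gn by (simp add: algebra_simps)
 also have "\<dots> = (ii * q2 * (r3 * r3)) ^ 2" unfolding r22 power_mult_distrib ii2 q22 by (simp add: power2_eq_square algebra_simps)
 finally have N: "n * g n = ii * q2 * (r3 * r3) \<or> n * g n = - (ii * q2 * (r3 * r3))" by (simp only: power2_eq_iff)
 have "g (n * g n) = n * g n" using ggn by (simp add: aut_mult[OF g(1)] mult.commute)
 hence "g (ii * q2 * (r3 * r3)) = ii * q2 * (r3 * r3)" using N by (auto simp: aut_minus[OF g(1)])
 moreover have "g (ii * q2 * (r3 * r3)) = - (ii * q2 * (r3 * r3))"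
 proof -
  have "g r3 * g r3 = (e' * e') * - (r2 * r2)" unfolding ef'(5) by (simp add: mult_ac)
  hence "g r3 * g r3 = - (r3 * r3)" unfolding ee r22 by simp
  thus ?thesis by (simp add: aut_mult[OF g(1)] g(2,3))
 qed
 ultimately show False using F(6) by (metis ii_neq_uminus(1) ii_nz(1,2) mult_eq_0_iff)
qed

end

theorem eight_coincidence_False: False
proof -
 obtain u v w r1 r2 r3 c where "tri u v w r1 r2 r3" "V c" "c ii = - ii" "c (r2 * r3) = r2 * r3" using normalized_triple by blast
 note * = split_case[OF this] swap_case[OF this]
 show False using * by blast
qed

end

section \<open>Coincidence at level 2\<close>

lemma family_A_shift: "family_A (4 - m) = - 27 * (m ^ 2 - 8 * m + 13) * (m ^ 2 - 27) ^ 3"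
 unfolding family_A_def by Groebner_Basis.algebra

lemma family_B_shift: "family_B (4 - m) = 54 * (m ^ 2 - 10 * m + 27) * (m ^ 2 - 2 * m - 17) * (m ^ 2 - 27) ^ 4"
 unfolding family_B_def by Groebner_Basis.algebra

lemma (in eighth_root) family_parameter:
 fixes q w d A B :: rat
 assumes d: "16 * d ^ 2 = 432 * w ^ 2 + 40 * q ^ 3 * w + q ^ 6" and A: "48 * A = - (q ^ 4) - 16 * q * w"
  and B: "216 * B = - (d * (q ^ 3 + 4 * w))" and w: "w ~= 0"
 shows "\<exists>t u. u ~= 0 \<and> u ^ 4 * family_A t = A \<and> u ^ 6 * family_B t = B"
proof -
 have q: "q ~= 0"
 proof
  assume "q = 0"
  hence "d ^ 2 = 27 * w ^ 2" using d by simp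
  hence "(d / w) ^ 2 = 27" using w by (simp add: power_divide)
  thus False using rat_square_neq by blast
 qed
 define m where "m = (4 * d - q ^ 3) / (4 * w)"
 define M where "M = m ^ 2 - 27"
 have M0: "M ~= 0" using rat_square_neq(2)[of m] by (simp add: M_def)
 have d': "d = m * w + q ^ 3 / 4" unfolding m_def using w by (simp add: field_simps)
 have "w * (16 * m ^ 2 * w + 8 * m * q ^ 3) = w * (432 * w + 40 * q ^ 3)"
  using d unfolding d' by (simp add: power2_eq_square algebra_simps eval_nat_numeral)
 hence "16 * m ^ 2 * w + 8 * m * q ^ 3 = 432 * w + 40 * q ^ 3" using w by simp
 hence wM: "2 * M * w = (5 - m) * q ^ 3" unfolding M_def by (simp add: algebra_simps)
 hence w': "w = (5 - m) * q ^ 3 / (2 * M)" using M0 by (simp add: field_simps)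
 define u where "u = q / (6 * M)"
 have "u ~= 0" using q M0 by (simp add: u_def)
 moreover have "u ^ 4 * family_A (4 - m) = A"
 proof -
  have "u ^ 4 * family_A (4 - m) = - (q ^ 4 * (M + 8 * (5 - m))) / (48 * M)"
   unfolding family_A_shift M_def[symmetric] u_def power_divide power_mult_distrib
   using M0 by (simp add: field_simps) (simp add: M_def algebra_simps eval_nat_numeral)
  also have "\<dots> = (- (q ^ 4) - 16 * q * w) / 48" unfolding w' using M0 by (simp add: field_simps) (simp add: algebra_simps eval_nat_numeral)
  also have "\<dots> = A" using A by simp
  finally show ?thesis .
 qed
 moreover have "u ^ 6 * family_B (4 - m) = B"
 proof -
  have 1: "d = - (q ^ 3 * (m ^ 2 - 10 * m + 27)) / (4 * M)"
   unfolding d' w' using M0 by (simp add: field_simps) (simp add: M_def algebra_simps eval_nat_numeral)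
  have 2: "q ^ 3 + 4 * w = q ^ 3 * (m ^ 2 - 2 * m - 17) / M"
   unfolding w' using M0 by (simp add: field_simps) (simp add: M_def algebra_simps eval_nat_numeral)
  have "216 * B = (q ^ 3 * q ^ 3) * ((m ^ 2 - 10 * m + 27) * (m ^ 2 - 2 * m - 17)) / (4 * M ^ 2)"
  proof -
   have "- (- (z * x) / (4 * M) * (z * y / M)) = (z * z) * (x * y) / (4 * M ^ 2)" for x y z
    by (simp add: power2_eq_square mult_ac)
   thus ?thesis unfolding B 2 unfolding 1 .
  qed
  also have "\<dots> = 216 * (u ^ 6 * family_B (4 - m))"
   unfolding family_B_shift M_def[symmetric] u_def power_divide power_mult_distrib
  proof -
   have "q ^ 6 = q ^ 3 * q ^ 3" "M ^ 6 = M ^ 4 * M ^ 2" by (simp_all flip: power_add)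
   moreover have "z * (x * y) / (4 * M ^ 2) = 216 * (z / (6 ^ 6 * (M ^ 4 * M ^ 2)) * (54 * x * y * M ^ 4))" for x y z
    using M0 by (simp add: field_simps)
   ultimately show "q ^ 3 * q ^ 3 * ((m ^ 2 - 10 * m + 27) * (m ^ 2 - 2 * m - 17)) / (4 * M ^ 2)
     = 216 * (q ^ 6 / (6 ^ 6 * M ^ 6) * (54 * (m ^ 2 - 10 * m + 27) * (m ^ 2 - 2 * m - 17) * M ^ 4))"
    by (simp only:)
  qed
  finally show ?thesis by simp
 qed
 ultimately show ?thesis by blast
qed

locale four_coincidence = galois_triple +
 assumes H1: "field_aut sg ==> \<forall>x\<in>S. sg x = x ==> r \<in> rad4 S ==> sg r = r"
begin

lemma V_trivial: assumes t: "tri u v w r1 r2 r3" and s: "V sg"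
 shows "sg r1 = r1" "sg r2 = r2" "sg r3 = r3" "sg ii = ii"
proof -
 note F = tri_facts[OF t]
 have fx: "field_aut sg" "\<forall>x\<in>S. sg x = x" using s by (simp_all add: V_def)
 have m: "r1 \<in> rad4 S" "r2 \<in> rad4 S" "r3 \<in> rad4 S" "ii * r1 \<in> rad4 S"
  unfolding rad4_def mem_Collect_eq
  by (rule bexI[OF _ F(9)], rule bexI[OF _ F(10)], intro conjI F(1,13),
    rule bexI[OF _ F(10)], rule bexI[OF _ F(8)], intro conjI F(2) F(12)[symmetric],
    rule bexI[OF _ F(8)], rule bexI[OF _ F(9)], intro conjI F(3,11),
    rule bexI[OF _ F(10)], rule bexI[OF _ F(9)], intro conjI F(13)[symmetric], simp add: power_mult_distrib ii2 F(1))
 show r: "sg r1 = r1" "sg r2 = r2" "sg r3 = r3" using H1[OF fx] m by auto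
 have "sg ii * r1 = ii * r1" using H1[OF fx m(4)] r(1) by (simp add: aut_mult[OF fx(1)])
 thus "sg ii = ii" using F(4) by simp
qed

lemma same_perm:
 assumes t: "tri u v w r1 r2 r3" and s: "field_aut sg" "field_aut g" and e: "sg u = g u" "sg v = g v" "sg w = g w"
 shows "sg r1 = g r1" "sg r2 = g r2" "sg r3 = g r3" "sg ii = g ii"
proof -
 let ?k = "inv_into UNIV g \<circ> sg"
 have "\<forall>x\<in>S. ?k x = x" using tri_facts(14)[OF t] e by (auto simp: aut_inv_apply[OF s(2)])
 moreover have "field_aut ?k" by (intro aut_comp aut_inv s)
 ultimately have V: "V ?k" by (simp only: V_def simp_thms)
 have *: "sg x = g x" if "?k x = x" for x using arg_cong[OF that, of g] by (simp add: aut_inv_apply[OF s(2)])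
 show "sg r1 = g r1" by (rule *[OF V_trivial(1)[OF t V]])
 show "sg r2 = g r2" by (rule *[OF V_trivial(2)[OF t V]])
 show "sg r3 = g r3" by (rule *[OF V_trivial(3)[OF t V]])
 show "sg ii = g ii" by (rule *[OF V_trivial(4)[OF t V]])
qed

definition dihedral :: "qbar => qbar => qbar => qbar => (qbar => qbar) => bool" where
 "dihedral j r1 r2 r3 sg \<longleftrightarrow>
  (sg j = j \<and> ((sg r1 = r1 \<and> sg r2 = r2 \<and> sg r3 = r3) \<or> (sg r1 = r2 \<and> sg r2 = r3 \<and> sg r3 = r1) \<or> (sg r1 = r3 \<and> sg r2 = r1 \<and> sg r3 = r2))) \<or>
  (sg j = - j \<and> ((sg r1 = j * r1 \<and> sg r2 = j * r3 \<and> sg r3 = j * r2) \<or> (sg r1 = j * r3 \<and> sg r2 = j * r2 \<and> sg r3 = j * r1)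
    \<or> (sg r1 = j * r2 \<and> sg r2 = j * r1 \<and> sg r3 = j * r3)))"

lemma dihedral_action:
 "\<exists>j u v w r1 r2 r3. j * j = - 1 \<and> tri u v w r1 r2 r3 \<and> (\<forall>sg. field_aut sg \<longrightarrow> dihedral j r1 r2 r3 sg)"
proof -
 obtain \<tau> where ta: "field_aut \<tau>" "\<tau> ii = - ii" using aut_signs(1) by blast
 note T = aut_simps[OF ta(1)]
 obtain x y z where S0: "S = {x, y, z}" "x ~= y" "x ~= z" "y ~= z" using S_cases by blast
 obtain p1 p2 p3 where t0: "tri x y z p1 p2 p3" using tri_exists[OF S0] by blast
 have "\<not> V (\<tau> \<circ> \<tau> \<circ> \<tau>)" using V_trivial(4)[OF t0, of "\<tau> \<circ> \<tau> \<circ> \<tau>"] ta(2) by (auto simp: T)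
 then obtain u v w where tu: "S = {u, v, w}" "u ~= v" "u ~= w" "v ~= w" "\<tau> u = u" "\<tau> v = w" "\<tau> w = v" using perm_type[OF ta(1)] by blast
 obtain r1 s2 r3 where t1: "tri u v w r1 s2 r3" using tri_exists[OF tu(1-4)] by blast
 note F1 = tri_facts[OF t1]
 note sw = swap_action[OF t1 ta(1) tu(5-7)]
 obtain f where f: "f = 1 \<or> f = - 1" "\<tau> r1 = f * (ii * r1)" using sign_factor[OF sw(1)] by blast
 obtain e where e: "e = 1 \<or> e = - 1" "\<tau> s2 = e * (ii * r3)" using sign_factor[OF sw(2)] by blast
 obtain e' where e': "e' = 1 \<or> e' = - 1" "\<tau> r3 = e' * (ii * s2)" using sign_factor[OF sw(3)] by blast
 have fx: "\<tau> e = e" "\<tau> f = f" "\<tau> e' = e'" using e(1) f(1) e'(1) by (auto simp: T)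
 have VI: "V sg" if "field_aut sg" "sg u = u" "sg v = v" "sg w = w" for sg
 proof -
  have "\<forall>x\<in>S. sg x = x" using that tu(1) by auto
  thus ?thesis using that(1) by (simp only: V_def simp_thms)
 qed
 have "(\<tau> \<circ> \<tau>) s2 = s2" by (rule V_trivial(2)[OF t1 VI[OF aut_comp[OF ta(1) ta(1)]]]) (use tu in simp_all)
 hence "e * e' * s2 = 1 * s2" by (simp add: T e(2) e'(2) fx ta(2) mult_ac)
 hence "e * e' = 1" using F1(5) by (simp only: mult_cancel_right simp_thms)
 hence ee: "e' = e" using e(1) e'(1) by auto
 define j where "j = f * ii"
 define r2 where "r2 = (e * f) * s2"
 have sq: "f * f = 1" "e * e = 1" using e(1) f(1) by auto
 have sq': "f * (f * a) = a" "e * (e * a) = a" for a using sq by (simp_all add: mult.assoc[symmetric])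
 have jj: "j * j = - 1" unfolding j_def using sq(1) by (simp add: mult_ac sq')
 have jj': "j * (j * a) = - a" for a using jj by (simp add: mult.assoc[symmetric])
 have tj: "\<tau> j = - j" unfolding j_def using ta(2) by (simp add: T fx)
 have t2: "tri u v w r1 r2 r3"
 proof -
  have "r2 ^ 2 = s2 ^ 2" unfolding r2_def using e(1) f(1) by auto
  thus ?thesis using t1 unfolding tri_def by simp
 qed
 have tr: "\<tau> r1 = j * r1" "\<tau> r2 = j * r3" "\<tau> r3 = j * r2"
  unfolding j_def r2_def using f(2) e(2) e'(2) ee by (simp_all add: T fx mult_ac sq')
 have js: "sg j = j \<or> sg j = - j" if "field_aut sg" for sg
  using aut_sqrt_sign[OF that, of j j] jj aut_minus[OF that] aut_1[OF that] by (simp add: power2_eq_square)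
 have Vj: "sg j = g j" if "sg ii = g ii" "field_aut sg" "field_aut g" for sg g
  using that f(1) unfolding j_def by (auto simp: aut_mult aut_minus aut_1)
 have same: "dihedral j a1 a2 a3 sg" if tt: "tri u v w a1 a2 a3" and g: "field_aut g" "dihedral j a1 a2 a3 g" and s: "field_aut sg"
  and eq: "sg u = g u" "sg v = g v" "sg w = g w" for g sg a1 a2 a3
  using g(2) unfolding dihedral_def same_perm[OF tt s g(1) eq] Vj[OF same_perm(4)[OF tt s g(1) eq] s g(1)] .
 show ?thesis
 proof (cases "\<exists>\<rho>. field_aut \<rho> \<and> \<rho> u = v \<and> \<rho> v = w \<and> \<rho> w = u")
  case True
  then obtain \<rho> where rho: "field_aut \<rho>" "\<rho> u = v" "\<rho> v = w" "\<rho> w = u" by blast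
  note R = aut_simps[OF rho(1)] and F2 = tri_facts[OF t2]
  have rs: "\<rho> r1 = r2 \<or> \<rho> r1 = - r2" "\<rho> r2 = r3 \<or> \<rho> r2 = - r3" "\<rho> r3 = r1 \<or> \<rho> r3 = - r1"
   by (rule aut_sqrt_sign[OF rho(1)]; simp add: F2 aut_diff[OF rho(1)] rho)+
  obtain a' where a': "a' = 1 \<or> a' = - 1" "\<rho> r1 = a' * r2" using sign_factor[OF rs(1)] by blast
  obtain b' where b': "b' = 1 \<or> b' = - 1" "\<rho> r2 = b' * r3" using sign_factor[OF rs(2)] by blast
  obtain c' where c': "c' = 1 \<or> c' = - 1" "\<rho> r3 = c' * r1" using sign_factor[OF rs(3)] by blast
  have fx': "\<rho> a' = a'" "\<rho> b' = b'" "\<rho> c' = c'" "\<tau> a' = a'" "\<tau> b' = b'" "\<tau> c' = c'"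
   using a'(1) b'(1) c'(1) by (auto simp: R T)
  have V3: "V (\<rho> \<circ> \<rho> \<circ> \<rho>)" by (rule VI[OF aut_comp[OF aut_comp[OF rho(1) rho(1)] rho(1)]]) (use rho in simp_all)
  have rj: "\<rho> j = j"
  proof -
   have "(\<rho> \<circ> \<rho> \<circ> \<rho>) j = j" using Vj[of "\<rho> \<circ> \<rho> \<circ> \<rho>" id] V_trivial(4)[OF t2 V3] V_aut[OF V3] aut_id by simp
   thus ?thesis using js[OF rho(1)] by (auto simp: R)
  qed
  have "(\<rho> \<circ> \<rho> \<circ> \<rho>) r1 = r1" by (rule V_trivial(1)[OF t2 V3])
  hence "(a' * b' * c') * r1 = 1 * r1" by (simp add: R a'(2) b'(2) c'(2) fx' mult_ac)
  hence abc: "a' * b' * c' = 1" using F2(4) by (simp only: mult_cancel_right simp_thms)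
  have "V ((\<tau> \<circ> \<rho>) \<circ> (\<tau> \<circ> \<rho>))" by (rule VI[OF aut_comp[OF aut_comp[OF ta(1) rho(1)] aut_comp[OF ta(1) rho(1)]]]) (use rho tu in simp_all)
  hence "((\<tau> \<circ> \<rho>) \<circ> (\<tau> \<circ> \<rho>)) r1 = r1" by (rule V_trivial(1)[OF t2])
  hence "(a' * c') * r1 = 1 * r1" by (simp add: R T a'(2) b'(2) c'(2) fx' tr tj rj mult_ac jj')
  hence ac: "a' * c' = 1" using F2(4) by (simp only: mult_cancel_right simp_thms)
  have ca: "c' = a'" "b' = 1" using a'(1) b'(1) c'(1) abc ac by auto
  have aa: "a' * a' = 1" "a' * (a' * q) = q" for q using a'(1) by auto
  define r1' where "r1' = a' * r1"
  have t3: "tri u v w r1' r2 r3"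
  proof -
   have "r1' ^ 2 = r1 ^ 2" unfolding r1'_def using a'(1) by auto
   thus ?thesis using t2 unfolding tri_def by simp
  qed
  have tr': "\<tau> r1' = j * r1'" "\<rho> r1' = r2" "\<rho> r2 = r3" "\<rho> r3 = r1'"
   unfolding r1'_def using a'(2) b'(2) c'(2) ca tr by (simp_all add: T R fx' aa mult_ac)
  have gens: "dihedral j r1' r2 r3 id" "dihedral j r1' r2 r3 \<rho>" "dihedral j r1' r2 r3 (\<rho> \<circ> \<rho>)"
   "dihedral j r1' r2 r3 \<tau>" "dihedral j r1' r2 r3 (\<tau> \<circ> \<rho>)" "dihedral j r1' r2 r3 (\<rho> \<circ> \<tau>)"
   unfolding dihedral_def by (simp_all add: rj tj tr tr' R T)
  have "dihedral j r1' r2 r3 sg" if s: "field_aut sg" for sg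
  proof -
   note F' = tri_facts[OF tri_aut[OF t3 s]]
   have mem: "sg u \<in> {u, v, w}" "sg v \<in> {u, v, w}" "sg w \<in> {u, v, w}" using F'(8-10) tu(1) by auto
   note D = same[OF t3 aut_id gens(1) s] same[OF t3 rho(1) gens(2) s] same[OF t3 aut_comp[OF rho(1) rho(1)] gens(3) s]
    same[OF t3 ta(1) gens(4) s] same[OF t3 aut_comp[OF ta(1) rho(1)] gens(5) s] same[OF t3 aut_comp[OF rho(1) ta(1)] gens(6) s]
   show ?thesis using permutation_3[OF mem F'(11-13)]
    by (elim disjE conjE) (use D rho tu(5-7) in \<open>simp_all\<close>)
  qed
  thus ?thesis using jj t3 by blast
 next
  case no: False
  have gens: "dihedral j r1 r2 r3 id" "dihedral j r1 r2 r3 \<tau>" unfolding dihedral_def by (simp_all add: tj tr)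
  have "dihedral j r1 r2 r3 sg" if s: "field_aut sg" for sg
  proof -
   note F' = tri_facts[OF tri_aut[OF t2 s]]
   have mem: "sg u \<in> {u, v, w}" "sg v \<in> {u, v, w}" "sg w \<in> {u, v, w}" using F'(8-10) tu(1) by auto
   have no': "\<not> (\<rho> u = v \<and> \<rho> v = w \<and> \<rho> w = u)" if "field_aut \<rho>" for \<rho> using no that by blast
   note N = no'[OF s] no'[OF aut_comp[OF s s]] no'[OF aut_comp[OF ta(1) s]] no'[OF aut_comp[OF s ta(1)]]
   note D = same[OF t2 aut_id gens(1) s] same[OF t2 ta(1) gens(2) s]
   show ?thesis using permutation_3[OF mem F'(11-13)]
    by (elim disjE conjE) (use D N tu(5-7) in \<open>simp_all\<close>)
  qed
  thus ?thesis using jj t2 by blast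
 qed
qed

text \<open>The invariants are \<open>q = (1 + j) (r1 + r2 + r3)\<close>, \<open>W = (1 - j) r1 r2 r3\<close> and
 \<open>D = (1 + j) (r1 - r2) (r2 - r3) (r3 - r1)\<close>; the relation is the discriminant of the cubic with roots \<open>r1, r2, r3\<close>.\<close>

lemma rational_invariants:
 "\<exists>q W D u v w. S = {u, v, w} \<and> u ~= v \<and> u ~= w \<and> v ~= w \<and> W ~= 0 \<and> 16 * D ^ 2 = 432 * W ^ 2 + 40 * q ^ 3 * W + q ^ 6 \<and>
  (u + v + w = 0 \<longrightarrow> 48 * (u * v + u * w + v * w) = to_ac (- (q ^ 4) - 16 * q * W) \<and> 216 * - (u * v * w) = to_ac (- (D * (q ^ 3 + 4 * W))))"
proof -
 obtain j u v w r1 r2 r3 where jj: "j * j = - 1" and t: "tri u v w r1 r2 r3" and d: "\<And>sg. field_aut sg ==> dihedral j r1 r2 r3 sg"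
  using dihedral_action by blast
 note F = tri_facts[OF t]
 have jj': "j * (j * x) = - x" for x using jj by (simp add: mult.assoc[symmetric])
 define p s3 \<delta> where "p = r1 + r2 + r3" and "s3 = r1 * r2 * r3" and "\<delta> = (r1 - r2) * (r2 - r3) * (r3 - r1)"
 have inv: "sg ((1 + j) * p) = (1 + j) * p \<and> sg ((1 - j) * s3) = (1 - j) * s3 \<and> sg ((1 + j) * \<delta>) = (1 + j) * \<delta>" if s: "field_aut sg" for sg
 proof -
  note A = aut_simps[OF s]
  have "(sg j = j \<and> sg p = p \<and> sg s3 = s3 \<and> sg \<delta> = \<delta>) \<or> (sg j = - j \<and> sg p = j * p \<and> sg s3 = - (j * s3) \<and> sg \<delta> = j * \<delta>)"
   using d[OF s] unfolding dihedral_def p_def s3_def \<delta>_def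
   by (elim disjE conjE) (simp_all add: A algebra_simps jj jj')
  thus ?thesis by (elim disjE conjE) (simp_all add: A algebra_simps jj jj')
 qed
 obtain q where q: "(1 + j) * p = to_ac q" using fixed_imp_rational inv by blast
 obtain W where W: "(1 - j) * s3 = to_ac W" using fixed_imp_rational inv by blast
 obtain D where D: "(1 + j) * \<delta> = to_ac D" using fixed_imp_rational inv by blast
 have j2: "(1 + j) * (1 - j) = 2" by (simp add: algebra_simps jj)
 have W0: "W ~= 0"
 proof
  assume "W = 0"
  hence "(1 + j) * ((1 - j) * s3) = 0" using W by simp
  hence "2 * s3 = 0" by (simp only: mult.assoc[symmetric] j2)
  thus False using F(4-6) by (simp add: s3_def)
 qed
 define s2 where "s2 = r1 * r2 + r1 * r3 + r2 * r3"
 have "p ^ 2 = (r1 ^ 2 + r2 ^ 2 + r3 ^ 2) + 2 * s2" unfolding p_def s2_def by (simp add: power2_eq_square algebra_simps)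
 hence s2: "2 * s2 = p ^ 2" unfolding F(7) by simp
 have disc: "\<delta> ^ 2 = p ^ 2 * s2 ^ 2 - 4 * s2 ^ 3 - 4 * p ^ 3 * s3 + 18 * p * s2 * s3 - 27 * s3 ^ 2"
  unfolding \<delta>_def p_def s2_def s3_def by Groebner_Basis.algebra
 have q2: "to_ac q ^ 2 = 2 * j * p ^ 2" unfolding q[symmetric] by (simp add: power2_eq_square algebra_simps jj jj')
 have qW: "to_ac q * to_ac W = 2 * p * s3" unfolding q[symmetric] W[symmetric] by (simp add: algebra_simps jj jj')
 have W2: "to_ac W ^ 2 = - 2 * j * s3 ^ 2" unfolding W[symmetric] by (simp add: power2_eq_square algebra_simps jj jj')
 have DD: "to_ac D ^ 2 = 2 * j * \<delta> ^ 2" unfolding D[symmetric] by (simp add: power2_eq_square algebra_simps jj jj')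
 have q4: "to_ac q ^ 4 = - 4 * p ^ 4"
 proof -
  have "to_ac q ^ 4 = (to_ac q ^ 2) ^ 2" by (simp flip: power_mult)
  thus ?thesis unfolding q2 by (simp add: power2_eq_square eval_nat_numeral mult_ac jj jj')
 qed
 have e1: "16 * D ^ 2 = 432 * W ^ 2 + 40 * q ^ 3 * W + q ^ 6"
 proof -
  have "to_ac (432 * W ^ 2 + 40 * q ^ 3 * W + q ^ 6) = 432 * to_ac W ^ 2 + 40 * to_ac q ^ 2 * (to_ac q * to_ac W) + to_ac q ^ 2 * to_ac q ^ 4"
   by (simp add: eval_nat_numeral mult_ac)
  also have "\<dots> = 2 * j * (- 432 * s3 ^ 2 + 80 * p ^ 3 * s3 - 4 * p ^ 6)" unfolding q2 qW W2 q4 by Groebner_Basis.algebra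
  also have "\<dots> = 16 * (2 * j * \<delta> ^ 2)" unfolding disc using s2 by Groebner_Basis.algebra
  also have "\<dots> = to_ac (16 * D ^ 2)" unfolding DD[symmetric] by simp
  finally show ?thesis by (simp only: to_ac_eq_iff)
 qed
 have e2: "48 * (u * v + u * w + v * w) = to_ac (- (q ^ 4) - 16 * q * W)" if z: "u + v + w = 0"
 proof -
  have "48 * (u * v + u * w + v * w) = 4 * p ^ 4 - 32 * (p * s3)"
  proof -
   have "3 * (u * v + u * w + v * w) = r1 ^ 2 * r2 ^ 2 + r1 ^ 2 * r3 ^ 2 + r2 ^ 2 * r3 ^ 2" unfolding F(1-3) using z by Groebner_Basis.algebra
   also have "\<dots> = s2 ^ 2 - 2 * (p * s3)" unfolding s2_def p_def s3_def by Groebner_Basis.algebra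
   finally have "48 * (u * v + u * w + v * w) = 4 * (2 * s2) ^ 2 - 32 * (p * s3)" by Groebner_Basis.algebra
   thus ?thesis unfolding s2 by (simp flip: power_mult)
  qed
  also have "\<dots> = - (to_ac q ^ 4) - 16 * (to_ac q * to_ac W)" unfolding q4 qW by simp
  finally show ?thesis by (simp add: mult.assoc)
 qed
 have e3: "216 * - (u * v * w) = to_ac (- (D * (q ^ 3 + 4 * W)))" if z: "u + v + w = 0"
 proof -
  have u3: "3 * u = r3 ^ 2 - r2 ^ 2" "3 * v = r1 ^ 2 - r3 ^ 2" "3 * w = r2 ^ 2 - r1 ^ 2" unfolding F(1-3) using z by (Groebner_Basis.algebra)+
  have "27 * - (u * v * w) = - ((3 * u) * (3 * v) * (3 * w))" by simp
  also have "\<dots> = \<delta> * (p * s2 - s3)" unfolding u3 \<delta>_def p_def s2_def s3_def by Groebner_Basis.algebra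
  finally have 1: "216 * - (u * v * w) = 4 * (\<delta> * (p * (2 * s2) - 2 * s3))" by Groebner_Basis.algebra
  have "to_ac q ^ 3 = to_ac q ^ 2 * to_ac q" by (simp add: eval_nat_numeral)
  hence q3: "to_ac q ^ 3 = - 2 * (1 - j) * p ^ 3" unfolding q2 unfolding q[symmetric] by (simp add: eval_nat_numeral algebra_simps jj jj')
  have "to_ac (- (D * (q ^ 3 + 4 * W))) = - (to_ac D * (to_ac q ^ 3 + 4 * to_ac W))" by simp
  also have "\<dots> = - (((1 + j) * (1 - j)) * (\<delta> * (- 2 * p ^ 3 + 4 * s3)))" unfolding q3 D[symmetric] W[symmetric] by Groebner_Basis.algebra
  also have "\<dots> = 4 * (\<delta> * (p ^ 3 - 2 * s3))" unfolding j2 by (simp add: algebra_simps)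
  also have "\<dots> = 216 * - (u * v * w)" unfolding 1 s2 by (simp add: eval_nat_numeral mult_ac)
  finally show ?thesis by simp
 qed
 have "S = {u, v, w} \<and> u ~= v \<and> u ~= w \<and> v ~= w" using F by blast
 thus ?thesis using W0 e1 e2 e3 by blast
qed

end

context rational_weierstrass
begin

lemma coincide_if_division_field_eq:
 assumes "division_field E (2 ^ (n + 1)) = division_field E (2 ^ n)" shows "R.coincide n"
 unfolding R.coincide_def using fixes_tors_if_division_field_eq[OF assms] by auto

lemma coincidence_at_2:
 assumes n: "n \<ge> 1" and eq: "division_field E (2 ^ (n + 1)) = division_field E (2 ^ n)"
 shows "n = 1 \<and> (\<exists>t. elliptic_curve (family_curve t) \<and> wc_isomorphic E (family_curve t))"
proof -
 have co: "R.coincide n" by (rule coincide_if_division_field_eq[OF eq])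
 obtain ii q2 :: qbar where iq: "ii ^ 2 = - 1" "q2 ^ 2 = 2" using alg_closed_sqrt by metis
 interpret G: galois_triple ii q2 R.roots2
  by standard (use iq R.card_roots2 R.aut_roots2 in auto)
 have n1: "n = 1"
 proof (rule ccontr)
  assume "n ~= 1"
  hence c2: "R.coincide 2" using R.coincide_2[of n] n co by simp
  interpret eight_coincidence ii q2 R.roots2
   by standard (rule R.coincide_2_radicals[OF c2])
  show False by (rule eight_coincidence_False)
 qed
 have c1: "R.coincide 1" using co n1 by simp
 interpret four_coincidence ii q2 R.roots2
  by standard (rule R.coincide_1_radicals[OF c1])
 obtain q W D u v w where S: "R.roots2 = {u, v, w}" "u ~= v" "u ~= w" "v ~= w" and W: "W ~= 0"
  and D: "16 * D ^ 2 = 432 * W ^ 2 + 40 * q ^ 3 * W + q ^ 6"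
  and ab: "u + v + w = 0 ==> 48 * (u * v + u * w + v * w) = to_ac (- (q ^ 4) - 16 * q * W) \<and>
   216 * - (u * v * w) = to_ac (- (D * (q ^ 3 + 4 * W)))"
  using rational_invariants by blast
 have "u \<in> R.roots2" "v \<in> R.roots2" "w \<in> R.roots2" using S(1) by auto
 note f = R.roots2_factor(1-3)[OF this S(2-4)]
 have "to_ac (48 * short_A E) = to_ac (- (q ^ 4) - 16 * q * W)" using ab[OF f(1)] f(2) by (simp add: short_Eb)
 hence A: "48 * short_A E = - (q ^ 4) - 16 * q * W" by (simp only: to_ac_eq_iff)
 have "to_ac (216 * short_B E) = to_ac (- (D * (q ^ 3 + 4 * W)))" using ab[OF f(1)] f(3) by (simp add: short_Eb)
 hence B: "216 * short_B E = - (D * (q ^ 3 + 4 * W))" by (simp only: to_ac_eq_iff)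
 obtain t z where z: "z ~= 0" "z ^ 4 * family_A t = short_A E" "z ^ 6 * family_B t = short_B E"
  using G.family_parameter[OF D A B W] by blast
 have iso: "wc_isomorphic E (family_curve t)" unfolding family_curve_def by (rule wc_isomorphic_short[OF z])
 have "elliptic_curve (family_curve t)" unfolding elliptic_curve_def
 proof
  assume "wc_discriminant (family_curve t) = 0"
  moreover have "short_A (family_curve t) = family_A t" "short_B (family_curve t) = family_B t"
   by (simp_all add: short_A_def short_B_def family_curve_def)
  ultimately have d: "4 * family_A t ^ 3 + 27 * family_B t ^ 2 = 0" unfolding discriminant_short by simp
  have "4 * short_A E ^ 3 + 27 * short_B E ^ 2 = z ^ 12 * (4 * family_A t ^ 3 + 27 * family_B t ^ 2)"
   unfolding z(2,3)[symmetric] by (simp add: power_mult_distrib algebra_simps flip: power_mult)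
  hence "wc_discriminant E = 0" unfolding discriminant_short d by simp
  thus False using ell by (simp add: elliptic_curve_def)
 qed
 with n1 iso show ?thesis by blast
qed

end

theorem theorem1p4:
  fixes E :: "rat weierstrass" and p n :: nat
  assumes "elliptic_curve E" and "Factorial_Ring.prime p" and "n \<ge> 1"
  shows "(division_field E (p ^ (n + 1)) = division_field E (p ^ n) \<longrightarrow>
            p = 2 \<and> n = 1 \<and>
            (\<exists>t. elliptic_curve (family_curve t) \<and> wc_isomorphic E (family_curve t)))
       \<and> (\<forall>\<zeta> :: qbar. primitive_root_of_unity (p ^ (n + 1)) \<zeta> \<longrightarrow>
            division_field E (p ^ n) \<inter> rat_adjoin {\<zeta>} = rat_adjoin {\<zeta>} \<longrightarrow> p = 2)"
proof -
  interpret rational_weierstrass E by standard (rule assms(1))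
  have two: "p = 2 \<or> odd p" using assms(2) by (metis prime_odd_nat prime_ge_2_nat le_neq_implies_less)
  have "p = 2 \<and> n = 1 \<and> (\<exists>t. elliptic_curve (family_curve t) \<and> wc_isomorphic E (family_curve t))"
    if eq: "division_field E (p ^ (n + 1)) = division_field E (p ^ n)"
  proof -
    have "p = 2" using two odd_prime_division_field_neq[OF assms(2) _ assms(3)] eq by blast
    thus ?thesis using coincidence_at_2[OF assms(3)] eq by blast
  qed
  moreover have "p = 2" if z: "primitive_root_of_unity (p ^ (n + 1)) \<zeta>"
    and sub: "division_field E (p ^ n) \<inter> rat_adjoin {\<zeta>} = rat_adjoin {\<zeta>}" for \<zeta> :: qbar
  proof -
    have "\<zeta> \<in> rat_adjoin {\<zeta>}" unfolding rat_adjoin_def by (rule generate_field.incl) simp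
    hence "\<zeta> \<in> division_field E (p ^ n)" using sub by blast
    thus ?thesis using two odd_prime_root_of_unity_notin[OF assms(2) _ assms(3) z] by blast
  qed
  ultimately show ?thesis by blast
qed

end
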